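(* Let $k$ be a field and let $A=k[x_1;\tau_1,\delta_1]\cdots[x_n;\tau_n,\delta_n]$ be an iterated skew polynomial ring, where each $\tau_i$ is a $k$-linear automorphism of $k\langle x_1,\dots,x_{i-1}\rangle$ with $\tau_i(x_j)=\lambda_{ij}x_j$ for all $1\le j<i\le n$ and some $\lambda_{ij}\in k^\times$, and each $\delta_i$ is a $k$-linear $\tau_i$-derivation. Assume that there exist $q_i\in k^\times$ with $q_i\ne1$ such that $\delta_i\tau_i=q_i\tau_i\delta_i$, and that $\delta_i$ extends to a locally nilpotent, iterative higher $q_i$-skew $\tau_i$-derivation on $k\langle x_1,\dots,x_{i-1}\rangle$, for $i=1,\dots,n$. Set $\lambda_{ii}=1$ and $\lambda_{ji}=\lambda_{ij}^{-1}$ for $j<i$, and $\boldsymbol\lambda=(\lambda_{ij})\in M_n(k)$. Then: (1) $A$ and $\mathcal O_{\boldsymbol\lambda}(k^n)$ have isomorphic division rings of fractions. (2) $A$ is a PI-algebra if and only if all the $\lambda_{ij}$ are roots of unity, in which case $A$ and $\mathcal O_{\boldsymbol\lambda}(k^n)$ have the same PI degree.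
   Context: Conventions: $k$ has arbitrary characteristic. In a skew polynomial ring $R[x;\tau,\delta]$, $R$ is a $k$-algebra, $\tau$ is a $k$-algebra automorphism of $R$, $\delta$ is a $k$-linear $\tau$-derivation ($\delta(rs)=\tau(r)\delta(s)+\delta(r)s$), and $xr=\tau(r)x+\delta(r)$. $k\langle x_1,\dots,x_{i-1}\rangle$ denotes the subalgebra $k[x_1;\tau_1,\delta_1]\cdots[x_{i-1};\tau_{i-1},\delta_{i-1}]$ (equal to $k$ if $i=1$). The multiparameter quantum affine space $\mathcal O_{\boldsymbol\lambda}(k^n)$, for a multiplicatively antisymmetric matrix $\boldsymbol\lambda$ ($\lambda_{ii}=1$, $\lambda_{ji}=\lambda_{ij}^{-1}$), is the $k$-algebra with generators $x_1,\dots,x_n$ and relations $x_ix_j=\lambda_{ij}x_jx_i$ for all $i,j$. For an indeterminate $t$: $(m)_t=t^{m-1}+\cdots+t+1$, $(m)!_t=(m)_t\cdots(1)_t$, $(0)!_t=1$, $\binom{n}{m}_t=\frac{(n)!_t}{(m)!_t(n-m)!_t}$ (a polynomial in $t$), and $\binom{n}{m}_q$ is its value at $t=q$. A higher $q$-skew $\tau$-derivation on a $k$-algebra $R$ is a sequence $d_0,d_1,d_2,\dots$ of $k$-linear operators on $R$ with $d_0=\mathrm{id}$, $d_n(rs)=\sum_{i=0}^n\tau^{n-i}d_i(r)\,d_{n-i}(s)$ for all $r,s\in R$ and all $n$, and $d_i\tau=q^i\tau d_i$ for all $i$. It is locally nilpotent if for every $r\in R$ there is $n\ge0$ with $d_i(r)=0$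 for all $i\ge n$. It is iterative if $d_id_j=\binom{i+j}{j}_qd_{i+j}$ for all $i,j$. A $\tau$-derivation $\delta$ with $\delta\tau=q\tau\delta$ extends to $\{d_i\}$ if $d_1=\delta$. *)

theory Defs
  imports
    "HOL-Algebra.Module"
    "HOL-Algebra.QuotRing"
    "HOL-Algebra.Generated_Rings"
    "HOL-Computational_Algebra.Polynomial"
begin

text \<open>
  The library's \<open>algebra\<close> locale covers commutative algebras only; this is the version without
  commutativity. The scalar multiplication is the one of the \<open>module\<close> record.
\<close>

locale k_algebra = module K A + K: field K + A: ring A
  for K (structure) and A (structure) +
  assumes smult_mult_left:
    "\<lbrakk>c \<in> carrier K; a \<in> carrier A; b \<in> carrier A\<rbrakk>
      \<Longrightarrow> (c \<odot>\<^bsub>A\<^esub> a) \<otimes>\<^bsub>A\<^esub> b = c \<odot>\<^bsub>A\<^esub> (a \<otimes>\<^bsub>A\<^esub> b)"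
  and smult_mult_right:
    "\<lbrakk>c \<in> carrier K; a \<in> carrier A; b \<in> carrier A\<rbrakk>
      \<Longrightarrow> a \<otimes>\<^bsub>A\<^esub> (c \<odot>\<^bsub>A\<^esub> b) = c \<odot>\<^bsub>A\<^esub> (a \<otimes>\<^bsub>A\<^esub> b)"

definition scalar :: "('k, 'a, 'm) module_scheme \<Rightarrow> 'k \<Rightarrow> 'a"
  where "scalar A c = c \<odot>\<^bsub>A\<^esub> \<one>\<^bsub>A\<^esub>"

definition subalgebra_gen ::
    "('k, 'l) ring_scheme \<Rightarrow> ('k, 'a, 'm) module_scheme \<Rightarrow> 'a set \<Rightarrow> 'a set"
  where "subalgebra_gen K A X = generate_ring A (scalar A ` carrier K \<union> X)"

definition linear_op ::
    "('k, 'l) ring_scheme \<Rightarrow> ('k, 'a, 'm) module_scheme \<Rightarrow> 'a set \<Rightarrow> ('a \<Rightarrow> 'a) \<Rightarrow> bool"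
  where "linear_op K A R f \<longleftrightarrow>
    f ` R \<subseteq> R \<and>
    (\<forall>r\<in>R. \<forall>s\<in>R. f (r \<oplus>\<^bsub>A\<^esub> s) = f r \<oplus>\<^bsub>A\<^esub> f s) \<and>
    (\<forall>c\<in>carrier K. \<forall>r\<in>R. f (c \<odot>\<^bsub>A\<^esub> r) = c \<odot>\<^bsub>A\<^esub> f r)"


section \<open>Skew polynomial rings\<close>

definition algebra_automorphism ::
    "('k, 'l) ring_scheme \<Rightarrow> ('k, 'a, 'm) module_scheme \<Rightarrow> 'a set \<Rightarrow> ('a \<Rightarrow> 'a) \<Rightarrow> bool"
  where "algebra_automorphism K A R \<tau> \<longleftrightarrow>
    \<tau> \<in> ring_iso (A\<lparr>carrier := R\<rparr>) (A\<lparr>carrier := R\<rparr>) \<and> linear_op K A R \<tau>"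

definition skew_derivation ::
    "('k, 'l) ring_scheme \<Rightarrow> ('k, 'a, 'm) module_scheme \<Rightarrow> 'a set \<Rightarrow> ('a \<Rightarrow> 'a) \<Rightarrow> ('a \<Rightarrow> 'a) \<Rightarrow> bool"
  where "skew_derivation K A R \<tau> \<delta> \<longleftrightarrow>
    linear_op K A R \<delta> \<and>
    (\<forall>r\<in>R. \<forall>s\<in>R. \<delta> (r \<otimes>\<^bsub>A\<^esub> s) = (\<tau> r \<otimes>\<^bsub>A\<^esub> \<delta> s) \<oplus>\<^bsub>A\<^esub> (\<delta> r \<otimes>\<^bsub>A\<^esub> s))"

text \<open>
  \<open>S = R[x;\<tau>,\<delta>]\<close> inside the ambient algebra \<open>A\<close>: \<open>S\<close> is a ring containing \<open>R\<close> and \<open>x\<close>, it is a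
  free left \<open>R\<close>-module with basis \<open>1, x, x\<^sup>2, \<dots>\<close>, and \<open>x r = \<tau>(r) x + \<delta>(r)\<close>.
\<close>

definition skew_polynomial_ring ::
    "('k, 'l) ring_scheme \<Rightarrow> ('k, 'a, 'm) module_scheme \<Rightarrow> 'a set \<Rightarrow> 'a
      \<Rightarrow> ('a \<Rightarrow> 'a) \<Rightarrow> ('a \<Rightarrow> 'a) \<Rightarrow> 'a set \<Rightarrow> bool"
  where "skew_polynomial_ring K A R x \<tau> \<delta> S \<longleftrightarrow>
    subring R A \<and> subring S A \<and> R \<subseteq> S \<and> x \<in> S \<and>
    algebra_automorphism K A R \<tau> \<and>
    skew_derivation K A R \<tau> \<delta> \<and>
    (\<forall>r\<in>R. x \<otimes>\<^bsub>A\<^esub> r = (\<tau> r \<otimes>\<^bsub>A\<^esub> x) \<oplus>\<^bsub>A\<^esub> \<delta> r) \<and>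
    (\<forall>s\<in>S. \<exists>!c. (\<forall>j. c j \<in> R) \<and> finite {j. c j \<noteq> \<zero>\<^bsub>A\<^esub>} \<and>
        s = (\<Oplus>\<^bsub>A\<^esub>j\<in>{j. c j \<noteq> \<zero>\<^bsub>A\<^esub>}. c j \<otimes>\<^bsub>A\<^esub> x [^]\<^bsub>A\<^esub> (j::nat)))"

text \<open>\<open>k\<langle>x\<^sub>1, \<dots>, x\<^sub>i\<^sub>-\<^sub>1\<rangle>\<close>, the ring that \<open>x\<^sub>i\<close> is adjoined to\<close>

definition lower_subalgebra ::
    "('k, 'l) ring_scheme \<Rightarrow> ('k, 'a, 'm) module_scheme \<Rightarrow> (nat \<Rightarrow> 'a) \<Rightarrow> nat \<Rightarrow> 'a set"
  where "lower_subalgebra K A x i = subalgebra_gen K A (x ` {1..<i})"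

text \<open>
  \<open>A = k[x\<^sub>1;\<tau>\<^sub>1,\<delta>\<^sub>1]\<cdots>[x\<^sub>n;\<tau>\<^sub>n,\<delta>\<^sub>n]\<close>. Indices run from 1 to \<open>n\<close>. The injectivity condition says that the
  bottom ring, the subalgebra generated by the empty set, is a copy of \<open>k\<close>; without it
  the zero ring would qualify.
\<close>

definition iterated_skew_polynomial_ring ::
    "('k, 'l) ring_scheme \<Rightarrow> ('k, 'a, 'm) module_scheme \<Rightarrow> nat \<Rightarrow> (nat \<Rightarrow> 'a)
      \<Rightarrow> (nat \<Rightarrow> 'a \<Rightarrow> 'a) \<Rightarrow> (nat \<Rightarrow> 'a \<Rightarrow> 'a) \<Rightarrow> bool"
  where "iterated_skew_polynomial_ring K A n x \<tau> \<delta> \<longleftrightarrow>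
    k_algebra K A \<and>
    inj_on (scalar A) (carrier K) \<and>
    (\<forall>i\<in>{1..n}. skew_polynomial_ring K A
        (lower_subalgebra K A x i) (x i) (\<tau> i) (\<delta> i) (lower_subalgebra K A x (Suc i))) \<and>
    carrier A = lower_subalgebra K A x (Suc n)"


section \<open>Higher skew derivations\<close>

definition qnum :: "nat \<Rightarrow> int poly"
  where "qnum m = (\<Sum>i<m. Polynomial.monom 1 i)"

definition qfactorial :: "nat \<Rightarrow> int poly"
  where "qfactorial m = (\<Prod>i=1..m. qnum i)"

text \<open>
  The division is exact in \<open>\<int>[t]\<close> for \<open>m \<le> n\<close>, which is the only case used.
\<close>

definition qbinomial :: "nat \<Rightarrow> nat \<Rightarrow> int poly"
  where "qbinomial n m = qfactorial n div (qfactorial m * qfactorial (n - m))"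

definition eval_int_poly :: "('k, 'l) ring_scheme \<Rightarrow> int poly \<Rightarrow> 'k \<Rightarrow> 'k"
  where "eval_int_poly K p q =
    (\<Oplus>\<^bsub>K\<^esub>i\<in>{..Polynomial.degree p}. [Polynomial.coeff p i] \<cdot>\<^bsub>K\<^esub> (q [^]\<^bsub>K\<^esub> i))"

definition higher_skew_derivation ::
    "('k, 'l) ring_scheme \<Rightarrow> ('k, 'a, 'm) module_scheme \<Rightarrow> 'a set \<Rightarrow> 'k \<Rightarrow> ('a \<Rightarrow> 'a)
      \<Rightarrow> (nat \<Rightarrow> 'a \<Rightarrow> 'a) \<Rightarrow> bool"
  where "higher_skew_derivation K A R q \<tau> d \<longleftrightarrow>
    (\<forall>i. linear_op K A R (d i)) \<and>
    (\<forall>r\<in>R. d 0 r = r) \<and>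
    (\<forall>n. \<forall>r\<in>R. \<forall>s\<in>R.
        d n (r \<otimes>\<^bsub>A\<^esub> s) = (\<Oplus>\<^bsub>A\<^esub>i\<in>{..n}. (\<tau> ^^ (n - i)) (d i r) \<otimes>\<^bsub>A\<^esub> d (n - i) s)) \<and>
    (\<forall>i. \<forall>r\<in>R. d i (\<tau> r) = (q [^]\<^bsub>K\<^esub> i) \<odot>\<^bsub>A\<^esub> \<tau> (d i r))"

definition locally_nilpotent ::
    "('k, 'a, 'm) module_scheme \<Rightarrow> 'a set \<Rightarrow> (nat \<Rightarrow> 'a \<Rightarrow> 'a) \<Rightarrow> bool"
  where "locally_nilpotent A R d \<longleftrightarrow> (\<forall>r\<in>R. \<exists>n. \<forall>i\<ge>n. d i r = \<zero>\<^bsub>A\<^esub>)"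

definition iterative ::
    "('k, 'l) ring_scheme \<Rightarrow> ('k, 'a, 'm) module_scheme \<Rightarrow> 'a set \<Rightarrow> 'k
      \<Rightarrow> (nat \<Rightarrow> 'a \<Rightarrow> 'a) \<Rightarrow> bool"
  where "iterative K A R q d \<longleftrightarrow>
    (\<forall>i j. \<forall>r\<in>R. d i (d j r) = eval_int_poly K (qbinomial (i + j) j) q \<odot>\<^bsub>A\<^esub> d (i + j) r)"


section \<open>Free algebras and quantum affine space\<close>

text \<open>
  The free algebra on letters indexed by \<open>I\<close>: finitely supported functions from words over \<open>I\<close>
  to \<open>K\<close>, with the product induced by concatenation.
\<close>

definition free_algebra ::
    "('k, 'l) ring_scheme \<Rightarrow> nat set \<Rightarrow> ('k, nat list \<Rightarrow> 'k) module"
  where "free_algebra K I =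
    \<lparr>carrier = {f. (\<forall>w. f w \<in> carrier K) \<and> finite {w. f w \<noteq> \<zero>\<^bsub>K\<^esub>} \<and>
                   (\<forall>w. f w \<noteq> \<zero>\<^bsub>K\<^esub> \<longrightarrow> set w \<subseteq> I)},
     monoid.mult = (\<lambda>f g w. \<Oplus>\<^bsub>K\<^esub>i\<in>{..length w}. f (take i w) \<otimes>\<^bsub>K\<^esub> g (drop i w)),
     one = (\<lambda>w. if w = [] then \<one>\<^bsub>K\<^esub> else \<zero>\<^bsub>K\<^esub>),
     zero = (\<lambda>w. \<zero>\<^bsub>K\<^esub>),
     add = (\<lambda>f g w. f w \<oplus>\<^bsub>K\<^esub> g w),
     module.smult = (\<lambda>c f w. c \<otimes>\<^bsub>K\<^esub> f w)\<rparr>"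

definition free_var :: "('k, 'l) ring_scheme \<Rightarrow> nat \<Rightarrow> nat list \<Rightarrow> 'k"
  where "free_var K i = (\<lambda>w. if w = [i] then \<one>\<^bsub>K\<^esub> else \<zero>\<^bsub>K\<^esub>)"

text \<open>
  The scalar action on cosets: \<open>c (I + a) = I + c a\<close>. Adding \<open>I\<close> makes this right for \<open>c = 0\<close> too.
\<close>

definition quotient_algebra ::
    "('k, 'a, 'm) module_scheme \<Rightarrow> 'a set \<Rightarrow> ('k, 'a set) module"
  where "quotient_algebra F I =
    \<lparr>carrier = carrier (F Quot I), monoid.mult = monoid.mult (F Quot I), one = one (F Quot I),
     zero = zero (F Quot I), add = add (F Quot I),
     module.smult = (\<lambda>c X. I <+>\<^bsub>F\<^esub> (module.smult F c ` X))\<rparr>"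

definition quantum_affine_space ::
    "('k, 'l) ring_scheme \<Rightarrow> nat \<Rightarrow> (nat \<Rightarrow> nat \<Rightarrow> 'k) \<Rightarrow> ('k, (nat list \<Rightarrow> 'k) set) module"
  where "quantum_affine_space K n \<Lambda> =
    (let F = free_algebra K {1..n}; X = free_var K in
     quotient_algebra F
       (Idl\<^bsub>F\<^esub> {(X i \<otimes>\<^bsub>F\<^esub> X j) \<ominus>\<^bsub>F\<^esub> (\<Lambda> i j \<odot>\<^bsub>F\<^esub> (X j \<otimes>\<^bsub>F\<^esub> X i)) | i j. i \<in> {1..n} \<and> j \<in> {1..n}}))"

definition mult_antisymmetric ::
    "('k, 'l) ring_scheme \<Rightarrow> nat \<Rightarrow> (nat \<Rightarrow> nat \<Rightarrow> 'k) \<Rightarrow> bool"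
  where "mult_antisymmetric K n \<Lambda> \<longleftrightarrow>
    (\<forall>i\<in>{1..n}. \<Lambda> i i = \<one>\<^bsub>K\<^esub>) \<and>
    (\<forall>i\<in>{1..n}. \<forall>j\<in>{1..n}. \<Lambda> i j \<in> carrier K - {\<zero>\<^bsub>K\<^esub>} \<and> \<Lambda> j i = inv\<^bsub>K\<^esub> (\<Lambda> i j))"

definition root_of_unity :: "('k, 'l) ring_scheme \<Rightarrow> 'k \<Rightarrow> bool"
  where "root_of_unity K c \<longleftrightarrow> (\<exists>m::nat. m > 0 \<and> c [^]\<^bsub>K\<^esub> m = \<one>\<^bsub>K\<^esub>)"


section \<open>Division rings of fractions\<close>

definition division_ring_of_fractions ::
    "('a, 'm) ring_scheme \<Rightarrow> ('d, 'p) ring_scheme \<Rightarrow> ('a \<Rightarrow> 'd) \<Rightarrow> bool"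
  where "division_ring_of_fractions A D \<iota> \<longleftrightarrow>
    ring D \<and> Units D = carrier D - {\<zero>\<^bsub>D\<^esub>} \<and>
    \<iota> \<in> ring_hom A D \<and> inj_on \<iota> (carrier A) \<and>
    (\<forall>d\<in>carrier D.
      (\<exists>a\<in>carrier A. \<exists>s\<in>carrier A - {\<zero>\<^bsub>A\<^esub>}. d = \<iota> a \<otimes>\<^bsub>D\<^esub> inv\<^bsub>D\<^esub> (\<iota> s)) \<and>
      (\<exists>a\<in>carrier A. \<exists>s\<in>carrier A - {\<zero>\<^bsub>A\<^esub>}. d = inv\<^bsub>D\<^esub> (\<iota> s) \<otimes>\<^bsub>D\<^esub> \<iota> a))"

text \<open>
  Both algebras have division rings of fractions, and these are isomorphic as \<open>k\<close>-algebras. The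
  carrier types are those of sets of pairs (numerator, denominator), where the Ore localization
  is constructed. As division rings of fractions are unique up to isomorphism over the algebra,
  it does not matter which ones are taken.
\<close>

definition isomorphic_division_rings_of_fractions ::
    "('k, 'l) ring_scheme \<Rightarrow> ('k, 'a, 'm) module_scheme \<Rightarrow> ('k, 'b, 'p) module_scheme \<Rightarrow> bool"
  where "isomorphic_division_rings_of_fractions K A B \<longleftrightarrow>
    (\<exists>(D :: ('a \<times> 'a) set ring) \<iota> (E :: ('b \<times> 'b) set ring) \<kappa> \<phi>.
      division_ring_of_fractions A D \<iota> \<and>
      division_ring_of_fractions B E \<kappa> \<and>
      \<phi> \<in> ring_iso D E \<and>
      (\<forall>c\<in>carrier K. \<phi> (\<iota> (scalar A c)) = \<kappa> (scalar B c)))"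


section \<open>Polynomial identities\<close>

definition nc_eval ::
    "('k, 'l) ring_scheme \<Rightarrow> ('k, 'a, 'm) module_scheme \<Rightarrow> (nat list \<Rightarrow> 'k) \<Rightarrow> (nat \<Rightarrow> 'a) \<Rightarrow> 'a"
  where "nc_eval K A f a =
    (\<Oplus>\<^bsub>A\<^esub>w\<in>{w. f w \<noteq> \<zero>\<^bsub>K\<^esub>}. f w \<odot>\<^bsub>A\<^esub> foldr (\<lambda>i p. a i \<otimes>\<^bsub>A\<^esub> p) w \<one>\<^bsub>A\<^esub>)"

definition nc_degree :: "('k, 'l) ring_scheme \<Rightarrow> (nat list \<Rightarrow> 'k) \<Rightarrow> nat"
  where "nc_degree K f = Max (length ` {w. f w \<noteq> \<zero>\<^bsub>K\<^esub>})"

definition polynomial_identity ::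
    "('k, 'l) ring_scheme \<Rightarrow> ('k, 'a, 'm) module_scheme \<Rightarrow> (nat list \<Rightarrow> 'k) \<Rightarrow> bool"
  where "polynomial_identity K A f \<longleftrightarrow>
    f \<in> carrier (free_algebra K UNIV) \<and> f \<noteq> \<zero>\<^bsub>free_algebra K UNIV\<^esub> \<and>
    (\<forall>a. (\<forall>i. a i \<in> carrier A) \<longrightarrow> nc_eval K A f a = \<zero>\<^bsub>A\<^esub>)"

definition PI_algebra :: "('k, 'l) ring_scheme \<Rightarrow> ('k, 'a, 'm) module_scheme \<Rightarrow> bool"
  where "PI_algebra K A \<longleftrightarrow> (\<exists>f. polynomial_identity K A f)"

text \<open>
  Half of the minimal degree of a polynomial identity; meaningful for prime PI-algebras, where by
  Posner's theorem it is the square root of the dimension of the ring of fractions over its centre.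
\<close>

definition PI_degree :: "('k, 'l) ring_scheme \<Rightarrow> ('k, 'a, 'm) module_scheme \<Rightarrow> real"
  where "PI_degree K A =
    real (LEAST m. \<exists>f. polynomial_identity K A f \<and> nc_degree K f = m) / 2"

end

theory Submission
  imports
    Defs
    "HOL-Algebra.Weak_Morphisms"
    "HOL-Combinatorics.Multiset_Permutations"
    "HOL-Library.Function_Algebras"
begin

text \<open>
  Let \<open>T\<close> be the quantum torus, with basis \<open>y\<^sup>\<alpha>\<close>, \<open>\<alpha> \<in> \<int>\<^sup>n\<close>. By induction on \<open>i\<close> the algebra
  \<open>k\<langle>x\<^sub>1, \<dots>, x\<^sub>i\<rangle>\<close> embeds into \<open>T\<close> in such a way that \<open>\<tau>\<^sub>j\<close>, \<open>j > i\<close>, becomes conjugation by \<open>y\<^sub>j\<close>. The point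
  is that \<open>\<delta>\<^sub>i\<close> is inner: comparing \<open>\<delta>\<^sub>i(y\<^sup>s y\<^sup>t)\<close> with \<open>\<delta>\<^sub>i(y\<^sup>t y\<^sup>s)\<close>, the coefficient of \<open>\<delta>\<^sub>i(y\<^sup>s)\<close> at \<open>y\<^sup>\<alpha> y\<^sup>s\<close> is,
  as a function of \<open>s\<close>, proportional to \<open>1 - \<theta>\<^sub>s(\<alpha>)\<close>, where \<open>\<theta>\<^sub>s(\<alpha>)\<close> measures how \<open>y\<^sup>s\<close> commutes with
  \<open>y\<^sup>\<alpha> y\<^sub>i\<^sup>-\<^sup>1\<close>; the exponents \<open>\<alpha>\<close> with \<open>\<theta>\<^sub>s(\<alpha>) = 1\<close> for all \<open>s\<close> do not occur, because \<open>\<delta>\<^sub>i \<tau>\<^sub>i = q\<^sub>i \<tau>\<^sub>i \<delta>\<^sub>i\<close> and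
  \<open>q\<^sub>i \<noteq> 1\<close>. So \<open>\<delta>\<^sub>i(r) = C r - \<tau>\<^sub>i(r) C\<close> for some \<open>C \<in> T\<close>, and \<open>x\<^sub>i \<mapsto> y\<^sub>i + C\<close> extends the embedding.

  Both \<open>A\<close> and \<open>\<O>\<^sub>\<lambda>(k\<^sup>n)\<close> are therefore orders in \<open>T\<close>: every \<open>y\<^sup>\<alpha>\<close> is a quotient of two monomials in the image.
  As \<open>T\<close> is an Ore domain, all its orders have the division ring of fractions of \<open>T\<close>. The degrees of
  polynomial identities are those of multilinear identities. If the \<open>\<lambda>\<^sub>i\<^sub>j\<close> are \<open>N\<close>-th roots of unity, the
  monomials \<open>y\<^sup>N\<^sup>\<beta>\<close> are central, so by clearing denominators an order has the multilinear identities of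
  \<open>T\<close>, and \<open>T\<close> has one of degree \<open>m\<close> as soon as \<open>m! > N\<^sup>n\<^sup>m\<close>. Otherwise an order contains monomials with
  \<open>b a = \<theta> a b\<close>, \<open>\<theta>\<close> not a root of unity; evaluated at \<open>a\<^bsup>r\<^sub>1\<^esup> b, \<dots>, a\<^bsup>r\<^sub>m\<^esup> b\<close>, a multilinear identity becomes a
  linear dependence between distinct characters of \<open>\<nat>\<^sup>m\<close>.
\<close>

section \<open>Twisted monoid algebras\<close>

text \<open>The obstacle is that the image of a subalgebra in the torus need not be spanned by the
  monomials it contains, so what holds for monomials does not pass to the image by linearity.
  Carried through the induction instead is that every exponent is a difference of two exponents of
  monomials in the image. A suitable monomial then moves any finite support among those exponents,
  and it can be cancelled afterwards, being a unit of the torus. Inner derivations, fractions and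
  identities are all transferred by this device.

  Later automorphisms must also remain conjugations. Applying \<open>\<tau>_j\<close> to the
  relation of \<open>x_i\<close> gives
  \<open>\<lambda>_ji \<delta>_i \<tau>_j = \<tau>_j \<delta>_i\<close>. This forces the exponents
  of \<open>C\<close> to have weight \<open>\<lambda>_ji\<close> under conjugation by
  \<open>y_j\<close>, the weight of \<open>y_i\<close> itself, so that \<open>y_i + C\<close> is
  again an eigenvector.

  That exponents with \<open>\<theta>_s(\<alpha>) = 1\<close> for all \<open>s\<close> do not occur
  is seen at \<open>s = \<alpha>\<close>: as \<open>y^\<alpha>\<close> commutes with itself, it
  would commute with \<open>y_i\<close>, while the relation between \<open>\<delta>_i\<close> and
  \<open>\<tau>_i\<close> gives it the weight \<open>q_i^-1\<close>.\<close>

context abelian_monoid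
begin

lemma finsum_delta:
  assumes "finite A" "c \<in> carrier G"
  shows "(\<Oplus>i\<in>A. if i = a then c else \<zero>) = (if a \<in> A then c else \<zero>)"
proof (cases "a \<in> A")
  case True
  then show ?thesis using finsum_singleton[OF True assms(1), of "\<lambda>_. c"] assms(2)
    by (simp add: eq_commute[of _ a] Pi_def cong: if_cong)
next
  case False
  then have "(\<Oplus>i\<in>A. if i = a then c else \<zero>) = (\<Oplus>i\<in>A. \<zero>)"
    by (intro finsum_cong') auto
  then show ?thesis using False by simp
qed

lemma finsum_extend:
  assumes "finite B" "A \<subseteq> B" "\<And>i. i \<in> B - A \<Longrightarrow> f i = \<zero>" "f \<in> A \<rightarrow> carrier G"
  shows "finsum G f A = finsum G f B"
  using assms by (intro add.finprod_mono_neutral_cong_left) auto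

lemma finsum_zero':
  assumes "\<And>i. i \<in> A \<Longrightarrow> f i = \<zero>"
  shows "finsum G f A = \<zero>"
proof -
  have "finsum G f A = (\<Oplus>i\<in>A. \<zero>)"
    using assms by (intro finsum_cong') auto
  then show ?thesis by simp
qed

lemma finsum_swap:
  assumes "finite A" "finite B" "\<And>i j. i \<in> A \<Longrightarrow> j \<in> B \<Longrightarrow> f i j \<in> carrier G"
  shows "(\<Oplus>i\<in>A. \<Oplus>j\<in>B. f i j) = (\<Oplus>j\<in>B. \<Oplus>i\<in>A. f i j)"
  using assms(1,3)
proof (induction A rule: finite_induct)
  case empty
  show ?case by simp
next
  case (insert a A)
  then have "(\<Oplus>j\<in>B. \<Oplus>i\<in>insert a A. f i j) = (\<Oplus>j\<in>B. f a j \<oplus> (\<Oplus>i\<in>A. f i j))"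
    by (intro finsum_cong') (auto intro!: add.m_closed finsum_closed)
  also have "\<dots> = (\<Oplus>j\<in>B. f a j) \<oplus> (\<Oplus>j\<in>B. \<Oplus>i\<in>A. f i j)"
    using insert by (intro finsum_addf) (auto intro!: finsum_closed)
  finally show ?case
    using insert by (subst finsum_insert) (auto intro!: finsum_closed)
qed

end

text \<open>Formulated for commutative monoids, so that it covers taking a coefficient, letting
  scalars act on a fixed vector, and ring homomorphisms alike.\<close>

lemma (in abelian_monoid) finsum_hom:
  assumes "abelian_monoid H" "h \<zero> = \<zero>\<^bsub>H\<^esub>" "\<And>a. a \<in> carrier G \<Longrightarrow> h a \<in> carrier H"
    "\<And>a b. a \<in> carrier G \<Longrightarrow> b \<in> carrier G \<Longrightarrow> h (a \<oplus> b) = h a \<oplus>\<^bsub>H\<^esub> h b"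
    "f \<in> A \<rightarrow> carrier G"
  shows "h (finsum G f A) = (\<Oplus>\<^bsub>H\<^esub>i\<in>A. h (f i))"
proof -
  interpret H: abelian_monoid H by fact
  show ?thesis using assms(5)
  proof (induction A rule: infinite_finite_induct)
    case (insert a A)
    then show ?case
      using assms by (simp add: Pi_def)
  qed (use assms(2) in simp_all)
qed

text \<open>The algebra of the monoid \<open>I\<close> deformed by a 2-cocycle \<open>c\<close>. It
  serves twice: the torus is the case of integer exponents with a bicharacter, the free algebra that
  of words with the constant cocycle. The product sums over the two supports because an exponent
  splits into two summands in infinitely many ways.\<close>

definition twisted_algebra ::
    "('k, 'l) ring_scheme \<Rightarrow> 'i set \<Rightarrow> ('i \<Rightarrow> 'i \<Rightarrow> 'i) \<Rightarrow> 'i \<Rightarrow> ('i \<Rightarrow> 'i \<Rightarrow> 'k) \<Rightarrow> ('k, 'i \<Rightarrow> 'k) module"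
  where "twisted_algebra K I m e c =
    \<lparr>carrier = {f. (\<forall>w. f w \<in> carrier K) \<and> finite {w. f w \<noteq> \<zero>\<^bsub>K\<^esub>} \<and> {w. f w \<noteq> \<zero>\<^bsub>K\<^esub>} \<subseteq> I},
     monoid.mult = (\<lambda>f g w. \<Oplus>\<^bsub>K\<^esub>u\<in>{u. f u \<noteq> \<zero>\<^bsub>K\<^esub>}. \<Oplus>\<^bsub>K\<^esub>v\<in>{v. g v \<noteq> \<zero>\<^bsub>K\<^esub>}.
       if m u v = w then c u v \<otimes>\<^bsub>K\<^esub> (f u \<otimes>\<^bsub>K\<^esub> g v) else \<zero>\<^bsub>K\<^esub>),
     one = (\<lambda>w. if w = e then \<one>\<^bsub>K\<^esub> else \<zero>\<^bsub>K\<^esub>),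
     zero = (\<lambda>w. \<zero>\<^bsub>K\<^esub>),
     add = (\<lambda>f g w. f w \<oplus>\<^bsub>K\<^esub> g w),
     module.smult = (\<lambda>c f w. c \<otimes>\<^bsub>K\<^esub> f w)\<rparr>"

definition single :: "('k, 'l) ring_scheme \<Rightarrow> 'k \<Rightarrow> 'i \<Rightarrow> 'i \<Rightarrow> 'k"
  where "single K a u = (\<lambda>w. if w = u then a else \<zero>\<^bsub>K\<^esub>)"

locale twisted_monoid_algebra = field K for K (structure) +
  fixes I :: "'i set" and m :: "'i \<Rightarrow> 'i \<Rightarrow> 'i" and e :: 'i and c :: "'i \<Rightarrow> 'i \<Rightarrow> 'a" and T
  assumes m_in: "u \<in> I \<Longrightarrow> v \<in> I \<Longrightarrow> m u v \<in> I"
    and e_in: "e \<in> I"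
    and m_assoc': "u \<in> I \<Longrightarrow> v \<in> I \<Longrightarrow> w \<in> I \<Longrightarrow> m (m u v) w = m u (m v w)"
    and m_unit: "u \<in> I \<Longrightarrow> m e u = u" "u \<in> I \<Longrightarrow> m u e = u"
    and c_in: "u \<in> I \<Longrightarrow> v \<in> I \<Longrightarrow> c u v \<in> carrier K"
    and c_cocycle: "u \<in> I \<Longrightarrow> v \<in> I \<Longrightarrow> w \<in> I \<Longrightarrow>
      c u v \<otimes> c (m u v) w = c v w \<otimes> c u (m v w)"
    and c_unit: "u \<in> I \<Longrightarrow> c e u = \<one>" "u \<in> I \<Longrightarrow> c u e = \<one>"
  defines "T \<equiv> twisted_algebra K I m e c"
begin

lemma T_simps:
  "one T = (\<lambda>w. if w = e then \<one> else \<zero>)"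
  "zero T = (\<lambda>w. \<zero>)"
  "add T f g = (\<lambda>w. f w \<oplus> g w)"
  "module.smult T a f = (\<lambda>w. a \<otimes> f w)"
  by (auto simp: T_def twisted_algebra_def)

lemma T_one: "\<one>\<^bsub>T\<^esub> = single K \<one> e"
  by (simp add: T_simps single_def)

lemma T_carrier:
  "f \<in> carrier T \<longleftrightarrow> (\<forall>w. f w \<in> carrier K) \<and> finite {w. f w \<noteq> \<zero>} \<and> {w. f w \<noteq> \<zero>} \<subseteq> I"
  by (auto simp: T_def twisted_algebra_def)

lemma T_carrierI:
  assumes "\<And>w. f w \<in> carrier K" "finite F" "F \<subseteq> I" "\<And>w. f w \<noteq> \<zero> \<Longrightarrow> w \<in> F"
  shows "f \<in> carrier T"
proof -
  have "{w. f w \<noteq> \<zero>} \<subseteq> F" using assms(4) by auto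
  then show ?thesis unfolding T_carrier using assms(1,3) finite_subset[OF _ assms(2)] by blast
qed

lemma T_val: "f \<in> carrier T \<Longrightarrow> f w \<in> carrier K"
  by (simp add: T_carrier)

lemma T_fin [simp, intro]: "f \<in> carrier T \<Longrightarrow> finite {w. f w \<noteq> \<zero>}"
  by (simp add: T_carrier)

lemma T_supp: "f \<in> carrier T \<Longrightarrow> f w \<noteq> \<zero> \<Longrightarrow> w \<in> I"
  by (rule subsetD[of "{w. f w \<noteq> \<zero>}"]) (simp_all add: T_carrier)

lemma T_mult_eq:
  "f \<otimes>\<^bsub>T\<^esub> g = (\<lambda>w. \<Oplus>u\<in>{u. f u \<noteq> \<zero>}. \<Oplus>v\<in>{v. g v \<noteq> \<zero>}.
     if m u v = w then c u v \<otimes> (f u \<otimes> g v) else \<zero>)"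
  unfolding T_def twisted_algebra_def monoid.simps(1) ..

text \<open>Terms may cancel in a sum, so the products compared in the distributive laws have
  different supports. Summing over arbitrary finite sets that contain the supports puts them over a
  common index set.\<close>

lemma T_mult:
  assumes f: "f \<in> carrier T" and g: "g \<in> carrier T"
    and F: "finite F" "\<And>u. f u \<noteq> \<zero> \<Longrightarrow> u \<in> F" "F \<subseteq> I"
    and G: "finite G" "\<And>u. g u \<noteq> \<zero> \<Longrightarrow> u \<in> G" "G \<subseteq> I"
  shows "(f \<otimes>\<^bsub>T\<^esub> g) w = (\<Oplus>u\<in>F. \<Oplus>v\<in>G. if m u v = w then c u v \<otimes> (f u \<otimes> g v) else \<zero>)"
proof -
  note [simp] = T_val[OF f] T_val[OF g]
  have *: "(\<Oplus>v\<in>{v. g v \<noteq> \<zero>}. if m u v = w then c u v \<otimes> (f u \<otimes> g v) else \<zero>) =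
     (\<Oplus>v\<in>G. if m u v = w then c u v \<otimes> (f u \<otimes> g v) else \<zero>)" if "u \<in> I" for u
    using G that c_in f g T_supp[OF g] by (intro finsum_extend) auto
  have "(f \<otimes>\<^bsub>T\<^esub> g) w = (\<Oplus>u\<in>{u. f u \<noteq> \<zero>}. \<Oplus>v\<in>{v. g v \<noteq> \<zero>}.
      if m u v = w then c u v \<otimes> (f u \<otimes> g v) else \<zero>)"
    by (simp only: T_mult_eq)
  also have "\<dots> = (\<Oplus>u\<in>{u. f u \<noteq> \<zero>}. \<Oplus>v\<in>G. if m u v = w then c u v \<otimes> (f u \<otimes> g v) else \<zero>)"
    by (rule finsum_cong'[OF refl])
      (use F G c_in f g T_supp[OF f] * in \<open>auto intro!: finsum_closed simp: subset_iff\<close>)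
  also have "\<dots> = (\<Oplus>u\<in>F. \<Oplus>v\<in>G. if m u v = w then c u v \<otimes> (f u \<otimes> g v) else \<zero>)"
    using F G c_in f g T_supp[OF f]
    by (intro finsum_extend) (auto intro!: finsum_closed finsum_zero' simp: subset_iff)
  finally show ?thesis .
qed

lemma T_mult_closed:
  assumes f: "f \<in> carrier T" and g: "g \<in> carrier T"
  shows "f \<otimes>\<^bsub>T\<^esub> g \<in> carrier T"
proof (rule T_carrierI)
  note [simp] = T_val[OF f] T_val[OF g]
  let ?F = "{u. f u \<noteq> \<zero>}" and ?G = "{u. g u \<noteq> \<zero>}"
  let ?S = "(\<lambda>(u,v). m u v) ` (?F \<times> ?G)"
  have eq: "(f \<otimes>\<^bsub>T\<^esub> g) w = (\<Oplus>u\<in>?F. \<Oplus>v\<in>?G. if m u v = w then c u v \<otimes> (f u \<otimes> g v) else \<zero>)" for w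
    using f g T_supp by (intro T_mult) auto
  show "(f \<otimes>\<^bsub>T\<^esub> g) w \<in> carrier K" for w
    unfolding eq using f g c_in T_supp by (auto intro!: finsum_closed)
  show "finite ?S" using f g by auto
  show "?S \<subseteq> I" using f g m_in T_supp by auto
  show "w \<in> ?S" if "(f \<otimes>\<^bsub>T\<^esub> g) w \<noteq> \<zero>" for w
  proof (rule ccontr)
    assume "w \<notin> ?S"
    then have "(f \<otimes>\<^bsub>T\<^esub> g) w = \<zero>"
      unfolding eq by (intro finsum_zero') auto
    with that show False by simp
  qed
qed

lemma T_add_closed:
  assumes f: "f \<in> carrier T" and g: "g \<in> carrier T"
  shows "f \<oplus>\<^bsub>T\<^esub> g \<in> carrier T"
  by (rule T_carrierI[where F = "{u. f u \<noteq> \<zero>} \<union> {u. g u \<noteq> \<zero>}"])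
    (use f g T_supp T_val[OF f] T_val[OF g] in \<open>auto simp: T_simps\<close>)

lemma T_abelian_group: "abelian_group T"
proof (rule abelian_groupI)
  fix f assume f: "f \<in> carrier T"
  show "\<exists>g\<in>carrier T. g \<oplus>\<^bsub>T\<^esub> f = \<zero>\<^bsub>T\<^esub>"
  proof
    show "(\<lambda>w. \<ominus> f w) \<in> carrier T"
      by (rule T_carrierI[where F = "{u. f u \<noteq> \<zero>}"]) (use f T_supp T_val[OF f] in auto)
    show "(\<lambda>w. \<ominus> f w) \<oplus>\<^bsub>T\<^esub> f = \<zero>\<^bsub>T\<^esub>"
      using f T_val[OF f] by (simp add: T_simps l_neg)
  qed
next
  show "\<zero>\<^bsub>T\<^esub> \<in> carrier T"
    by (simp add: T_carrier T_simps)
qed (simp_all add: T_add_closed, simp_all add: T_simps a_ac T_carrier)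

sublocale TA: abelian_group T by (rule T_abelian_group)

lemma single_in [simp, intro]: "a \<in> carrier K \<Longrightarrow> u \<in> I \<Longrightarrow> single K a u \<in> carrier T"
  by (rule T_carrierI[where F = "{u}"]) (auto simp: single_def split: if_splits)

lemma single_zero [simp]: "single K \<zero> u = \<zero>\<^bsub>T\<^esub>"
  by (auto simp: single_def T_simps)

lemma single_mult:
  assumes "a \<in> carrier K" "b \<in> carrier K" "u \<in> I" "v \<in> I"
  shows "single K a u \<otimes>\<^bsub>T\<^esub> single K b v = single K (c u v \<otimes> (a \<otimes> b)) (m u v)"
proof
  fix w
  have "(single K a u \<otimes>\<^bsub>T\<^esub> single K b v) w = (\<Oplus>u'\<in>{u}. \<Oplus>v'\<in>{v}. if m u' v' = w
      then c u' v' \<otimes> (single K a u u' \<otimes> single K b v v') else \<zero>)"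
    by (rule T_mult) (use assms in \<open>auto simp: single_in, auto simp: single_def split: if_splits\<close>)
  also have "\<dots> = (if m u v = w then c u v \<otimes> (a \<otimes> b) else \<zero>)"
    using assms c_in by (simp add: single_def Pi_def)
  finally show "(single K a u \<otimes>\<^bsub>T\<^esub> single K b v) w = single K (c u v \<otimes> (a \<otimes> b)) (m u v) w"
    by (auto simp: single_def)
qed

lemma T_finsum_apply:
  assumes "f \<in> A \<rightarrow> carrier T"
  shows "finsum T f A w = (\<Oplus>i\<in>A. f i w)"
  using assms by (intro TA.finsum_hom[where h = "\<lambda>f. f w"]) (auto simp: T_simps abelian_monoid_axioms T_val)

lemma single_expansion:
  assumes "f \<in> carrier T" "finite F" "F \<subseteq> I" "\<And>u. f u \<noteq> \<zero> \<Longrightarrow> u \<in> F"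
  shows "f = (\<Oplus>\<^bsub>T\<^esub>u\<in>F. single K (f u) u)"
proof
  fix w
  note [simp] = T_val[OF assms(1)]
  have "(\<Oplus>\<^bsub>T\<^esub>u\<in>F. single K (f u) u) w = (\<Oplus>u\<in>F. single K (f u) u w)"
    using assms by (intro T_finsum_apply) auto
  also have "\<dots> = (\<Oplus>u\<in>F. if u = w then f w else \<zero>)"
    using assms by (intro finsum_cong') (auto simp: single_def)
  also have "\<dots> = f w"
    using assms by (subst finsum_delta) (auto, metis)
  finally show "f w = (\<Oplus>\<^bsub>T\<^esub>u\<in>F. single K (f u) u) w" by simp
qed

lemma T_induct [consumes 1, case_names zero single add]:
  assumes "f \<in> carrier T" and "P \<zero>\<^bsub>T\<^esub>"
    and single: "\<And>a u. a \<in> carrier K \<Longrightarrow> u \<in> I \<Longrightarrow> f u = a \<Longrightarrow> P (single K a u)"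
    and add: "\<And>f g. f \<in> carrier T \<Longrightarrow> g \<in> carrier T \<Longrightarrow> P f \<Longrightarrow> P g \<Longrightarrow> P (f \<oplus>\<^bsub>T\<^esub> g)"
  shows "P f"
proof -
  note [simp] = T_val[OF assms(1)]
  have "P (\<Oplus>\<^bsub>T\<^esub>u\<in>F. single K (f u) u)" if "finite F" "F \<subseteq> I" for F
    using that
  proof (induction F rule: finite_induct)
    case (insert u F)
    then have *: "(\<lambda>u. single K (f u) u) \<in> F \<rightarrow> carrier T" "single K (f u) u \<in> carrier T"
      using assms(1) by auto
    then show ?case
      using insert T_val[OF assms(1)] by (auto intro!: add single TA.finsum_closed)
  qed (simp add: assms(2))
  from this[of "{w. f w \<noteq> \<zero>}"] show ?thesis
    using assms(1) single_expansion[of f "{w. f w \<noteq> \<zero>}"] by (auto simp: T_carrier)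
qed

lemma T_l_distr:
  assumes f: "f \<in> carrier T" and g: "g \<in> carrier T" and h: "h \<in> carrier T"
  shows "(f \<oplus>\<^bsub>T\<^esub> g) \<otimes>\<^bsub>T\<^esub> h = f \<otimes>\<^bsub>T\<^esub> h \<oplus>\<^bsub>T\<^esub> g \<otimes>\<^bsub>T\<^esub> h"
proof
  fix w
  note [simp] = T_val[OF f] T_val[OF g] T_val[OF h]
  let ?F = "{u. f u \<noteq> \<zero>} \<union> {u. g u \<noteq> \<zero>}" and ?H = "{u. h u \<noteq> \<zero>}"
  note m = T_mult[where F = ?F and G = ?H]
  have fin: "finite ?F" "finite ?H" "?F \<subseteq> I" "?H \<subseteq> I" using assms by (auto simp: T_carrier)
  have "((f \<oplus>\<^bsub>T\<^esub> g) \<otimes>\<^bsub>T\<^esub> h) w = (\<Oplus>u\<in>?F. \<Oplus>v\<in>?H. if m u v = w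
      then c u v \<otimes> ((f u \<oplus> g u) \<otimes> h v) else \<zero>)"
    using assms fin by (subst m) (auto simp: T_add_closed, auto simp: T_simps(3) cong: if_cong)
  also have "\<dots> = (\<Oplus>u\<in>?F. \<Oplus>v\<in>?H. (if m u v = w then c u v \<otimes> (f u \<otimes> h v) else \<zero>)
      \<oplus> (if m u v = w then c u v \<otimes> (g u \<otimes> h v) else \<zero>))"
    using assms fin c_in
    by (intro finsum_cong' refl) (auto intro!: finsum_closed simp: l_distr r_distr subset_iff)
  also have "\<dots> = (f \<otimes>\<^bsub>T\<^esub> h) w \<oplus> (g \<otimes>\<^bsub>T\<^esub> h) w"
    using assms fin c_in
    apply (subst m[of f h w]) apply (auto)[8]
    apply (subst m[of g h w]) apply (auto)[8]
    apply (subst finsum_addf[symmetric])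
    apply (auto intro!: finsum_closed simp: subset_iff)[2]
    apply (intro finsum_cong' refl)
    apply (auto intro!: finsum_closed simp: subset_iff)[1]
    apply (subst finsum_addf)
    apply (auto intro!: finsum_closed simp: subset_iff)
    done
  finally show "((f \<oplus>\<^bsub>T\<^esub> g) \<otimes>\<^bsub>T\<^esub> h) w = (f \<otimes>\<^bsub>T\<^esub> h \<oplus>\<^bsub>T\<^esub> g \<otimes>\<^bsub>T\<^esub> h) w"
    by (simp add: T_simps)
qed

lemma T_r_distr:
  assumes f: "f \<in> carrier T" and g: "g \<in> carrier T" and h: "h \<in> carrier T"
  shows "h \<otimes>\<^bsub>T\<^esub> (f \<oplus>\<^bsub>T\<^esub> g) = h \<otimes>\<^bsub>T\<^esub> f \<oplus>\<^bsub>T\<^esub> h \<otimes>\<^bsub>T\<^esub> g"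
proof
  fix w
  note [simp] = T_val[OF f] T_val[OF g] T_val[OF h]
  let ?F = "{u. f u \<noteq> \<zero>} \<union> {u. g u \<noteq> \<zero>}" and ?H = "{u. h u \<noteq> \<zero>}"
  note m = T_mult[where F = ?H and G = ?F]
  have fin: "finite ?F" "finite ?H" "?F \<subseteq> I" "?H \<subseteq> I" using assms by (auto simp: T_carrier)
  have "(h \<otimes>\<^bsub>T\<^esub> (f \<oplus>\<^bsub>T\<^esub> g)) w = (\<Oplus>u\<in>?H. \<Oplus>v\<in>?F. if m u v = w
      then c u v \<otimes> (h u \<otimes> (f v \<oplus> g v)) else \<zero>)"
    using assms fin by (subst m) (auto simp: T_add_closed, auto simp: T_simps(3) cong: if_cong)
  also have "\<dots> = (\<Oplus>u\<in>?H. \<Oplus>v\<in>?F. (if m u v = w then c u v \<otimes> (h u \<otimes> f v) else \<zero>)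
      \<oplus> (if m u v = w then c u v \<otimes> (h u \<otimes> g v) else \<zero>))"
    using assms fin c_in
    by (intro finsum_cong' refl) (auto intro!: finsum_closed simp: r_distr subset_iff)
  also have "\<dots> = (h \<otimes>\<^bsub>T\<^esub> f) w \<oplus> (h \<otimes>\<^bsub>T\<^esub> g) w"
    using assms fin c_in
    apply (subst m[of h f w]) apply (auto)[8]
    apply (subst m[of h g w]) apply (auto)[8]
    apply (subst finsum_addf[symmetric])
    apply (auto intro!: finsum_closed simp: subset_iff)[2]
    apply (intro finsum_cong' refl)
    apply (auto intro!: finsum_closed simp: subset_iff)[1]
    apply (subst finsum_addf)
    apply (auto intro!: finsum_closed simp: subset_iff)
    done
  finally show "(h \<otimes>\<^bsub>T\<^esub> (f \<oplus>\<^bsub>T\<^esub> g)) w = (h \<otimes>\<^bsub>T\<^esub> f \<oplus>\<^bsub>T\<^esub> h \<otimes>\<^bsub>T\<^esub> g) w"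
    by (simp add: T_simps)
qed

lemma T_zero_mult:
  assumes "f \<in> carrier T"
  shows "\<zero>\<^bsub>T\<^esub> \<otimes>\<^bsub>T\<^esub> f = \<zero>\<^bsub>T\<^esub>" "f \<otimes>\<^bsub>T\<^esub> \<zero>\<^bsub>T\<^esub> = \<zero>\<^bsub>T\<^esub>"
  by (simp_all add: T_mult_eq T_simps(2) finsum_zero')

lemma T_assoc_single:
  assumes "a \<in> carrier K" "b \<in> carrier K" "d \<in> carrier K" "u \<in> I" "v \<in> I" "w \<in> I"
  shows "(single K a u \<otimes>\<^bsub>T\<^esub> single K b v) \<otimes>\<^bsub>T\<^esub> single K d w =
    single K a u \<otimes>\<^bsub>T\<^esub> (single K b v \<otimes>\<^bsub>T\<^esub> single K d w)"
proof -
  have "c (m u v) w \<otimes> (c u v \<otimes> (a \<otimes> b) \<otimes> d) = (c u v \<otimes> c (m u v) w) \<otimes> (a \<otimes> (b \<otimes> d))"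
    using assms c_in m_in by (simp add: m_ac)
  also have "\<dots> = c u (m v w) \<otimes> (a \<otimes> (c v w \<otimes> (b \<otimes> d)))"
    using assms c_in m_in by (subst c_cocycle) (simp_all add: m_ac)
  finally show ?thesis
    using assms m_in c_in by (simp add: single_mult m_assoc')
qed

lemma T_assoc:
  assumes f: "f \<in> carrier T" and g: "g \<in> carrier T" and h: "h \<in> carrier T"
  shows "(f \<otimes>\<^bsub>T\<^esub> g) \<otimes>\<^bsub>T\<^esub> h = f \<otimes>\<^bsub>T\<^esub> (g \<otimes>\<^bsub>T\<^esub> h)"
  using f g h
proof (induction f arbitrary: g h rule: T_induct)
  case (single a u)
  show ?case using single(4,5)
  proof (induction g arbitrary: h rule: T_induct)
    case m': (single b v)
    show ?case using m'(4)
    proof (induction h rule: T_induct)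
      case (single d w)
      then show ?case using m' \<open>a \<in> carrier K\<close> \<open>u \<in> I\<close> by (intro T_assoc_single)
    qed (use m'(1,2) \<open>a \<in> carrier K\<close> \<open>u \<in> I\<close> in
        \<open>auto simp: T_r_distr T_mult_closed T_zero_mult\<close>)
  qed (use single(1,2) in \<open>auto simp: T_r_distr T_l_distr T_mult_closed T_zero_mult\<close>)
qed (auto simp: T_r_distr T_l_distr T_mult_closed T_zero_mult)

lemma T_ring: "ring T"
proof (rule ringI)
  show "Group.monoid T"
  proof (rule monoidI)
    show "\<one>\<^bsub>T\<^esub> \<otimes>\<^bsub>T\<^esub> f = f" if "f \<in> carrier T" for f
      using that by (induction f rule: T_induct)
        (auto simp: T_one single_mult T_r_distr T_zero_mult e_in m_unit c_unit)
    show "f \<otimes>\<^bsub>T\<^esub> \<one>\<^bsub>T\<^esub> = f" if "f \<in> carrier T" for f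
      using that by (induction f rule: T_induct)
        (auto simp: T_one single_mult T_l_distr T_zero_mult e_in m_unit c_unit)
  qed (auto simp: T_mult_closed T_assoc T_one e_in)
qed (auto simp: T_l_distr T_r_distr T_abelian_group)

sublocale T: ring T by (rule T_ring)

lemma T_smult_closed [simp]: "a \<in> carrier K \<Longrightarrow> f \<in> carrier T \<Longrightarrow> a \<odot>\<^bsub>T\<^esub> f \<in> carrier T"
  by (rule T_carrierI[where F = "{u. f u \<noteq> \<zero>}"]) (auto simp: T_simps T_val T_supp)

lemma T_smult_single:
  "a \<in> carrier K \<Longrightarrow> a \<odot>\<^bsub>T\<^esub> single K b u = single K (a \<otimes> b) u"
  by (auto simp: T_simps single_def)

lemma T_module: "module K T"
proof (rule moduleI)
  show "\<And>a f. a \<in> carrier K \<Longrightarrow> f \<in> carrier T \<Longrightarrow> a \<odot>\<^bsub>T\<^esub> f \<in> carrier T"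
    by simp
qed (simp_all add: T_simps(3,4) l_distr r_distr m_assoc is_cring T_abelian_group fun_eq_iff T_val)

sublocale M: module K T by (rule T_module)

lemma T_k_algebra: "k_algebra K T"
proof (intro k_algebra.intro T_module field_axioms T_ring k_algebra_axioms.intro)
  fix a f g assume a: "a \<in> carrier K" and fg: "f \<in> carrier T" "g \<in> carrier T"
  \<comment> \<open>Scalars act as multiplication by a multiple of the unit, on the left and on the
    right; both algebra axioms then become instances of associativity.\<close>
  have eq: "a \<odot>\<^bsub>T\<^esub> f = single K a e \<otimes>\<^bsub>T\<^esub> f \<and> a \<odot>\<^bsub>T\<^esub> f = f \<otimes>\<^bsub>T\<^esub> single K a e" if "f \<in> carrier T" for f
    using that
    by (induction f rule: T_induct)
      (use a e_in in \<open>auto simp: M.smult_r_distr T.r_distr T.l_distr T_smult_single single_mult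
        m_unit c_unit m_comm\<close>)
  show "(a \<odot>\<^bsub>T\<^esub> f) \<otimes>\<^bsub>T\<^esub> g = a \<odot>\<^bsub>T\<^esub> (f \<otimes>\<^bsub>T\<^esub> g)"
    using eq[of f] eq[of "f \<otimes>\<^bsub>T\<^esub> g"] a fg e_in by (simp add: T.m_assoc)
  have "f \<otimes>\<^bsub>T\<^esub> (a \<odot>\<^bsub>T\<^esub> g) = (f \<otimes>\<^bsub>T\<^esub> g) \<otimes>\<^bsub>T\<^esub> single K a e"
    using eq[of g] a fg e_in T.m_assoc[of f g "single K a e"] by auto
  then show "f \<otimes>\<^bsub>T\<^esub> (a \<odot>\<^bsub>T\<^esub> g) = a \<odot>\<^bsub>T\<^esub> (f \<otimes>\<^bsub>T\<^esub> g)"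
    using eq[of "f \<otimes>\<^bsub>T\<^esub> g"] fg by auto
qed

end

section \<open>Ore localization\<close>

locale ore_domain = ring R for R (structure) +
  assumes nontrivial: "\<one> \<noteq> \<zero>"
    and no_zero_divisors: "\<lbrakk>a \<in> carrier R; b \<in> carrier R; a \<otimes> b = \<zero>\<rbrakk> \<Longrightarrow> a = \<zero> \<or> b = \<zero>"
    and right_ore: "\<lbrakk>a \<in> carrier R; b \<in> carrier R; a \<noteq> \<zero>; b \<noteq> \<zero>\<rbrakk> \<Longrightarrow>
      \<exists>u\<in>carrier R. \<exists>v\<in>carrier R. a \<otimes> u = b \<otimes> v \<and> u \<noteq> \<zero> \<and> v \<noteq> \<zero>"
    and left_ore: "\<lbrakk>a \<in> carrier R; b \<in> carrier R; a \<noteq> \<zero>; b \<noteq> \<zero>\<rbrakk> \<Longrightarrow>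
      \<exists>u\<in>carrier R. \<exists>v\<in>carrier R. u \<otimes> a = v \<otimes> b \<and> u \<noteq> \<zero> \<and> v \<noteq> \<zero>"
begin

text \<open>A fraction \<open>d\<close> is encoded by the set of all pairs \<open>(s, a)\<close> with \<open>d s = a\<close>: the graph of a
  homomorphism of right modules defined on a nonzero right ideal, with maximal domain of definition.\<close>

definition partial_hom :: "('a \<times> 'a) set \<Rightarrow> bool"
  where "partial_hom G \<longleftrightarrow> G \<subseteq> carrier R \<times> carrier R \<and>
    (\<forall>s a t b. (s, a) \<in> G \<longrightarrow> (t, b) \<in> G \<longrightarrow> (s \<oplus> t, a \<oplus> b) \<in> G) \<and>
    (\<forall>s a r. (s, a) \<in> G \<longrightarrow> r \<in> carrier R \<longrightarrow> (s \<otimes> r, a \<otimes> r) \<in> G) \<and>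
    (\<forall>a. (\<zero>, a) \<in> G \<longrightarrow> a = \<zero>) \<and>
    (\<exists>s a. (s, a) \<in> G \<and> s \<noteq> \<zero>)"

text \<open>All pairs that the fraction \<open>d\<close> of \<open>G\<close> forces: from
  \<open>d s v = a v\<close> one may cancel \<open>v\<close>. The saturated graphs are the maximal
  ones, one for each fraction.\<close>

definition saturation :: "('a \<times> 'a) set \<Rightarrow> ('a \<times> 'a) set"
  where "saturation G = {(s, a). s \<in> carrier R \<and> a \<in> carrier R \<and>
    (\<exists>v\<in>carrier R. v \<noteq> \<zero> \<and> (s \<otimes> v, a \<otimes> v) \<in> G)}"

lemma phomD:
  assumes "partial_hom G"
  shows "(s, a) \<in> G \<Longrightarrow> s \<in> carrier R" "(s, a) \<in> G \<Longrightarrow> a \<in> carrier R"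
    "(s, a) \<in> G \<Longrightarrow> (t, b) \<in> G \<Longrightarrow> (s \<oplus> t, a \<oplus> b) \<in> G"
    "(s, a) \<in> G \<Longrightarrow> r \<in> carrier R \<Longrightarrow> (s \<otimes> r, a \<otimes> r) \<in> G"
    "(\<zero>, a) \<in> G \<Longrightarrow> a = \<zero>"
    "\<exists>s a. (s, a) \<in> G \<and> s \<noteq> \<zero>"
  using assms unfolding partial_hom_def by blast+

lemma phom_zero: "partial_hom G \<Longrightarrow> (\<zero>, \<zero>) \<in> G"
  using phomD(6)[of G] phomD(4)[of G _ _ \<zero>] phomD(1,2)[of G] by fastforce

lemma phom_functional:
  assumes "partial_hom G" "(s, a) \<in> G" "(s, b) \<in> G"
  shows "a = b"
proof -
  have cl: "s \<in> carrier R" "a \<in> carrier R" "b \<in> carrier R" using phomD(1,2)[OF assms(1)] assms by auto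
  have "(s \<otimes> \<ominus> \<one>, b \<otimes> \<ominus> \<one>) \<in> G" using phomD(4)[OF assms(1,3)] by simp
  then have "(s \<oplus> s \<otimes> \<ominus> \<one>, a \<oplus> b \<otimes> \<ominus> \<one>) \<in> G" using phomD(3)[OF assms(1,2)] by simp
  then have "(\<zero>, a \<ominus> b) \<in> G" using cl by (simp add: r_minus r_neg a_minus_def)
  then have "a \<ominus> b = \<zero>" by (rule phomD(5)[OF assms(1)])
  then show ?thesis using cl by simp
qed

lemma mult_nz: "\<lbrakk>a \<in> carrier R; b \<in> carrier R; a \<noteq> \<zero>; b \<noteq> \<zero>\<rbrakk> \<Longrightarrow> a \<otimes> b \<noteq> \<zero>"
  using no_zero_divisors by blast

lemma phom_sat:
  assumes G: "partial_hom G"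
  shows "partial_hom (saturation G)"
  unfolding partial_hom_def
proof (intro conjI allI impI)
  show "saturation G \<subseteq> carrier R \<times> carrier R" by (auto simp: saturation_def)
next
  fix s a t b assume "(s, a) \<in> saturation G" "(t, b) \<in> saturation G"
  then obtain v w where st: "s \<in> carrier R" "a \<in> carrier R" "t \<in> carrier R" "b \<in> carrier R"
    and v: "v \<in> carrier R" "v \<noteq> \<zero>" "(s \<otimes> v, a \<otimes> v) \<in> G"
    and w: "w \<in> carrier R" "w \<noteq> \<zero>" "(t \<otimes> w, b \<otimes> w) \<in> G" by (auto simp: saturation_def)
  \<comment> \<open>A common right multiple of \<open>v\<close> and \<open>w\<close> is a multiplier
    that works for both pairs.\<close>
  obtain u z where u: "u \<in> carrier R" "z \<in> carrier R" "v \<otimes> u = w \<otimes> z" "u \<noteq> \<zero>" "z \<noteq> \<zero>"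
    using right_ore[of v w] v w by blast
  have "(s \<otimes> (v \<otimes> u), a \<otimes> (v \<otimes> u)) \<in> G" "(t \<otimes> (v \<otimes> u), b \<otimes> (v \<otimes> u)) \<in> G"
    using phomD(4)[OF G v(3) u(1)] phomD(4)[OF G w(3) u(2)] st v w u by (simp_all add: m_assoc)
  from phomD(3)[OF G this] have "((s \<oplus> t) \<otimes> (v \<otimes> u), (a \<oplus> b) \<otimes> (v \<otimes> u)) \<in> G"
    using st v(1) u(1) by (simp only: l_distr m_closed)
  then show "(s \<oplus> t, a \<oplus> b) \<in> saturation G"
    using st v u mult_nz[of v u] by (auto simp: saturation_def intro!: bexI[of _ "v \<otimes> u"])
next
  fix s a r assume "(s, a) \<in> saturation G" and r: "r \<in> carrier R"
  then obtain v where s: "s \<in> carrier R" "a \<in> carrier R"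
    and v: "v \<in> carrier R" "v \<noteq> \<zero>" "(s \<otimes> v, a \<otimes> v) \<in> G" by (auto simp: saturation_def)
  show "(s \<otimes> r, a \<otimes> r) \<in> saturation G"
  proof (cases "r = \<zero>")
    case True
    then show ?thesis
      using s phom_zero[OF G] nontrivial by (auto simp: saturation_def intro!: bexI[of _ \<one>])
  next
    case False
    then obtain u z where u: "u \<in> carrier R" "z \<in> carrier R" "r \<otimes> u = v \<otimes> z" "u \<noteq> \<zero>"
      using right_ore[of r v] v r by blast
    have "(s \<otimes> r \<otimes> u, a \<otimes> r \<otimes> u) \<in> G"
      using phomD(4)[OF G v(3) u(2)] s v u r by (simp add: m_assoc)
    then show ?thesis using s r u by (auto simp: saturation_def)
  qed
next
  fix a assume "(\<zero>, a) \<in> saturation G"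
  then obtain v where "a \<in> carrier R" "v \<in> carrier R" "v \<noteq> \<zero>" "(\<zero>, a \<otimes> v) \<in> G"
    by (auto simp: saturation_def)
  then show "a = \<zero>" using phomD(5)[OF G] no_zero_divisors by blast
next
  obtain s a where "(s, a) \<in> G" "s \<noteq> \<zero>" using phomD(6)[OF G] by blast
  moreover from this have "(s, a) \<in> saturation G"
    using phomD(1,2)[OF G] nontrivial by (auto simp: saturation_def intro!: bexI[of _ \<one>])
  ultimately show "\<exists>s a. (s, a) \<in> saturation G \<and> s \<noteq> \<zero>" by blast
qed

lemma sat_incl: "partial_hom G \<Longrightarrow> G \<subseteq> saturation G"
  using phomD(1,2)[of G] nontrivial by (auto simp: saturation_def intro!: bexI[of _ \<one>])

lemma sat_mono: "G \<subseteq> H \<Longrightarrow> saturation G \<subseteq> saturation H"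
  by (auto simp: saturation_def)

lemma sat_idem: "partial_hom G \<Longrightarrow> saturation (saturation G) = saturation G"
proof
  assume G: "partial_hom G"
  show "saturation G \<subseteq> saturation (saturation G)" by (intro sat_incl phom_sat G)
  show "saturation (saturation G) \<subseteq> saturation G"
  proof clarify
    fix s a assume "(s, a) \<in> saturation (saturation G)"
    then obtain v w where s: "s \<in> carrier R" "a \<in> carrier R" and v: "v \<in> carrier R" "v \<noteq> \<zero>"
      and w: "w \<in> carrier R" "w \<noteq> \<zero>" "(s \<otimes> v \<otimes> w, a \<otimes> v \<otimes> w) \<in> G"
      by (auto simp: saturation_def)
    then have "(s \<otimes> (v \<otimes> w), a \<otimes> (v \<otimes> w)) \<in> G" by (simp add: m_assoc)
    then show "(s, a) \<in> saturation G"
      using s v w mult_nz[of v w] by (auto simp: saturation_def intro!: bexI[of _ "v \<otimes> w"])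
  qed
qed

text \<open>A fraction is determined by its values on any nonzero right ideal: by the Ore condition
  every \<open>s\<close> in the larger domain has a nonzero multiple in the smaller one.
  Consequently each ring axiom below only needs an inclusion between two graphs.\<close>

lemma sat_eqI:
  assumes F: "partial_hom F" and G: "partial_hom G" and "F \<subseteq> G"
  shows "saturation F = saturation G"
proof
  show "saturation F \<subseteq> saturation G" by (rule sat_mono) fact
  have "G \<subseteq> saturation F"
  proof clarify
    fix s a assume sa: "(s, a) \<in> G"
    then have cl: "s \<in> carrier R" "a \<in> carrier R" using phomD(1,2)[OF G] by auto
    show "(s, a) \<in> saturation F"
    proof (cases "s = \<zero>")
      case True
      then have "a = \<zero>" using phomD(5)[OF G] sa by simp
      then show ?thesis using True phom_zero[OF F] sat_incl[OF F] by auto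
    next
      case False
      obtain t b where tb: "(t, b) \<in> F" "t \<noteq> \<zero>" using phomD(6)[OF F] by blast
      then have cl': "t \<in> carrier R" "b \<in> carrier R" using phomD(1,2)[OF F] by auto
      obtain u v where u: "u \<in> carrier R" "v \<in> carrier R" "s \<otimes> u = t \<otimes> v" "u \<noteq> \<zero>"
        using right_ore[of s t] cl cl' False tb by blast
      have 1: "(t \<otimes> v, b \<otimes> v) \<in> F" using phomD(4)[OF F tb(1) u(2)] .
      moreover have "(s \<otimes> u, a \<otimes> u) \<in> G" using phomD(4)[OF G sa u(1)] .
      ultimately have "b \<otimes> v = a \<otimes> u" using phom_functional[OF G] \<open>F \<subseteq> G\<close> u(3) by auto
      then show ?thesis using 1 u cl by (auto simp: saturation_def)
    qed
  qed
  then show "saturation G \<subseteq> saturation F"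
    using sat_mono[of G "saturation F"] sat_idem[OF F] by simp
qed

section \<open>Sum and composition of partial homomorphisms\<close>

definition raw_add :: "('a \<times> 'a) set \<Rightarrow> ('a \<times> 'a) set \<Rightarrow> ('a \<times> 'a) set"
  where "raw_add G H = {(s, a \<oplus> b) | s a b. (s, a) \<in> G \<and> (s, b) \<in> H}"

definition raw_mult :: "('a \<times> 'a) set \<Rightarrow> ('a \<times> 'a) set \<Rightarrow> ('a \<times> 'a) set"
  where "raw_mult G H = {(s, b) | s a b. (s, a) \<in> H \<and> (a, b) \<in> G}"

definition left_mult :: "'a \<Rightarrow> ('a \<times> 'a) set"
  where "left_mult r = {(s, r \<otimes> s) | s. s \<in> carrier R}"

lemma left_mult_iff: "(s, a) \<in> left_mult r \<longleftrightarrow> s \<in> carrier R \<and> a = r \<otimes> s"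
  by (auto simp: left_mult_def)

lemma raw_addI: "(s, a) \<in> G \<Longrightarrow> (s, b) \<in> H \<Longrightarrow> c = a \<oplus> b \<Longrightarrow> (s, c) \<in> raw_add G H"
  by (auto simp: raw_add_def)

lemma raw_addE:
  assumes "(s, c) \<in> raw_add G H"
  obtains a b where "(s, a) \<in> G" "(s, b) \<in> H" "c = a \<oplus> b"
  using assms by (auto simp: raw_add_def)

lemma raw_mult_iff: "(s, b) \<in> raw_mult G H \<longleftrightarrow> (\<exists>a. (s, a) \<in> H \<and> (a, b) \<in> G)"
  by (auto simp: raw_mult_def)

lemma phom_add:
  assumes G: "partial_hom G" and H: "partial_hom H"
  shows "partial_hom (raw_add G H)"
  unfolding partial_hom_def
proof (intro conjI allI impI)
  show "raw_add G H \<subseteq> carrier R \<times> carrier R"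
    using phomD(1,2)[OF G] phomD(1,2)[OF H] by (auto simp: raw_add_def)
next
  fix s a t b assume "(s, a) \<in> raw_add G H" "(t, b) \<in> raw_add G H"
  then obtain a1 a2 b1 b2 where *: "(s, a1) \<in> G" "(s, a2) \<in> H" "(t, b1) \<in> G" "(t, b2) \<in> H"
    "a = a1 \<oplus> a2" "b = b1 \<oplus> b2" by (auto simp: raw_add_def)
  then show "(s \<oplus> t, a \<oplus> b) \<in> raw_add G H"
    using phomD(2)[OF G] phomD(2)[OF H]
    by (intro raw_addI[OF phomD(3)[OF G *(1,3)] phomD(3)[OF H *(2,4)]])
      (auto simp: a_assoc add.m_lcomm[of a2])
next
  fix s a r assume "(s, a) \<in> raw_add G H" and r: "r \<in> carrier R"
  then obtain a1 a2 where *: "(s, a1) \<in> G" "(s, a2) \<in> H" "a = a1 \<oplus> a2" by (auto simp: raw_add_def)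
  then show "(s \<otimes> r, a \<otimes> r) \<in> raw_add G H"
    using phomD(2)[OF G] phomD(2)[OF H] r
    by (intro raw_addI[OF phomD(4)[OF G *(1) r] phomD(4)[OF H *(2) r]]) (auto simp: l_distr)
next
  fix a assume "(\<zero>, a) \<in> raw_add G H"
  then obtain b c where "(\<zero>, b) \<in> G" "(\<zero>, c) \<in> H" "a = b \<oplus> c" by (rule raw_addE)
  then show "a = \<zero>" using phomD(5)[OF G, of b] phomD(5)[OF H, of c] by simp
next
  obtain s a where s: "(s, a) \<in> G" "s \<noteq> \<zero>" using phomD(6)[OF G] by blast
  obtain t b where t: "(t, b) \<in> H" "t \<noteq> \<zero>" using phomD(6)[OF H] by blast
  have cl: "s \<in> carrier R" "t \<in> carrier R" using s t phomD(1)[OF G] phomD(1)[OF H] by auto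
  obtain u v where u: "u \<in> carrier R" "v \<in> carrier R" "s \<otimes> u = t \<otimes> v" "u \<noteq> \<zero>"
    using right_ore[OF cl s(2) t(2)] by blast
  have "(s \<otimes> u, a \<otimes> u \<oplus> b \<otimes> v) \<in> raw_add G H"
    using phomD(4)[OF G s(1) u(1)] phomD(4)[OF H t(1) u(2)] u(3) by (auto intro: raw_addI)
  then show "\<exists>s a. (s, a) \<in> raw_add G H \<and> s \<noteq> \<zero>" using mult_nz[of s u] cl u s by blast
qed

lemma phom_mult:
  assumes G: "partial_hom G" and H: "partial_hom H"
  shows "partial_hom (raw_mult G H)"
  unfolding partial_hom_def
proof (intro conjI allI impI)
  show "raw_mult G H \<subseteq> carrier R \<times> carrier R"
    using phomD(1,2)[OF G] phomD(1,2)[OF H] by (auto simp: raw_mult_def)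
next
  fix s a t b assume "(s, a) \<in> raw_mult G H" "(t, b) \<in> raw_mult G H"
  then show "(s \<oplus> t, a \<oplus> b) \<in> raw_mult G H"
    using phomD(3)[OF G] phomD(3)[OF H] unfolding raw_mult_iff by blast
next
  fix s a r assume "(s, a) \<in> raw_mult G H" and r: "r \<in> carrier R"
  then show "(s \<otimes> r, a \<otimes> r) \<in> raw_mult G H"
    using phomD(4)[OF G _ r] phomD(4)[OF H _ r] unfolding raw_mult_iff by blast
next
  fix a assume "(\<zero>, a) \<in> raw_mult G H"
  then show "a = \<zero>" using phomD(5)[OF G] phomD(5)[OF H] unfolding raw_mult_iff by blast
next
  obtain s a where s: "(s, a) \<in> H" "s \<noteq> \<zero>" using phomD(6)[OF H] by blast
  obtain t b where t: "(t, b) \<in> G" "t \<noteq> \<zero>" using phomD(6)[OF G] by blast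
  have cl: "s \<in> carrier R" "a \<in> carrier R" "t \<in> carrier R"
    using s t phomD(1)[OF G] phomD(1,2)[OF H] by auto
  show "\<exists>s a. (s, a) \<in> raw_mult G H \<and> s \<noteq> \<zero>"
  proof (cases "a = \<zero>")
    case True
    then show ?thesis using s phom_zero[OF G] unfolding raw_mult_iff by blast
  next
    case False
    then obtain u v where u: "u \<in> carrier R" "v \<in> carrier R" "a \<otimes> u = t \<otimes> v" "u \<noteq> \<zero>"
      using right_ore[of a t] cl t by blast
    have "(s \<otimes> u, b \<otimes> v) \<in> raw_mult G H"
      unfolding raw_mult_iff using phomD(4)[OF G t(1) u(2)] phomD(4)[OF H s(1) u(1)] u(3) by auto
    then show ?thesis using mult_nz[of s u] cl u s by blast
  qed
qed

lemma phom_left_mult: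
  assumes "r \<in> carrier R"
  shows "partial_hom (left_mult r)" "saturation (left_mult r) = left_mult r"
proof -
  show *: "partial_hom (left_mult r)"
    unfolding partial_hom_def left_mult_def
    using assms nontrivial by (auto simp: r_distr m_assoc)
  show "saturation (left_mult r) = left_mult r"
  proof
    show "left_mult r \<subseteq> saturation (left_mult r)" by (rule sat_incl) fact
    show "saturation (left_mult r) \<subseteq> left_mult r"
    proof clarify
      fix s a assume "(s, a) \<in> saturation (left_mult r)"
      then obtain v where v: "s \<in> carrier R" "a \<in> carrier R" "v \<in> carrier R" "v \<noteq> \<zero>"
        "a \<otimes> v = r \<otimes> (s \<otimes> v)"
        by (auto simp: saturation_def left_mult_def)
      then have "(a \<ominus> r \<otimes> s) \<otimes> v = \<zero>"
        using assms by (simp add: a_minus_def l_distr l_minus m_assoc r_neg)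
      then have "a \<ominus> r \<otimes> s = \<zero>" using no_zero_divisors[of "a \<ominus> r \<otimes> s" v] v assms by auto
      then show "(s, a) \<in> left_mult r" using v assms by (auto simp: left_mult_def)
    qed
  qed
qed

text \<open>Saturated graphs represent each fraction exactly once, so no equivalence classes have to
  be formed, and they are sets of pairs, the carrier type in which division rings of fractions are
  compared.\<close>

definition fraction_ring :: "('a \<times> 'a) set ring"
  where "fraction_ring =
    \<lparr>carrier = {G. partial_hom G \<and> saturation G = G},
     monoid.mult = (\<lambda>G H. saturation (raw_mult G H)), one = left_mult \<one>, zero = left_mult \<zero>,
     add = (\<lambda>G H. saturation (raw_add G H))\<rparr>"

lemma raw_mono: "G \<subseteq> G' \<Longrightarrow> H \<subseteq> H' \<Longrightarrow> raw_add G H \<subseteq> raw_add G' H'"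
  "G \<subseteq> G' \<Longrightarrow> H \<subseteq> H' \<Longrightarrow> raw_mult G H \<subseteq> raw_mult G' H'"
  by (auto simp: raw_add_def raw_mult_def) blast+

text \<open>Saturation can be postponed to the end of a computation. The ring axioms thereby reduce
  to relations between plain graphs.\<close>

lemma sat_raw:
  assumes "partial_hom G" "partial_hom H"
  shows "saturation (raw_add (saturation G) H) = saturation (raw_add G H)"
    "saturation (raw_add G (saturation H)) = saturation (raw_add G H)"
    "saturation (raw_mult (saturation G) H) = saturation (raw_mult G H)"
    "saturation (raw_mult G (saturation H)) = saturation (raw_mult G H)"
  by (intro sat_eqI[symmetric] phom_add phom_mult phom_sat raw_mono sat_incl subset_refl assms)+

lemma left_mult_hom:
  assumes "a \<in> carrier R" "b \<in> carrier R"
  shows "raw_mult (left_mult a) (left_mult b) = left_mult (a \<otimes> b)"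
    "raw_add (left_mult a) (left_mult b) = left_mult (a \<oplus> b)"
  using assms by (auto simp: raw_mult_def raw_add_def left_mult_def m_assoc l_distr)

lemma fraction_ring_simps:
  "one fraction_ring = left_mult \<one>" "zero fraction_ring = left_mult \<zero>"
  "monoid.mult fraction_ring G H = saturation (raw_mult G H)"
  "add fraction_ring G H = saturation (raw_add G H)"
  "G \<in> carrier fraction_ring \<longleftrightarrow> partial_hom G \<and> saturation G = G"
  by (simp_all add: fraction_ring_def)

lemma raw_add_commute:
  assumes "partial_hom G" "partial_hom H"
  shows "raw_add G H = raw_add H G"
proof -
  have "raw_add G H \<subseteq> raw_add H G" if "partial_hom G" "partial_hom H" for G H
    using phomD(2)[OF that(1)] phomD(2)[OF that(2)] by (auto elim!: raw_addE intro!: raw_addI a_comm)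
  then show ?thesis using assms by blast
qed

text \<open>The last law is only an inclusion: a sum of two values can lie in the domain of
  \<open>L\<close> although the values themselves do not. After saturation the two sides agree by
  \<open>sat_eqI\<close>.\<close>

lemma raw_assoc:
  assumes "partial_hom G" "partial_hom H" "partial_hom L"
  shows "raw_add (raw_add G H) L = raw_add G (raw_add H L)"
    "raw_mult (raw_mult G H) L = raw_mult G (raw_mult H L)"
    "raw_mult (raw_add G H) L = raw_add (raw_mult G L) (raw_mult H L)"
    "raw_add (raw_mult L G) (raw_mult L H) \<subseteq> raw_mult L (raw_add G H)"
proof -
  note cl = phomD(2)[OF assms(1)] phomD(2)[OF assms(2)] phomD(2)[OF assms(3)]
  show "raw_add (raw_add G H) L = raw_add G (raw_add H L)"
  proof (intro subset_antisym subrelI)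
    fix s d assume "(s, d) \<in> raw_add (raw_add G H) L"
    then obtain a b c where "(s, a) \<in> G" "(s, b) \<in> H" "(s, c) \<in> L" "d = (a \<oplus> b) \<oplus> c"
      by (auto elim!: raw_addE)
    then show "(s, d) \<in> raw_add G (raw_add H L)"
      using cl by (intro raw_addI[OF _ raw_addI[OF _ _ refl]]) (auto simp: a_assoc)
  next
    fix s d assume "(s, d) \<in> raw_add G (raw_add H L)"
    then obtain a b c where "(s, a) \<in> G" "(s, b) \<in> H" "(s, c) \<in> L" "d = a \<oplus> (b \<oplus> c)"
      by (auto elim!: raw_addE)
    then show "(s, d) \<in> raw_add (raw_add G H) L"
      using cl by (intro raw_addI[OF raw_addI[OF _ _ refl]]) (auto simp: a_assoc)
  qed
  show "raw_mult (raw_mult G H) L = raw_mult G (raw_mult H L)"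
    unfolding raw_mult_def by blast
  show "raw_mult (raw_add G H) L = raw_add (raw_mult G L) (raw_mult H L)"
  proof (intro subset_antisym subrelI)
    fix s d assume "(s, d) \<in> raw_mult (raw_add G H) L"
    then show "(s, d) \<in> raw_add (raw_mult G L) (raw_mult H L)"
      unfolding raw_mult_iff by (auto elim!: raw_addE intro!: raw_addI simp: raw_mult_iff)
  next
    fix s d assume "(s, d) \<in> raw_add (raw_mult G L) (raw_mult H L)"
    then obtain a b u v where "(s, u) \<in> L" "(u, a) \<in> G" "(s, v) \<in> L" "(v, b) \<in> H" "d = a \<oplus> b"
      by (auto elim!: raw_addE simp: raw_mult_iff)
    moreover from this have "u = v" using phom_functional[OF assms(3)] by blast
    ultimately show "(s, d) \<in> raw_mult (raw_add G H) L"
      unfolding raw_mult_iff by (auto intro: raw_addI)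
  qed
  show "raw_add (raw_mult L G) (raw_mult L H) \<subseteq> raw_mult L (raw_add G H)"
  proof (intro subrelI)
    fix s d assume "(s, d) \<in> raw_add (raw_mult L G) (raw_mult L H)"
    then obtain a b u v where "(s, u) \<in> G" "(u, a) \<in> L" "(s, v) \<in> H" "(v, b) \<in> L" "d = a \<oplus> b"
      by (auto elim!: raw_addE simp: raw_mult_iff)
    then show "(s, d) \<in> raw_mult L (raw_add G H)"
      unfolding raw_mult_iff using phomD(3)[OF assms(3)] by (blast intro: raw_addI)
  qed
qed

lemma raw_unit:
  assumes "partial_hom G"
  shows "raw_mult (left_mult \<one>) G = G" "raw_mult G (left_mult \<one>) = G" "raw_add (left_mult \<zero>) G = G"
proof -
  note cl = phomD(1,2)[OF assms]
  show "raw_mult (left_mult \<one>) G = G" "raw_mult G (left_mult \<one>) = G"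
    using cl by (force simp: raw_mult_iff left_mult_iff)+
  have "(s, b) \<in> raw_add (left_mult \<zero>) G" if "(s, b) \<in> G" for s b
    using that cl by (intro raw_addI[where a = \<zero>, OF _ that]) (auto simp: left_mult_def)
  then show "raw_add (left_mult \<zero>) G = G"
    using cl by (auto simp: left_mult_def elim!: raw_addE)
qed

lemma fraction_ring_ring: "ring fraction_ring"
proof (rule ringI)
  show "abelian_group fraction_ring"
  proof (rule abelian_groupI)
    fix G assume "G \<in> carrier fraction_ring"
    then have G: "partial_hom G" "saturation G = G" by (auto simp: fraction_ring_simps)
    let ?N = "raw_mult (left_mult (\<ominus> \<one>)) G"
    have N: "partial_hom ?N" by (intro phom_mult phom_left_mult G) simp
    have eq: "?N = {(s, \<ominus> a) | s a. (s, a) \<in> G}"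
    proof (intro subset_antisym subrelI)
      fix s b assume "(s, b) \<in> ?N"
      then show "(s, b) \<in> {(s, \<ominus> a) | s a. (s, a) \<in> G}"
        using phomD(1,2)[OF G(1)] by (auto simp: raw_mult_iff left_mult_iff l_minus)
    next
      fix s b assume "(s, b) \<in> {(s, \<ominus> a) | s a. (s, a) \<in> G}"
      then obtain a where "b = \<ominus> a" "(s, a) \<in> G" by blast
      then show "(s, b) \<in> ?N"
        using phomD(1,2)[OF G(1)] unfolding raw_mult_iff left_mult_iff by (force simp: l_minus)
    qed
    have "raw_add ?N G \<subseteq> left_mult \<zero>"
    proof (intro subrelI)
      fix s d assume "(s, d) \<in> raw_add ?N G"
      then obtain a b where ab: "(s, a) \<in> G" "(s, b) \<in> G" "d = \<ominus> a \<oplus> b"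
        unfolding eq by (auto elim!: raw_addE)
      then have "a = b" using phom_functional[OF G(1)] by blast
      then show "(s, d) \<in> left_mult \<zero>"
        using ab phomD(1,2)[OF G(1)] by (auto simp: left_mult_def l_neg)
    qed
    then have "saturation (raw_add (saturation ?N) G) = left_mult \<zero>"
      using sat_eqI[of "raw_add ?N G" "left_mult \<zero>"] phom_add[OF N G(1)] phom_left_mult[of \<zero>]
        sat_raw(1)[OF N G(1)] by simp
    then show "\<exists>y\<in>carrier fraction_ring. y \<oplus>\<^bsub>fraction_ring\<^esub> G = \<zero>\<^bsub>fraction_ring\<^esub>"
      using phom_sat[OF N] sat_idem[OF N] by (auto simp: fraction_ring_simps intro!: bexI[of _ "saturation ?N"])
  next
    fix G H assume "G \<in> carrier fraction_ring" "H \<in> carrier fraction_ring"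
    then show "G \<oplus>\<^bsub>fraction_ring\<^esub> H = H \<oplus>\<^bsub>fraction_ring\<^esub> G"
      using raw_add_commute[of G H] by (simp add: fraction_ring_simps)
  qed (auto simp: fraction_ring_simps phom_add phom_sat sat_idem phom_left_mult sat_raw raw_assoc(1) raw_unit)
  show "Group.monoid fraction_ring"
    by (rule monoidI)
      (auto simp: fraction_ring_simps phom_mult phom_sat sat_idem phom_left_mult sat_raw raw_assoc(2) raw_unit)
  fix G H L assume "G \<in> carrier fraction_ring" "H \<in> carrier fraction_ring" "L \<in> carrier fraction_ring"
  then have *: "partial_hom G" "partial_hom H" "partial_hom L"
    by (auto simp: fraction_ring_simps)
  then show "(G \<oplus>\<^bsub>fraction_ring\<^esub> H) \<otimes>\<^bsub>fraction_ring\<^esub> L =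
    G \<otimes>\<^bsub>fraction_ring\<^esub> L \<oplus>\<^bsub>fraction_ring\<^esub> H \<otimes>\<^bsub>fraction_ring\<^esub> L"
    by (simp add: fraction_ring_simps phom_mult phom_sat phom_add sat_raw raw_assoc(3))
  have "saturation (raw_mult L (raw_add G H)) = saturation (raw_add (raw_mult L G) (raw_mult L H))"
    using * by (intro sat_eqI[symmetric] raw_assoc(4) phom_add phom_mult)
  then show "L \<otimes>\<^bsub>fraction_ring\<^esub> (G \<oplus>\<^bsub>fraction_ring\<^esub> H) =
    L \<otimes>\<^bsub>fraction_ring\<^esub> G \<oplus>\<^bsub>fraction_ring\<^esub> L \<otimes>\<^bsub>fraction_ring\<^esub> H"
    using * by (simp add: fraction_ring_simps phom_mult phom_sat phom_add sat_raw)
qed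

sublocale Q: ring fraction_ring by (rule fraction_ring_ring)

lemma left_mult_ring_hom: "left_mult \<in> ring_hom R fraction_ring"
  by (rule ring_hom_memI) (auto simp: fraction_ring_simps phom_left_mult left_mult_hom)

lemma left_mult_inj: "inj_on left_mult (carrier R)"
proof (rule inj_onI)
  fix a b assume ab: "a \<in> carrier R" "b \<in> carrier R" "left_mult a = left_mult b"
  then have "(\<one>, a \<otimes> \<one>) \<in> left_mult b" by (metis left_mult_iff one_closed)
  then show "a = b" using ab by (simp add: left_mult_iff)
qed

text \<open>The inverse of a fraction is the converse graph. It is single-valued because a nonzero
  fraction kills no nonzero \<open>s\<close>: by the Ore condition a multiple of \<open>s\<close> is
  also a multiple of some \<open>t\<close> with value \<open>b \<noteq> \<zero>\<close>, and the
  value there would be both zero and a nonzero multiple of \<open>b\<close>.\<close>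

lemma fraction_ring_Units: "Units fraction_ring = carrier fraction_ring - {\<zero>\<^bsub>fraction_ring\<^esub>}"
proof (intro subset_antisym subsetI)
  fix G assume "G \<in> Units fraction_ring"
  moreover have "\<one>\<^bsub>fraction_ring\<^esub> \<noteq> \<zero>\<^bsub>fraction_ring\<^esub>"
    using left_mult_inj nontrivial by (auto simp: fraction_ring_simps inj_on_def)
  ultimately show "G \<in> carrier fraction_ring - {\<zero>\<^bsub>fraction_ring\<^esub>}"
    using Q.Units_r_inv Q.l_null by (metis Diff_iff Q.Units_closed Q.Units_inv_closed singletonD)
next
  fix G assume "G \<in> carrier fraction_ring - {\<zero>\<^bsub>fraction_ring\<^esub>}"
  then have G: "partial_hom G" "saturation G = G" "G \<noteq> left_mult \<zero>" by (auto simp: fraction_ring_simps)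
  note cl = phomD(1,2)[OF G(1)]
  have "\<exists>t b. (t, b) \<in> G \<and> b \<noteq> \<zero>"
  proof (rule ccontr)
    assume "\<not> ?thesis"
    then have "G \<subseteq> left_mult \<zero>" using cl by (force simp: left_mult_iff)
    from sat_eqI[OF G(1) _ this] show False using G phom_left_mult[of \<zero>] by auto
  qed
  then obtain t b where tb: "(t, b) \<in> G" "b \<noteq> \<zero>" by blast
  then have t: "t \<noteq> \<zero>" using phomD(5)[OF G(1)] by blast
  have inj: "s = \<zero>" if s: "(s, \<zero>) \<in> G" for s
  proof (rule ccontr)
    assume "s \<noteq> \<zero>"
    then obtain u v where u: "u \<in> carrier R" "v \<in> carrier R" "s \<otimes> u = t \<otimes> v" "v \<noteq> \<zero>"
      using right_ore[of s t] cl s t tb by blast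
    have "(s \<otimes> u, \<zero> \<otimes> u) \<in> G" "(t \<otimes> v, b \<otimes> v) \<in> G"
      by (rule phomD(4)[OF G(1) s u(1)], rule phomD(4)[OF G(1) tb(1) u(2)])
    then have "b \<otimes> v = \<zero> \<otimes> u" using phom_functional[OF G(1)] u(3) by auto
    then show False using mult_nz[of b v] cl tb u by auto
  qed
  let ?C = "converse G"
  have C: "partial_hom ?C"
    unfolding partial_hom_def
  proof (intro conjI allI impI)
    show "?C \<subseteq> carrier R \<times> carrier R" using cl by auto
    show "\<exists>s a. (s, a) \<in> ?C \<and> s \<noteq> \<zero>" using tb by auto
  qed (simp_all add: phomD(3,4)[OF G(1)] inj)
  have "raw_mult ?C G \<subseteq> left_mult \<one>"
  proof (intro subrelI)
    fix s d assume "(s, d) \<in> raw_mult ?C G"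
    then obtain a where "(s, a) \<in> G" "(d, a) \<in> G" by (auto simp: raw_mult_iff)
    moreover from this have "s = d" using phom_functional[OF C] by blast
    ultimately show "(s, d) \<in> left_mult \<one>" using cl by (auto simp: left_mult_def)
  qed
  then have 1: "saturation (raw_mult (saturation ?C) G) = left_mult \<one>"
    using sat_raw(3)[OF C G(1)] sat_eqI[OF phom_mult[OF C G(1)]] phom_left_mult[of \<one>] by simp
  have "raw_mult G ?C \<subseteq> left_mult \<one>"
  proof (intro subrelI)
    fix s d assume "(s, d) \<in> raw_mult G ?C"
    then obtain a where "(a, s) \<in> G" "(a, d) \<in> G" by (auto simp: raw_mult_iff)
    moreover from this have "s = d" using phom_functional[OF G(1)] by blast
    ultimately show "(s, d) \<in> left_mult \<one>" using cl by (auto simp: left_mult_def)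
  qed
  then have 2: "saturation (raw_mult G (saturation ?C)) = left_mult \<one>"
    using sat_raw(4)[OF G(1) C] sat_eqI[OF phom_mult[OF G(1) C]] phom_left_mult[of \<one>] by simp
  show "G \<in> Units fraction_ring"
    unfolding Units_def using 1 2 G phom_sat[OF C] sat_idem[OF C]
    by (auto simp: fraction_ring_simps intro!: bexI[of _ "saturation ?C"])
qed

theorem division_ring_of_fractions_exists: "division_ring_of_fractions R fraction_ring left_mult"
  unfolding division_ring_of_fractions_def
proof (intro conjI fraction_ring_ring fraction_ring_Units left_mult_ring_hom left_mult_inj ballI)
  let ?Q = fraction_ring
  note [simp] = ring_hom_closed[OF left_mult_ring_hom]
  have U: "left_mult s \<in> Units ?Q" if "s \<in> carrier R" "s \<noteq> \<zero>" for s
    using that left_mult_inj unfolding fraction_ring_Units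
    by (auto simp: fraction_ring_simps inj_on_def phom_left_mult)
  fix G assume GQ: "G \<in> carrier ?Q"
  then have G: "partial_hom G" "saturation G = G" by (auto simp: fraction_ring_simps)
  obtain s a where sa: "(s, a) \<in> G" "s \<noteq> \<zero>" using phomD(6)[OF G(1)] by blast
  have cl: "s \<in> carrier R" "a \<in> carrier R" using phomD(1,2)[OF G(1)] sa by auto
  have "left_mult a \<subseteq> raw_mult G (left_mult s)"
    using phomD(4)[OF G(1) sa(1)] cl by (auto simp: left_mult_def raw_mult_def)
  from sat_eqI[OF _ _ this] have eq: "G \<otimes>\<^bsub>?Q\<^esub> left_mult s = left_mult a"
    using phom_left_mult cl phom_mult G by (simp add: fraction_ring_simps)
  have "G = left_mult a \<otimes>\<^bsub>?Q\<^esub> inv\<^bsub>?Q\<^esub> (left_mult s)"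
    using eq U[OF cl(1) sa(2)] GQ cl by (metis Q.Units_closed Q.Units_inv_closed Q.Units_r_inv Q.m_assoc Q.r_one)
  then show "\<exists>a\<in>carrier R. \<exists>s\<in>carrier R - {\<zero>}. G = left_mult a \<otimes>\<^bsub>?Q\<^esub> inv\<^bsub>?Q\<^esub> (left_mult s)"
    using cl sa by blast
  \<comment> \<open>The left Ore condition turns the right fraction \<open>a s^-1\<close> into a
    left one: \<open>u a = v s\<close> means \<open>a s^-1 = u^-1 v\<close>.\<close>
  obtain u v where uv: "u \<in> carrier R" "v \<in> carrier R" "u \<noteq> \<zero>" "u \<otimes> a = v \<otimes> s"
  proof (cases "a = \<zero>")
    case True
    then show ?thesis using that[of \<one> \<zero>] nontrivial cl by simp
  next
    case False
    then show ?thesis using left_ore[of a s] cl sa that by blast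
  qed
  have "(left_mult u \<otimes>\<^bsub>?Q\<^esub> G) \<otimes>\<^bsub>?Q\<^esub> left_mult s = left_mult v \<otimes>\<^bsub>?Q\<^esub> left_mult s"
    using eq uv cl GQ ring_hom_mult[OF left_mult_ring_hom, symmetric] by (simp add: Q.m_assoc)
  then have "left_mult u \<otimes>\<^bsub>?Q\<^esub> G = left_mult v"
    using U[OF cl(1) sa(2)] uv GQ
    by (metis Q.Units_closed Q.Units_inv_closed Q.Units_r_inv Q.m_assoc Q.m_closed Q.r_one ring_hom_closed[OF left_mult_ring_hom])
  then have "G = inv\<^bsub>?Q\<^esub> (left_mult u) \<otimes>\<^bsub>?Q\<^esub> left_mult v"
    using U[OF uv(1,3)] GQ by (metis Q.Units_closed Q.Units_inv_closed Q.Units_l_inv Q.m_assoc Q.l_one)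
  then show "\<exists>a\<in>carrier R. \<exists>s\<in>carrier R - {\<zero>}. G = inv\<^bsub>?Q\<^esub> (left_mult s) \<otimes>\<^bsub>?Q\<^esub> left_mult a"
    using uv by blast
qed

end

section \<open>Fractions of orders, and their transport to a prescribed carrier type\<close>

lemma (in ring) Units_nonzero:
  assumes "u \<in> Units R" "x \<in> carrier R" "x \<noteq> \<zero>"
  shows "u \<noteq> \<zero>"
proof
  assume "u = \<zero>"
  then have "\<one> = \<zero>" using Units_r_inv[OF assms(1)] l_null[OF Units_inv_closed[OF assms(1)]] by simp
  then show False using assms(2,3) l_one[of x] by simp
qed

lemma (in monoid) Units_cancel_middle:
  assumes "x \<in> carrier G" "u \<in> Units G" "y \<in> carrier G"
  shows "(x \<otimes> u) \<otimes> (inv u \<otimes> y) = x \<otimes> y" "(x \<otimes> inv u) \<otimes> (u \<otimes> y) = x \<otimes> y"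
proof -
  have "u \<otimes> (inv u \<otimes> y) = y" "inv u \<otimes> (u \<otimes> y) = y"
    using assms by (simp_all add: m_assoc[symmetric] Units_closed)
  then show "(x \<otimes> u) \<otimes> (inv u \<otimes> y) = x \<otimes> y" "(x \<otimes> inv u) \<otimes> (u \<otimes> y) = x \<otimes> y"
    using assms by (simp_all add: m_assoc Units_closed)
qed

text \<open>One unit \<open>m\<close> clears numerator and denominator at once, and
  \<open>t s^-1 = (t m) (s m)^-1\<close> is then a fraction of elements of \<open>B\<close>; on the
  left likewise.\<close>

lemma division_ring_of_fractions_suborder:
  assumes "ring B" "ring T" and D: "division_ring_of_fractions T D \<iota>"
    and \<Phi>: "\<Phi> \<in> ring_hom B T" "inj_on \<Phi> (carrier B)"
    and r: "\<And>t t'. \<lbrakk>t \<in> carrier T; t' \<in> carrier T\<rbrakk> \<Longrightarrow> \<exists>m\<in>Units T. t \<otimes>\<^bsub>T\<^esub> m \<in> \<Phi> ` carrier B \<and> t' \<otimes>\<^bsub>T\<^esub> m \<in> \<Phi> ` carrier B"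
    and l: "\<And>t t'. \<lbrakk>t \<in> carrier T; t' \<in> carrier T\<rbrakk> \<Longrightarrow> \<exists>m\<in>Units T. m \<otimes>\<^bsub>T\<^esub> t \<in> \<Phi> ` carrier B \<and> m \<otimes>\<^bsub>T\<^esub> t' \<in> \<Phi> ` carrier B"
  shows "division_ring_of_fractions B D (\<iota> \<circ> \<Phi>)"
proof -
  interpret B: ring B by fact
  interpret T: ring T by fact
  interpret D: ring D using D by (simp add: division_ring_of_fractions_def)
  have UD: "Units D = carrier D - {\<zero>\<^bsub>D\<^esub>}" and \<iota>: "\<iota> \<in> ring_hom T D" "inj_on \<iota> (carrier T)"
    using D by (auto simp: division_ring_of_fractions_def)
  have \<iota>0: "\<iota> \<zero>\<^bsub>T\<^esub> = \<zero>\<^bsub>D\<^esub>" and \<Phi>0: "\<Phi> \<zero>\<^bsub>B\<^esub> = \<zero>\<^bsub>T\<^esub>"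
    using ring_hom_zero[OF \<iota>(1)] ring_hom_zero[OF \<Phi>(1)] assms(1,2) D.ring_axioms by auto
  note [simp] = ring_hom_closed[OF \<iota>(1)] ring_hom_closed[OF \<Phi>(1)]
  have nz: "\<iota> t \<in> Units D" if "t \<in> carrier T" "t \<noteq> \<zero>\<^bsub>T\<^esub>" for t
    using that \<iota> \<iota>0 UD by (auto simp: inj_on_def)
  have inv_prod: "inv\<^bsub>D\<^esub> (a \<otimes>\<^bsub>D\<^esub> b) = inv\<^bsub>D\<^esub> b \<otimes>\<^bsub>D\<^esub> inv\<^bsub>D\<^esub> a" if "a \<in> Units D" "b \<in> Units D" for a b
    using D.inv_unique'[of "a \<otimes>\<^bsub>D\<^esub> b" "inv\<^bsub>D\<^esub> b \<otimes>\<^bsub>D\<^esub> inv\<^bsub>D\<^esub> a"] that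
    by (metis D.Units_closed D.Units_inv_closed D.Units_l_inv D.Units_m_closed D.Units_r_inv D.m_assoc
        D.m_closed D.r_one)
  show ?thesis unfolding division_ring_of_fractions_def
  proof (intro conjI ballI D.ring_axioms UD)
    show "\<iota> \<circ> \<Phi> \<in> ring_hom B D" using \<iota>(1) \<Phi>(1) by (rule ring_hom_trans[rotated])
    show "inj_on (\<iota> \<circ> \<Phi>) (carrier B)"
      using \<iota>(2) \<Phi> by (intro comp_inj_on) (auto intro: inj_on_subset)
    fix d assume d: "d \<in> carrier D"
    obtain t s where ts: "t \<in> carrier T" "s \<in> carrier T" "s \<noteq> \<zero>\<^bsub>T\<^esub>" "d = \<iota> t \<otimes>\<^bsub>D\<^esub> inv\<^bsub>D\<^esub> (\<iota> s)"
      using D d unfolding division_ring_of_fractions_def by blast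
    obtain m a b where m: "m \<in> Units T" and ab: "a \<in> carrier B" "b \<in> carrier B"
      "t \<otimes>\<^bsub>T\<^esub> m = \<Phi> a" "s \<otimes>\<^bsub>T\<^esub> m = \<Phi> b" using r[OF ts(1,2)] by auto
    have m': "m \<in> carrier T" "m \<noteq> \<zero>\<^bsub>T\<^esub>"
      using m T.Units_nonzero[OF m ts(2,3)] by auto
    have b0: "b \<noteq> \<zero>\<^bsub>B\<^esub>"
    proof
      assume "b = \<zero>\<^bsub>B\<^esub>"
      then have "s \<otimes>\<^bsub>T\<^esub> m \<otimes>\<^bsub>T\<^esub> inv\<^bsub>T\<^esub> m = \<zero>\<^bsub>T\<^esub>" using ab(4) \<Phi>0 m by simp
      then show False using ts(2,3) m T.m_assoc[of s m "inv\<^bsub>T\<^esub> m"] by (simp add: T.Units_closed)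
    qed
    have "\<iota> (\<Phi> a) \<otimes>\<^bsub>D\<^esub> inv\<^bsub>D\<^esub> (\<iota> (\<Phi> b)) = (\<iota> t \<otimes>\<^bsub>D\<^esub> \<iota> m) \<otimes>\<^bsub>D\<^esub> (inv\<^bsub>D\<^esub> (\<iota> m) \<otimes>\<^bsub>D\<^esub> inv\<^bsub>D\<^esub> (\<iota> s))"
      using ts m' nz by (simp add: ab(3,4)[symmetric] ring_hom_mult[OF \<iota>(1)] inv_prod)
    also have "\<dots> = d"
      using ts m' nz[OF m'] nz[of s] by (simp add: D.Units_cancel_middle)
    finally show "\<exists>a\<in>carrier B. \<exists>s\<in>carrier B - {\<zero>\<^bsub>B\<^esub>}. d = (\<iota> \<circ> \<Phi>) a \<otimes>\<^bsub>D\<^esub> inv\<^bsub>D\<^esub> ((\<iota> \<circ> \<Phi>) s)"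
      using ab b0 by (metis Diff_iff comp_apply singletonD)
  next
    fix d assume d: "d \<in> carrier D"
    obtain t s where ts: "t \<in> carrier T" "s \<in> carrier T" "s \<noteq> \<zero>\<^bsub>T\<^esub>" "d = inv\<^bsub>D\<^esub> (\<iota> s) \<otimes>\<^bsub>D\<^esub> \<iota> t"
      using D d unfolding division_ring_of_fractions_def by blast
    obtain m a b where m: "m \<in> Units T" and ab: "a \<in> carrier B" "b \<in> carrier B"
      "m \<otimes>\<^bsub>T\<^esub> t = \<Phi> a" "m \<otimes>\<^bsub>T\<^esub> s = \<Phi> b" using l[OF ts(1,2)] by auto
    have m': "m \<in> carrier T" "m \<noteq> \<zero>\<^bsub>T\<^esub>"
      using m T.Units_nonzero[OF m ts(2,3)] by auto
    have b0: "b \<noteq> \<zero>\<^bsub>B\<^esub>"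
    proof
      assume "b = \<zero>\<^bsub>B\<^esub>"
      then have "inv\<^bsub>T\<^esub> m \<otimes>\<^bsub>T\<^esub> (m \<otimes>\<^bsub>T\<^esub> s) = \<zero>\<^bsub>T\<^esub>" using ab(4) \<Phi>0 m by simp
      then show False using ts(2,3) m T.m_assoc[of "inv\<^bsub>T\<^esub> m" m s] by (simp add: T.Units_closed)
    qed
    have "inv\<^bsub>D\<^esub> (\<iota> (\<Phi> b)) \<otimes>\<^bsub>D\<^esub> \<iota> (\<Phi> a) = (inv\<^bsub>D\<^esub> (\<iota> s) \<otimes>\<^bsub>D\<^esub> inv\<^bsub>D\<^esub> (\<iota> m)) \<otimes>\<^bsub>D\<^esub> (\<iota> m \<otimes>\<^bsub>D\<^esub> \<iota> t)"
      using ts m' nz by (simp add: ab(3,4)[symmetric] ring_hom_mult[OF \<iota>(1)] inv_prod)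
    also have "\<dots> = d"
      using ts m' nz[OF m'] nz[of s] by (simp add: D.Units_cancel_middle)
    finally show "\<exists>a\<in>carrier B. \<exists>s\<in>carrier B - {\<zero>\<^bsub>B\<^esub>}. d = inv\<^bsub>D\<^esub> ((\<iota> \<circ> \<Phi>) s) \<otimes>\<^bsub>D\<^esub> (\<iota> \<circ> \<Phi>) a"
      using ab b0 by (metis Diff_iff comp_apply singletonD)
  qed
qed

text \<open>Orders of different types share the division ring of the torus, but each must be given
  one of its own type. The element \<open>d\<close> is sent to the set of all \<open>(s, a)\<close>
  with \<open>d s = a\<close>; this set determines \<open>d\<close> because every element is a right
  fraction.\<close>

lemma division_ring_of_fractions_transport:
  assumes "ring B" and D: "division_ring_of_fractions B D \<kappa>"
  shows "\<exists>(D' :: ('b \<times> 'b) set ring) h. h \<in> ring_iso D D' \<and>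
    division_ring_of_fractions (B :: ('b, 'm) ring_scheme) D' (h \<circ> \<kappa>)"
proof -
  interpret B: ring B by fact
  interpret D: ring D using D by (simp add: division_ring_of_fractions_def)
  have UD: "Units D = carrier D - {\<zero>\<^bsub>D\<^esub>}" and \<kappa>: "\<kappa> \<in> ring_hom B D" "inj_on \<kappa> (carrier B)"
    using D by (auto simp: division_ring_of_fractions_def)
  note [simp] = ring_hom_closed[OF \<kappa>(1)]
  have \<kappa>0: "\<kappa> \<zero>\<^bsub>B\<^esub> = \<zero>\<^bsub>D\<^esub>"
    using ring_hom_zero[OF \<kappa>(1)] assms(1) D.ring_axioms by auto
  define h where "h = (\<lambda>d. {(s, a). s \<in> carrier B \<and> a \<in> carrier B \<and> d \<otimes>\<^bsub>D\<^esub> \<kappa> s = \<kappa> a})"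
  have nz: "\<kappa> s \<in> Units D" if "s \<in> carrier B - {\<zero>\<^bsub>B\<^esub>}" for s
    using that \<kappa> \<kappa>0 UD by (auto simp: inj_on_def)
  have "inj_on h (carrier D)"
  proof (rule inj_onI)
    fix d d' assume d: "d \<in> carrier D" "d' \<in> carrier D" "h d = h d'"
    obtain a s where as: "a \<in> carrier B" "s \<in> carrier B - {\<zero>\<^bsub>B\<^esub>}" "d = \<kappa> a \<otimes>\<^bsub>D\<^esub> inv\<^bsub>D\<^esub> (\<kappa> s)"
      using D d(1) unfolding division_ring_of_fractions_def by blast
    have s: "\<kappa> s \<in> Units D" "\<kappa> s \<in> carrier D" "inv\<^bsub>D\<^esub> (\<kappa> s) \<in> carrier D" using nz[OF as(2)] as by auto
    then have "d \<otimes>\<^bsub>D\<^esub> \<kappa> s = \<kappa> a" using as by (simp add: D.m_assoc)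
    then have "(s, a) \<in> h d'" using as d(3) by (auto simp: h_def)
    then have "d' \<otimes>\<^bsub>D\<^esub> \<kappa> s = d \<otimes>\<^bsub>D\<^esub> \<kappa> s" using \<open>d \<otimes>\<^bsub>D\<^esub> \<kappa> s = \<kappa> a\<close> by (simp add: h_def)
    then show "d = d'" using d s by (metis D.Units_r_inv D.m_assoc D.r_one)
  qed
  then have h: "h \<in> ring_iso D (image_ring h D)" "ring (image_ring h D)"
    using inj_imp_image_ring_iso D.inj_imp_image_ring_is_ring by auto
  let ?D = "image_ring h D"
  interpret D': ring ?D by fact
  have hom: "h \<in> ring_hom D ?D" "inj_on h (carrier D)" "h ` carrier D = carrier ?D"
    using h(1) by (auto simp: ring_iso_def bij_betw_def)
  have h0: "h \<zero>\<^bsub>D\<^esub> = \<zero>\<^bsub>?D\<^esub>" using ring_hom_zero[OF hom(1)] D.ring_axioms h(2) by auto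
  have hU: "h u \<in> Units ?D \<and> h (inv\<^bsub>D\<^esub> u) = inv\<^bsub>?D\<^esub> (h u)" if u: "u \<in> Units D" for u
  proof -
    have "h u \<otimes>\<^bsub>?D\<^esub> h (inv\<^bsub>D\<^esub> u) = \<one>\<^bsub>?D\<^esub>" "h (inv\<^bsub>D\<^esub> u) \<otimes>\<^bsub>?D\<^esub> h u = \<one>\<^bsub>?D\<^esub>"
      using u ring_hom_mult[OF hom(1), symmetric] ring_hom_one[OF hom(1)]
      by (simp_all only: D.Units_closed D.Units_inv_closed D.Units_r_inv D.Units_l_inv)
    moreover have "h u \<in> carrier ?D" "h (inv\<^bsub>D\<^esub> u) \<in> carrier ?D"
      using u ring_hom_closed[OF hom(1)] by auto
    ultimately show ?thesis using D'.inv_unique'[of "h u" "h (inv\<^bsub>D\<^esub> u)"] by (auto simp: Units_def)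
  qed
  have "division_ring_of_fractions B ?D (h \<circ> \<kappa>)"
    unfolding division_ring_of_fractions_def
  proof (intro conjI ballI h(2))
    show "Units ?D = carrier ?D - {\<zero>\<^bsub>?D\<^esub>}"
    proof (intro subset_antisym subsetI)
      fix y assume "y \<in> carrier ?D - {\<zero>\<^bsub>?D\<^esub>}"
      then obtain d where "d \<in> carrier D" "y = h d" "d \<noteq> \<zero>\<^bsub>D\<^esub>"
        using hom(3) h0 by (metis Diff_iff imageE singletonI)
      then show "y \<in> Units ?D" using hU UD by auto
    next
      fix y assume y: "y \<in> Units ?D"
      have "\<zero>\<^bsub>?D\<^esub> \<noteq> \<one>\<^bsub>?D\<^esub>"
      proof
        assume "\<zero>\<^bsub>?D\<^esub> = \<one>\<^bsub>?D\<^esub>"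
        then have "h \<zero>\<^bsub>D\<^esub> = h \<one>\<^bsub>D\<^esub>" using h0 ring_hom_one[OF hom(1)] by simp
        then have "\<zero>\<^bsub>D\<^esub> = \<one>\<^bsub>D\<^esub>" using hom(2) by (auto simp: inj_on_def)
        moreover have "\<one>\<^bsub>D\<^esub> \<in> Units D" by simp
        ultimately show False using UD by simp
      qed
      then show "y \<in> carrier ?D - {\<zero>\<^bsub>?D\<^esub>}"
        using y D'.Units_r_inv D'.l_null by (metis Diff_iff D'.Units_closed D'.Units_inv_closed singletonD)
    qed
    show "h \<circ> \<kappa> \<in> ring_hom B ?D" using hom(1) \<kappa>(1) by (rule ring_hom_trans[rotated])
    show "inj_on (h \<circ> \<kappa>) (carrier B)"
      using hom(2) \<kappa> by (intro comp_inj_on) (auto intro: inj_on_subset)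
    fix y assume "y \<in> carrier ?D"
    then obtain d where d: "d \<in> carrier D" "y = h d" using hom(3) by auto
    obtain a s where as: "a \<in> carrier B" "s \<in> carrier B - {\<zero>\<^bsub>B\<^esub>}" "d = \<kappa> a \<otimes>\<^bsub>D\<^esub> inv\<^bsub>D\<^esub> (\<kappa> s)"
      using D d(1) unfolding division_ring_of_fractions_def by blast
    then have "y = h (\<kappa> a) \<otimes>\<^bsub>?D\<^esub> inv\<^bsub>?D\<^esub> (h (\<kappa> s))"
      using d nz hU ring_hom_mult[OF hom(1)] by auto
    then show "\<exists>a\<in>carrier B. \<exists>s\<in>carrier B - {\<zero>\<^bsub>B\<^esub>}. y = (h \<circ> \<kappa>) a \<otimes>\<^bsub>?D\<^esub> inv\<^bsub>?D\<^esub> ((h \<circ> \<kappa>) s)"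
      using as by (auto simp del: Diff_iff)
    obtain a s where as: "a \<in> carrier B" "s \<in> carrier B - {\<zero>\<^bsub>B\<^esub>}" "d = inv\<^bsub>D\<^esub> (\<kappa> s) \<otimes>\<^bsub>D\<^esub> \<kappa> a"
      using D d(1) unfolding division_ring_of_fractions_def by blast
    then have "y = inv\<^bsub>?D\<^esub> (h (\<kappa> s)) \<otimes>\<^bsub>?D\<^esub> h (\<kappa> a)"
      using d nz hU ring_hom_mult[OF hom(1)] by auto
    then show "\<exists>a\<in>carrier B. \<exists>s\<in>carrier B - {\<zero>\<^bsub>B\<^esub>}. y = inv\<^bsub>?D\<^esub> ((h \<circ> \<kappa>) s) \<otimes>\<^bsub>?D\<^esub> (h \<circ> \<kappa>) a"
      using as by (auto simp del: Diff_iff)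
  qed
  then show ?thesis using h(1) by blast
qed

section \<open>The quantum torus\<close>

text \<open>Gaussian elimination. It provides the dimension counts behind both the Ore condition of
  the torus and the existence of a multilinear identity.\<close>

lemma (in field) linear_system_nontrivial_solution:
  assumes "finite J" "finite I" "card J < card I"
    "\<And>i j. i \<in> I \<Longrightarrow> j \<in> J \<Longrightarrow> M j i \<in> carrier R"
  shows "\<exists>v. (\<forall>i\<in>I. v i \<in> carrier R) \<and> (\<exists>i\<in>I. v i \<noteq> \<zero>) \<and> (\<forall>j\<in>J. (\<Oplus>i\<in>I. M j i \<otimes> v i) = \<zero>)"
  using assms
proof (induction J arbitrary: I M rule: finite_induct)
  case empty
  then have "I \<noteq> {}" by auto
  then show ?case by (intro exI[of _ "\<lambda>_. \<one>"]) auto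
next
  case (insert j J)
  note M = insert.prems(3)
  show ?case
  proof (cases "\<forall>i\<in>I. M j i = \<zero>")
    case True
    have "card J < card I" using insert by simp
    from insert.IH[OF insert.prems(1) this, of M] M obtain v where
      v: "\<forall>i\<in>I. v i \<in> carrier R" "\<exists>i\<in>I. v i \<noteq> \<zero>" "\<forall>j\<in>J. (\<Oplus>i\<in>I. M j i \<otimes> v i) = \<zero>" by auto
    have "(\<Oplus>i\<in>I. M j i \<otimes> v i) = \<zero>" using True v(1) by (intro finsum_zero') auto
    then show ?thesis using v by auto
  next
    case False
    then obtain p where p: "p \<in> I" "M j p \<noteq> \<zero>" by blast
    then have pj: "M j p \<in> carrier R" "inv (M j p) \<in> carrier R" "M j p \<otimes> inv (M j p) = \<one>"
      using M by (auto simp: field_Units)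
    define I' where "I' = I - {p}"
    have I': "finite I'" "p \<notin> I'" "I = insert p I'" using insert.prems p by (auto simp: I'_def)
    have card: "card J < card I'" using insert I' by auto
    \<comment> \<open>The unknown \<open>p\<close> is eliminated with the pivot
      \<open>M j p\<close>; equation \<open>j\<close> is then met by the choice of
      \<open>v p\<close> below.\<close>
    define N where "N = (\<lambda>k i. M k i \<ominus> M k p \<otimes> inv (M j p) \<otimes> M j i)"
    have N: "N k i \<in> carrier R" if "i \<in> I'" "k \<in> J" for i k
      using that M pj p I' by (auto simp: N_def)
    obtain w where
      w: "\<forall>i\<in>I'. w i \<in> carrier R" "\<exists>i\<in>I'. w i \<noteq> \<zero>" "\<forall>k\<in>J. (\<Oplus>i\<in>I'. N k i \<otimes> w i) = \<zero>"
      using insert.IH[of I' N, OF I'(1) card N] by blast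
    define s where "s = (\<Oplus>i\<in>I'. M j i \<otimes> w i)"
    have Mw: "(\<lambda>i. M k i \<otimes> w i) \<in> I' \<rightarrow> carrier R" if "k \<in> insert j J" for k
      using that M w I' by auto
    have s: "s \<in> carrier R" unfolding s_def using Mw by (intro finsum_closed) auto
    define v where "v = (\<lambda>i. if i = p then \<ominus> (inv (M j p) \<otimes> s) else w i)"
    have v: "\<forall>i\<in>I. v i \<in> carrier R" using w s pj I' by (auto simp: v_def)
    have split: "(\<Oplus>i\<in>I. M k i \<otimes> v i) = M k p \<otimes> (\<ominus> (inv (M j p) \<otimes> s)) \<oplus> (\<Oplus>i\<in>I'. M k i \<otimes> w i)"
      if k: "k \<in> insert j J" for k
    proof -
      have "(\<Oplus>i\<in>I. M k i \<otimes> v i) = M k p \<otimes> v p \<oplus> (\<Oplus>i\<in>I'. M k i \<otimes> v i)"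
        unfolding I'(3) using I' v M k by (intro finsum_insert) auto
      also have "(\<Oplus>i\<in>I'. M k i \<otimes> v i) = (\<Oplus>i\<in>I'. M k i \<otimes> w i)"
        using I' Mw[OF k] by (intro finsum_cong') (auto simp: v_def)
      finally show ?thesis by (simp add: v_def)
    qed
    have "(\<Oplus>i\<in>I. M j i \<otimes> v i) = \<zero>"
    proof -
      have "M j p \<otimes> (\<ominus> (inv (M j p) \<otimes> s)) = \<ominus> s"
        using pj s by (simp add: r_minus m_assoc[symmetric])
      then show ?thesis using split[of j] s by (simp add: s_def[symmetric] l_neg)
    qed
    moreover have "(\<Oplus>i\<in>I. M k i \<otimes> v i) = \<zero>" if k: "k \<in> J" for k
    proof -
      define q where "q = M k p \<otimes> inv (M j p)"
      have kp: "M k p \<in> carrier R" using M k p by auto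
      have q: "q \<in> carrier R" using kp pj by (simp add: q_def)
      have "\<zero> = (\<Oplus>i\<in>I'. N k i \<otimes> w i)" using w k by simp
      also have "\<dots> = (\<Oplus>i\<in>I'. M k i \<otimes> w i \<oplus> (\<ominus> q) \<otimes> (M j i \<otimes> w i))"
        using M w I' k q
        by (intro finsum_cong') (auto simp: N_def q_def[symmetric] a_minus_def l_distr l_minus m_assoc)
      also have "\<dots> = (\<Oplus>i\<in>I'. M k i \<otimes> w i) \<oplus> (\<Oplus>i\<in>I'. (\<ominus> q) \<otimes> (M j i \<otimes> w i))"
        using Mw[of k] Mw[of j] k q M w I' by (intro finsum_addf) auto
      also have "(\<Oplus>i\<in>I'. (\<ominus> q) \<otimes> (M j i \<otimes> w i)) = (\<ominus> q) \<otimes> s"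
        unfolding s_def using I' Mw[of j] q by (intro finsum_rdistr[symmetric]) auto
      finally have "(\<Oplus>i\<in>I'. M k i \<otimes> w i) \<oplus> (\<ominus> q) \<otimes> s = \<zero>" by simp
      moreover have "(\<Oplus>i\<in>I'. M k i \<otimes> w i) \<in> carrier R" using Mw[of k] k by (intro finsum_closed) auto
      moreover have "M k p \<otimes> (\<ominus> (inv (M j p) \<otimes> s)) = (\<ominus> q) \<otimes> s"
        using kp pj s by (simp add: q_def r_minus l_minus m_assoc)
      ultimately show ?thesis using split[of k] k q s by (simp add: a_comm)
    qed
    moreover have "\<exists>i\<in>I. v i \<noteq> \<zero>" using w(2) I' by (auto simp: v_def)
    ultimately show ?thesis using v by (intro exI[of _ v]) auto
  qed
qed

text \<open>Integer vectors of length \<open>n\<close> as functions that vanish off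
  \<open>{1..n}\<close>, so that the exponents belonging to the successive subalgebras form an
  increasing chain inside one type.\<close>

definition exponents :: "nat \<Rightarrow> (nat \<Rightarrow> int) set"
  where "exponents n = {\<alpha>. \<forall>i. i \<notin> {1..n} \<longrightarrow> \<alpha> i = 0}"

definition unit_vec :: "nat \<Rightarrow> nat \<Rightarrow> int"
  where "unit_vec i = (\<lambda>j. if j = i then 1 else 0)"

lemma exponents_closed [simp, intro]:
  "0 \<in> exponents n"
  "\<alpha> \<in> exponents n \<Longrightarrow> \<beta> \<in> exponents n \<Longrightarrow> \<alpha> + \<beta> \<in> exponents n"
  "\<alpha> \<in> exponents n \<Longrightarrow> \<beta> \<in> exponents n \<Longrightarrow> \<alpha> - \<beta> \<in> exponents n"
  "\<alpha> \<in> exponents n \<Longrightarrow> - \<alpha> \<in> exponents n"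
  "i \<in> {1..n} \<Longrightarrow> unit_vec i \<in> exponents n"
  by (auto simp: exponents_def unit_vec_def)

lemma exponents_mono: "m \<le> n \<Longrightarrow> exponents m \<subseteq> exponents n"
  by (fastforce simp: exponents_def)

text \<open>The unique product property, obtained from the lexicographic order. Induction on the
  number of coordinates in which elements may differ: a sum with largest last coordinate can only
  come from summands with largest last coordinates, and among these one coordinate fewer
  varies.\<close>

lemma unique_sum:
  assumes "finite F" "finite G" "F \<noteq> {}" "G \<noteq> {}" "F \<subseteq> exponents n" "G \<subseteq> exponents n"
  shows "\<exists>\<alpha>\<in>F. \<exists>\<beta>\<in>G. \<forall>\<alpha>'\<in>F. \<forall>\<beta>'\<in>G. \<alpha>' + \<beta>' = \<alpha> + \<beta> \<longrightarrow> \<alpha>' = \<alpha> \<and> \<beta>' = \<beta>"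
proof -
  have "\<exists>\<alpha>\<in>F. \<exists>\<beta>\<in>G. \<forall>\<alpha>'\<in>F. \<forall>\<beta>'\<in>G. \<alpha>' + \<beta>' = \<alpha> + \<beta> \<longrightarrow> \<alpha>' = \<alpha> \<and> \<beta>' = \<beta>"
    if "finite F" "finite G" "F \<noteq> {}" "G \<noteq> {}"
      "\<And>\<alpha> \<alpha>' i. \<alpha> \<in> F \<Longrightarrow> \<alpha>' \<in> F \<Longrightarrow> i \<notin> {1..k} \<Longrightarrow> \<alpha> i = \<alpha>' i"
      "\<And>\<alpha> \<alpha>' i. \<alpha> \<in> G \<Longrightarrow> \<alpha>' \<in> G \<Longrightarrow> i \<notin> {1..k} \<Longrightarrow> \<alpha> i = \<alpha>' i" for k and F G :: "(nat \<Rightarrow> int) set"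
    using that
  proof (induction k arbitrary: F G)
    case 0
    then obtain \<alpha> \<beta> where "\<alpha> \<in> F" "\<beta> \<in> G" by blast
    then show ?case using 0(5,6) by (intro bexI[of _ \<alpha>] bexI[of _ \<beta>]) (auto simp: fun_eq_iff)
  next
    case (Suc k)
    define a where "a = Max ((\<lambda>\<alpha>. \<alpha> (Suc k)) ` F)"
    define b where "b = Max ((\<lambda>\<alpha>. \<alpha> (Suc k)) ` G)"
    have a: "\<alpha> (Suc k) \<le> a" if "\<alpha> \<in> F" for \<alpha> unfolding a_def using that Suc.prems by (intro Max_ge) auto
    have b: "\<alpha> (Suc k) \<le> b" if "\<alpha> \<in> G" for \<alpha> unfolding b_def using that Suc.prems by (intro Max_ge) auto
    define F' where "F' = {\<alpha> \<in> F. \<alpha> (Suc k) = a}"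
    define G' where "G' = {\<alpha> \<in> G. \<alpha> (Suc k) = b}"
    have "a \<in> (\<lambda>\<alpha>. \<alpha> (Suc k)) ` F" "b \<in> (\<lambda>\<alpha>. \<alpha> (Suc k)) ` G"
      unfolding a_def b_def using Suc.prems(1-4) by (auto intro!: Max_in)
    then have ne: "F' \<noteq> {}" "G' \<noteq> {}"
      by (auto simp: F'_def G'_def)
    have F': "\<alpha> i = \<alpha>' i" if "\<alpha> \<in> F'" "\<alpha>' \<in> F'" "i \<notin> {1..k}" for \<alpha> \<alpha>' i
      using that Suc.prems(5)[of \<alpha> \<alpha>' i] by (cases "i = Suc k") (auto simp: F'_def)
    have G': "\<alpha> i = \<alpha>' i" if "\<alpha> \<in> G'" "\<alpha>' \<in> G'" "i \<notin> {1..k}" for \<alpha> \<alpha>' i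
      using that Suc.prems(6)[of \<alpha> \<alpha>' i] by (cases "i = Suc k") (auto simp: G'_def)
    have fin: "finite F'" "finite G'" using Suc.prems by (auto simp: F'_def G'_def)
    have "\<exists>\<alpha>\<in>F'. \<exists>\<beta>\<in>G'. \<forall>\<alpha>'\<in>F'. \<forall>\<beta>'\<in>G'. \<alpha>' + \<beta>' = \<alpha> + \<beta> \<longrightarrow> \<alpha>' = \<alpha> \<and> \<beta>' = \<beta>"
      by (rule Suc.IH) (use fin ne F' G' in blast)+
    then obtain \<alpha> \<beta> where ab: "\<alpha> \<in> F'" "\<beta> \<in> G'"
      "\<forall>\<alpha>'\<in>F'. \<forall>\<beta>'\<in>G'. \<alpha>' + \<beta>' = \<alpha> + \<beta> \<longrightarrow> \<alpha>' = \<alpha> \<and> \<beta>' = \<beta>" by blast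
    have "\<alpha>' = \<alpha> \<and> \<beta>' = \<beta>" if p: "\<alpha>' \<in> F" "\<beta>' \<in> G" "\<alpha>' + \<beta>' = \<alpha> + \<beta>" for \<alpha>' \<beta>'
    proof -
      have "\<alpha>' (Suc k) + \<beta>' (Suc k) = a + b"
        using p(3) ab(1,2) by (auto simp: fun_eq_iff F'_def G'_def)
      then have "\<alpha>' \<in> F'" "\<beta>' \<in> G'" using a[OF p(1)] b[OF p(2)] p by (auto simp: F'_def G'_def)
      then show ?thesis using ab p by blast
    qed
    moreover have "\<alpha> \<in> F" "\<beta> \<in> G" using ab(1,2) by (simp_all add: F'_def G'_def)
    ultimately show ?case by blast
  qed
  note key = this
  have z: "\<alpha> i = \<alpha>' i" if "\<alpha> \<in> exponents n" "\<alpha>' \<in> exponents n" "i \<notin> {1..n}" for \<alpha> \<alpha>' i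
  proof -
    have "\<alpha> i = 0" "\<alpha>' i = 0" using that unfolding exponents_def by blast+
    then show ?thesis by simp
  qed
  show ?thesis
  proof (rule key[of F G n])
    show "\<alpha> i = \<alpha>' i" if "\<alpha> \<in> F" "\<alpha>' \<in> F" "i \<notin> {1..n}" for \<alpha> \<alpha>' i
      by (rule z[OF subsetD[OF assms(5)] subsetD[OF assms(5)]]) (rule that)+
    show "\<alpha> i = \<alpha>' i" if "\<alpha> \<in> G" "\<alpha>' \<in> G" "i \<notin> {1..n}" for \<alpha> \<alpha>' i
      by (rule z[OF subsetD[OF assms(6)] subsetD[OF assms(6)]]) (rule that)+
  qed (rule assms)+
qed

definition box :: "nat \<Rightarrow> int \<Rightarrow> int \<Rightarrow> (nat \<Rightarrow> int) set"
  where "box n a b = {\<alpha> \<in> exponents n. \<forall>i\<in>{1..n}. a \<le> \<alpha> i \<and> \<alpha> i < b}"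

lemma card_box: "finite (box n a b)" "card (box n a b) = nat (b - a) ^ n"
proof -
  have "bij_betw (\<lambda>f i. if i \<in> {1..n} then f i else 0) ({1..n} \<rightarrow>\<^sub>E {a..<b}) (box n a b)"
  proof (rule bij_betw_byWitness[where f' = "\<lambda>f. restrict f {1..n}"])
    show "\<forall>f\<in>{1..n} \<rightarrow>\<^sub>E {a..<b}. restrict (\<lambda>i. if i \<in> {1..n} then f i else 0) {1..n} = f"
      by (auto simp: fun_eq_iff PiE_def extensional_def)
    show "\<forall>f\<in>box n a b. (\<lambda>i. if i \<in> {1..n} then restrict f {1..n} i else 0) = f"
      by (auto simp: fun_eq_iff box_def exponents_def)
    show "(\<lambda>f i. if i \<in> {1..n} then f i else 0) ` ({1..n} \<rightarrow>\<^sub>E {a..<b}) \<subseteq> box n a b"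
      by (auto simp: box_def exponents_def PiE_def Pi_def)
    show "(\<lambda>f. restrict f {1..n}) ` box n a b \<subseteq> {1..n} \<rightarrow>\<^sub>E {a..<b}"
      by (auto simp: box_def)
  qed
  moreover have "finite ({1..n} \<rightarrow>\<^sub>E {a..<b})" "card ({1..n} \<rightarrow>\<^sub>E {a..<b}) = nat (b - a) ^ n"
    by (auto simp: card_PiE intro: finite_PiE)
  ultimately show "finite (box n a b)" "card (box n a b) = nat (b - a) ^ n"
    by (auto simp: bij_betw_finite bij_betw_same_card[symmetric])
qed

text \<open>A fixed margin changes the number of points of a large box by a factor close to 1. A
  factor below 2 is what makes two unknown coefficients per point outnumber the equations in
  \<open>common_multiple\<close>.\<close>

lemma boxes_grow_slowly: "\<exists>N::nat. (N + 2 * M) ^ n < 2 * N ^ n"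
proof -
  \<comment> \<open>Chosen so that \<open>4 * M * n < N + 2 * M\<close>, which is the inequality
    \<open>1 + n * x > 1 / 2\<close> needed after Bernoulli.\<close>
  define N where "N = 4 * M * n + 1"
  define x :: real where "x = - 2 * M / (N + 2 * M)"
  have "N > 0" by (simp add: N_def)
  then have pos: "real N > 0" by linarith
  have x: "1 + x = N / (N + 2 * M)" using pos by (simp add: x_def field_simps)
  then have "-1 \<le> x" using pos by (smt (verit) divide_nonneg_nonneg of_nat_0_le_iff)
  then have "1 + n * x \<le> (N / (N + 2 * M)) ^ n" using Bernoulli_inequality[of x n] x by simp
  moreover have "1 + n * x > 1 / 2"
    using pos unfolding x_def by (simp add: field_simps N_def)
  ultimately have "1 / 2 < (N / (N + 2 * M)) ^ n" by simp
  then have "real ((N + 2 * M) ^ n) < real (2 * N ^ n)"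
    using pos by (simp add: power_divide field_simps)
  then show ?thesis unfolding of_nat_less_iff by blast
qed

section \<open>The torus and its commutation bicharacter\<close>

locale quantum_torus = field K for K (structure) +
  fixes n :: nat and \<Lambda> :: "nat \<Rightarrow> nat \<Rightarrow> 'a" and T
  assumes antisym: "mult_antisymmetric K n \<Lambda>"
  defines "T \<equiv> twisted_algebra K (exponents n) (+) 0 (\<lambda>\<alpha> \<beta>. finprod (units_of K)
      (\<lambda>p. \<Lambda> (fst p) (snd p) [^]\<^bsub>units_of K\<^esub> (\<alpha> (fst p) * \<beta> (snd p)))
      {p \<in> {1..n} \<times> {1..n}. snd p < fst p})"
begin

text \<open>The basis element \<open>y^\<alpha>\<close> is the product of the
  \<open>y_i^\<alpha>_i\<close> in increasing order of \<open>i\<close>. Sorting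
  \<open>y^\<alpha> y^\<beta>\<close> moves each \<open>y_j\<close> to the left past the
  \<open>y_i\<close> with \<open>j < i\<close>, and this is the scalar that results. The powers are
  taken in the group of units because the exponents may be negative.\<close>

definition twist :: "(nat \<Rightarrow> int) \<Rightarrow> (nat \<Rightarrow> int) \<Rightarrow> 'a"
  where "twist \<alpha> \<beta> = finprod (units_of K)
      (\<lambda>p. \<Lambda> (fst p) (snd p) [^]\<^bsub>units_of K\<^esub> (\<alpha> (fst p) * \<beta> (snd p)))
      {p \<in> {1..n} \<times> {1..n}. snd p < fst p}"

text \<open>\<open>y\<^sup>\<alpha> y\<^sup>\<beta> = \<langle>\<alpha>, \<beta>\<rangle> y\<^sup>\<beta> y\<^sup>\<alpha>\<close>\<close>

definition comm :: "(nat \<Rightarrow> int) \<Rightarrow> (nat \<Rightarrow> int) \<Rightarrow> 'a"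
  where "comm \<alpha> \<beta> = twist \<alpha> \<beta> \<otimes> inv (twist \<beta> \<alpha>)"

lemma T_twist: "T = twisted_algebra K (exponents n) (+) 0 twist"
  unfolding T_def twist_def ..

interpretation U: comm_group "units_of K" by (rule units_comm_group)

lemma Lambda_Units: "i \<in> {1..n} \<Longrightarrow> j \<in> {1..n} \<Longrightarrow> \<Lambda> i j \<in> Units K"
  using antisym unfolding mult_antisymmetric_def field_Units by blast

lemma Lambda_swap: "i \<in> {1..n} \<Longrightarrow> j \<in> {1..n} \<Longrightarrow> \<Lambda> j i = inv (\<Lambda> i j)"
  using antisym unfolding mult_antisymmetric_def by blast

lemma Lambda_diag: "i \<in> {1..n} \<Longrightarrow> \<Lambda> i i = \<one>"
  using antisym unfolding mult_antisymmetric_def by blast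

lemma Lambda_factor:
  "(\<lambda>p. \<Lambda> (fst p) (snd p) [^]\<^bsub>units_of K\<^esub> (f p :: int)) \<in> {p \<in> {1..n} \<times> {1..n}. snd p < fst p} \<rightarrow> carrier (units_of K)"
  using Lambda_Units by (auto simp: units_of_carrier intro!: U.int_pow_closed[unfolded units_of_carrier])

lemma twist_Units [simp]: "twist \<alpha> \<beta> \<in> Units K"
  using U.finprod_closed[OF Lambda_factor] by (simp add: twist_def units_of_carrier)

text \<open>Bimultiplicativity makes the twist a 2-cocycle, which is where the associativity of the
  torus comes from; \<open>comm\<close> inherits it.\<close>

lemma twist_add:
  "twist (\<alpha> + \<beta>) \<gamma> = twist \<alpha> \<gamma> \<otimes> twist \<beta> \<gamma>"
  "twist \<gamma> (\<alpha> + \<beta>) = twist \<gamma> \<alpha> \<otimes> twist \<gamma> \<beta>"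
proof -
  have "finprod (units_of K) (\<lambda>p. \<Lambda> (fst p) (snd p) [^]\<^bsub>units_of K\<^esub> (f p + g p :: int)) {p \<in> {1..n} \<times> {1..n}. snd p < fst p}
    = finprod (units_of K) (\<lambda>p. \<Lambda> (fst p) (snd p) [^]\<^bsub>units_of K\<^esub> f p) {p \<in> {1..n} \<times> {1..n}. snd p < fst p}
    \<otimes> finprod (units_of K) (\<lambda>p. \<Lambda> (fst p) (snd p) [^]\<^bsub>units_of K\<^esub> g p) {p \<in> {1..n} \<times> {1..n}. snd p < fst p}" for f g
  proof -
    have "finprod (units_of K) (\<lambda>p. \<Lambda> (fst p) (snd p) [^]\<^bsub>units_of K\<^esub> (f p + g p :: int)) {p \<in> {1..n} \<times> {1..n}. snd p < fst p}
      = finprod (units_of K) (\<lambda>p. \<Lambda> (fst p) (snd p) [^]\<^bsub>units_of K\<^esub> f p \<otimes>\<^bsub>units_of K\<^esub> \<Lambda> (fst p) (snd p) [^]\<^bsub>units_of K\<^esub> g p)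
        {p \<in> {1..n} \<times> {1..n}. snd p < fst p}"
      by (rule U.finprod_cong'[OF refl])
        (use Lambda_Units Lambda_factor in \<open>auto simp: Pi_def units_of_carrier intro!: U.int_pow_mult U.m_closed[unfolded units_of_carrier]\<close>)
    also have "\<dots> = finprod (units_of K) (\<lambda>p. \<Lambda> (fst p) (snd p) [^]\<^bsub>units_of K\<^esub> f p) {p \<in> {1..n} \<times> {1..n}. snd p < fst p}
    \<otimes>\<^bsub>units_of K\<^esub> finprod (units_of K) (\<lambda>p. \<Lambda> (fst p) (snd p) [^]\<^bsub>units_of K\<^esub> g p) {p \<in> {1..n} \<times> {1..n}. snd p < fst p}"
      by (rule U.finprod_multf[OF Lambda_factor Lambda_factor])
    finally show ?thesis by (simp add: units_of_mult)
  qed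
  then show "twist (\<alpha> + \<beta>) \<gamma> = twist \<alpha> \<gamma> \<otimes> twist \<beta> \<gamma>" "twist \<gamma> (\<alpha> + \<beta>) = twist \<gamma> \<alpha> \<otimes> twist \<gamma> \<beta>"
    unfolding twist_def by (simp_all add: distrib_left distrib_right)
qed

lemma twist_0 [simp]: "twist 0 \<alpha> = \<one>" "twist \<alpha> 0 = \<one>"
  by (simp_all add: twist_def U.finprod_one[unfolded units_of_one] units_of_one)

lemma twist_in [simp]: "twist \<alpha> \<beta> \<in> carrier K" and twist_nz [simp]: "twist \<alpha> \<beta> \<noteq> \<zero>"
  using twist_Units[of \<alpha> \<beta>] by (auto simp: field_Units simp del: twist_Units)

lemma comm_Units [simp]: "comm \<alpha> \<beta> \<in> Units K"
  by (simp add: comm_def)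

lemma comm_in [simp]: "comm \<alpha> \<beta> \<in> carrier K" and comm_nz [simp]: "comm \<alpha> \<beta> \<noteq> \<zero>"
  using comm_Units[of \<alpha> \<beta>] by (auto simp: field_Units simp del: comm_Units)

lemma comm_twist: "comm \<alpha> \<beta> \<otimes> twist \<beta> \<alpha> = twist \<alpha> \<beta>"
  by (simp add: comm_def m_assoc)

lemma comm_eqI: "a \<in> carrier K \<Longrightarrow> a \<otimes> twist \<beta> \<alpha> = twist \<alpha> \<beta> \<Longrightarrow> comm \<alpha> \<beta> = a"
  by (metis comm_twist comm_in m_rcancel twist_in twist_nz)

lemma comm_add:
  "comm (\<alpha> + \<beta>) \<gamma> = comm \<alpha> \<gamma> \<otimes> comm \<beta> \<gamma>"
  "comm \<gamma> (\<alpha> + \<beta>) = comm \<gamma> \<alpha> \<otimes> comm \<gamma> \<beta>"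
proof -
  have swap: "(a \<otimes> b) \<otimes> (c \<otimes> d) = (a \<otimes> c) \<otimes> (b \<otimes> d)"
    if "a \<in> carrier K" "b \<in> carrier K" "c \<in> carrier K" "d \<in> carrier K" for a b c d
    using that by (simp add: m_ac)
  show "comm (\<alpha> + \<beta>) \<gamma> = comm \<alpha> \<gamma> \<otimes> comm \<beta> \<gamma>"
    by (rule comm_eqI) (simp, unfold twist_add, subst swap, simp_all add: comm_twist)
  show "comm \<gamma> (\<alpha> + \<beta>) = comm \<gamma> \<alpha> \<otimes> comm \<gamma> \<beta>"
    by (rule comm_eqI) (simp, unfold twist_add, subst swap, simp_all add: comm_twist)
qed

lemma comm_0 [simp]: "comm 0 \<alpha> = \<one>" "comm \<alpha> 0 = \<one>"
  by (simp_all add: comm_def)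

lemma comm_self [simp]: "comm \<alpha> \<alpha> = \<one>"
  by (simp add: comm_def)

lemma twist_unit_vec:
  assumes ij: "i \<in> {1..n}" "j \<in> {1..n}"
  shows "twist (unit_vec i) (unit_vec j) = (if j < i then \<Lambda> i j else \<one>)"
proof -
  have "twist (unit_vec i) (unit_vec j) = finprod (units_of K) (\<lambda>p. if (i, j) = p then \<Lambda> i j else \<one>\<^bsub>units_of K\<^esub>)
    {p \<in> {1..n} \<times> {1..n}. snd p < fst p}"
    unfolding twist_def
  proof (rule U.finprod_cong'[OF refl])
    fix p assume p: "p \<in> {p \<in> {1..n} \<times> {1..n}. snd p < fst p}"
    show "\<Lambda> (fst p) (snd p) [^]\<^bsub>units_of K\<^esub> (unit_vec i (fst p) * unit_vec j (snd p))
      = (if (i, j) = p then \<Lambda> i j else \<one>\<^bsub>units_of K\<^esub>)"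
      using p Lambda_Units[OF ij] U.int_pow_1 by (cases p) (auto simp: unit_vec_def units_of_carrier)
  qed (use Lambda_Units[OF ij] in \<open>auto simp: units_of_carrier units_of_one\<close>)
  also have "\<dots> = (if j < i then \<Lambda> i j else \<one>)"
  proof (cases "j < i")
    case True
    then show ?thesis
      using ij Lambda_Units[OF ij]
        U.finprod_singleton[of "(i, j)" "{p \<in> {1..n} \<times> {1..n}. snd p < fst p}" "\<lambda>_. \<Lambda> i j"]
      by (auto simp: units_of_carrier)
  next
    case False
    then have "finprod (units_of K) (\<lambda>p. if (i, j) = p then \<Lambda> i j else \<one>\<^bsub>units_of K\<^esub>)
      {p \<in> {1..n} \<times> {1..n}. snd p < fst p} = \<one>\<^bsub>units_of K\<^esub>"
      by (intro U.finprod_one_eqI) auto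
    then show ?thesis using False by (simp add: units_of_one)
  qed
  finally show ?thesis .
qed

text \<open>The generators of the torus thus obey the relations of quantum affine space.\<close>

lemma comm_unit_vec:
  assumes "i \<in> {1..n}" "j \<in> {1..n}"
  shows "comm (unit_vec i) (unit_vec j) = \<Lambda> i j"
proof -
  show ?thesis
  proof (cases i j rule: linorder_cases)
    case less
    then show ?thesis
      using twist_unit_vec[OF assms] twist_unit_vec[OF assms(2,1)] Lambda_swap[OF assms(2,1)] Lambda_Units[OF assms(2,1)]
      by (simp add: comm_def Units_closed)
  next
    case equal
    then show ?thesis using Lambda_diag assms by simp
  next
    case greater
    then show ?thesis
      using twist_unit_vec[OF assms] twist_unit_vec[OF assms(2,1)] Lambda_Units[OF assms] by (simp add: comm_def Units_closed)
  qed
qed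

sublocale TM: twisted_monoid_algebra K "exponents n" "(+)" 0 twist T
proof (unfold_locales, goal_cases)
  case (7 u v w)
  then show ?case by (simp add: twist_add m_ac)
qed (auto simp: add.assoc T_twist)

lemma single_times:
  assumes "a \<in> carrier K" "\<alpha> \<in> exponents n" "t \<in> carrier T"
  shows "(single K a \<alpha> \<otimes>\<^bsub>T\<^esub> t) \<gamma> = twist \<alpha> (\<gamma> - \<alpha>) \<otimes> (a \<otimes> t (\<gamma> - \<alpha>))"
proof -
  note [simp] = TM.T_val[OF assms(3)]
  let ?G = "{v. t v \<noteq> \<zero>}"
  have "(single K a \<alpha> \<otimes>\<^bsub>T\<^esub> t) \<gamma> = (\<Oplus>u\<in>{\<alpha>}. \<Oplus>v\<in>?G.
      if u + v = \<gamma> then twist u v \<otimes> (single K a \<alpha> u \<otimes> t v) else \<zero>)"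
    by (rule TM.T_mult)
      (use assms TM.T_supp[OF assms(3)] in \<open>auto, auto simp: single_def split: if_splits\<close>)
  also have "\<dots> = (\<Oplus>v\<in>?G. if \<alpha> + v = \<gamma> then twist \<alpha> v \<otimes> (a \<otimes> t v) else \<zero>)"
    using assms by (subst finsum_insert) (auto simp: single_def Pi_def intro!: finsum_closed cong: if_cong)
  also have "\<dots> = (\<Oplus>v\<in>?G. if v = \<gamma> - \<alpha> then twist \<alpha> (\<gamma> - \<alpha>) \<otimes> (a \<otimes> t (\<gamma> - \<alpha>)) else \<zero>)"
    using assms by (intro finsum_cong' refl) (auto simp: algebra_simps)
  also have "\<dots> = twist \<alpha> (\<gamma> - \<alpha>) \<otimes> (a \<otimes> t (\<gamma> - \<alpha>))"
    using assms by (subst finsum_delta) auto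
  finally show ?thesis .
qed

lemma times_single:
  assumes "a \<in> carrier K" "\<alpha> \<in> exponents n" "t \<in> carrier T"
  shows "(t \<otimes>\<^bsub>T\<^esub> single K a \<alpha>) \<gamma> = twist (\<gamma> - \<alpha>) \<alpha> \<otimes> (t (\<gamma> - \<alpha>) \<otimes> a)"
proof -
  note [simp] = TM.T_val[OF assms(3)]
  let ?G = "{v. t v \<noteq> \<zero>}"
  have "(t \<otimes>\<^bsub>T\<^esub> single K a \<alpha>) \<gamma> = (\<Oplus>v\<in>?G. \<Oplus>u\<in>{\<alpha>}.
      if v + u = \<gamma> then twist v u \<otimes> (t v \<otimes> single K a \<alpha> u) else \<zero>)"
    by (rule TM.T_mult)
      (use assms TM.T_supp[OF assms(3)] in \<open>auto, auto simp: single_def split: if_splits\<close>)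
  also have "\<dots> = (\<Oplus>v\<in>?G. if v = \<gamma> - \<alpha> then twist (\<gamma> - \<alpha>) \<alpha> \<otimes> (t (\<gamma> - \<alpha>) \<otimes> a) else \<zero>)"
    using assms by (intro finsum_cong' refl) (auto simp: algebra_simps single_def)
  also have "\<dots> = twist (\<gamma> - \<alpha>) \<alpha> \<otimes> (t (\<gamma> - \<alpha>) \<otimes> a)"
    using assms by (subst finsum_delta) auto
  finally show ?thesis .
qed

lemma single_Units:
  assumes "a \<in> carrier K" "a \<noteq> \<zero>" "\<alpha> \<in> exponents n"
  shows "single K a \<alpha> \<in> Units T"
proof -
  have a: "a \<in> Units K" using assms by (simp add: field_Units)
  \<comment> \<open>Since \<open>y^\<alpha>\<close> and \<open>y^(-\<alpha>)\<close> commute, a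
    single candidate is an inverse on both sides.\<close>
  have "comm \<alpha> (- \<alpha>) = \<one>" using comm_add(2)[of \<alpha> \<alpha> "- \<alpha>"] by simp
  then have tw: "twist \<alpha> (- \<alpha>) = twist (- \<alpha>) \<alpha>" using comm_twist[of \<alpha> "- \<alpha>"] by simp
  let ?b = "inv (twist \<alpha> (- \<alpha>)) \<otimes> inv a"
  have b: "?b \<in> carrier K" using a by simp
  have "twist \<alpha> (- \<alpha>) \<otimes> (a \<otimes> ?b) = (twist \<alpha> (- \<alpha>) \<otimes> inv (twist \<alpha> (- \<alpha>))) \<otimes> (a \<otimes> inv a)"
    using a Units_inv_closed[OF twist_Units] by (simp only: m_ac twist_in Units_closed Units_inv_closed m_closed)
  then have eq: "twist \<alpha> (- \<alpha>) \<otimes> (a \<otimes> ?b) = \<one>" using a by simp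
  have "single K a \<alpha> \<otimes>\<^bsub>T\<^esub> single K ?b (- \<alpha>) = \<one>\<^bsub>T\<^esub>" "single K ?b (- \<alpha>) \<otimes>\<^bsub>T\<^esub> single K a \<alpha> = \<one>\<^bsub>T\<^esub>"
    using assms b eq m_comm[OF b assms(1)] by (simp_all add: TM.single_mult TM.T_one tw[symmetric])
  moreover have "single K a \<alpha> \<in> carrier T" "single K ?b (- \<alpha>) \<in> carrier T"
    using assms b by auto
  ultimately show ?thesis unfolding Units_def by auto
qed

text \<open>At an exponent that is a sum of exponents of \<open>f\<close> and \<open>g\<close> in
  only one way, the coefficient of the product is a single nonzero term.\<close>

lemma T_no_zero_divisors:
  assumes f: "f \<in> carrier T" "f \<noteq> \<zero>\<^bsub>T\<^esub>" and g: "g \<in> carrier T" "g \<noteq> \<zero>\<^bsub>T\<^esub>"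
  shows "f \<otimes>\<^bsub>T\<^esub> g \<noteq> \<zero>\<^bsub>T\<^esub>"
proof -
  note [simp] = TM.T_val[OF f(1)] TM.T_val[OF g(1)]
  let ?F = "{u. f u \<noteq> \<zero>}" and ?G = "{u. g u \<noteq> \<zero>}"
  have sup: "finite ?F" "finite ?G" "?F \<subseteq> exponents n" "?G \<subseteq> exponents n"
    using f(1) g(1) by (auto simp: TM.T_carrier)
  have "?F \<noteq> {}" "?G \<noteq> {}" using f g by (auto simp: TM.T_simps fun_eq_iff)
  from unique_sum[OF sup(1,2) this sup(3,4)] obtain \<alpha> \<beta> where ab: "f \<alpha> \<noteq> \<zero>" "g \<beta> \<noteq> \<zero>"
    and u: "\<And>\<alpha>' \<beta>'. f \<alpha>' \<noteq> \<zero> \<Longrightarrow> g \<beta>' \<noteq> \<zero> \<Longrightarrow> \<alpha>' + \<beta>' = \<alpha> + \<beta> \<Longrightarrow> \<alpha>' = \<alpha> \<and> \<beta>' = \<beta>" by blast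
  let ?X = "twist \<alpha> \<beta> \<otimes> (f \<alpha> \<otimes> g \<beta>)"
  have "(f \<otimes>\<^bsub>T\<^esub> g) (\<alpha> + \<beta>) = (\<Oplus>u\<in>?F. \<Oplus>v\<in>?G. if u + v = \<alpha> + \<beta> then twist u v \<otimes> (f u \<otimes> g v) else \<zero>)"
    using f g sup by (intro TM.T_mult) auto
  also have "\<dots> = (\<Oplus>u\<in>?F. if u = \<alpha> then ?X else \<zero>)"
  proof (rule finsum_cong'[OF refl])
    fix u' assume u': "u' \<in> ?F"
    have "(\<Oplus>v\<in>?G. if u' + v = \<alpha> + \<beta> then twist u' v \<otimes> (f u' \<otimes> g v) else \<zero>)
      = (\<Oplus>v\<in>?G. if v = \<beta> then (if u' = \<alpha> then ?X else \<zero>) else \<zero>)"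
      by (rule finsum_cong'[OF refl]) (use u' u in \<open>auto\<close>)
    also have "\<dots> = (if u' = \<alpha> then ?X else \<zero>)"
      using sup ab by (subst finsum_delta) auto
    finally show "(\<Oplus>v\<in>?G. if u' + v = \<alpha> + \<beta> then twist u' v \<otimes> (f u' \<otimes> g v) else \<zero>)
      = (if u' = \<alpha> then ?X else \<zero>)" .
  qed auto
  also have "\<dots> = ?X" using sup ab by (subst finsum_delta) auto
  finally have "(f \<otimes>\<^bsub>T\<^esub> g) (\<alpha> + \<beta>) = ?X" .
  moreover have "?X \<noteq> \<zero>" using ab by (simp add: integral_iff)
  ultimately show ?thesis by (auto simp: TM.T_simps)
qed

section \<open>The Ore condition\<close>

lemma finite_subset_box:
  assumes "finite F" "F \<subseteq> exponents n"
  shows "\<exists>M::nat. F \<subseteq> box n (- int M) (int M)"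
proof -
  define M where "M = Suc (nat (\<Sum>\<gamma>\<in>F. \<Sum>i\<in>{1..n}. \<bar>\<gamma> i\<bar>))"
  have "\<bar>\<gamma> i\<bar> < int M" if "\<gamma> \<in> F" "i \<in> {1..n}" for \<gamma> i
  proof -
    have "\<bar>\<gamma> i\<bar> \<le> (\<Sum>i\<in>{1..n}. \<bar>\<gamma> i\<bar>)" using that by (intro member_le_sum) auto
    also have "\<dots> \<le> (\<Sum>\<gamma>\<in>F. \<Sum>i\<in>{1..n}. \<bar>\<gamma> i\<bar>)"
      using that assms by (intro member_le_sum[of \<gamma> F "\<lambda>\<gamma>. \<Sum>i\<in>{1..n}. \<bar>\<gamma> i\<bar>"]) (auto intro: sum_nonneg)
    finally show ?thesis unfolding M_def by linarith
  qed
  then show ?thesis using assms by (intro exI[of _ M]) (force simp: box_def)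
qed

text \<open>Counting dimensions: multiplication by a fixed element enlarges a box only by a bounded amount.\<close>

lemma common_multiple:
  assumes L: "\<And>\<alpha>. \<alpha> \<in> exponents n \<Longrightarrow> L1 \<alpha> \<in> carrier T" "\<And>\<alpha>. \<alpha> \<in> exponents n \<Longrightarrow> L2 \<alpha> \<in> carrier T"
    and M: "\<And>\<alpha> \<gamma>. \<alpha> \<in> exponents n \<Longrightarrow> L1 \<alpha> \<gamma> \<noteq> \<zero> \<Longrightarrow> \<gamma> - \<alpha> \<in> box n (- int M) (int M)"
      "\<And>\<alpha> \<gamma>. \<alpha> \<in> exponents n \<Longrightarrow> L2 \<alpha> \<gamma> \<noteq> \<zero> \<Longrightarrow> \<gamma> - \<alpha> \<in> box n (- int M) (int M)"
  shows "\<exists>P w1 w2. finite P \<and> P \<subseteq> exponents n \<and> (\<forall>\<alpha>\<in>P. w1 \<alpha> \<in> carrier K \<and> w2 \<alpha> \<in> carrier K) \<and>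
    (\<exists>\<alpha>\<in>P. w1 \<alpha> \<noteq> \<zero> \<or> w2 \<alpha> \<noteq> \<zero>) \<and>
    (\<Oplus>\<^bsub>T\<^esub>\<alpha>\<in>P. w1 \<alpha> \<odot>\<^bsub>T\<^esub> L1 \<alpha>) = (\<Oplus>\<^bsub>T\<^esub>\<alpha>\<in>P. w2 \<alpha> \<odot>\<^bsub>T\<^esub> L2 \<alpha>)"
proof -
  obtain N :: nat where N: "(N + 2 * M) ^ n < 2 * N ^ n" using boxes_grow_slowly by blast
  define P where "P = box n 0 (int N)"
  define J where "J = box n (- int M) (int N + int M)"
  have P: "finite P" "P \<subseteq> exponents n" "card P = N ^ n"
    by (auto simp: P_def card_box) (auto simp: box_def)
  have J: "finite J" "card J = (N + 2 * M) ^ n"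
    by (auto simp: J_def card_box intro!: arg_cong[of _ _ "\<lambda>k. k ^ n"])
  \<comment> \<open>Two copies of \<open>P\<close> index the unknowns, the coefficients of the two
    multipliers. The points of \<open>J\<close> index the equations, and \<open>N\<close> was chosen
    to make them fewer.\<close>
  define I where "I = Inl ` P \<union> (Inr ` P :: ((nat \<Rightarrow> int) + (nat \<Rightarrow> int)) set)"
  have I: "finite I" "card I = 2 * N ^ n"
    using P unfolding I_def by (simp, subst card_Un_disjoint) (auto simp: card_image inj_on_def)
  define m where "m = (\<lambda>\<gamma>. case_sum (\<lambda>\<alpha>. L1 \<alpha> \<gamma>) (\<lambda>\<alpha>. \<ominus> L2 \<alpha> \<gamma>))"
  have Lv: "L1 \<alpha> \<gamma> \<in> carrier K" "L2 \<alpha> \<gamma> \<in> carrier K" if "\<alpha> \<in> P" for \<alpha> \<gamma>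
    using that P L TM.T_val by auto
  have "\<exists>v. (\<forall>i\<in>I. v i \<in> carrier K) \<and> (\<exists>i\<in>I. v i \<noteq> \<zero>) \<and> (\<forall>\<gamma>\<in>J. (\<Oplus>i\<in>I. m \<gamma> i \<otimes> v i) = \<zero>)"
    using I J N Lv by (intro linear_system_nontrivial_solution) (auto simp: I_def m_def)
  then obtain v where v: "\<forall>i\<in>I. v i \<in> carrier K" "\<exists>i\<in>I. v i \<noteq> \<zero>" "\<forall>\<gamma>\<in>J. (\<Oplus>i\<in>I. m \<gamma> i \<otimes> v i) = \<zero>"
    by blast
  have vP: "v (Inl \<alpha>) \<in> carrier K" "v (Inr \<alpha>) \<in> carrier K" if "\<alpha> \<in> P" for \<alpha>
    using v that by (auto simp: I_def)
  have sumI: "(\<Oplus>i\<in>I. m \<gamma> i \<otimes> v i) = (\<Oplus>\<alpha>\<in>P. v (Inl \<alpha>) \<otimes> L1 \<alpha> \<gamma>) \<ominus> (\<Oplus>\<alpha>\<in>P. v (Inr \<alpha>) \<otimes> L2 \<alpha> \<gamma>)" for \<gamma>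
  proof -
    have "(\<Oplus>i\<in>I. m \<gamma> i \<otimes> v i) = (\<Oplus>i\<in>Inl ` P. m \<gamma> i \<otimes> v i) \<oplus> (\<Oplus>i\<in>Inr ` P. m \<gamma> i \<otimes> v i)"
      unfolding I_def using P vP Lv by (intro finsum_Un_disjoint) (auto simp: m_def)
    also have "(\<Oplus>i\<in>Inl ` P. m \<gamma> i \<otimes> v i) = (\<Oplus>\<alpha>\<in>P. m \<gamma> (Inl \<alpha>) \<otimes> v (Inl \<alpha>))"
      using vP Lv by (intro finsum_reindex) (auto simp: m_def)
    also have "\<dots> = (\<Oplus>\<alpha>\<in>P. v (Inl \<alpha>) \<otimes> L1 \<alpha> \<gamma>)"
      using vP Lv by (intro finsum_cong') (auto simp: m_def m_comm)
    also have "(\<Oplus>i\<in>Inr ` P. m \<gamma> i \<otimes> v i) = (\<Oplus>\<alpha>\<in>P. m \<gamma> (Inr \<alpha>) \<otimes> v (Inr \<alpha>))"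
      using vP Lv by (intro finsum_reindex) (auto simp: m_def)
    also have "\<dots> = (\<Oplus>\<alpha>\<in>P. \<ominus> \<one> \<otimes> (v (Inr \<alpha>) \<otimes> L2 \<alpha> \<gamma>))"
      using vP Lv by (intro finsum_cong') (auto simp: m_def l_minus m_comm[of "v (Inr _)"])
    also have "\<dots> = \<ominus> \<one> \<otimes> (\<Oplus>\<alpha>\<in>P. v (Inr \<alpha>) \<otimes> L2 \<alpha> \<gamma>)"
      using vP Lv P by (intro finsum_rdistr[symmetric]) auto
    also have "\<dots> = \<ominus> (\<Oplus>\<alpha>\<in>P. v (Inr \<alpha>) \<otimes> L2 \<alpha> \<gamma>)"
      using vP Lv by (simp add: l_minus finsum_closed)
    finally show ?thesis by (simp add: a_minus_def)
  qed
  have "(\<Oplus>\<^bsub>T\<^esub>\<alpha>\<in>P. v (Inl \<alpha>) \<odot>\<^bsub>T\<^esub> L1 \<alpha>) = (\<Oplus>\<^bsub>T\<^esub>\<alpha>\<in>P. v (Inr \<alpha>) \<odot>\<^bsub>T\<^esub> L2 \<alpha>)"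
  proof
    fix \<gamma>
    have e1: "(\<Oplus>\<^bsub>T\<^esub>\<alpha>\<in>P. v (Inl \<alpha>) \<odot>\<^bsub>T\<^esub> L1 \<alpha>) \<gamma> = (\<Oplus>\<alpha>\<in>P. v (Inl \<alpha>) \<otimes> L1 \<alpha> \<gamma>)"
      using P vP L by (subst TM.T_finsum_apply) (auto simp: TM.T_simps(4)[symmetric] subset_iff, simp add: TM.T_simps)
    have e2: "(\<Oplus>\<^bsub>T\<^esub>\<alpha>\<in>P. v (Inr \<alpha>) \<odot>\<^bsub>T\<^esub> L2 \<alpha>) \<gamma> = (\<Oplus>\<alpha>\<in>P. v (Inr \<alpha>) \<otimes> L2 \<alpha> \<gamma>)"
      using P vP L by (subst TM.T_finsum_apply) (auto simp: TM.T_simps(4)[symmetric] subset_iff, simp add: TM.T_simps)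
    show "(\<Oplus>\<^bsub>T\<^esub>\<alpha>\<in>P. v (Inl \<alpha>) \<odot>\<^bsub>T\<^esub> L1 \<alpha>) \<gamma> = (\<Oplus>\<^bsub>T\<^esub>\<alpha>\<in>P. v (Inr \<alpha>) \<odot>\<^bsub>T\<^esub> L2 \<alpha>) \<gamma>"
    proof (cases "\<gamma> \<in> J")
      case True
      then have "(\<Oplus>\<alpha>\<in>P. v (Inl \<alpha>) \<otimes> L1 \<alpha> \<gamma>) \<ominus> (\<Oplus>\<alpha>\<in>P. v (Inr \<alpha>) \<otimes> L2 \<alpha> \<gamma>) = \<zero>"
        using v(3) sumI by simp
      then show ?thesis unfolding e1 e2 using vP Lv by (subst (asm) r_right_minus_eq) (auto intro!: finsum_closed)
    next
      case False
      \<comment> \<open>A point outside \<open>J\<close> is not reached from \<open>P\<close> within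
        the margin \<open>M\<close>, so both sides vanish there without an equation being
        imposed.\<close>
      have *: "L1 \<alpha> \<gamma> = \<zero> \<and> L2 \<alpha> \<gamma> = \<zero>" if "\<alpha> \<in> P" for \<alpha>
      proof (rule ccontr)
        assume "\<not> ?thesis"
        then have b: "\<gamma> - \<alpha> \<in> box n (- int M) (int M)" using M that P by blast
        have "\<gamma> = \<alpha> + (\<gamma> - \<alpha>)" by simp
        then have "\<gamma> \<in> exponents n" using b that P exponents_closed(2)[of \<alpha> n "\<gamma> - \<alpha>"] by (auto simp: box_def)
        then have "\<gamma> \<in> J" using b that unfolding J_def P_def box_def by fastforce
        then show False using False by simp
      qed
      have "(\<Oplus>\<alpha>\<in>P. v (Inl \<alpha>) \<otimes> L1 \<alpha> \<gamma>) = \<zero>" "(\<Oplus>\<alpha>\<in>P. v (Inr \<alpha>) \<otimes> L2 \<alpha> \<gamma>) = \<zero>"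
        using * vP by (auto intro!: finsum_zero')
      then show ?thesis unfolding e1 e2 by simp
    qed
  qed
  then show ?thesis
    using P vP v(2)
    by (intro exI[of _ P] exI[of _ "\<lambda>\<alpha>. v (Inl \<alpha>)"] exI[of _ "\<lambda>\<alpha>. v (Inr \<alpha>)"]) (auto simp: I_def)
qed

lemma single_eq_smult: "a \<in> carrier K \<Longrightarrow> single K a \<alpha> = a \<odot>\<^bsub>T\<^esub> single K \<one> \<alpha>"
  by (simp add: TM.T_smult_single)

lemma finsum_single_apply:
  assumes "finite P" "P \<subseteq> exponents n" "\<alpha> \<in> P" "\<And>\<alpha>. \<alpha> \<in> P \<Longrightarrow> w \<alpha> \<in> carrier K"
  shows "(\<Oplus>\<^bsub>T\<^esub>\<alpha>\<in>P. single K (w \<alpha>) \<alpha>) \<alpha> = w \<alpha>"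
proof -
  have "(\<Oplus>\<^bsub>T\<^esub>\<alpha>\<in>P. single K (w \<alpha>) \<alpha>) \<alpha> = (\<Oplus>\<beta>\<in>P. single K (w \<beta>) \<beta> \<alpha>)"
    using assms by (intro TM.T_finsum_apply) (auto simp: subset_iff)
  also have "\<dots> = (\<Oplus>\<beta>\<in>P. if \<beta> = \<alpha> then w \<alpha> else \<zero>)"
    using assms by (intro finsum_cong') (auto simp: single_def)
  finally show ?thesis using assms by (simp add: finsum_delta)
qed

lemma T_ore_domain: "ore_domain T"
proof (intro ore_domain.intro TM.T_ring ore_domain_axioms.intro)
  interpret TK: k_algebra K T by (rule TM.T_k_algebra)
  show "\<one>\<^bsub>T\<^esub> \<noteq> \<zero>\<^bsub>T\<^esub>"
  proof
    assume "\<one>\<^bsub>T\<^esub> = \<zero>\<^bsub>T\<^esub>"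
    then have "\<one>\<^bsub>T\<^esub> 0 = \<zero>\<^bsub>T\<^esub> 0" by simp
    then show False by (simp add: TM.T_simps)
  qed
  show "a = \<zero>\<^bsub>T\<^esub> \<or> b = \<zero>\<^bsub>T\<^esub>" if "a \<in> carrier T" "b \<in> carrier T" "a \<otimes>\<^bsub>T\<^esub> b = \<zero>\<^bsub>T\<^esub>" for a b
    using that T_no_zero_divisors by blast
next
  interpret TK: k_algebra K T by (rule TM.T_k_algebra)
  fix a b assume a: "a \<in> carrier T" "a \<noteq> \<zero>\<^bsub>T\<^esub>" and b: "b \<in> carrier T" "b \<noteq> \<zero>\<^bsub>T\<^esub>"
  have "finite ({u. a u \<noteq> \<zero>} \<union> {u. b u \<noteq> \<zero>})" "{u. a u \<noteq> \<zero>} \<union> {u. b u \<noteq> \<zero>} \<subseteq> exponents n"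
    using a(1) b(1) by (auto simp: TM.T_carrier)
  from finite_subset_box[OF this] obtain M :: nat where
    M: "{u. a u \<noteq> \<zero>} \<union> {u. b u \<noteq> \<zero>} \<subseteq> box n (- int M) (int M)" by blast
  note [simp] = TM.T_val[OF a(1)] TM.T_val[OF b(1)]
  have one: "single K \<one> \<alpha> \<in> carrier T" if "\<alpha> \<in> exponents n" for \<alpha> using that by auto
  \<comment> \<open>The linear system only guarantees that one of the two multipliers is nonzero; in
    a domain the other one follows.\<close>
  have nz: "u \<noteq> \<zero>\<^bsub>T\<^esub> \<and> v \<noteq> \<zero>\<^bsub>T\<^esub>"
    if "u \<in> carrier T" "v \<in> carrier T" "a \<otimes>\<^bsub>T\<^esub> u = b \<otimes>\<^bsub>T\<^esub> v \<or> u \<otimes>\<^bsub>T\<^esub> a = v \<otimes>\<^bsub>T\<^esub> b" "u \<noteq> \<zero>\<^bsub>T\<^esub> \<or> v \<noteq> \<zero>\<^bsub>T\<^esub>" for u v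
    using that T_no_zero_divisors a b by (metis TM.T_zero_mult)
  have elt: "(\<Oplus>\<^bsub>T\<^esub>\<alpha>\<in>P. single K (w \<alpha>) \<alpha>) \<in> carrier T"
    if "P \<subseteq> exponents n" "\<And>\<alpha>. \<alpha> \<in> P \<Longrightarrow> w \<alpha> \<in> carrier K" for P w
    using that by (intro TM.TA.finsum_closed) (auto simp: subset_iff)
  have ne: "(\<Oplus>\<^bsub>T\<^esub>\<alpha>\<in>P. single K (w \<alpha>) \<alpha>) \<noteq> \<zero>\<^bsub>T\<^esub>"
    if "finite P" "P \<subseteq> exponents n" "\<And>\<alpha>. \<alpha> \<in> P \<Longrightarrow> w \<alpha> \<in> carrier K" "\<alpha> \<in> P" "w \<alpha> \<noteq> \<zero>" for P w \<alpha>
    using finsum_single_apply[of P \<alpha> w] that by (auto simp: TM.T_simps(2))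
  have Lr: "d \<otimes>\<^bsub>T\<^esub> (\<Oplus>\<^bsub>T\<^esub>\<alpha>\<in>P. single K (w \<alpha>) \<alpha>) = (\<Oplus>\<^bsub>T\<^esub>\<alpha>\<in>P. w \<alpha> \<odot>\<^bsub>T\<^esub> (d \<otimes>\<^bsub>T\<^esub> single K \<one> \<alpha>))"
    if "d \<in> carrier T" "finite P" "P \<subseteq> exponents n" "\<And>\<alpha>. \<alpha> \<in> P \<Longrightarrow> w \<alpha> \<in> carrier K" for d P w
  proof -
    have "d \<otimes>\<^bsub>T\<^esub> (\<Oplus>\<^bsub>T\<^esub>\<alpha>\<in>P. single K (w \<alpha>) \<alpha>) = (\<Oplus>\<^bsub>T\<^esub>\<alpha>\<in>P. d \<otimes>\<^bsub>T\<^esub> single K (w \<alpha>) \<alpha>)"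
      using that by (intro TM.T.finsum_rdistr) (auto simp: subset_iff)
    also have "\<dots> = (\<Oplus>\<^bsub>T\<^esub>\<alpha>\<in>P. w \<alpha> \<odot>\<^bsub>T\<^esub> (d \<otimes>\<^bsub>T\<^esub> single K \<one> \<alpha>))"
      using that one by (intro TM.TA.finsum_cong' refl)
        (auto simp: subset_iff single_eq_smult[of "w _"] TK.smult_mult_right)
    finally show ?thesis .
  qed
  have Ll: "(\<Oplus>\<^bsub>T\<^esub>\<alpha>\<in>P. single K (w \<alpha>) \<alpha>) \<otimes>\<^bsub>T\<^esub> d = (\<Oplus>\<^bsub>T\<^esub>\<alpha>\<in>P. w \<alpha> \<odot>\<^bsub>T\<^esub> (single K \<one> \<alpha> \<otimes>\<^bsub>T\<^esub> d))"
    if "d \<in> carrier T" "finite P" "P \<subseteq> exponents n" "\<And>\<alpha>. \<alpha> \<in> P \<Longrightarrow> w \<alpha> \<in> carrier K" for d P w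
  proof -
    have "(\<Oplus>\<^bsub>T\<^esub>\<alpha>\<in>P. single K (w \<alpha>) \<alpha>) \<otimes>\<^bsub>T\<^esub> d = (\<Oplus>\<^bsub>T\<^esub>\<alpha>\<in>P. single K (w \<alpha>) \<alpha> \<otimes>\<^bsub>T\<^esub> d)"
      using that by (intro TM.T.finsum_ldistr) (auto simp: subset_iff)
    also have "\<dots> = (\<Oplus>\<^bsub>T\<^esub>\<alpha>\<in>P. w \<alpha> \<odot>\<^bsub>T\<^esub> (single K \<one> \<alpha> \<otimes>\<^bsub>T\<^esub> d))"
      using that one by (intro TM.TA.finsum_cong' refl)
        (auto simp: subset_iff single_eq_smult[of "w _"] TK.smult_mult_left)
    finally show ?thesis .
  qed
  have "\<exists>P w1 w2. finite P \<and> P \<subseteq> exponents n \<and> (\<forall>\<alpha>\<in>P. w1 \<alpha> \<in> carrier K \<and> w2 \<alpha> \<in> carrier K) \<and>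
    (\<exists>\<alpha>\<in>P. w1 \<alpha> \<noteq> \<zero> \<or> w2 \<alpha> \<noteq> \<zero>) \<and>
    (\<Oplus>\<^bsub>T\<^esub>\<alpha>\<in>P. w1 \<alpha> \<odot>\<^bsub>T\<^esub> (a \<otimes>\<^bsub>T\<^esub> single K \<one> \<alpha>)) = (\<Oplus>\<^bsub>T\<^esub>\<alpha>\<in>P. w2 \<alpha> \<odot>\<^bsub>T\<^esub> (b \<otimes>\<^bsub>T\<^esub> single K \<one> \<alpha>))"
    using M a b one by (intro common_multiple[of _ _ M]) (auto simp: times_single integral_iff subset_iff)
  then obtain P w1 w2 where P: "finite P" "P \<subseteq> exponents n"
    and w: "\<forall>\<alpha>\<in>P. w1 \<alpha> \<in> carrier K \<and> w2 \<alpha> \<in> carrier K"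
    and P5: "\<exists>\<alpha>\<in>P. w1 \<alpha> \<noteq> \<zero> \<or> w2 \<alpha> \<noteq> \<zero>"
    and eq: "(\<Oplus>\<^bsub>T\<^esub>\<alpha>\<in>P. w1 \<alpha> \<odot>\<^bsub>T\<^esub> (a \<otimes>\<^bsub>T\<^esub> single K \<one> \<alpha>)) = (\<Oplus>\<^bsub>T\<^esub>\<alpha>\<in>P. w2 \<alpha> \<odot>\<^bsub>T\<^esub> (b \<otimes>\<^bsub>T\<^esub> single K \<one> \<alpha>))"
    by (elim exE conjE) (rule that)
  then have w1: "\<And>\<alpha>. \<alpha> \<in> P \<Longrightarrow> w1 \<alpha> \<in> carrier K" and w2: "\<And>\<alpha>. \<alpha> \<in> P \<Longrightarrow> w2 \<alpha> \<in> carrier K"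
    by auto
  let ?U = "\<Oplus>\<^bsub>T\<^esub>\<alpha>\<in>P. single K (w1 \<alpha>) \<alpha>" and ?V = "\<Oplus>\<^bsub>T\<^esub>\<alpha>\<in>P. single K (w2 \<alpha>) \<alpha>"
  have UV: "?U \<in> carrier T" "?V \<in> carrier T" "?U \<noteq> \<zero>\<^bsub>T\<^esub> \<or> ?V \<noteq> \<zero>\<^bsub>T\<^esub>"
    using elt[of P w1] elt[of P w2] ne[of P w1] ne[of P w2] P w P5 by auto
  have P6: "a \<otimes>\<^bsub>T\<^esub> (\<Oplus>\<^bsub>T\<^esub>\<alpha>\<in>P. single K (w1 \<alpha>) \<alpha>) = b \<otimes>\<^bsub>T\<^esub> (\<Oplus>\<^bsub>T\<^esub>\<alpha>\<in>P. single K (w2 \<alpha>) \<alpha>)"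
    using Lr[OF a(1) P(1,2), of w1, OF w1] Lr[OF b(1) P(1,2), of w2, OF w2] eq by simp
  show "\<exists>u\<in>carrier T. \<exists>v\<in>carrier T. a \<otimes>\<^bsub>T\<^esub> u = b \<otimes>\<^bsub>T\<^esub> v \<and> u \<noteq> \<zero>\<^bsub>T\<^esub> \<and> v \<noteq> \<zero>\<^bsub>T\<^esub>"
    using nz[OF UV(1,2)] P6 UV by blast
  have "\<exists>P w1 w2. finite P \<and> P \<subseteq> exponents n \<and> (\<forall>\<alpha>\<in>P. w1 \<alpha> \<in> carrier K \<and> w2 \<alpha> \<in> carrier K) \<and>
    (\<exists>\<alpha>\<in>P. w1 \<alpha> \<noteq> \<zero> \<or> w2 \<alpha> \<noteq> \<zero>) \<and>
    (\<Oplus>\<^bsub>T\<^esub>\<alpha>\<in>P. w1 \<alpha> \<odot>\<^bsub>T\<^esub> (single K \<one> \<alpha> \<otimes>\<^bsub>T\<^esub> a)) = (\<Oplus>\<^bsub>T\<^esub>\<alpha>\<in>P. w2 \<alpha> \<odot>\<^bsub>T\<^esub> (single K \<one> \<alpha> \<otimes>\<^bsub>T\<^esub> b))"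
    using M a b one by (intro common_multiple[of _ _ M]) (auto simp: single_times integral_iff subset_iff)
  then obtain P w1 w2 where P: "finite P" "P \<subseteq> exponents n"
    and w: "\<forall>\<alpha>\<in>P. w1 \<alpha> \<in> carrier K \<and> w2 \<alpha> \<in> carrier K"
    and P5: "\<exists>\<alpha>\<in>P. w1 \<alpha> \<noteq> \<zero> \<or> w2 \<alpha> \<noteq> \<zero>"
    and eq: "(\<Oplus>\<^bsub>T\<^esub>\<alpha>\<in>P. w1 \<alpha> \<odot>\<^bsub>T\<^esub> (single K \<one> \<alpha> \<otimes>\<^bsub>T\<^esub> a)) = (\<Oplus>\<^bsub>T\<^esub>\<alpha>\<in>P. w2 \<alpha> \<odot>\<^bsub>T\<^esub> (single K \<one> \<alpha> \<otimes>\<^bsub>T\<^esub> b))"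
    by (elim exE conjE) (rule that)
  then have w1: "\<And>\<alpha>. \<alpha> \<in> P \<Longrightarrow> w1 \<alpha> \<in> carrier K" and w2: "\<And>\<alpha>. \<alpha> \<in> P \<Longrightarrow> w2 \<alpha> \<in> carrier K"
    by auto
  let ?U = "\<Oplus>\<^bsub>T\<^esub>\<alpha>\<in>P. single K (w1 \<alpha>) \<alpha>" and ?V = "\<Oplus>\<^bsub>T\<^esub>\<alpha>\<in>P. single K (w2 \<alpha>) \<alpha>"
  have UV: "?U \<in> carrier T" "?V \<in> carrier T" "?U \<noteq> \<zero>\<^bsub>T\<^esub> \<or> ?V \<noteq> \<zero>\<^bsub>T\<^esub>"
    using elt[of P w1] elt[of P w2] ne[of P w1] ne[of P w2] P w P5 by auto
  have P6: "(\<Oplus>\<^bsub>T\<^esub>\<alpha>\<in>P. single K (w1 \<alpha>) \<alpha>) \<otimes>\<^bsub>T\<^esub> a = (\<Oplus>\<^bsub>T\<^esub>\<alpha>\<in>P. single K (w2 \<alpha>) \<alpha>) \<otimes>\<^bsub>T\<^esub> b"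
    using Ll[OF a(1) P(1,2), of w1, OF w1] Ll[OF b(1) P(1,2), of w2, OF w2] eq by simp
  show "\<exists>u\<in>carrier T. \<exists>v\<in>carrier T. u \<otimes>\<^bsub>T\<^esub> a = v \<otimes>\<^bsub>T\<^esub> b \<and> u \<noteq> \<zero>\<^bsub>T\<^esub> \<and> v \<noteq> \<zero>\<^bsub>T\<^esub>"
    using nz[OF UV(1,2)] P6 UV by blast
qed

end

section \<open>Orders in the quantum torus\<close>

context quantum_torus
begin

lemma monomial_product:
  assumes R: "\<forall>s\<in>R. \<forall>t\<in>R. s \<otimes>\<^bsub>T\<^esub> t \<in> R" "\<forall>a\<in>carrier K. \<forall>t\<in>R. a \<odot>\<^bsub>T\<^esub> t \<in> R" and m: "m \<le> n"
    and "single K \<one> \<alpha> \<in> R" "single K \<one> \<beta> \<in> R" "\<alpha> \<in> exponents m" "\<beta> \<in> exponents m"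
  shows "single K \<one> (\<alpha> + \<beta>) \<in> R"
proof -
  have ab: "\<alpha> \<in> exponents n" "\<beta> \<in> exponents n" using assms exponents_mono[OF m] by auto
  have "inv (twist \<alpha> \<beta>) \<odot>\<^bsub>T\<^esub> (single K \<one> \<alpha> \<otimes>\<^bsub>T\<^esub> single K \<one> \<beta>) \<in> R"
    using assms by (intro bspec[OF bspec[OF R(2)]] bspec[OF bspec[OF R(1)]]) auto
  then show ?thesis using ab by (simp add: TM.single_mult TM.T_smult_single)
qed

text \<open>Multiplying the shifts found for single exponents gives one for finitely many, as
  products of monomials in \<open>R\<close> are again monomials up to a scalar. The parameter
  \<open>m\<close> allows the use for a subalgebra in the middle of the chain as well as for a full
  order.\<close>

lemma common_shift:
  assumes R: "\<forall>s\<in>R. \<forall>t\<in>R. s \<otimes>\<^bsub>T\<^esub> t \<in> R" "\<forall>a\<in>carrier K. \<forall>t\<in>R. a \<odot>\<^bsub>T\<^esub> t \<in> R"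
    and R_one: "single K \<one> 0 \<in> R" and m: "m \<le> n"
    and mono: "\<forall>\<alpha>\<in>exponents m. \<exists>\<beta>\<in>exponents m. single K \<one> \<beta> \<in> R \<and> single K \<one> (\<beta> + \<alpha>) \<in> R"
    and F: "finite F" "F \<subseteq> exponents m"
  shows "\<exists>\<beta>\<in>exponents m. single K \<one> \<beta> \<in> R \<and> (\<forall>\<alpha>\<in>F. single K \<one> (\<beta> + \<alpha>) \<in> R)"
proof -
  note add = monomial_product[OF R m]
  show ?thesis using F
  proof (induction F rule: finite_induct)
    case empty
    show ?case by (rule bexI[of _ 0]) (simp_all add: R_one del: zero_fun_apply)
  next
    case (insert \<alpha> F)
    then obtain \<beta> where \<beta>: "\<beta> \<in> exponents m" "single K \<one> \<beta> \<in> R" "\<forall>\<alpha>\<in>F. single K \<one> (\<beta> + \<alpha>) \<in> R" by blast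
    have \<alpha>: "\<alpha> \<in> exponents m" using insert by simp
    obtain \<gamma> where \<gamma>: "\<gamma> \<in> exponents m" "single K \<one> \<gamma> \<in> R" "single K \<one> (\<gamma> + \<alpha>) \<in> R" using bspec[OF mono \<alpha>] by blast
    have "single K \<one> (\<beta> + \<gamma> + \<alpha>') \<in> R" if "\<alpha>' \<in> insert \<alpha> F" for \<alpha>'
    proof (cases "\<alpha>' = \<alpha>")
      case True
      show ?thesis unfolding True add.assoc by (rule add[OF \<beta>(2) \<gamma>(3) \<beta>(1) exponents_closed(2)[OF \<gamma>(1) \<alpha>]])
    next
      case False
      then have f: "\<alpha>' \<in> F" "\<alpha>' \<in> exponents m" using that insert by auto
      have "\<beta> + \<gamma> + \<alpha>' = \<gamma> + (\<beta> + \<alpha>')" by (simp add: ac_simps)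
      then show ?thesis
        using add[OF \<gamma>(2) bspec[OF \<beta>(3) f(1)] \<gamma>(1) exponents_closed(2)[OF \<beta>(1) f(2)]] by (simp only:)
    qed
    moreover have "single K \<one> (\<beta> + \<gamma>) \<in> R" "\<beta> + \<gamma> \<in> exponents m"
      by (rule add[OF \<beta>(2) \<gamma>(2) \<beta>(1) \<gamma>(1)], rule exponents_closed(2)[OF \<beta>(1) \<gamma>(1)])
    ultimately show ?case by blast
  qed
qed

text \<open>The image may contain elements whose monomials are not in it; the last clause only asks
  for sufficiently many monomials. The clause on scalars lets \<open>B\<close> inherit the algebra
  axioms from the torus, see \<open>order_k_algebra\<close>.\<close>

definition torus_order :: "('a, 'c, 'm) module_scheme \<Rightarrow> ('c \<Rightarrow> (nat \<Rightarrow> int) \<Rightarrow> 'a) \<Rightarrow> bool"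
  where "torus_order B \<Phi> \<longleftrightarrow> ring B \<and> \<Phi> \<in> ring_hom B T \<and> inj_on \<Phi> (carrier B) \<and>
    (\<forall>a\<in>carrier K. \<forall>b\<in>carrier B. a \<odot>\<^bsub>B\<^esub> b \<in> carrier B \<and> \<Phi> (a \<odot>\<^bsub>B\<^esub> b) = a \<odot>\<^bsub>T\<^esub> \<Phi> b) \<and>
    (\<forall>\<alpha>\<in>exponents n. \<exists>\<beta>\<in>exponents n.
      single K \<one> \<beta> \<in> \<Phi> ` carrier B \<and> single K \<one> (\<beta> + \<alpha>) \<in> \<Phi> ` carrier B)"

end

locale quantum_torus_order = quantum_torus +
  fixes B :: "('a, 'c, 'm) module_scheme" and \<Phi> :: "'c \<Rightarrow> (nat \<Rightarrow> int) \<Rightarrow> 'a"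
  assumes order: "torus_order B \<Phi>"
begin

lemma B_ring: "ring B" and \<Phi>_hom: "\<Phi> \<in> ring_hom B T" and \<Phi>_inj: "inj_on \<Phi> (carrier B)"
  and smult_in: "\<And>a b. a \<in> carrier K \<Longrightarrow> b \<in> carrier B \<Longrightarrow> a \<odot>\<^bsub>B\<^esub> b \<in> carrier B"
  and \<Phi>_smult: "\<And>a b. a \<in> carrier K \<Longrightarrow> b \<in> carrier B \<Longrightarrow> \<Phi> (a \<odot>\<^bsub>B\<^esub> b) = a \<odot>\<^bsub>T\<^esub> \<Phi> b"
  and monomials: "\<And>\<alpha>. \<alpha> \<in> exponents n \<Longrightarrow> \<exists>\<beta>\<in>exponents n.
      single K \<one> \<beta> \<in> \<Phi> ` carrier B \<and> single K \<one> (\<beta> + \<alpha>) \<in> \<Phi> ` carrier B"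
  using order unfolding torus_order_def by blast+

sublocale B: ring B by (rule B_ring)

lemma \<Phi>_zero: "\<Phi> \<zero>\<^bsub>B\<^esub> = \<zero>\<^bsub>T\<^esub>"
  using ring_hom_zero[OF \<Phi>_hom B_ring TM.T_ring] .

lemma image_closed:
  "s \<in> \<Phi> ` carrier B \<Longrightarrow> t \<in> \<Phi> ` carrier B \<Longrightarrow> s \<otimes>\<^bsub>T\<^esub> t \<in> \<Phi> ` carrier B"
  "s \<in> \<Phi> ` carrier B \<Longrightarrow> t \<in> \<Phi> ` carrier B \<Longrightarrow> s \<oplus>\<^bsub>T\<^esub> t \<in> \<Phi> ` carrier B"
  "\<zero>\<^bsub>T\<^esub> \<in> \<Phi> ` carrier B" "\<one>\<^bsub>T\<^esub> \<in> \<Phi> ` carrier B"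
  "a \<in> carrier K \<Longrightarrow> t \<in> \<Phi> ` carrier B \<Longrightarrow> a \<odot>\<^bsub>T\<^esub> t \<in> \<Phi> ` carrier B"
proof -
  show "s \<otimes>\<^bsub>T\<^esub> t \<in> \<Phi> ` carrier B" if "s \<in> \<Phi> ` carrier B" "t \<in> \<Phi> ` carrier B"
    using that by (auto simp: ring_hom_mult[OF \<Phi>_hom, symmetric])
  show "s \<oplus>\<^bsub>T\<^esub> t \<in> \<Phi> ` carrier B" if "s \<in> \<Phi> ` carrier B" "t \<in> \<Phi> ` carrier B"
    using that by (auto simp: ring_hom_add[OF \<Phi>_hom, symmetric])
  show "\<zero>\<^bsub>T\<^esub> \<in> \<Phi> ` carrier B" using \<Phi>_zero by (metis B.zero_closed imageI)
  show "\<one>\<^bsub>T\<^esub> \<in> \<Phi> ` carrier B" using ring_hom_one[OF \<Phi>_hom] by (metis B.one_closed imageI)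
  show "a \<odot>\<^bsub>T\<^esub> t \<in> \<Phi> ` carrier B" if "a \<in> carrier K" "t \<in> \<Phi> ` carrier B"
    using that smult_in by (auto simp: \<Phi>_smult[symmetric])
qed

text \<open>A submonoid of the exponents, whose differences are all of
  \<open>exponents n\<close>.\<close>

definition S :: "(nat \<Rightarrow> int) set"
  where "S = {\<alpha> \<in> exponents n. single K \<one> \<alpha> \<in> \<Phi> ` carrier B}"

lemma single_in_image: "\<alpha> \<in> S \<Longrightarrow> a \<in> carrier K \<Longrightarrow> single K a \<alpha> \<in> \<Phi> ` carrier B"
  using image_closed(5)[of a "single K \<one> \<alpha>"] by (simp add: S_def TM.T_smult_single)

lemma S_exponents: "\<alpha> \<in> S \<Longrightarrow> \<alpha> \<in> exponents n"
  by (simp add: S_def)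

lemma S_0: "0 \<in> S"
  using image_closed(4) by (simp add: S_def TM.T_one)

lemma image_ball:
  "\<forall>s\<in>\<Phi> ` carrier B. \<forall>t\<in>\<Phi> ` carrier B. s \<otimes>\<^bsub>T\<^esub> t \<in> \<Phi> ` carrier B"
  "\<forall>a\<in>carrier K. \<forall>t\<in>\<Phi> ` carrier B. a \<odot>\<^bsub>T\<^esub> t \<in> \<Phi> ` carrier B"
  using image_closed(1,5) by blast+

lemma S_add: "\<alpha> \<in> S \<Longrightarrow> \<beta> \<in> S \<Longrightarrow> \<alpha> + \<beta> \<in> S"
  using monomial_product[OF image_ball order_refl, of \<alpha> \<beta>] by (simp add: S_def del: plus_fun_apply)

lemma S_mult: "\<alpha> \<in> S \<Longrightarrow> (\<lambda>i. int k * \<alpha> i) \<in> S"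
proof (induction k)
  case 0
  then show ?case using S_0 by (simp add: zero_fun_def)
next
  case (Suc k)
  have "(\<lambda>i. int (Suc k) * \<alpha> i) = \<alpha> + (\<lambda>i. int k * \<alpha> i)" by (auto simp: fun_eq_iff algebra_simps)
  then show ?case using S_add[of \<alpha>] Suc by simp
qed

lemma S_common:
  assumes "finite F" "F \<subseteq> exponents n"
  shows "\<exists>\<beta>\<in>S. \<forall>\<alpha>\<in>F. \<beta> + \<alpha> \<in> S"
proof -
  have "single K \<one> 0 \<in> \<Phi> ` carrier B" using S_0 by (simp add: S_def)
  moreover have "\<forall>\<alpha>\<in>exponents n. \<exists>\<beta>\<in>exponents n.
      single K \<one> \<beta> \<in> \<Phi> ` carrier B \<and> single K \<one> (\<beta> + \<alpha>) \<in> \<Phi> ` carrier B" using monomials by blast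
  ultimately have "\<exists>\<beta>\<in>exponents n. single K \<one> \<beta> \<in> \<Phi> ` carrier B \<and> (\<forall>\<alpha>\<in>F. single K \<one> (\<beta> + \<alpha>) \<in> \<Phi> ` carrier B)"
    by (rule common_shift[OF image_ball _ order_refl _ assms])
  then
  obtain \<beta> where \<beta>: "\<beta> \<in> exponents n" "single K \<one> \<beta> \<in> \<Phi> ` carrier B"
    "\<And>\<alpha>. \<alpha> \<in> F \<Longrightarrow> single K \<one> (\<beta> + \<alpha>) \<in> \<Phi> ` carrier B" by blast
  moreover have "\<beta> + \<alpha> \<in> exponents n" if "\<alpha> \<in> F" for \<alpha> using \<beta>(1) subsetD[OF assms(2) that] by (rule exponents_closed(2))
  ultimately show ?thesis unfolding S_def by blast
qed

lemma supported_in_image: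
  assumes "t \<in> carrier T" "\<And>\<alpha>. t \<alpha> \<noteq> \<zero> \<Longrightarrow> \<alpha> \<in> S"
  shows "t \<in> \<Phi> ` carrier B"
proof -
  have "(\<Oplus>\<^bsub>T\<^esub>\<alpha>\<in>F. single K (t \<alpha>) \<alpha>) \<in> \<Phi> ` carrier B" if "finite F" "F \<subseteq> S" for F
    using that
  proof (induction F rule: finite_induct)
    case (insert \<alpha> F)
    have cl: "single K (t \<beta>) \<beta> \<in> carrier T" if "\<beta> \<in> insert \<alpha> F" for \<beta>
      using that insert S_exponents TM.T_val[OF assms(1)] by auto
    show ?case
      using insert cl TM.T_val[OF assms(1)]
      by (subst TM.TA.finsum_insert) (auto intro!: image_closed single_in_image)
  qed (simp add: image_closed)
  from this[of "{\<alpha>. t \<alpha> \<noteq> \<zero>}"] show ?thesis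
    using assms TM.single_expansion[OF assms(1), of "{\<alpha>. t \<alpha> \<noteq> \<zero>}"] S_exponents by (auto simp: subset_iff)
qed

text \<open>The same monomial works on both sides, because multiplication by
  \<open>y^\<beta>\<close> from the left or from the right shifts supports by \<open>\<beta>\<close>
  in either case.\<close>

lemma denominators:
  assumes "finite X" "X \<subseteq> carrier T"
  shows "\<exists>\<beta>\<in>S. \<forall>t\<in>X. single K \<one> \<beta> \<otimes>\<^bsub>T\<^esub> t \<in> \<Phi> ` carrier B \<and> t \<otimes>\<^bsub>T\<^esub> single K \<one> \<beta> \<in> \<Phi> ` carrier B"
proof -
  let ?F = "\<Union>t\<in>X. {\<alpha>. t \<alpha> \<noteq> \<zero>}"
  have "finite ?F" "?F \<subseteq> exponents n" using assms by (auto dest: TM.T_supp)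
  from S_common[OF this] obtain \<beta> where \<beta>: "\<beta> \<in> S" "\<forall>\<alpha>\<in>?F. \<beta> + \<alpha> \<in> S" by blast
  have "single K \<one> \<beta> \<otimes>\<^bsub>T\<^esub> t \<in> \<Phi> ` carrier B \<and> t \<otimes>\<^bsub>T\<^esub> single K \<one> \<beta> \<in> \<Phi> ` carrier B" if t: "t \<in> X" for t
  proof -
    have tT: "t \<in> carrier T" and b: "single K \<one> \<beta> \<in> carrier T" using t assms \<beta> S_exponents by auto
    have "\<gamma> \<in> S" if "t (\<gamma> - \<beta>) \<noteq> \<zero>" for \<gamma>
    proof -
      have "\<gamma> - \<beta> \<in> ?F" using t that by blast
      then have "\<beta> + (\<gamma> - \<beta>) \<in> S" using \<beta>(2) by blast
      then show ?thesis by simp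
    qed
    then show ?thesis
      using tT b \<beta>(1) S_exponents TM.T_val[OF tT]
      by (auto intro!: supported_in_image simp: single_times times_single integral_iff)
  qed
  then show ?thesis using \<beta>(1) by blast
qed

lemma fractions_of_order:
  assumes "division_ring_of_fractions T D \<iota>"
  shows "division_ring_of_fractions B D (\<iota> \<circ> \<Phi>)"
proof (rule division_ring_of_fractions_suborder[OF B_ring TM.T_ring assms \<Phi>_hom \<Phi>_inj])
  fix t t' assume "t \<in> carrier T" "t' \<in> carrier T"
  then obtain \<beta> where \<beta>: "\<beta> \<in> S" "\<forall>t\<in>{t, t'}. single K \<one> \<beta> \<otimes>\<^bsub>T\<^esub> t \<in> \<Phi> ` carrier B \<and> t \<otimes>\<^bsub>T\<^esub> single K \<one> \<beta> \<in> \<Phi> ` carrier B"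
    using denominators[of "{t, t'}"] by auto
  have "single K \<one> \<beta> \<in> Units T" using \<beta>(1) S_exponents by (intro single_Units) auto
  then show "\<exists>m\<in>Units T. t \<otimes>\<^bsub>T\<^esub> m \<in> \<Phi> ` carrier B \<and> t' \<otimes>\<^bsub>T\<^esub> m \<in> \<Phi> ` carrier B"
    "\<exists>m\<in>Units T. m \<otimes>\<^bsub>T\<^esub> t \<in> \<Phi> ` carrier B \<and> m \<otimes>\<^bsub>T\<^esub> t' \<in> \<Phi> ` carrier B"
    using \<beta>(2) by auto
qed

end

context quantum_torus
begin

theorem orders_have_isomorphic_fractions:
  fixes B :: "('a, 'c, 'm) module_scheme" and C :: "('a, 'd, 'p) module_scheme"
  assumes "torus_order B \<Phi>" "torus_order C \<Psi>"
  shows "isomorphic_division_rings_of_fractions K B C"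
proof -
  interpret B: quantum_torus_order K n \<Lambda> T B \<Phi> by unfold_locales (use assms in \<open>auto simp: T_def\<close>)
  interpret C: quantum_torus_order K n \<Lambda> T C \<Psi> by unfold_locales (use assms in \<open>auto simp: T_def\<close>)
  interpret O: ore_domain T by (rule T_ore_domain)
  note Q = O.division_ring_of_fractions_exists
  obtain D :: "('c \<times> 'c) set ring" and h where D: "h \<in> ring_iso O.fraction_ring D" "division_ring_of_fractions B D (h \<circ> (O.left_mult \<circ> \<Phi>))"
    using division_ring_of_fractions_transport[OF B.B_ring B.fractions_of_order[OF Q]] by blast
  obtain E :: "('d \<times> 'd) set ring" and g where E: "g \<in> ring_iso O.fraction_ring E" "division_ring_of_fractions C E (g \<circ> (O.left_mult \<circ> \<Psi>))"
    using division_ring_of_fractions_transport[OF C.B_ring C.fractions_of_order[OF Q]] by blast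
  \<comment> \<open>Both \<open>h\<close> and \<open>g\<close> start from the fraction ring of the
    torus, so \<open>g\<close> after the inverse of \<open>h\<close> compares the two copies. It
    respects scalars since both orders send them to the same scalars of the torus.\<close>
  let ?h' = "inv_into (carrier O.fraction_ring) h"
  have iso: "?h' \<in> ring_iso D O.fraction_ring"
    using ring_iso_set_sym[OF O.fraction_ring_ring D(1)] .
  have inj: "inj_on h (carrier O.fraction_ring)" using D(1) by (auto simp: ring_iso_def bij_betw_def)
  have "(g \<circ> ?h') ((h \<circ> (O.left_mult \<circ> \<Phi>)) (scalar B a)) = (g \<circ> (O.left_mult \<circ> \<Psi>)) (scalar C a)"
    if a: "a \<in> carrier K" for a
  proof -
    have "\<Phi> (scalar B a) = a \<odot>\<^bsub>T\<^esub> \<one>\<^bsub>T\<^esub>" "\<Psi> (scalar C a) = a \<odot>\<^bsub>T\<^esub> \<one>\<^bsub>T\<^esub>"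
      using a B.\<Phi>_smult[OF a B.B.one_closed] C.\<Phi>_smult[OF a C.B.one_closed] ring_hom_one[OF B.\<Phi>_hom] ring_hom_one[OF C.\<Phi>_hom]
      by (simp_all add: scalar_def)
    moreover have "O.left_mult (a \<odot>\<^bsub>T\<^esub> \<one>\<^bsub>T\<^esub>) \<in> carrier O.fraction_ring"
      using a by (intro ring_hom_closed[OF O.left_mult_ring_hom]) auto
    ultimately show ?thesis using inj by simp
  qed
  then show ?thesis
    unfolding isomorphic_division_rings_of_fractions_def
    using D(2) E(2) ring_iso_set_trans[OF iso E(1)] by blast
qed

end

section \<open>Inner skew derivations of the quantum torus\<close>

lemma (in twisted_monoid_algebra) mult_support:
  assumes f: "f \<in> carrier T" and g: "g \<in> carrier T" and nz: "(f \<otimes>\<^bsub>T\<^esub> g) w \<noteq> \<zero>"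
  obtains u v where "f u \<noteq> \<zero>" "g v \<noteq> \<zero>" "w = m u v"
proof -
  have "\<exists>u v. f u \<noteq> \<zero> \<and> g v \<noteq> \<zero> \<and> w = m u v"
  proof (rule ccontr)
    assume "\<not> ?thesis"
    then have "(f \<otimes>\<^bsub>T\<^esub> g) w = \<zero>"
      unfolding T_mult_eq by (intro finsum_zero') auto
    with nz show False by simp
  qed
  then show ?thesis using that by blast
qed

lemma exponents_induct [consumes 1, case_names zero unit_vec add minus]:
  assumes "\<gamma> \<in> exponents m" and zero: "P 0" and unit_vec: "\<And>j. j \<in> {1..m} \<Longrightarrow> P (unit_vec j)"
    and add: "\<And>\<alpha> \<beta>. P \<alpha> \<Longrightarrow> P \<beta> \<Longrightarrow> P (\<alpha> + \<beta>)" and minus: "\<And>\<alpha>. P \<alpha> \<Longrightarrow> P (- \<alpha>)"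
  shows "P \<gamma>"
  using assms(1) unit_vec
proof (induction m arbitrary: \<gamma>)
  case 0
  then have "\<gamma> = 0" by (auto simp: exponents_def fun_eq_iff)
  then show ?case using zero by (simp only:)
next
  case (Suc m)
  have nat_mult: "P (\<lambda>j. int k * unit_vec (Suc m) j)" for k
  proof (induction k)
    case 0
    then show ?case using zero by (simp add: zero_fun_def)
  next
    case (Suc k)
    have "(\<lambda>j. int (Suc k) * unit_vec (Suc m) j) = unit_vec (Suc m) + (\<lambda>j. int k * unit_vec (Suc m) j)"
      by (auto simp: fun_eq_iff algebra_simps)
    then show ?case using add Suc \<open>\<And>j. j \<in> {1..Suc m} \<Longrightarrow> P (unit_vec j)\<close>[of "Suc m"] by simp
  qed
  have int_mult: "P (\<lambda>j. k * unit_vec (Suc m) j)" for k :: int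
  proof (cases "k \<ge> 0")
    case True
    then show ?thesis using nat_mult[of "nat k"] by simp
  next
    case False
    then have "(\<lambda>j. k * unit_vec (Suc m) j) = - (\<lambda>j. int (nat (- k)) * unit_vec (Suc m) j)"
      by (auto simp: fun_eq_iff)
    then show ?thesis using minus[OF nat_mult[of "nat (- k)"]] by simp
  qed
  define \<gamma>' where "\<gamma>' = (\<lambda>j. if j = Suc m then 0 else \<gamma> j)"
  have "\<gamma>' \<in> exponents m"
    using Suc.prems(1) by (auto simp: exponents_def \<gamma>'_def)
  then have "P \<gamma>'" using Suc by auto
  moreover have "\<gamma> = \<gamma>' + (\<lambda>j. \<gamma> (Suc m) * unit_vec (Suc m) j)"
    by (auto simp: fun_eq_iff \<gamma>'_def unit_vec_def)
  ultimately show ?case using add[of \<gamma>'] int_mult by metis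
qed

text \<open>The scalar bookkeeping of \<open>inner_skew_derivation\<close>. The premise
  \<open>eq\<close> compares the coefficients of \<open>D (y^s y^u)\<close> and of
  \<open>\<langle>s, u\<rangle> D (y^u y^s)\<close> at one exponent. There \<open>es\<close>,
  \<open>eu\<close> are weights under conjugation by \<open>y_i\<close>, \<open>cs\<close>,
  \<open>cu\<close> are commutation factors with \<open>y^\<alpha>\<close>, and \<open>B\<close>,
  \<open>C\<close>, \<open>D\<close>, \<open>F\<close> are twists. Both sides are multiples of
  \<open>B C D\<close>, which cancels.\<close>

lemma (in field) proportionality:
  assumes "es \<in> carrier R" "eu \<in> carrier R" "cs \<in> carrier R" "cu \<in> carrier R" "ps \<in> carrier R" "pu \<in> carrier R"
    "su \<in> carrier R" "B \<in> carrier R" "C \<in> carrier R" "D \<in> carrier R" "F \<in> carrier R"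
    and nz: "B \<noteq> \<zero>" "C \<noteq> \<zero>" "D \<noteq> \<zero>" and su: "su \<otimes> F = B"
    and eq: "es \<otimes> (((cs \<otimes> D) \<otimes> B) \<otimes> (pu \<otimes> C)) \<oplus> (C \<otimes> B) \<otimes> (ps \<otimes> D)
      = su \<otimes> (eu \<otimes> (((cu \<otimes> C) \<otimes> F) \<otimes> (ps \<otimes> D)) \<oplus> (D \<otimes> F) \<otimes> (pu \<otimes> C))"
  shows "(\<one> \<ominus> es \<otimes> cs) \<otimes> pu = (\<one> \<ominus> eu \<otimes> cu) \<otimes> ps"
proof -
  let ?X = "B \<otimes> (C \<otimes> D)"
  have l: "es \<otimes> (((cs \<otimes> D) \<otimes> B) \<otimes> (pu \<otimes> C)) \<oplus> (C \<otimes> B) \<otimes> (ps \<otimes> D) = ?X \<otimes> (es \<otimes> cs \<otimes> pu \<oplus> ps)"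
    using assms(1-11) by (simp add: r_distr m_ac)
  have "su \<otimes> (eu \<otimes> (((cu \<otimes> C) \<otimes> F) \<otimes> (ps \<otimes> D)) \<oplus> (D \<otimes> F) \<otimes> (pu \<otimes> C))
    = ((su \<otimes> F) \<otimes> (C \<otimes> D)) \<otimes> (eu \<otimes> cu \<otimes> ps \<oplus> pu)"
    using assms(1-11) by (simp add: r_distr m_ac)
  then have "?X \<otimes> (es \<otimes> cs \<otimes> pu \<oplus> ps) = ?X \<otimes> (eu \<otimes> cu \<otimes> ps \<oplus> pu)" using eq l su by simp
  then have *: "es \<otimes> cs \<otimes> pu \<oplus> ps = eu \<otimes> cu \<otimes> ps \<oplus> pu"
    using m_lcancel[of ?X] nz assms(1-11) by (simp add: integral_iff)
  have cancel: "\<ominus> a \<oplus> w = \<ominus> b \<oplus> y"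
    if "a \<in> carrier R" "b \<in> carrier R" "w \<in> carrier R" "y \<in> carrier R" "a \<oplus> y = b \<oplus> w" for a b w y
  proof -
    have "(b \<oplus> a) \<oplus> (\<ominus> a \<oplus> w) = b \<oplus> w" "(a \<oplus> b) \<oplus> (\<ominus> b \<oplus> y) = a \<oplus> y"
      using that(1-4) by (simp_all add: a_assoc r_neg2)
    then have "(b \<oplus> a) \<oplus> (\<ominus> a \<oplus> w) = (b \<oplus> a) \<oplus> (\<ominus> b \<oplus> y)"
      using that by (simp add: a_comm[of a b])
    then show ?thesis using that(1-4) by simp
  qed
  show ?thesis
    using cancel[OF _ _ _ _ *] assms(1-11) by (simp add: a_minus_def l_distr l_minus a_comm)
qed

section \<open>Conjugation by the generators, and skew derivations for it\<close>

context quantum_torus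
begin

text \<open>Conjugation by \<open>y_j\<close>. As it scales each monomial, it is written on
  coefficients, where weights can be compared exponent by exponent.\<close>

definition conj_y :: "nat \<Rightarrow> ((nat \<Rightarrow> int) \<Rightarrow> 'a) \<Rightarrow> (nat \<Rightarrow> int) \<Rightarrow> 'a"
  where "conj_y j t = (\<lambda>\<alpha>. comm (unit_vec j) \<alpha> \<otimes> t \<alpha>)"

lemma conj_y_closed [simp]: "t \<in> carrier T \<Longrightarrow> conj_y j t \<in> carrier T"
  by (rule TM.T_carrierI[where F = "{u. t u \<noteq> \<zero>}"])
    (auto simp: conj_y_def TM.T_val TM.T_supp)

lemma conj_y_single: "conj_y j (single K a \<alpha>) = single K (comm (unit_vec j) \<alpha> \<otimes> a) \<alpha>"
  by (auto simp: conj_y_def single_def)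

lemma conj_y_add: "s \<in> carrier T \<Longrightarrow> t \<in> carrier T \<Longrightarrow> conj_y j (s \<oplus>\<^bsub>T\<^esub> t) = conj_y j s \<oplus>\<^bsub>T\<^esub> conj_y j t"
  by (auto simp: conj_y_def TM.T_simps r_distr TM.T_val)

lemma conj_y_zero: "conj_y j \<zero>\<^bsub>T\<^esub> = \<zero>\<^bsub>T\<^esub>"
  by (auto simp: conj_y_def TM.T_simps)

lemma conj_y_smult: "a \<in> carrier K \<Longrightarrow> t \<in> carrier T \<Longrightarrow> conj_y j (a \<odot>\<^bsub>T\<^esub> t) = a \<odot>\<^bsub>T\<^esub> conj_y j t"
  by (auto simp: conj_y_def TM.T_simps m_lcomm TM.T_val)

lemma conj_y_mult:
  assumes "s \<in> carrier T" "t \<in> carrier T"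
  shows "conj_y j (s \<otimes>\<^bsub>T\<^esub> t) = conj_y j s \<otimes>\<^bsub>T\<^esub> conj_y j t"
  using assms
proof (induction s rule: TM.T_induct)
  case (single a \<alpha>)
  show ?case using single(4)
  proof (induction t rule: TM.T_induct)
    case s': (single b \<beta>)
    have "comm (unit_vec j) (\<alpha> + \<beta>) \<otimes> (twist \<alpha> \<beta> \<otimes> (a \<otimes> b))
      = twist \<alpha> \<beta> \<otimes> ((comm (unit_vec j) \<alpha> \<otimes> a) \<otimes> (comm (unit_vec j) \<beta> \<otimes> b))"
      using single s' by (simp add: comm_add m_ac)
    then show ?case using single s' by (simp add: conj_y_single TM.single_mult)
  qed (use single(1,2) in \<open>simp_all add: conj_y_add conj_y_zero TM.T.r_distr\<close>)
qed (simp_all add: conj_y_add conj_y_zero TM.T.l_distr)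

lemma conj_y_conj: "j \<in> {1..n} \<Longrightarrow> t \<in> carrier T \<Longrightarrow>
    single K \<one> (unit_vec j) \<otimes>\<^bsub>T\<^esub> t = conj_y j t \<otimes>\<^bsub>T\<^esub> single K \<one> (unit_vec j)"
proof
  fix \<gamma> assume j: "j \<in> {1..n}" and t: "t \<in> carrier T"
  let ?e = "unit_vec j" and ?\<alpha> = "\<gamma> - unit_vec j"
  have "twist ?e ?\<alpha> \<otimes> t ?\<alpha> = twist ?\<alpha> ?e \<otimes> (comm ?e ?\<alpha> \<otimes> t ?\<alpha>)"
    using TM.T_val[OF t] comm_twist[of ?e ?\<alpha>, symmetric] by (simp add: m_ac)
  then show "(single K \<one> ?e \<otimes>\<^bsub>T\<^esub> t) \<gamma> = (conj_y j t \<otimes>\<^bsub>T\<^esub> single K \<one> ?e) \<gamma>"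
    using j t TM.T_val[OF t] by (simp add: single_times times_single) (simp add: conj_y_def)
qed

text \<open>At the exponent \<open>\<alpha> + s\<close>, the equation
  \<open>D (y^s) = C y^s - conj_y i (y^s) C\<close> reads
  \<open>(\<one> - \<theta> s \<alpha>) C(\<alpha>) = p s \<alpha>\<close>: one unknown
  \<open>C(\<alpha>)\<close> for each \<open>\<alpha>\<close>, and one equation for each monomial in
  \<open>R\<close>. The commutation of monomials makes these equations compatible. That each
  exponent of \<open>C\<close> occurs in some \<open>D (y^s)\<close> is recorded because the weights
  of \<open>C\<close> under the later automorphisms are read off from it.\<close>

lemma inner_skew_derivation:
  fixes D :: "((nat \<Rightarrow> int) \<Rightarrow> 'a) \<Rightarrow> ((nat \<Rightarrow> int) \<Rightarrow> 'a)"
  assumes m: "m \<le> n" and i: "i \<in> {1..n}"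
    and R: "R \<subseteq> carrier T" "\<And>t \<alpha>. t \<in> R \<Longrightarrow> t \<alpha> \<noteq> \<zero> \<Longrightarrow> \<alpha> \<in> exponents m"
    and R_zero: "\<zero>\<^bsub>T\<^esub> \<in> R"
    and R_add: "\<And>s t. s \<in> R \<Longrightarrow> t \<in> R \<Longrightarrow> s \<oplus>\<^bsub>T\<^esub> t \<in> R"
    and R_mult: "\<And>s t. s \<in> R \<Longrightarrow> t \<in> R \<Longrightarrow> s \<otimes>\<^bsub>T\<^esub> t \<in> R"
    and R_smult: "\<And>a t. a \<in> carrier K \<Longrightarrow> t \<in> R \<Longrightarrow> a \<odot>\<^bsub>T\<^esub> t \<in> R"
    and R_common: "\<And>F. finite F \<Longrightarrow> F \<subseteq> exponents m \<Longrightarrow>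
      \<exists>\<beta>\<in>exponents m. single K \<one> \<beta> \<in> R \<and> (\<forall>\<alpha>\<in>F. single K \<one> (\<beta> + \<alpha>) \<in> R)"
    and D_in: "\<And>t. t \<in> R \<Longrightarrow> D t \<in> R"
    and D_add: "\<And>s t. s \<in> R \<Longrightarrow> t \<in> R \<Longrightarrow> D (s \<oplus>\<^bsub>T\<^esub> t) = D s \<oplus>\<^bsub>T\<^esub> D t"
    and D_smult: "\<And>a t. a \<in> carrier K \<Longrightarrow> t \<in> R \<Longrightarrow> D (a \<odot>\<^bsub>T\<^esub> t) = a \<odot>\<^bsub>T\<^esub> D t"
    and D_mult: "\<And>s t. s \<in> R \<Longrightarrow> t \<in> R \<Longrightarrow> D (s \<otimes>\<^bsub>T\<^esub> t) = conj_y i s \<otimes>\<^bsub>T\<^esub> D t \<oplus>\<^bsub>T\<^esub> D s \<otimes>\<^bsub>T\<^esub> t"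
    and q: "q \<in> carrier K" "q \<noteq> \<one>" "\<And>t. t \<in> R \<Longrightarrow> D (conj_y i t) = q \<odot>\<^bsub>T\<^esub> conj_y i (D t)"
  shows "\<exists>C\<in>carrier T. (\<forall>\<alpha>. C \<alpha> \<noteq> \<zero> \<longrightarrow> \<alpha> \<in> exponents m \<and>
      (\<exists>s\<in>exponents m. single K \<one> s \<in> R \<and> D (single K \<one> s) (\<alpha> + s) \<noteq> \<zero>)) \<and>
    (\<forall>t\<in>R. D t \<oplus>\<^bsub>T\<^esub> conj_y i t \<otimes>\<^bsub>T\<^esub> C = C \<otimes>\<^bsub>T\<^esub> t)"
proof -
  interpret TK: k_algebra K T by (rule TM.T_k_algebra)
  let ?y = "\<lambda>\<alpha>. single K \<one> \<alpha>"
  define S where "S = {s \<in> exponents m. ?y s \<in> R}"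
  have mn: "exponents m \<subseteq> exponents n" by (rule exponents_mono) fact
  have SE: "s \<in> exponents n" if "s \<in> S" for s using that mn by (auto simp: S_def)
  have yT: "?y s \<in> carrier T" if "s \<in> S" for s using SE that by auto
  have DT: "D t \<in> carrier T" if "t \<in> R" for t using that D_in R by auto
  have Dv: "D t \<alpha> \<in> carrier K" if "t \<in> R" for t \<alpha> using TM.T_val[OF DT[OF that]] .
  have yS: "?y s \<in> R" if "s \<in> S" for s using that by (simp add: S_def)
  \<comment> \<open>The coefficient of \<open>D (y^s)\<close> with respect to
    \<open>y^\<alpha> y^s\<close> instead of \<open>y^(\<alpha> + s)\<close>; the twist between the
    two is divided out.\<close>
  define p where "p = (\<lambda>s \<alpha>. D (?y s) (\<alpha> + s) \<otimes> inv (twist \<alpha> s))"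
  have p_in [simp]: "p s \<alpha> \<in> carrier K" if "s \<in> S" for s \<alpha>
    using Dv[OF yS[OF that]] by (simp add: p_def)
  have p_twist: "D (?y s) (\<alpha> + s) = p s \<alpha> \<otimes> twist \<alpha> s" if "s \<in> S" for s \<alpha>
    using Dv[OF yS[OF that]] by (simp add: p_def m_assoc)
  have p_nz: "D (?y s) (\<alpha> + s) \<noteq> \<zero>" if "s \<in> S" "p s \<alpha> \<noteq> \<zero>" for s \<alpha>
    using that p_twist[OF that(1)] by (simp add: integral_iff)
  \<comment> \<open>\<open>conj_y i (y^s) y^\<alpha>\<close> is \<open>\<theta> s \<alpha>\<close>
    times \<open>y^\<alpha> y^s\<close>.\<close>
  define \<theta> where "\<theta> = (\<lambda>s \<alpha>. comm (unit_vec i) s \<otimes> comm s \<alpha>)"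
  have \<theta>_in [simp]: "\<theta> s \<alpha> \<in> carrier K" for s \<alpha> by (simp add: \<theta>_def)
  have rel: "(\<one> \<ominus> \<theta> s \<alpha>) \<otimes> p u \<alpha> = (\<one> \<ominus> \<theta> u \<alpha>) \<otimes> p s \<alpha>" if s: "s \<in> S" and u: "u \<in> S" for s u \<alpha>
  proof -
    have D2: "D (?y s \<otimes>\<^bsub>T\<^esub> ?y u) (\<alpha> + s + u) = comm (unit_vec i) s \<otimes> ((twist s \<alpha> \<otimes> twist s u) \<otimes> (p u \<alpha> \<otimes> twist \<alpha> u))
      \<oplus> (twist \<alpha> u \<otimes> twist s u) \<otimes> (p s \<alpha> \<otimes> twist \<alpha> s)" if s: "s \<in> S" and u: "u \<in> S" for s u
    proof -
      have "\<alpha> + s + u - s = \<alpha> + u" by simp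
      then have "(conj_y i (?y s) \<otimes>\<^bsub>T\<^esub> D (?y u)) (\<alpha> + s + u)
        = (twist s \<alpha> \<otimes> twist s u) \<otimes> (comm (unit_vec i) s \<otimes> (p u \<alpha> \<otimes> twist \<alpha> u))"
        using s u SE DT yS by (simp add: conj_y_single single_times twist_add p_twist)
      moreover have "(D (?y s) \<otimes>\<^bsub>T\<^esub> ?y u) (\<alpha> + s + u) = (twist \<alpha> u \<otimes> twist s u) \<otimes> (p s \<alpha> \<otimes> twist \<alpha> s)"
        using s u SE DT yS by (simp add: times_single twist_add p_twist)
      ultimately show ?thesis
        using s u yS by (simp add: D_mult TM.T_simps(3) m_lcomm)
    qed
    have "?y s \<otimes>\<^bsub>T\<^esub> ?y u = comm s u \<odot>\<^bsub>T\<^esub> (?y u \<otimes>\<^bsub>T\<^esub> ?y s)"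
      using s u SE by (simp add: TM.single_mult TM.T_smult_single comm_twist add.commute)
    then have "D (?y s \<otimes>\<^bsub>T\<^esub> ?y u) = comm s u \<odot>\<^bsub>T\<^esub> D (?y u \<otimes>\<^bsub>T\<^esub> ?y s)"
      using D_smult[of "comm s u" "?y u \<otimes>\<^bsub>T\<^esub> ?y s"] s u yS R_mult by simp
    moreover have "\<alpha> + s + u = \<alpha> + u + s" by (simp add: add.assoc add.commute[of s u])
    ultimately have "D (?y s \<otimes>\<^bsub>T\<^esub> ?y u) (\<alpha> + s + u) = comm s u \<otimes> D (?y u \<otimes>\<^bsub>T\<^esub> ?y s) (\<alpha> + u + s)"
      by (simp only: TM.T_simps(4))
    then have "comm (unit_vec i) s \<otimes> ((twist s \<alpha> \<otimes> twist s u) \<otimes> (p u \<alpha> \<otimes> twist \<alpha> u))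
      \<oplus> (twist \<alpha> u \<otimes> twist s u) \<otimes> (p s \<alpha> \<otimes> twist \<alpha> s) =
      comm s u \<otimes> (comm (unit_vec i) u \<otimes> ((twist u \<alpha> \<otimes> twist u s) \<otimes> (p s \<alpha> \<otimes> twist \<alpha> s))
      \<oplus> (twist \<alpha> s \<otimes> twist u s) \<otimes> (p u \<alpha> \<otimes> twist \<alpha> u))"
      unfolding D2[OF s u] D2[OF u s] .
    then show ?thesis
      unfolding \<theta>_def using s u
      by (intro proportionality[where B = "twist s u" and C = "twist \<alpha> u" and D = "twist \<alpha> s"
            and F = "twist u s" and su = "comm s u"])
        (simp_all add: comm_twist)
  qed
  \<comment> \<open>The relation between \<open>D\<close> and \<open>conj_y i\<close>, applied to
    the eigenvector \<open>y^s\<close>, determines the weight of every \<open>\<alpha>\<close> that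
    occurs in \<open>D (y^s)\<close>.\<close>
  have weight: "q \<otimes> comm (unit_vec i) \<alpha> = \<one>" if s: "s \<in> S" and "p s \<alpha> \<noteq> \<zero>" for s \<alpha>
  proof -
    let ?d = "D (?y s) (\<alpha> + s)" and ?e = "comm (unit_vec i) s"
    have d: "?d \<in> carrier K" "?d \<noteq> \<zero>" using Dv[OF yS[OF s]] p_nz[OF that] by auto
    have "?e \<odot>\<^bsub>T\<^esub> D (?y s) = q \<odot>\<^bsub>T\<^esub> conj_y i (D (?y s))"
      using q(3)[OF yS[OF s]] D_smult[of ?e "?y s"] yS[OF s] by (simp add: conj_y_single TM.T_smult_single)
    then have "(?e \<odot>\<^bsub>T\<^esub> D (?y s)) (\<alpha> + s) = (q \<odot>\<^bsub>T\<^esub> conj_y i (D (?y s))) (\<alpha> + s)" by simp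
    then have "?e \<otimes> ?d = q \<otimes> (comm (unit_vec i) \<alpha> \<otimes> ?e \<otimes> ?d)"
      by (simp add: TM.T_simps(4) conj_y_def comm_add)
    then have "(?e \<otimes> ?d) \<otimes> \<one> = (?e \<otimes> ?d) \<otimes> (q \<otimes> comm (unit_vec i) \<alpha>)"
      using d q by (simp add: m_ac)
    moreover have "?e \<otimes> ?d \<noteq> \<zero>" using d by (simp add: integral_iff)
    ultimately have "\<one> = q \<otimes> comm (unit_vec i) \<alpha>"
      using d q by (intro iffD1[OF m_lcancel[of "?e \<otimes> ?d" \<one> "q \<otimes> comm (unit_vec i) \<alpha>"]]) auto
    then show ?thesis by simp
  qed
  have "finite (unit_vec ` {1..m})" "unit_vec ` {1..m} \<subseteq> exponents m" by auto
  from R_common[OF this] obtain \<beta> where \<beta>: "\<beta> \<in> exponents m" "?y \<beta> \<in> R"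
    "\<forall>j\<in>{1..m}. ?y (\<beta> + unit_vec j) \<in> R" by auto
  \<comment> \<open>A finite test set: \<open>\<theta>\<close> is multiplicative in its first
    argument and the differences of elements of \<open>S0\<close> include the unit vectors, so
    \<open>\<theta> = \<one>\<close> on \<open>S0\<close> implies it on all exponents. Finiteness of
    \<open>S0\<close> is what makes the support of \<open>C\<close> finite.\<close>
  define S0 where "S0 = insert \<beta> ((\<lambda>j. \<beta> + unit_vec j) ` {1..m})"
  have S0: "finite S0" "S0 \<subseteq> S" using \<beta> by (auto simp: S0_def S_def)
  have \<theta>_add: "\<theta> (s + u) \<alpha> = \<theta> s \<alpha> \<otimes> \<theta> u \<alpha>" for s u \<alpha>
    by (simp add: \<theta>_def comm_add m_ac)
  have \<theta>_all: "\<theta> s \<alpha> = \<one>" if all: "\<And>t. t \<in> S0 \<Longrightarrow> \<theta> t \<alpha> = \<one>" and s: "s \<in> exponents m" for s \<alpha>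
    using s
  proof (induction s rule: exponents_induct)
    case zero
    show ?case by (simp add: \<theta>_def del: zero_fun_apply)
  next
    case (unit_vec j)
    then have "\<theta> (\<beta> + unit_vec j) \<alpha> = \<one>" "\<theta> \<beta> \<alpha> = \<one>" by (auto intro!: all simp: S0_def)
    then show ?case by (simp add: \<theta>_add del: plus_fun_apply)
  next
    case (add s u)
    then show ?case by (simp add: \<theta>_add del: plus_fun_apply)
  next
    case (minus s)
    have "\<theta> (- s) \<alpha> \<otimes> \<theta> s \<alpha> = \<one>" by (simp add: \<theta>_add[symmetric]) (simp add: \<theta>_def del: zero_fun_apply)
    then show ?case using minus by (simp del: uminus_apply)
  qed
  define pick where "pick = (\<lambda>\<alpha>. SOME t. t \<in> S0 \<and> \<theta> t \<alpha> \<noteq> \<one>)"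
  \<comment> \<open>The equation for one \<open>s\<close> with nonzero factor is solved, and
    compatibility takes care of the others. If all factors vanish the value is zero, and
    \<open>key\<close> shows that the right-hand sides vanish too.\<close>
  define C where "C = (\<lambda>\<alpha>. if \<exists>t\<in>S0. \<theta> t \<alpha> \<noteq> \<one> then p (pick \<alpha>) \<alpha> \<otimes> inv (\<one> \<ominus> \<theta> (pick \<alpha>) \<alpha>) else \<zero>)"
  have pick: "pick \<alpha> \<in> S0 \<and> \<theta> (pick \<alpha>) \<alpha> \<noteq> \<one>" if "\<exists>t\<in>S0. \<theta> t \<alpha> \<noteq> \<one>" for \<alpha>
    unfolding pick_def by (rule someI_ex[of "\<lambda>t. t \<in> S0 \<and> \<theta> t \<alpha> \<noteq> \<one>"]) (use that in blast)
  have inv_\<theta>: "\<one> \<ominus> \<theta> t \<alpha> \<in> Units K" if "\<theta> t \<alpha> \<noteq> \<one>" for t \<alpha>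
    using that r_right_minus_eq[of \<one> "\<theta> t \<alpha>"] by (auto simp: field_Units)
  have C_in: "C \<alpha> \<in> carrier K" for \<alpha>
  proof (cases "\<exists>t\<in>S0. \<theta> t \<alpha> \<noteq> \<one>")
    case True
    have "p (pick \<alpha>) \<alpha> \<in> carrier K" "\<one> \<ominus> \<theta> (pick \<alpha>) \<alpha> \<in> Units K"
      using pick[OF True] S0 inv_\<theta> by auto
    then show ?thesis using True by (simp add: C_def)
  next
    case False
    then have "C \<alpha> = \<zero>" unfolding C_def by (rule if_not_P)
    then show ?thesis by simp
  qed
  have C_nz: "\<exists>s\<in>S0. p s \<alpha> \<noteq> \<zero>" if "C \<alpha> \<noteq> \<zero>" for \<alpha>
  proof -
    have ex: "\<exists>t\<in>S0. \<theta> t \<alpha> \<noteq> \<one>" using that unfolding C_def by presburger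
    have "p (pick \<alpha>) \<alpha> \<noteq> \<zero>"
    proof
      assume "p (pick \<alpha>) \<alpha> = \<zero>"
      then have "C \<alpha> = \<zero>" using ex inv_\<theta> pick[OF ex] by (simp add: C_def)
      with that show False by simp
    qed
    then show ?thesis using pick[OF ex] by blast
  qed
  have p_m: "\<alpha> \<in> exponents m" if "s \<in> S" "p s \<alpha> \<noteq> \<zero>" for s \<alpha>
  proof -
    have "\<alpha> + s \<in> exponents m" using R(2)[OF D_in[OF yS[OF that(1)]] p_nz[OF that]] .
    from exponents_closed(3)[OF this, of s] show ?thesis using that by (simp add: S_def)
  qed
  have C_T: "C \<in> carrier T"
  proof (rule TM.T_carrierI[OF C_in])
    let ?F = "\<Union>s\<in>S0. (\<lambda>\<gamma>. \<gamma> - s) ` {\<gamma>. D (?y s) \<gamma> \<noteq> \<zero>}"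
    show "finite ?F" using S0 DT yS by auto
    show "?F \<subseteq> exponents n"
    proof clarify
      fix s \<gamma> assume "s \<in> S0" "D (?y s) \<gamma> \<noteq> \<zero>"
      then show "\<gamma> - s \<in> exponents n" using S0 SE DT yS TM.T_supp by (intro exponents_closed) blast+
    qed
    fix \<alpha> assume "C \<alpha> \<noteq> \<zero>"
    then obtain s where s: "s \<in> S0" "p s \<alpha> \<noteq> \<zero>" using C_nz by blast
    then have "D (?y s) (\<alpha> + s) \<noteq> \<zero>" using p_nz S0 by blast
    moreover have "\<alpha> = (\<alpha> + s) - s" by simp
    ultimately show "\<alpha> \<in> ?F" using s(1) by blast
  qed
  have key: "(\<one> \<ominus> \<theta> s \<alpha>) \<otimes> C \<alpha> = p s \<alpha>" if s: "s \<in> S" for s \<alpha>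
  proof (cases "\<exists>t\<in>S0. \<theta> t \<alpha> \<noteq> \<one>")
    case True
    let ?t = "pick \<alpha>"
    have t: "?t \<in> S" "\<one> \<ominus> \<theta> ?t \<alpha> \<in> Units K" using pick[OF True] S0 inv_\<theta> by auto
    have "(\<one> \<ominus> \<theta> s \<alpha>) \<otimes> C \<alpha> = ((\<one> \<ominus> \<theta> s \<alpha>) \<otimes> p ?t \<alpha>) \<otimes> inv (\<one> \<ominus> \<theta> ?t \<alpha>)"
      using True t by (simp add: C_def m_assoc)
    also have "\<dots> = (p s \<alpha> \<otimes> (\<one> \<ominus> \<theta> ?t \<alpha>)) \<otimes> inv (\<one> \<ominus> \<theta> ?t \<alpha>)"
      using rel[OF s t(1)] s t by (simp add: m_comm)
    also have "\<dots> = p s \<alpha>" using s t by (simp add: m_assoc)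
    finally show ?thesis .
  next
    case False
    have "p s \<alpha> = \<zero>"
    proof (rule ccontr)
      assume nz: "p s \<alpha> \<noteq> \<zero>"
      \<comment> \<open>At \<open>s = \<alpha>\<close> the factor
        \<open>comm \<alpha> \<alpha>\<close> is trivial, so only the weight of
        \<open>\<alpha>\<close> under conjugation by \<open>y_i\<close> remains; it would be 1, and
        \<open>weight\<close> would give \<open>q = \<one>\<close>.\<close>
      have "\<theta> \<alpha> \<alpha> = \<one>" using \<theta>_all[of \<alpha> \<alpha>] False p_m[OF s nz] by blast
      then have "comm (unit_vec i) \<alpha> = \<one>" by (simp add: \<theta>_def)
      then show False using weight[OF s nz] q by simp
    qed
    then show ?thesis using False by (simp add: C_def)
  qed
  have inner_y: "D (?y s) \<oplus>\<^bsub>T\<^esub> conj_y i (?y s) \<otimes>\<^bsub>T\<^esub> C = C \<otimes>\<^bsub>T\<^esub> ?y s" if s: "s \<in> S" for s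
  proof
    fix \<gamma>
    define \<alpha> where "\<alpha> = \<gamma> - s"
    have \<gamma>: "\<gamma> = \<alpha> + s" by (simp add: \<alpha>_def)
    have "twist s \<alpha> \<otimes> (comm (unit_vec i) s \<otimes> C \<alpha>) = twist \<alpha> s \<otimes> (\<theta> s \<alpha> \<otimes> C \<alpha>)"
      using C_in comm_twist[of s \<alpha>, symmetric] by (simp add: \<theta>_def m_ac)
    moreover have "p s \<alpha> \<oplus> \<theta> s \<alpha> \<otimes> C \<alpha> = C \<alpha>"
      using key[OF s, of \<alpha>, symmetric] C_in[of \<alpha>] by (simp add: a_minus_def l_distr l_minus a_assoc l_neg)
    moreover have "p s \<alpha> \<otimes> twist \<alpha> s \<oplus> twist \<alpha> s \<otimes> (\<theta> s \<alpha> \<otimes> C \<alpha>) = twist \<alpha> s \<otimes> (p s \<alpha> \<oplus> \<theta> s \<alpha> \<otimes> C \<alpha>)"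
      using C_in s by (simp add: r_distr m_comm)
    ultimately show "(D (?y s) \<oplus>\<^bsub>T\<^esub> conj_y i (?y s) \<otimes>\<^bsub>T\<^esub> C) \<gamma> = (C \<otimes>\<^bsub>T\<^esub> ?y s) \<gamma>"
      using SE[OF s] C_T C_in s
      by (simp add: TM.T_simps(3) conj_y_single single_times times_single p_twist \<gamma> m_comm)
  qed
  define G where "G = {t \<in> R. D t \<oplus>\<^bsub>T\<^esub> conj_y i t \<otimes>\<^bsub>T\<^esub> C = C \<otimes>\<^bsub>T\<^esub> t}"
  have D0: "D \<zero>\<^bsub>T\<^esub> = \<zero>\<^bsub>T\<^esub>"
  proof -
    have "D \<zero>\<^bsub>T\<^esub> \<oplus>\<^bsub>T\<^esub> D \<zero>\<^bsub>T\<^esub> = D \<zero>\<^bsub>T\<^esub>" using D_add[OF R_zero R_zero] by simp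
    then show ?thesis using DT[OF R_zero] by simp
  qed
  have G_zero: "\<zero>\<^bsub>T\<^esub> \<in> G" using R_zero C_T by (simp add: G_def D0 conj_y_zero)
  have G_add: "s \<oplus>\<^bsub>T\<^esub> t \<in> G" if "s \<in> G" "t \<in> G" for s t
  proof -
    have st: "s \<in> R" "t \<in> R" "s \<in> carrier T" "t \<in> carrier T" using that R by (auto simp: G_def)
    have "D (s \<oplus>\<^bsub>T\<^esub> t) \<oplus>\<^bsub>T\<^esub> conj_y i (s \<oplus>\<^bsub>T\<^esub> t) \<otimes>\<^bsub>T\<^esub> C
      = (D s \<oplus>\<^bsub>T\<^esub> conj_y i s \<otimes>\<^bsub>T\<^esub> C) \<oplus>\<^bsub>T\<^esub> (D t \<oplus>\<^bsub>T\<^esub> conj_y i t \<otimes>\<^bsub>T\<^esub> C)"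
      using st C_T DT by (simp add: D_add conj_y_add TM.T.l_distr TM.TA.a_ac)
    then show ?thesis using that st C_T by (simp add: G_def R_add TM.T.r_distr)
  qed
  have G_smult: "a \<odot>\<^bsub>T\<^esub> t \<in> G" if "a \<in> carrier K" "t \<in> G" for a t
  proof -
    have t: "t \<in> R" "t \<in> carrier T" using that R by (auto simp: G_def)
    have "D (a \<odot>\<^bsub>T\<^esub> t) \<oplus>\<^bsub>T\<^esub> conj_y i (a \<odot>\<^bsub>T\<^esub> t) \<otimes>\<^bsub>T\<^esub> C = a \<odot>\<^bsub>T\<^esub> (D t \<oplus>\<^bsub>T\<^esub> conj_y i t \<otimes>\<^bsub>T\<^esub> C)"
      using t that C_T DT by (simp add: D_smult conj_y_smult TK.smult_mult_left TM.M.smult_r_distr)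
    then show ?thesis using that t C_T by (simp add: G_def R_smult TK.smult_mult_right)
  qed
  have G_supp: "t \<in> G" if t: "t \<in> carrier T" "\<And>\<alpha>. t \<alpha> \<noteq> \<zero> \<Longrightarrow> \<alpha> \<in> S" for t
  proof -
    have "(\<Oplus>\<^bsub>T\<^esub>\<alpha>\<in>F. single K (t \<alpha>) \<alpha>) \<in> G" if "finite F" "F \<subseteq> S" for F
      using that
    proof (induction F rule: finite_induct)
      case (insert \<alpha> F)
      have cl: "single K (t \<beta>) \<beta> \<in> carrier T" if "\<beta> \<in> insert \<alpha> F" for \<beta>
        using that insert SE TM.T_val[OF t(1)] by auto
      have "single K (t \<alpha>) \<alpha> \<in> G"
        using G_smult[of "t \<alpha>" "?y \<alpha>"] insert inner_y[of \<alpha>] yS[of \<alpha>] TM.T_val[OF t(1)]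
        by (simp add: G_def single_eq_smult[symmetric])
      then show ?case
        using insert cl by (subst TM.TA.finsum_insert) (auto intro!: G_add)
    qed (simp add: G_zero)
    from this[of "{\<alpha>. t \<alpha> \<noteq> \<zero>}"] show ?thesis
      using t TM.single_expansion[OF t(1), of "{\<alpha>. t \<alpha> \<noteq> \<zero>}"] SE by (auto simp: subset_iff)
  qed
  have inner: "D t \<oplus>\<^bsub>T\<^esub> conj_y i t \<otimes>\<^bsub>T\<^esub> C = C \<otimes>\<^bsub>T\<^esub> t" if t: "t \<in> R" for t
  proof -
    \<comment> \<open>An element \<open>t\<close> of \<open>R\<close> need not be a combination of
      monomials in \<open>R\<close>, but \<open>y^b t\<close> is one for suitable \<open>b\<close>.
      The formula is known for \<open>y^b\<close> and for \<open>y^b t\<close>, and the unit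
      \<open>conj_y i (y^b)\<close> can be cancelled.\<close>
    have tT: "t \<in> carrier T" using t R by auto
    have "finite {\<alpha>. t \<alpha> \<noteq> \<zero>}" "{\<alpha>. t \<alpha> \<noteq> \<zero>} \<subseteq> exponents m" using tT R(2)[OF t] by auto
    from R_common[OF this] obtain b where b: "b \<in> S" "\<And>\<alpha>. t \<alpha> \<noteq> \<zero> \<Longrightarrow> ?y (b + \<alpha>) \<in> R"
      by (auto simp: S_def)
    have bT: "?y b \<in> carrier T" "?y b \<in> R" using yT yS b by auto
    have "\<gamma> \<in> S" if "t (\<gamma> - b) \<noteq> \<zero>" for \<gamma>
    proof -
      have eq: "b + (\<gamma> - b) = \<gamma>" by (simp add: algebra_simps)
      have bm: "b \<in> exponents m" using b by (simp add: S_def)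
      have "?y (b + (\<gamma> - b)) \<in> R" by (rule b(2)[OF that])
      moreover have "b + (\<gamma> - b) \<in> exponents m"
        by (rule exponents_closed(2)[OF bm R(2)[OF t that]])
      ultimately
      show ?thesis unfolding eq S_def by simp
    qed
    then have "?y b \<otimes>\<^bsub>T\<^esub> t \<in> G"
      using bT tT b SE TM.T_val[OF tT] by (intro G_supp) (auto simp: single_times integral_iff)
    then have 1: "D (?y b \<otimes>\<^bsub>T\<^esub> t) \<oplus>\<^bsub>T\<^esub> conj_y i (?y b \<otimes>\<^bsub>T\<^esub> t) \<otimes>\<^bsub>T\<^esub> C = C \<otimes>\<^bsub>T\<^esub> (?y b \<otimes>\<^bsub>T\<^esub> t)"
      by (simp add: G_def)
    let ?h = "conj_y i (?y b)"
    have 2: "C \<otimes>\<^bsub>T\<^esub> (?y b \<otimes>\<^bsub>T\<^esub> t) = D (?y b) \<otimes>\<^bsub>T\<^esub> t \<oplus>\<^bsub>T\<^esub> ?h \<otimes>\<^bsub>T\<^esub> (C \<otimes>\<^bsub>T\<^esub> t)"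
      using inner_y[OF b(1), symmetric] C_T bT tT DT
      by (simp add: TM.T.m_assoc[symmetric] TM.T.l_distr)
    have "D (?y b) \<otimes>\<^bsub>T\<^esub> t \<oplus>\<^bsub>T\<^esub> ?h \<otimes>\<^bsub>T\<^esub> (D t \<oplus>\<^bsub>T\<^esub> conj_y i t \<otimes>\<^bsub>T\<^esub> C) = C \<otimes>\<^bsub>T\<^esub> (?y b \<otimes>\<^bsub>T\<^esub> t)"
      unfolding 1[symmetric] using C_T bT tT DT t
      by (simp add: D_mult conj_y_mult TM.T.r_distr TM.T.m_assoc TM.TA.a_ac)
    then have "?h \<otimes>\<^bsub>T\<^esub> (D t \<oplus>\<^bsub>T\<^esub> conj_y i t \<otimes>\<^bsub>T\<^esub> C) = ?h \<otimes>\<^bsub>T\<^esub> (C \<otimes>\<^bsub>T\<^esub> t)"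
      unfolding 2 using C_T bT tT DT t by simp
    moreover have "?h \<in> Units T"
      using SE[OF b(1)] by (auto simp: conj_y_single intro!: single_Units)
    ultimately show ?thesis
      using C_T bT tT DT t TM.T.Units_l_cancel by simp
  qed
  have "\<alpha> \<in> exponents m \<and> (\<exists>s\<in>exponents m. ?y s \<in> R \<and> D (?y s) (\<alpha> + s) \<noteq> \<zero>)" if C: "C \<alpha> \<noteq> \<zero>" for \<alpha>
  proof -
    obtain s where s: "s \<in> S" "p s \<alpha> \<noteq> \<zero>" using C_nz[OF C] S0 by blast
    then show ?thesis using p_m[OF s] p_nz[OF s] unfolding S_def by blast
  qed
  then show ?thesis using C_T inner by blast
qed

end

section \<open>Embedding the iterated skew polynomial ring\<close>

text \<open>Left polynomials in \<open>x\<close>, given by their coefficients, are evaluated at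
  \<open>X\<close>. The locale is instantiated twice, in the skew polynomial ring itself with
  \<open>id\<close> and in the target. The same operations on coefficients then describe both sides,
  and no formula for the product of two polynomials is needed.\<close>

locale skew_evaluation = A: ring A + B: ring B
  for A (structure) and B (structure) and R \<tau> \<delta> \<phi> X +
  assumes R: "subring R A"
    and \<tau>: "\<And>r. r \<in> R \<Longrightarrow> \<tau> r \<in> R" "\<tau> \<zero>\<^bsub>A\<^esub> = \<zero>\<^bsub>A\<^esub>"
    and \<delta>: "\<And>r. r \<in> R \<Longrightarrow> \<delta> r \<in> R" "\<delta> \<zero>\<^bsub>A\<^esub> = \<zero>\<^bsub>A\<^esub>"
    and \<phi>: "\<phi> \<in> ring_hom (A\<lparr>carrier := R\<rparr>) B"
    and X: "X \<in> carrier B"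
    and rel: "\<And>r. r \<in> R \<Longrightarrow> X \<otimes>\<^bsub>B\<^esub> \<phi> r = \<phi> (\<tau> r) \<otimes>\<^bsub>B\<^esub> X \<oplus>\<^bsub>B\<^esub> \<phi> (\<delta> r)"
begin

definition coeffs :: "(nat \<Rightarrow> 'a) set"
  where "coeffs = {c. (\<forall>j. c j \<in> R) \<and> finite {j. c j \<noteq> \<zero>\<^bsub>A\<^esub>}}"

definition ev :: "(nat \<Rightarrow> 'a) \<Rightarrow> 'c"
  where "ev c = (\<Oplus>\<^bsub>B\<^esub>j\<in>{j. c j \<noteq> \<zero>\<^bsub>A\<^esub>}. \<phi> (c j) \<otimes>\<^bsub>B\<^esub> X [^]\<^bsub>B\<^esub> j)"

lemma R_closed [simp]: "\<zero>\<^bsub>A\<^esub> \<in> R" "\<one>\<^bsub>A\<^esub> \<in> R" "r \<in> R \<Longrightarrow> s \<in> R \<Longrightarrow> r \<oplus>\<^bsub>A\<^esub> s \<in> R"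
  "r \<in> R \<Longrightarrow> s \<in> R \<Longrightarrow> r \<otimes>\<^bsub>A\<^esub> s \<in> R" "r \<in> R \<Longrightarrow> r \<in> carrier A"
  using subringE[OF R] by auto

lemma \<phi>_simps [simp]:
  "r \<in> R \<Longrightarrow> \<phi> r \<in> carrier B"
  "r \<in> R \<Longrightarrow> s \<in> R \<Longrightarrow> \<phi> (r \<oplus>\<^bsub>A\<^esub> s) = \<phi> r \<oplus>\<^bsub>B\<^esub> \<phi> s"
  "r \<in> R \<Longrightarrow> s \<in> R \<Longrightarrow> \<phi> (r \<otimes>\<^bsub>A\<^esub> s) = \<phi> r \<otimes>\<^bsub>B\<^esub> \<phi> s"
  "\<phi> \<one>\<^bsub>A\<^esub> = \<one>\<^bsub>B\<^esub>"
  using ring_hom_closed[OF \<phi>] ring_hom_add[OF \<phi>] ring_hom_mult[OF \<phi>] ring_hom_one[OF \<phi>] by auto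

lemma \<phi>_zero [simp]: "\<phi> \<zero>\<^bsub>A\<^esub> = \<zero>\<^bsub>B\<^esub>"
proof -
  have "\<phi> \<zero>\<^bsub>A\<^esub> \<oplus>\<^bsub>B\<^esub> \<phi> \<zero>\<^bsub>A\<^esub> = \<phi> \<zero>\<^bsub>A\<^esub>" using \<phi>_simps(2)[of "\<zero>\<^bsub>A\<^esub>" "\<zero>\<^bsub>A\<^esub>"] by simp
  then show ?thesis by simp
qed

lemma coeffsD: "c \<in> coeffs \<Longrightarrow> c j \<in> R"
  by (simp add: coeffs_def)

lemma coeffsI:
  assumes "\<And>j. c j \<in> R" "\<And>j. j \<ge> N \<Longrightarrow> c j = \<zero>\<^bsub>A\<^esub>"
  shows "c \<in> coeffs"
proof -
  have "{j. c j \<noteq> \<zero>\<^bsub>A\<^esub>} \<subseteq> {..<N}" using assms(2) by (auto simp: not_le[symmetric])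
  then show ?thesis using assms(1) finite_subset by (auto simp: coeffs_def)
qed

lemma coeffs_bounded: "c \<in> coeffs \<Longrightarrow> \<exists>N. \<forall>j\<ge>N. c j = \<zero>\<^bsub>A\<^esub>"
  using finite_nat_set_iff_bounded[of "{j. c j \<noteq> \<zero>\<^bsub>A\<^esub>}"] by (auto simp: coeffs_def not_le[symmetric])

lemma ev_upto:
  assumes "c \<in> coeffs" "\<And>j. j \<ge> N \<Longrightarrow> c j = \<zero>\<^bsub>A\<^esub>"
  shows "ev c = (\<Oplus>\<^bsub>B\<^esub>j\<in>{..<N}. \<phi> (c j) \<otimes>\<^bsub>B\<^esub> X [^]\<^bsub>B\<^esub> j)"
  unfolding ev_def using assms X coeffsD[OF assms(1)]
  by (intro B.finsum_extend) (auto simp: not_le[symmetric])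

lemma ev_closed [simp]: "c \<in> coeffs \<Longrightarrow> ev c \<in> carrier B"
  unfolding ev_def using X coeffsD[of c] by (intro B.finsum_closed) auto

lemma ev_add:
  assumes "c \<in> coeffs" "d \<in> coeffs"
  shows "(\<lambda>j. c j \<oplus>\<^bsub>A\<^esub> d j) \<in> coeffs" "ev (\<lambda>j. c j \<oplus>\<^bsub>A\<^esub> d j) = ev c \<oplus>\<^bsub>B\<^esub> ev d"
proof -
  note [simp] = coeffsD[OF assms(1)] coeffsD[OF assms(2)]
  obtain N M where NM: "\<forall>j\<ge>N. c j = \<zero>\<^bsub>A\<^esub>" "\<forall>j\<ge>M. d j = \<zero>\<^bsub>A\<^esub>" using assms coeffs_bounded by meson
  let ?N = "max N M"
  show cd: "(\<lambda>j. c j \<oplus>\<^bsub>A\<^esub> d j) \<in> coeffs" by (rule coeffsI[where N = ?N]) (use NM in auto)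
  have "ev (\<lambda>j. c j \<oplus>\<^bsub>A\<^esub> d j) = (\<Oplus>\<^bsub>B\<^esub>j\<in>{..<?N}. \<phi> (c j \<oplus>\<^bsub>A\<^esub> d j) \<otimes>\<^bsub>B\<^esub> X [^]\<^bsub>B\<^esub> j)"
    by (rule ev_upto[OF cd]) (use NM in auto)
  also have "\<dots> = (\<Oplus>\<^bsub>B\<^esub>j\<in>{..<?N}. \<phi> (c j) \<otimes>\<^bsub>B\<^esub> X [^]\<^bsub>B\<^esub> j \<oplus>\<^bsub>B\<^esub> \<phi> (d j) \<otimes>\<^bsub>B\<^esub> X [^]\<^bsub>B\<^esub> j)"
    using X by (intro B.finsum_cong' refl) (auto simp: B.l_distr)
  also have "\<dots> = ev c \<oplus>\<^bsub>B\<^esub> ev d"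
    using X NM by (subst B.finsum_addf) (auto simp: ev_upto[OF assms(1), of ?N] ev_upto[OF assms(2), of ?N])
  finally show "ev (\<lambda>j. c j \<oplus>\<^bsub>A\<^esub> d j) = ev c \<oplus>\<^bsub>B\<^esub> ev d" .
qed

lemma ev_lmult:
  assumes "c \<in> coeffs" "r \<in> R"
  shows "(\<lambda>j. r \<otimes>\<^bsub>A\<^esub> c j) \<in> coeffs" "ev (\<lambda>j. r \<otimes>\<^bsub>A\<^esub> c j) = \<phi> r \<otimes>\<^bsub>B\<^esub> ev c"
proof -
  note [simp] = coeffsD[OF assms(1)] assms(2)
  obtain N where N: "\<forall>j\<ge>N. c j = \<zero>\<^bsub>A\<^esub>" using assms coeffs_bounded by meson
  show cd: "(\<lambda>j. r \<otimes>\<^bsub>A\<^esub> c j) \<in> coeffs" by (rule coeffsI[where N = N]) (use N in auto)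
  have "ev (\<lambda>j. r \<otimes>\<^bsub>A\<^esub> c j) = (\<Oplus>\<^bsub>B\<^esub>j\<in>{..<N}. \<phi> (r \<otimes>\<^bsub>A\<^esub> c j) \<otimes>\<^bsub>B\<^esub> X [^]\<^bsub>B\<^esub> j)"
    by (rule ev_upto[OF cd]) (use N in auto)
  also have "\<dots> = (\<Oplus>\<^bsub>B\<^esub>j\<in>{..<N}. \<phi> r \<otimes>\<^bsub>B\<^esub> (\<phi> (c j) \<otimes>\<^bsub>B\<^esub> X [^]\<^bsub>B\<^esub> j))"
    using X by (intro B.finsum_cong' refl) (auto simp: B.m_assoc)
  also have "\<dots> = \<phi> r \<otimes>\<^bsub>B\<^esub> ev c"
    using X N by (subst B.finsum_rdistr[symmetric]) (auto simp: ev_upto[OF assms(1), of N])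
  finally show "ev (\<lambda>j. r \<otimes>\<^bsub>A\<^esub> c j) = \<phi> r \<otimes>\<^bsub>B\<^esub> ev c" .
qed

text \<open>The coefficients of \<open>x\<close> times a polynomial:
  \<open>x c_j x^j = \<tau>(c_j) x^(j+1) + \<delta>(c_j) x^j\<close>.\<close>

definition shift :: "(nat \<Rightarrow> 'a) \<Rightarrow> nat \<Rightarrow> 'a"
  where "shift c j = (if j = 0 then \<zero>\<^bsub>A\<^esub> else \<tau> (c (j - 1))) \<oplus>\<^bsub>A\<^esub> \<delta> (c j)"

lemma ev_shift:
  assumes "c \<in> coeffs"
  shows "shift c \<in> coeffs" "ev (shift c) = X \<otimes>\<^bsub>B\<^esub> ev c"
proof -
  note [simp] = coeffsD[OF assms(1)] \<tau> \<delta>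
  obtain N where N: "\<forall>j\<ge>N. c j = \<zero>\<^bsub>A\<^esub>" using assms coeffs_bounded by meson
  have N': "shift c j = \<zero>\<^bsub>A\<^esub>" if "j \<ge> Suc N" for j
  proof -
    have "c j = \<zero>\<^bsub>A\<^esub>" "c (j - 1) = \<zero>\<^bsub>A\<^esub>" using N that by auto
    then show ?thesis by (simp add: shift_def)
  qed
  have R': "shift c j \<in> R" for j by (simp add: shift_def)
  show cd: "shift c \<in> coeffs" by (rule coeffsI[where N = "Suc N"]) (use N' R' in auto)
  have "ev (shift c) = (\<Oplus>\<^bsub>B\<^esub>j\<in>{..<Suc N}. \<phi> (shift c j) \<otimes>\<^bsub>B\<^esub> X [^]\<^bsub>B\<^esub> j)"
    by (rule ev_upto[OF cd N'])
  also have "\<dots> = (\<Oplus>\<^bsub>B\<^esub>j\<in>{..<Suc N}. \<phi> (if j = 0 then \<zero>\<^bsub>A\<^esub> else \<tau> (c (j - 1))) \<otimes>\<^bsub>B\<^esub> X [^]\<^bsub>B\<^esub> j \<oplus>\<^bsub>B\<^esub> \<phi> (\<delta> (c j)) \<otimes>\<^bsub>B\<^esub> X [^]\<^bsub>B\<^esub> j)"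
    using X by (intro B.finsum_cong' refl) (auto simp: shift_def B.l_distr)
  also have "\<dots> = (\<Oplus>\<^bsub>B\<^esub>j\<in>{..<Suc N}. \<phi> (if j = 0 then \<zero>\<^bsub>A\<^esub> else \<tau> (c (j - 1))) \<otimes>\<^bsub>B\<^esub> X [^]\<^bsub>B\<^esub> j)
      \<oplus>\<^bsub>B\<^esub> (\<Oplus>\<^bsub>B\<^esub>j\<in>{..<Suc N}. \<phi> (\<delta> (c j)) \<otimes>\<^bsub>B\<^esub> X [^]\<^bsub>B\<^esub> j)"
    using X by (intro B.finsum_addf) auto
  also have "(\<Oplus>\<^bsub>B\<^esub>j\<in>{..<Suc N}. \<phi> (\<delta> (c j)) \<otimes>\<^bsub>B\<^esub> X [^]\<^bsub>B\<^esub> j) = (\<Oplus>\<^bsub>B\<^esub>j\<in>{..<N}. \<phi> (\<delta> (c j)) \<otimes>\<^bsub>B\<^esub> X [^]\<^bsub>B\<^esub> j)"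
    using X N by (intro B.finsum_extend[symmetric]) (auto simp: less_Suc_eq)
  also have "(\<Oplus>\<^bsub>B\<^esub>j\<in>{..<Suc N}. \<phi> (if j = 0 then \<zero>\<^bsub>A\<^esub> else \<tau> (c (j - 1))) \<otimes>\<^bsub>B\<^esub> X [^]\<^bsub>B\<^esub> j)
      = (\<Oplus>\<^bsub>B\<^esub>j\<in>Suc ` {..<N}. \<phi> (if j = 0 then \<zero>\<^bsub>A\<^esub> else \<tau> (c (j - 1))) \<otimes>\<^bsub>B\<^esub> X [^]\<^bsub>B\<^esub> j)"
    using X by (intro B.finsum_extend[symmetric]) (auto simp: lessThan_Suc_eq_insert_0)
  also have "\<dots> = (\<Oplus>\<^bsub>B\<^esub>j\<in>{..<N}. \<phi> (\<tau> (c j)) \<otimes>\<^bsub>B\<^esub> X [^]\<^bsub>B\<^esub> Suc j)"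
    using X by (subst B.finsum_reindex) auto
  also have "\<dots> \<oplus>\<^bsub>B\<^esub> (\<Oplus>\<^bsub>B\<^esub>j\<in>{..<N}. \<phi> (\<delta> (c j)) \<otimes>\<^bsub>B\<^esub> X [^]\<^bsub>B\<^esub> j)
    = (\<Oplus>\<^bsub>B\<^esub>j\<in>{..<N}. \<phi> (\<tau> (c j)) \<otimes>\<^bsub>B\<^esub> X [^]\<^bsub>B\<^esub> Suc j \<oplus>\<^bsub>B\<^esub> \<phi> (\<delta> (c j)) \<otimes>\<^bsub>B\<^esub> X [^]\<^bsub>B\<^esub> j)"
    using X by (intro B.finsum_addf[symmetric]) auto
  also have "\<dots> = (\<Oplus>\<^bsub>B\<^esub>j\<in>{..<N}. X \<otimes>\<^bsub>B\<^esub> (\<phi> (c j) \<otimes>\<^bsub>B\<^esub> X [^]\<^bsub>B\<^esub> j))"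
  proof (intro B.finsum_cong' refl)
    fix j
    have "X \<otimes>\<^bsub>B\<^esub> (\<phi> (c j) \<otimes>\<^bsub>B\<^esub> X [^]\<^bsub>B\<^esub> j) = (X \<otimes>\<^bsub>B\<^esub> \<phi> (c j)) \<otimes>\<^bsub>B\<^esub> X [^]\<^bsub>B\<^esub> j"
      using X by (simp add: B.m_assoc)
    also have "\<dots> = (\<phi> (\<tau> (c j)) \<otimes>\<^bsub>B\<^esub> X \<oplus>\<^bsub>B\<^esub> \<phi> (\<delta> (c j))) \<otimes>\<^bsub>B\<^esub> X [^]\<^bsub>B\<^esub> j" by (simp add: rel)
    finally show "\<phi> (\<tau> (c j)) \<otimes>\<^bsub>B\<^esub> X [^]\<^bsub>B\<^esub> Suc j \<oplus>\<^bsub>B\<^esub> \<phi> (\<delta> (c j)) \<otimes>\<^bsub>B\<^esub> X [^]\<^bsub>B\<^esub> j = X \<otimes>\<^bsub>B\<^esub> (\<phi> (c j) \<otimes>\<^bsub>B\<^esub> X [^]\<^bsub>B\<^esub> j)"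
      using X B.nat_pow_Suc2[OF X, of j] by (simp add: B.l_distr B.m_assoc)
  qed (use X in auto)
  also have "\<dots> = X \<otimes>\<^bsub>B\<^esub> ev c"
    using X N by (subst B.finsum_rdistr[symmetric]) (auto simp: ev_upto[OF assms(1), of N])
  finally show "ev (shift c) = X \<otimes>\<^bsub>B\<^esub> ev c" .
qed

lemma ev_const:
  assumes "r \<in> R"
  shows "(\<lambda>j. if j = 0 then r else \<zero>\<^bsub>A\<^esub>) \<in> coeffs" "ev (\<lambda>j. if j = 0 then r else \<zero>\<^bsub>A\<^esub>) = \<phi> r"
proof -
  let ?c = "\<lambda>j::nat. if j = 0 then r else \<zero>\<^bsub>A\<^esub>"
  show c: "?c \<in> coeffs" by (rule coeffsI[where N = 1]) (use assms in auto)
  have "ev ?c = (\<Oplus>\<^bsub>B\<^esub>j\<in>{..<Suc 0}. \<phi> (?c j) \<otimes>\<^bsub>B\<^esub> X [^]\<^bsub>B\<^esub> j)" by (rule ev_upto[OF c]) auto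
  then show "ev ?c = \<phi> r" using assms X by (simp add: lessThan_Suc)
qed

lemma ev_var:
  "(\<lambda>j. if j = 1 then \<one>\<^bsub>A\<^esub> else \<zero>\<^bsub>A\<^esub>) \<in> coeffs" "ev (\<lambda>j. if j = 1 then \<one>\<^bsub>A\<^esub> else \<zero>\<^bsub>A\<^esub>) = X"
proof -
  let ?c = "\<lambda>j::nat. if j = 1 then \<one>\<^bsub>A\<^esub> else \<zero>\<^bsub>A\<^esub>"
  show c: "?c \<in> coeffs" by (rule coeffsI[where N = 2]) auto
  have "ev ?c = (\<Oplus>\<^bsub>B\<^esub>j\<in>{..<Suc (Suc 0)}. \<phi> (?c j) \<otimes>\<^bsub>B\<^esub> X [^]\<^bsub>B\<^esub> j)" by (rule ev_upto[OF c]) auto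
  then show "ev ?c = X" using X by (simp add: lessThan_Suc)
qed

end

lemma skew_polynomial_ringD:
  assumes "skew_polynomial_ring K A R x \<tau> \<delta> S"
  shows "subring R A" "subring S A" "R \<subseteq> S" "x \<in> S"
    "algebra_automorphism K A R \<tau>" "skew_derivation K A R \<tau> \<delta>"
    "r \<in> R \<Longrightarrow> x \<otimes>\<^bsub>A\<^esub> r = (\<tau> r \<otimes>\<^bsub>A\<^esub> x) \<oplus>\<^bsub>A\<^esub> \<delta> r"
    "s \<in> S \<Longrightarrow> \<exists>!c. (\<forall>j. c j \<in> R) \<and> finite {j. c j \<noteq> \<zero>\<^bsub>A\<^esub>} \<and>
        s = (\<Oplus>\<^bsub>A\<^esub>j\<in>{j. c j \<noteq> \<zero>\<^bsub>A\<^esub>}. c j \<otimes>\<^bsub>A\<^esub> x [^]\<^bsub>A\<^esub> (j::nat))"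
proof -
  note * = assms[unfolded skew_polynomial_ring_def]
  show "subring R A" by (rule *[THEN conjunct1])
  note * = *[THEN conjunct2]
  show "subring S A" by (rule *[THEN conjunct1])
  note * = *[THEN conjunct2]
  show "R \<subseteq> S" by (rule *[THEN conjunct1])
  note * = *[THEN conjunct2]
  show "x \<in> S" by (rule *[THEN conjunct1])
  note * = *[THEN conjunct2]
  show "algebra_automorphism K A R \<tau>" by (rule *[THEN conjunct1])
  note * = *[THEN conjunct2]
  show "skew_derivation K A R \<tau> \<delta>" by (rule *[THEN conjunct1])
  note * = *[THEN conjunct2]
  show "r \<in> R \<Longrightarrow> x \<otimes>\<^bsub>A\<^esub> r = (\<tau> r \<otimes>\<^bsub>A\<^esub> x) \<oplus>\<^bsub>A\<^esub> \<delta> r" by (rule bspec[OF *[THEN conjunct1]])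
  show "s \<in> S \<Longrightarrow> \<exists>!c. (\<forall>j. c j \<in> R) \<and> finite {j. c j \<noteq> \<zero>\<^bsub>A\<^esub>} \<and>
        s = (\<Oplus>\<^bsub>A\<^esub>j\<in>{j. c j \<noteq> \<zero>\<^bsub>A\<^esub>}. c j \<otimes>\<^bsub>A\<^esub> x [^]\<^bsub>A\<^esub> (j::nat))"
    by (rule bspec[OF *[THEN conjunct2]])
qed

text \<open>The universal property of \<open>R[x;\<tau>,\<delta>]\<close>. The coefficients of
  \<open>s\<close> and of its image are part of the conclusion, since the injectivity and the
  support of the extension are read off from them.\<close>

lemma skew_polynomial_extension:
  assumes A: "ring A" and T: "ring T"
    and S: "skew_polynomial_ring K A R x \<tau> \<delta> S"
    and \<Phi>: "\<Phi> \<in> ring_hom (A\<lparr>carrier := R\<rparr>) T" and X: "X \<in> carrier T"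
    and rel: "\<And>r. r \<in> R \<Longrightarrow> X \<otimes>\<^bsub>T\<^esub> \<Phi> r = \<Phi> (\<tau> r) \<otimes>\<^bsub>T\<^esub> X \<oplus>\<^bsub>T\<^esub> \<Phi> (\<delta> r)"
  shows "\<exists>\<Psi>\<in>ring_hom (A\<lparr>carrier := S\<rparr>) T. (\<forall>r\<in>R. \<Psi> r = \<Phi> r) \<and> \<Psi> x = X \<and>
    (\<forall>s\<in>S. \<exists>c. (\<forall>j. c j \<in> R) \<and> finite {j. c j \<noteq> \<zero>\<^bsub>A\<^esub>} \<and>
      s = (\<Oplus>\<^bsub>A\<^esub>j\<in>{j. c j \<noteq> \<zero>\<^bsub>A\<^esub>}. c j \<otimes>\<^bsub>A\<^esub> x [^]\<^bsub>A\<^esub> (j::nat)) \<and>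
      \<Psi> s = (\<Oplus>\<^bsub>T\<^esub>j\<in>{j. c j \<noteq> \<zero>\<^bsub>A\<^esub>}. \<Phi> (c j) \<otimes>\<^bsub>T\<^esub> X [^]\<^bsub>T\<^esub> j))"
proof -
  interpret A: ring A by fact
  interpret T: ring T by fact
  note R = skew_polynomial_ringD(1)[OF S] and subS = skew_polynomial_ringD(2)[OF S]
    and RS = skew_polynomial_ringD(3)[OF S] and x = skew_polynomial_ringD(4)[OF S]
    and aut = skew_polynomial_ringD(5)[OF S] and der = skew_polynomial_ringD(6)[OF S]
    and relA = skew_polynomial_ringD(7)[OF S] and uniq = skew_polynomial_ringD(8)[OF S]
  have RA: "R \<subseteq> carrier A" and SA: "S \<subseteq> carrier A" using subringE(1) R subS by auto
  have lin: "linear_op K A R \<tau>" "linear_op K A R \<delta>"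
    using aut der by (auto simp: algebra_automorphism_def skew_derivation_def)
  have R0: "\<zero>\<^bsub>A\<^esub> \<in> R" using subringE(2)[OF R] .
  have lin0: "f \<zero>\<^bsub>A\<^esub> = \<zero>\<^bsub>A\<^esub>" if "linear_op K A R f" for f
  proof -
    have "f (\<zero>\<^bsub>A\<^esub> \<oplus>\<^bsub>A\<^esub> \<zero>\<^bsub>A\<^esub>) = f \<zero>\<^bsub>A\<^esub> \<oplus>\<^bsub>A\<^esub> f \<zero>\<^bsub>A\<^esub>" "f \<zero>\<^bsub>A\<^esub> \<in> carrier A"
      using that R0 RA unfolding linear_op_def by blast+
    then show ?thesis by simp
  qed
  have in_R: "f r \<in> R" if "linear_op K A R f" "r \<in> R" for f r
    using that unfolding linear_op_def by blast
  have cl: "\<And>r. r \<in> R \<Longrightarrow> \<tau> r \<in> R" "\<And>r. r \<in> R \<Longrightarrow> \<delta> r \<in> R" "\<tau> \<zero>\<^bsub>A\<^esub> = \<zero>\<^bsub>A\<^esub>" "\<delta> \<zero>\<^bsub>A\<^esub> = \<zero>\<^bsub>A\<^esub>"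
    by (rule in_R[OF lin(1)], assumption, rule in_R[OF lin(2)], assumption, rule lin0[OF lin(1)], rule lin0[OF lin(2)])
  interpret EA: skew_evaluation A A R \<tau> \<delta> id x
    by (intro skew_evaluation.intro skew_evaluation_axioms.intro A.ring_axioms R)
      (use RA SA x relA cl in \<open>auto intro!: ring_hom_memI\<close>)
  interpret ET: skew_evaluation A T R \<tau> \<delta> \<Phi> X
    by (intro skew_evaluation.intro skew_evaluation_axioms.intro A.ring_axioms T.ring_axioms R)
      (use rel cl \<Phi> X in auto)
  have ex1: "\<exists>!c. c \<in> ET.coeffs \<and> s = EA.ev c" if "s \<in> S" for s
    using uniq[OF that] by (simp add: ET.coeffs_def EA.ev_def)
  define cf where "cf = (\<lambda>s. THE c. c \<in> ET.coeffs \<and> s = EA.ev c)"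
  have cf: "cf s \<in> ET.coeffs" "EA.ev (cf s) = s" if "s \<in> S" for s
    using theI'[OF ex1[OF that]] by (auto simp: cf_def)
  have cf_eq: "cf s = c" if "s \<in> S" "c \<in> ET.coeffs" "EA.ev c = s" for s c
    unfolding cf_def by (rule the1_equality[OF ex1[OF that(1)]]) (use that in simp)
  define \<Psi> where "\<Psi> = (\<lambda>s. ET.ev (cf s))"
  have S_cl: "s \<oplus>\<^bsub>A\<^esub> t \<in> S" "s \<otimes>\<^bsub>A\<^esub> t \<in> S" if "s \<in> S" "t \<in> S" for s t
    using that subringE(6,7)[OF subS] by auto
  have \<Psi>_closed: "\<Psi> s \<in> carrier T" if "s \<in> S" for s using cf[OF that] by (simp add: \<Psi>_def)
  have \<Psi>_add: "\<Psi> (s \<oplus>\<^bsub>A\<^esub> t) = \<Psi> s \<oplus>\<^bsub>T\<^esub> \<Psi> t" if "s \<in> S" "t \<in> S" for s t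
  proof -
    have "cf (s \<oplus>\<^bsub>A\<^esub> t) = (\<lambda>j. cf s j \<oplus>\<^bsub>A\<^esub> cf t j)"
      using that cf S_cl EA.ev_add[of "cf s" "cf t"] by (intro cf_eq) auto
    then show ?thesis using that cf ET.ev_add[of "cf s" "cf t"] by (simp add: \<Psi>_def)
  qed
  have \<Psi>_lmult: "\<Psi> (r \<otimes>\<^bsub>A\<^esub> s) = \<Phi> r \<otimes>\<^bsub>T\<^esub> \<Psi> s" if "r \<in> R" "s \<in> S" for r s
  proof -
    have "cf (r \<otimes>\<^bsub>A\<^esub> s) = (\<lambda>j. r \<otimes>\<^bsub>A\<^esub> cf s j)"
      using that RS cf S_cl EA.ev_lmult[of "cf s" r] by (intro cf_eq) auto
    then show ?thesis using that cf ET.ev_lmult[of "cf s" r] by (simp add: \<Psi>_def)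
  qed
  have \<Psi>_xmult: "\<Psi> (x \<otimes>\<^bsub>A\<^esub> s) = X \<otimes>\<^bsub>T\<^esub> \<Psi> s" if "s \<in> S" for s
  proof -
    have "cf (x \<otimes>\<^bsub>A\<^esub> s) = ET.shift (cf s)"
      using that x cf S_cl EA.ev_shift[of "cf s"] by (intro cf_eq) auto
    then show ?thesis using that cf ET.ev_shift[of "cf s"] by (simp add: \<Psi>_def)
  qed
  have \<Psi>_R: "\<Psi> r = \<Phi> r" if "r \<in> R" for r
  proof -
    have "cf r = (\<lambda>j. if j = 0 then r else \<zero>\<^bsub>A\<^esub>)"
      using that RS EA.ev_const[of r] by (intro cf_eq) auto
    then show ?thesis using ET.ev_const[OF that] by (simp add: \<Psi>_def)
  qed
  have \<Psi>_x: "\<Psi> x = X"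
  proof -
    have "cf x = (\<lambda>j. if j = 1 then \<one>\<^bsub>A\<^esub> else \<zero>\<^bsub>A\<^esub>)"
      using x EA.ev_var by (intro cf_eq) auto
    then show ?thesis using ET.ev_var by (simp add: \<Psi>_def)
  qed
  \<comment> \<open>The elements for which multiplicativity on the left is known form a set closed
    under sums and products that contains \<open>R\<close> and \<open>x\<close>, hence all of
    \<open>S\<close>.\<close>
  define G where "G = {s \<in> S. \<forall>t\<in>S. \<Psi> (s \<otimes>\<^bsub>A\<^esub> t) = \<Psi> s \<otimes>\<^bsub>T\<^esub> \<Psi> t}"
  have G_R: "r \<in> G" if "r \<in> R" for r using that RS \<Psi>_lmult \<Psi>_R by (auto simp: G_def)
  have G_x: "x \<in> G" using x \<Psi>_xmult \<Psi>_x by (auto simp: G_def)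
  have G_add: "s \<oplus>\<^bsub>A\<^esub> t \<in> G" if "s \<in> G" "t \<in> G" for s t
    using that SA S_cl \<Psi>_closed by (auto simp: G_def A.l_distr T.l_distr \<Psi>_add subset_iff)
  have G_mult: "s \<otimes>\<^bsub>A\<^esub> t \<in> G" if "s \<in> G" "t \<in> G" for s t
    using that SA S_cl \<Psi>_closed by (auto simp: G_def A.m_assoc T.m_assoc subset_iff)
  have GA: "G \<subseteq> carrier A" using SA by (auto simp: G_def)
  have G_pow: "x [^]\<^bsub>A\<^esub> (j::nat) \<in> G" for j
  proof (induction j)
    case 0
    then show ?case using G_R[of "\<one>\<^bsub>A\<^esub>"] by simp
  next
    case (Suc j)
    then show ?case using G_mult[OF Suc G_x] by simp
  qed
  have "s \<in> G" if s: "s \<in> S" for s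
  proof -
    have cR: "cf s j \<in> R" for j using cf[OF s] ET.coeffsD by blast
    have "(\<Oplus>\<^bsub>A\<^esub>j\<in>J. cf s j \<otimes>\<^bsub>A\<^esub> x [^]\<^bsub>A\<^esub> j) \<in> G" if "finite J" for J
      using that
    proof (induction J rule: finite_induct)
      case empty
      then show ?case using G_R[OF R0] by simp
    next
      case (insert j J)
      have "(\<lambda>j. cf s j \<otimes>\<^bsub>A\<^esub> x [^]\<^bsub>A\<^esub> j) \<in> insert j J \<rightarrow> carrier A"
        using subsetD[OF RA cR] subsetD[OF GA G_pow] by auto
      then show ?case using insert G_add G_mult[OF G_R[OF cR] G_pow] by (subst A.finsum_insert) auto
    qed
    from this[of "{j. cf s j \<noteq> \<zero>\<^bsub>A\<^esub>}"] show ?thesis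
      using cf[OF s] by (simp add: EA.ev_def ET.coeffs_def)
  qed
  then have \<Psi>_mult: "\<Psi> (s \<otimes>\<^bsub>A\<^esub> t) = \<Psi> s \<otimes>\<^bsub>T\<^esub> \<Psi> t" if "s \<in> S" "t \<in> S" for s t
    using that by (auto simp: G_def)
  have "\<Psi> \<in> ring_hom (A\<lparr>carrier := S\<rparr>) T"
    using \<Psi>_closed \<Psi>_mult \<Psi>_add \<Psi>_R[of "\<one>\<^bsub>A\<^esub>"] by (intro ring_hom_memI) auto
  moreover have "\<exists>c. (\<forall>j. c j \<in> R) \<and> finite {j. c j \<noteq> \<zero>\<^bsub>A\<^esub>} \<and>
      s = (\<Oplus>\<^bsub>A\<^esub>j\<in>{j. c j \<noteq> \<zero>\<^bsub>A\<^esub>}. c j \<otimes>\<^bsub>A\<^esub> x [^]\<^bsub>A\<^esub> (j::nat)) \<and>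
      \<Psi> s = (\<Oplus>\<^bsub>T\<^esub>j\<in>{j. c j \<noteq> \<zero>\<^bsub>A\<^esub>}. \<Phi> (c j) \<otimes>\<^bsub>T\<^esub> X [^]\<^bsub>T\<^esub> j)" if "s \<in> S" for s
    using cf[OF that] by (intro exI[of _ "cf s"]) (simp add: \<Psi>_def ET.ev_def EA.ev_def ET.coeffs_def)
  ultimately show ?thesis using \<Psi>_R \<Psi>_x by blast
qed

section \<open>The chain of subalgebras and the notion of an embedding into the torus\<close>

locale iterated_skew_polynomial_algebra = quantum_torus +
  fixes A :: "('a, 'c, 'm) module_scheme" and x :: "nat \<Rightarrow> 'c" and \<tau> \<delta> :: "nat \<Rightarrow> 'c \<Rightarrow> 'c" and q :: "nat \<Rightarrow> 'a"
  assumes iter: "iterated_skew_polynomial_ring K A n x \<tau> \<delta>"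
    and \<tau>_var: "\<And>i j. 1 \<le> j \<Longrightarrow> j < i \<Longrightarrow> i \<le> n \<Longrightarrow> \<tau> i (x j) = \<Lambda> i j \<odot>\<^bsub>A\<^esub> x j"
    and q_in: "\<And>i. i \<in> {1..n} \<Longrightarrow> q i \<in> carrier K - {\<zero>\<^bsub>K\<^esub>, \<one>\<^bsub>K\<^esub>}"
    and q_skew: "\<And>i r. i \<in> {1..n} \<Longrightarrow> r \<in> lower_subalgebra K A x i
          \<Longrightarrow> \<delta> i (\<tau> i r) = q i \<odot>\<^bsub>A\<^esub> \<tau> i (\<delta> i r)"
begin

abbreviation "L i \<equiv> lower_subalgebra K A x (Suc i)"

lemma kA: "k_algebra K A" and scalar_inj: "inj_on (scalar A) (carrier K)" and top: "carrier A = L n"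
  using iter by (auto simp: iterated_skew_polynomial_ring_def)

lemma step: "m < n \<Longrightarrow> skew_polynomial_ring K A (L m) (x (Suc m)) (\<tau> (Suc m)) (\<delta> (Suc m)) (L (Suc m))"
  using iter unfolding iterated_skew_polynomial_ring_def by simp

sublocale kA: k_algebra K A by (rule kA)

lemma scalar_closed [simp]: "a \<in> carrier K \<Longrightarrow> scalar A a \<in> carrier A"
  by (simp add: scalar_def)

lemma x_in: "j \<in> {1..n} \<Longrightarrow> x j \<in> carrier A"
proof -
  assume "j \<in> {1..n}"
  then obtain m where m: "j = Suc m" "m < n" by (cases j) auto
  note s = step[OF m(2)]
  show ?thesis using skew_polynomial_ringD(4)[OF s] subringE(1)[OF skew_polynomial_ringD(2)[OF s]] m by auto
qed

lemma L_subring: "i \<le> n \<Longrightarrow> subring (L i) A"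
  unfolding lower_subalgebra_def subalgebra_gen_def
  using x_in by (intro kA.A.generate_ring_is_subring) (auto simp: image_subset_iff)

lemma L_carrier: "i \<le> n \<Longrightarrow> r \<in> L i \<Longrightarrow> r \<in> carrier A"
  using subringE(1)[OF L_subring] by auto

lemma scalar_in_L: "a \<in> carrier K \<Longrightarrow> scalar A a \<in> L i"
  unfolding lower_subalgebra_def subalgebra_gen_def by (intro generate_ring.incl) auto

lemma x_in_L: "j \<in> {1..i} \<Longrightarrow> x j \<in> L i"
  unfolding lower_subalgebra_def subalgebra_gen_def by (intro generate_ring.incl) auto

lemma L_closed:
  "r \<in> L i \<Longrightarrow> s \<in> L i \<Longrightarrow> r \<oplus>\<^bsub>A\<^esub> s \<in> L i" "r \<in> L i \<Longrightarrow> s \<in> L i \<Longrightarrow> r \<otimes>\<^bsub>A\<^esub> s \<in> L i" "r \<in> L i \<Longrightarrow> \<ominus>\<^bsub>A\<^esub> r \<in> L i"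
  unfolding lower_subalgebra_def subalgebra_gen_def by (rule generate_ring.intros; assumption)+

lemma smult_scalar: "a \<in> carrier K \<Longrightarrow> r \<in> carrier A \<Longrightarrow> a \<odot>\<^bsub>A\<^esub> r = scalar A a \<otimes>\<^bsub>A\<^esub> r"
  by (simp add: scalar_def kA.smult_mult_left)

lemma L_smult: "i \<le> n \<Longrightarrow> a \<in> carrier K \<Longrightarrow> r \<in> L i \<Longrightarrow> a \<odot>\<^bsub>A\<^esub> r \<in> L i"
  using smult_scalar[of a r] L_carrier L_closed(2)[OF scalar_in_L] by simp

lemma L_mono: "i \<le> j \<Longrightarrow> L i \<subseteq> L j"
proof
  fix r assume "i \<le> j" "r \<in> L i"
  then show "r \<in> L j"
    unfolding lower_subalgebra_def subalgebra_gen_def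
    by (induction rule: generate_ring.induct[OF \<open>r \<in> L i\<close>[unfolded lower_subalgebra_def subalgebra_gen_def]])
      (auto intro: generate_ring.intros)
qed

lemma \<tau>_props:
  assumes "j \<in> {1..n}"
  shows "\<tau> j \<in> ring_hom (A\<lparr>carrier := L (j - 1)\<rparr>) (A\<lparr>carrier := L (j - 1)\<rparr>)"
    "a \<in> carrier K \<Longrightarrow> r \<in> L (j - 1) \<Longrightarrow> \<tau> j (a \<odot>\<^bsub>A\<^esub> r) = a \<odot>\<^bsub>A\<^esub> \<tau> j r"
    "\<delta> j ` L (j - 1) \<subseteq> L (j - 1)"
    "r \<in> L (j - 1) \<Longrightarrow> s \<in> L (j - 1) \<Longrightarrow> \<delta> j (r \<oplus>\<^bsub>A\<^esub> s) = \<delta> j r \<oplus>\<^bsub>A\<^esub> \<delta> j s"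
    "a \<in> carrier K \<Longrightarrow> r \<in> L (j - 1) \<Longrightarrow> \<delta> j (a \<odot>\<^bsub>A\<^esub> r) = a \<odot>\<^bsub>A\<^esub> \<delta> j r"
    "r \<in> L (j - 1) \<Longrightarrow> s \<in> L (j - 1) \<Longrightarrow> \<delta> j (r \<otimes>\<^bsub>A\<^esub> s) = (\<tau> j r \<otimes>\<^bsub>A\<^esub> \<delta> j s) \<oplus>\<^bsub>A\<^esub> (\<delta> j r \<otimes>\<^bsub>A\<^esub> s)"
proof -
  obtain m where m: "j = Suc m" "m < n" using assms by (cases j) auto
  note s = step[OF m(2)]
  note aut = skew_polynomial_ringD(5)[OF s, unfolded algebra_automorphism_def]
    and der = skew_polynomial_ringD(6)[OF s, unfolded skew_derivation_def]
  show "\<tau> j \<in> ring_hom (A\<lparr>carrier := L (j - 1)\<rparr>) (A\<lparr>carrier := L (j - 1)\<rparr>)"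
    using aut m by (simp add: ring_iso_def)
  show "a \<in> carrier K \<Longrightarrow> r \<in> L (j - 1) \<Longrightarrow> \<tau> j (a \<odot>\<^bsub>A\<^esub> r) = a \<odot>\<^bsub>A\<^esub> \<tau> j r"
    using aut m by (simp add: linear_op_def)
  show "\<delta> j ` L (j - 1) \<subseteq> L (j - 1)"
    "r \<in> L (j - 1) \<Longrightarrow> s \<in> L (j - 1) \<Longrightarrow> \<delta> j (r \<oplus>\<^bsub>A\<^esub> s) = \<delta> j r \<oplus>\<^bsub>A\<^esub> \<delta> j s"
    "a \<in> carrier K \<Longrightarrow> r \<in> L (j - 1) \<Longrightarrow> \<delta> j (a \<odot>\<^bsub>A\<^esub> r) = a \<odot>\<^bsub>A\<^esub> \<delta> j r"
    "r \<in> L (j - 1) \<Longrightarrow> s \<in> L (j - 1) \<Longrightarrow> \<delta> j (r \<otimes>\<^bsub>A\<^esub> s) = (\<tau> j r \<otimes>\<^bsub>A\<^esub> \<delta> j s) \<oplus>\<^bsub>A\<^esub> (\<delta> j r \<otimes>\<^bsub>A\<^esub> s)"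
    using der m by (simp_all add: linear_op_def)
qed

lemma \<tau>_hom:
  assumes "j \<in> {1..n}" "i < j" "r \<in> L i" "s \<in> L i"
  shows "\<tau> j (r \<oplus>\<^bsub>A\<^esub> s) = \<tau> j r \<oplus>\<^bsub>A\<^esub> \<tau> j s" "\<tau> j (r \<otimes>\<^bsub>A\<^esub> s) = \<tau> j r \<otimes>\<^bsub>A\<^esub> \<tau> j s"
    "a \<in> carrier K \<Longrightarrow> \<tau> j (a \<odot>\<^bsub>A\<^esub> r) = a \<odot>\<^bsub>A\<^esub> \<tau> j r" "\<tau> j (\<ominus>\<^bsub>A\<^esub> r) = \<ominus>\<^bsub>A\<^esub> \<tau> j r"
    "\<tau> j r \<in> carrier A"
proof -
  have ij: "i \<le> j - 1" "i \<le> n" "j - 1 \<le> n" using assms by auto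
  have rs: "r \<in> L (j - 1)" "s \<in> L (j - 1)" using L_mono[OF ij(1)] assms by auto
  note h = \<tau>_props(1)[OF assms(1)]
  show "\<tau> j (r \<oplus>\<^bsub>A\<^esub> s) = \<tau> j r \<oplus>\<^bsub>A\<^esub> \<tau> j s" "\<tau> j (r \<otimes>\<^bsub>A\<^esub> s) = \<tau> j r \<otimes>\<^bsub>A\<^esub> \<tau> j s"
    using ring_hom_add[OF h, of r s] ring_hom_mult[OF h, of r s] rs by simp_all
  show sm: "\<tau> j (a \<odot>\<^bsub>A\<^esub> r) = a \<odot>\<^bsub>A\<^esub> \<tau> j r" if "a \<in> carrier K" for a
    using \<tau>_props(2)[OF assms(1) that rs(1)] .
  show cl: "\<tau> j r \<in> carrier A" using ring_hom_closed[OF h, of r] rs L_carrier[OF ij(3)] by simp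
  have neg: "\<ominus>\<^bsub>A\<^esub> t = (\<ominus>\<^bsub>K\<^esub> \<one>\<^bsub>K\<^esub>) \<odot>\<^bsub>A\<^esub> t" if "t \<in> carrier A" for t
    using that by (simp add: kA.smult_l_minus)
  show "\<tau> j (\<ominus>\<^bsub>A\<^esub> r) = \<ominus>\<^bsub>A\<^esub> \<tau> j r"
    using sm[of "\<ominus>\<^bsub>K\<^esub> \<one>\<^bsub>K\<^esub>"] neg[OF L_carrier[OF ij(2) assms(3)]] neg[OF cl] by simp
qed

lemma \<tau>_scalar: "j \<in> {1..n} \<Longrightarrow> a \<in> carrier K \<Longrightarrow> \<tau> j (scalar A a) = scalar A a"
proof -
  assume j: "j \<in> {1..n}" and a: "a \<in> carrier K"
  have one: "\<one>\<^bsub>A\<^esub> \<in> L (j - 1)" using scalar_in_L[of "\<one>\<^bsub>K\<^esub>"] by (simp add: scalar_def)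
  show ?thesis
    using \<tau>_props(2)[OF j a one] ring_hom_one[OF \<tau>_props(1)[OF j]] by (simp add: scalar_def)
qed

lemma L_induct [consumes 2, case_names scalar var add minus mult]:
  assumes i: "i \<le> n" and r: "r \<in> L i"
    and scalar: "\<And>a. a \<in> carrier K \<Longrightarrow> P (scalar A a)"
    and var: "\<And>j. j \<in> {1..i} \<Longrightarrow> P (x j)"
    and add: "\<And>r s. r \<in> L i \<Longrightarrow> s \<in> L i \<Longrightarrow> P r \<Longrightarrow> P s \<Longrightarrow> P (r \<oplus>\<^bsub>A\<^esub> s)"
    and minus: "\<And>r. r \<in> L i \<Longrightarrow> P r \<Longrightarrow> P (\<ominus>\<^bsub>A\<^esub> r)"
    and mult: "\<And>r s. r \<in> L i \<Longrightarrow> s \<in> L i \<Longrightarrow> P r \<Longrightarrow> P s \<Longrightarrow> P (r \<otimes>\<^bsub>A\<^esub> s)"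
  shows "P r"
proof -
  have one: "scalar A \<one>\<^bsub>K\<^esub> = \<one>\<^bsub>A\<^esub>" by (simp add: scalar_def)
  show ?thesis
    using r unfolding lower_subalgebra_def subalgebra_gen_def
  proof (induction r rule: generate_ring.induct)
    case one
    show ?case using scalar[of "\<one>\<^bsub>K\<^esub>"] \<open>scalar A \<one>\<^bsub>K\<^esub> = \<one>\<^bsub>A\<^esub>\<close> by simp
  next
    case (incl h)
    then show ?case using scalar var by (auto simp: atLeastLessThanSuc_atLeastAtMost)
  qed (use add minus mult in \<open>auto simp: lower_subalgebra_def subalgebra_gen_def\<close>)
qed

text \<open>The generators are eigenvectors of \<open>\<tau>_j\<close>, so not only its domain but
  also every earlier subalgebra is preserved.\<close>

lemma \<tau>_stable:
  assumes j: "j \<in> {1..n}" "i < j" and r: "r \<in> L i"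
  shows "\<tau> j r \<in> L i"
proof -
  have "i \<le> n" using j by simp
  then show ?thesis using r
  proof (induction r rule: L_induct)
  case (scalar a)
  then show ?case using \<tau>_scalar j scalar_in_L by simp
next
  case (var k)
  then show ?case using \<tau>_var[of k j] j L_smult[of i "\<Lambda> j k" "x k"] x_in_L Lambda_Units[of j k] by auto
qed (use j in \<open>auto simp: \<tau>_hom[OF j] intro: L_closed\<close>)
qed

text \<open>With \<open>i = m + 1\<close>, the value of \<open>\<tau>_j\<close> at
  \<open>x_i r\<close> is computed once as a product and once from
  \<open>x_i r = \<tau>_i(r) x_i + \<delta>_i(r)\<close>. Uniqueness of coefficients over
  \<open>L m\<close> allows the constant terms to be compared.\<close>

lemma \<tau>_comm_\<delta>:
  assumes "m < n" "j \<in> {1..n}" "Suc m < j" and r: "r \<in> L m"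
  shows "\<Lambda> j (Suc m) \<odot>\<^bsub>A\<^esub> \<delta> (Suc m) (\<tau> j r) = \<tau> j (\<delta> (Suc m) r)"
proof -
  let ?i = "Suc m" and ?x = "x (Suc m)" and ?l = "\<Lambda> j (Suc m)"
  note s = step[OF assms(1)]
  have i: "?i \<in> {1..n}" using assms by auto
  have l: "?l \<in> carrier K" using Lambda_Units[OF assms(2) i] by auto
  have mono: "L m \<subseteq> L ?i" by (rule L_mono) simp
  have xL: "?x \<in> L ?i" by (rule x_in_L) simp
  have mL: "m \<le> n" "?i \<le> n" using assms by auto
  have tr: "\<tau> j r \<in> L m" using \<tau>_stable[of j m r] assms by simp
  have in_m: "\<tau> ?i t \<in> L m" "\<delta> ?i t \<in> L m" if "t \<in> L m" for t
    using ring_hom_closed[OF \<tau>_props(1)[OF i]] \<tau>_props(3)[OF i] that by auto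
  have tm: "\<tau> j t \<in> L m" if "t \<in> L m" for t using \<tau>_stable[of j m t] assms that by simp
  have e1: "?x \<otimes>\<^bsub>A\<^esub> \<tau> j r = \<tau> ?i (\<tau> j r) \<otimes>\<^bsub>A\<^esub> ?x \<oplus>\<^bsub>A\<^esub> \<delta> ?i (\<tau> j r)"
    by (rule skew_polynomial_ringD(7)[OF s tr])
  have tx: "\<tau> j ?x = ?l \<odot>\<^bsub>A\<^esub> ?x" using \<tau>_var[of ?i j] assms by simp
  note cl = L_carrier[OF mL(1)] x_in[OF i]
  have "\<tau> j (?x \<otimes>\<^bsub>A\<^esub> r) = ?l \<odot>\<^bsub>A\<^esub> (?x \<otimes>\<^bsub>A\<^esub> \<tau> j r)"
    using \<tau>_hom(2)[OF assms(2,3) xL, of r] mono r tx l cl tr by (auto simp: kA.smult_mult_left)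
  also have "\<dots> = (?l \<odot>\<^bsub>A\<^esub> \<tau> ?i (\<tau> j r)) \<otimes>\<^bsub>A\<^esub> ?x \<oplus>\<^bsub>A\<^esub> ?l \<odot>\<^bsub>A\<^esub> \<delta> ?i (\<tau> j r)"
    unfolding e1 using l cl in_m[OF tr] by (simp add: kA.smult_mult_left kA.smult_r_distr)
  finally have a: "\<tau> j (?x \<otimes>\<^bsub>A\<^esub> r) = \<dots>" .
  have e2: "?x \<otimes>\<^bsub>A\<^esub> r = \<tau> ?i r \<otimes>\<^bsub>A\<^esub> ?x \<oplus>\<^bsub>A\<^esub> \<delta> ?i r"
    by (rule skew_polynomial_ringD(7)[OF s r])
  have b: "\<tau> j (?x \<otimes>\<^bsub>A\<^esub> r) = (?l \<odot>\<^bsub>A\<^esub> \<tau> j (\<tau> ?i r)) \<otimes>\<^bsub>A\<^esub> ?x \<oplus>\<^bsub>A\<^esub> \<tau> j (\<delta> ?i r)"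
  proof -
    have "\<tau> ?i r \<otimes>\<^bsub>A\<^esub> ?x \<in> L ?i" "\<delta> ?i r \<in> L ?i" "\<tau> ?i r \<in> L ?i"
      using in_m[OF r] mono xL L_closed(2) by auto
    then have "\<tau> j (?x \<otimes>\<^bsub>A\<^esub> r) = \<tau> j (\<tau> ?i r) \<otimes>\<^bsub>A\<^esub> (?l \<odot>\<^bsub>A\<^esub> ?x) \<oplus>\<^bsub>A\<^esub> \<tau> j (\<delta> ?i r)"
      unfolding e2 using \<tau>_hom[OF assms(2,3)] xL tx by simp
    then show ?thesis using l cl tm[OF in_m(1)[OF r]] by (simp add: kA.smult_mult_left kA.smult_mult_right)
  qed
  \<comment> \<open>The coefficient function of \<open>u x + v\<close>, the form in which the
    uniqueness clause can be applied.\<close>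
  define lin where "lin = (\<lambda>u v j. if j = (0::nat) then v else if j = 1 then u else \<zero>\<^bsub>A\<^esub>)"
  have ev: "(\<forall>k. lin u v k \<in> L m) \<and> finite {k. lin u v k \<noteq> \<zero>\<^bsub>A\<^esub>} \<and>
    u \<otimes>\<^bsub>A\<^esub> ?x \<oplus>\<^bsub>A\<^esub> v = (\<Oplus>\<^bsub>A\<^esub>k\<in>{k. lin u v k \<noteq> \<zero>\<^bsub>A\<^esub>}. lin u v k \<otimes>\<^bsub>A\<^esub> ?x [^]\<^bsub>A\<^esub> k)"
    if uv: "u \<in> L m" "v \<in> L m" for u v
  proof (intro conjI)
    show "\<forall>k. lin u v k \<in> L m" using uv subringE(2)[OF L_subring[OF mL(1)]] by (simp add: lin_def)
    have sub: "{k. lin u v k \<noteq> \<zero>\<^bsub>A\<^esub>} \<subseteq> {0, 1}" by (auto simp: lin_def split: if_splits)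
    then show "finite {k. lin u v k \<noteq> \<zero>\<^bsub>A\<^esub>}" using finite_subset by blast
    have lc: "lin u v k \<in> carrier A" for k using uv cl by (simp add: lin_def)
    have "(\<Oplus>\<^bsub>A\<^esub>k\<in>{k. lin u v k \<noteq> \<zero>\<^bsub>A\<^esub>}. lin u v k \<otimes>\<^bsub>A\<^esub> ?x [^]\<^bsub>A\<^esub> k) = (\<Oplus>\<^bsub>A\<^esub>k\<in>{0, 1}. lin u v k \<otimes>\<^bsub>A\<^esub> ?x [^]\<^bsub>A\<^esub> k)"
      using sub lc cl by (intro kA.M.finsum_extend) auto
    also have "\<dots> = v \<oplus>\<^bsub>A\<^esub> u \<otimes>\<^bsub>A\<^esub> ?x" using uv cl lc by (subst kA.M.finsum_insert) (auto simp: lin_def)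
    finally show "u \<otimes>\<^bsub>A\<^esub> ?x \<oplus>\<^bsub>A\<^esub> v = (\<Oplus>\<^bsub>A\<^esub>k\<in>{k. lin u v k \<noteq> \<zero>\<^bsub>A\<^esub>}. lin u v k \<otimes>\<^bsub>A\<^esub> ?x [^]\<^bsub>A\<^esub> k)"
      using uv cl by (simp add: kA.M.a_comm)
  qed
  let ?u = "?l \<odot>\<^bsub>A\<^esub> \<tau> ?i (\<tau> j r)" and ?v = "?l \<odot>\<^bsub>A\<^esub> \<delta> ?i (\<tau> j r)"
  let ?u' = "?l \<odot>\<^bsub>A\<^esub> \<tau> j (\<tau> ?i r)" and ?v' = "\<tau> j (\<delta> ?i r)"
  have uv: "?u \<in> L m" "?v \<in> L m" "?u' \<in> L m" "?v' \<in> L m"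
    using L_smult[OF mL(1) l] in_m[OF tr] tm in_m[OF r] by auto
  have "?u \<otimes>\<^bsub>A\<^esub> ?x \<oplus>\<^bsub>A\<^esub> ?v \<in> L ?i" 
    by (intro L_closed(1) L_closed(2) subsetD[OF mono] uv xL)
  note uniq = ex1_iff_ex_Uniq[THEN iffD1, OF skew_polynomial_ringD(8)[OF s this], THEN conjunct2]
  have "lin ?u ?v = lin ?u' ?v'"
    by (rule Uniq_D[OF uniq]) (use ev[OF uv(1,2)] ev[OF uv(3,4)] a b in simp_all)
  then have "lin ?u ?v 0 = lin ?u' ?v' 0" by simp
  then show ?thesis by (simp add: lin_def)
qed

text \<open>The induction hypothesis. The support condition keeps the image free of
  \<open>y_(i+1)\<close>, so that powers of the next variable stay independent over it. The last
  clause, on all later automorphisms at once, makes the next derivation a skew derivation for a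
  conjugation. All stages map to the full torus, so each one extends the previous.\<close>

definition embedding :: "nat \<Rightarrow> ('c \<Rightarrow> (nat \<Rightarrow> int) \<Rightarrow> 'a) \<Rightarrow> bool"
  where "embedding i \<Phi> \<longleftrightarrow> \<Phi> \<in> ring_hom (A\<lparr>carrier := L i\<rparr>) T \<and> inj_on \<Phi> (L i) \<and>
    (\<forall>a\<in>carrier K. \<Phi> (scalar A a) = single K a 0) \<and>
    (\<forall>r\<in>L i. \<forall>\<alpha>. \<Phi> r \<alpha> \<noteq> \<zero>\<^bsub>K\<^esub> \<longrightarrow> \<alpha> \<in> exponents i) \<and>
    (\<forall>\<alpha>\<in>exponents i. \<exists>\<beta>\<in>exponents i. single K \<one>\<^bsub>K\<^esub> \<beta> \<in> \<Phi> ` L i \<and> single K \<one>\<^bsub>K\<^esub> (\<beta> + \<alpha>) \<in> \<Phi> ` L i) \<and>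
    (\<forall>j\<in>{i<..n}. \<forall>r\<in>L i. \<Phi> (\<tau> j r) = conj_y j (\<Phi> r))"

lemma smult_T: "a \<in> carrier K \<Longrightarrow> t \<in> carrier T \<Longrightarrow> a \<odot>\<^bsub>T\<^esub> t = single K a 0 \<otimes>\<^bsub>T\<^esub> t"
  using TM.T_val[of t] by (intro ext) (simp add: single_times TM.T_simps(4))

lemma embedding_0: "\<exists>\<Phi>. embedding 0 \<Phi>"
proof -
  have L0: "r \<in> scalar A ` carrier K" if "r \<in> L 0" for r
    using le0[of n] that
  proof (induction r rule: L_induct)
    case (add r s)
    then obtain a b where "a \<in> carrier K" "b \<in> carrier K" "r = scalar A a" "s = scalar A b" by blast
    then show ?case
      by (intro image_eqI[of _ _ "a \<oplus>\<^bsub>K\<^esub> b"]) (auto simp: scalar_def kA.smult_l_distr)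
  next
    case (minus r)
    then obtain a where "a \<in> carrier K" "r = scalar A a" by blast
    then show ?case
      by (intro image_eqI[of _ _ "\<ominus>\<^bsub>K\<^esub> a"]) (auto simp: scalar_def kA.smult_l_minus)
  next
    case (mult r s)
    then obtain a b where "a \<in> carrier K" "b \<in> carrier K" "r = scalar A a" "s = scalar A b" by blast
    then show ?case
      by (intro image_eqI[of _ _ "a \<otimes>\<^bsub>K\<^esub> b"]) (auto simp: scalar_def kA.smult_mult_left kA.smult_assoc1)
  qed auto
  define \<Phi> where "\<Phi> = (\<lambda>r. single K (inv_into (carrier K) (scalar A) r) (0 :: nat \<Rightarrow> int))"
  have \<Phi>: "\<Phi> (scalar A a) = single K a 0" if "a \<in> carrier K" for a
    using inv_into_f_f[OF scalar_inj that] by (simp add: \<Phi>_def)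
  have "embedding 0 \<Phi>"
    unfolding embedding_def
  proof (intro conjI ballI allI impI)
    have a: "scalar A a \<oplus>\<^bsub>A\<^esub> scalar A b = scalar A (a \<oplus>\<^bsub>K\<^esub> b)" "scalar A a \<otimes>\<^bsub>A\<^esub> scalar A b = scalar A (a \<otimes>\<^bsub>K\<^esub> b)"
      "\<one>\<^bsub>A\<^esub> = scalar A \<one>\<^bsub>K\<^esub>"
      if "a \<in> carrier K" "b \<in> carrier K" for a b
      using that by (auto simp: scalar_def kA.smult_l_distr kA.smult_mult_left kA.smult_assoc1)
    show "\<Phi> \<in> ring_hom (A\<lparr>carrier := L 0\<rparr>) T"
    proof (rule ring_hom_memI)
      fix r s assume "r \<in> carrier (A\<lparr>carrier := L 0\<rparr>)" "s \<in> carrier (A\<lparr>carrier := L 0\<rparr>)"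
      then have rs: "r \<in> L 0" "s \<in> L 0" by simp_all
      obtain u v where "u \<in> carrier K" "v \<in> carrier K" "r = scalar A u" "s = scalar A v"
        using L0[OF rs(1)] L0[OF rs(2)] by blast
      then show "\<Phi> (r \<otimes>\<^bsub>A\<lparr>carrier := L 0\<rparr>\<^esub> s) = \<Phi> r \<otimes>\<^bsub>T\<^esub> \<Phi> s"
        "\<Phi> (r \<oplus>\<^bsub>A\<lparr>carrier := L 0\<rparr>\<^esub> s) = \<Phi> r \<oplus>\<^bsub>T\<^esub> \<Phi> s"
        using a[of u v] by (simp_all add: \<Phi> TM.single_mult del: zero_fun_apply)
          (auto simp: TM.T_simps single_def)
    next
      show "\<Phi> \<one>\<^bsub>A\<lparr>carrier := L 0\<rparr>\<^esub> = \<one>\<^bsub>T\<^esub>"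
        using a(3)[of "\<one>\<^bsub>K\<^esub>" "\<one>\<^bsub>K\<^esub>"] by (simp add: \<Phi> TM.T_one)
    next
      fix r assume "r \<in> carrier (A\<lparr>carrier := L 0\<rparr>)"
      then have "r \<in> L 0" by simp
      then obtain u where "u \<in> carrier K" "r = scalar A u" using L0[of r] by blast
      then show "\<Phi> r \<in> carrier T" by (auto simp: \<Phi>)
    qed
    show "inj_on \<Phi> (L 0)"
    proof (rule inj_onI)
      fix r s assume rs: "r \<in> L 0" "s \<in> L 0" "\<Phi> r = \<Phi> s"
      obtain u v where uv: "u \<in> carrier K" "v \<in> carrier K" "r = scalar A u" "s = scalar A v"
        using L0[OF rs(1)] L0[OF rs(2)] by blast
      then have "single K u 0 = single K v (0 :: nat \<Rightarrow> int)" using rs(3) by (simp add: \<Phi>)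
      then have "single K u (0 :: nat \<Rightarrow> int) 0 = single K v (0 :: nat \<Rightarrow> int) 0" by (rule fun_cong)
      then show "r = s" using uv by (simp add: single_def del: zero_fun_apply)
    qed
    fix r \<alpha> assume "r \<in> L 0" "\<Phi> r \<alpha> \<noteq> \<zero>\<^bsub>K\<^esub>"
    then show "\<alpha> \<in> exponents 0" by (auto simp: \<Phi>_def single_def split: if_splits)
  next
    fix \<alpha> :: "nat \<Rightarrow> int" assume "\<alpha> \<in> exponents 0"
    then have "\<alpha> = 0" by (auto simp: exponents_def fun_eq_iff)
    moreover have "single K \<one>\<^bsub>K\<^esub> 0 \<in> \<Phi> ` L 0"
      using \<Phi>[of "\<one>\<^bsub>K\<^esub>"] scalar_in_L[of "\<one>\<^bsub>K\<^esub>" 0] by (metis imageI one_closed)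
    ultimately show "\<exists>\<beta>\<in>exponents 0. single K \<one>\<^bsub>K\<^esub> \<beta> \<in> \<Phi> ` L 0 \<and> single K \<one>\<^bsub>K\<^esub> (\<beta> + \<alpha>) \<in> \<Phi> ` L 0"
      by (intro bexI[of _ 0]) (simp_all del: zero_fun_apply)
  next
    fix j r assume "j \<in> {0<..n}" "r \<in> L 0"
    then obtain u where "u \<in> carrier K" "r = scalar A u" using L0[of r] by blast
    then show "\<Phi> (\<tau> j r) = conj_y j (\<Phi> r)"
      using \<open>j \<in> {0<..n}\<close> by (simp add: \<Phi> \<tau>_scalar conj_y_single del: zero_fun_apply)
  qed (simp add: \<Phi>)
  then show ?thesis by blast
qed

lemma embeddingD:
  assumes "embedding i \<Phi>" "i \<le> n"
  shows "r \<in> L i \<Longrightarrow> \<Phi> r \<in> carrier T"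
    "r \<in> L i \<Longrightarrow> s \<in> L i \<Longrightarrow> \<Phi> (r \<oplus>\<^bsub>A\<^esub> s) = \<Phi> r \<oplus>\<^bsub>T\<^esub> \<Phi> s"
    "r \<in> L i \<Longrightarrow> s \<in> L i \<Longrightarrow> \<Phi> (r \<otimes>\<^bsub>A\<^esub> s) = \<Phi> r \<otimes>\<^bsub>T\<^esub> \<Phi> s"
    "a \<in> carrier K \<Longrightarrow> r \<in> L i \<Longrightarrow> \<Phi> (a \<odot>\<^bsub>A\<^esub> r) = a \<odot>\<^bsub>T\<^esub> \<Phi> r"
    "inj_on \<Phi> (L i)" "a \<in> carrier K \<Longrightarrow> \<Phi> (scalar A a) = single K a 0"
    "r \<in> L i \<Longrightarrow> \<Phi> r \<alpha> \<noteq> \<zero>\<^bsub>K\<^esub> \<Longrightarrow> \<alpha> \<in> exponents i"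
    "\<alpha> \<in> exponents i \<Longrightarrow> \<exists>\<beta>\<in>exponents i. single K \<one>\<^bsub>K\<^esub> \<beta> \<in> \<Phi> ` L i \<and> single K \<one>\<^bsub>K\<^esub> (\<beta> + \<alpha>) \<in> \<Phi> ` L i"
    "j \<in> {i<..n} \<Longrightarrow> r \<in> L i \<Longrightarrow> \<Phi> (\<tau> j r) = conj_y j (\<Phi> r)"
    "\<Phi> \<in> ring_hom (A\<lparr>carrier := L i\<rparr>) T"
proof -
  have h: "\<Phi> \<in> ring_hom (A\<lparr>carrier := L i\<rparr>) T"
    and sc: "\<And>a. a \<in> carrier K \<Longrightarrow> \<Phi> (scalar A a) = single K a 0"
    using assms unfolding embedding_def by blast+
  show "r \<in> L i \<Longrightarrow> \<Phi> r \<in> carrier T"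
    "r \<in> L i \<Longrightarrow> s \<in> L i \<Longrightarrow> \<Phi> (r \<oplus>\<^bsub>A\<^esub> s) = \<Phi> r \<oplus>\<^bsub>T\<^esub> \<Phi> s"
    using ring_hom_closed[OF h, of r] ring_hom_add[OF h, of r s] by simp_all
  have mult: "r \<in> L i \<Longrightarrow> s \<in> L i \<Longrightarrow> \<Phi> (r \<otimes>\<^bsub>A\<^esub> s) = \<Phi> r \<otimes>\<^bsub>T\<^esub> \<Phi> s" for r s
    using ring_hom_mult[OF h, of r s] by simp
  then show "r \<in> L i \<Longrightarrow> s \<in> L i \<Longrightarrow> \<Phi> (r \<otimes>\<^bsub>A\<^esub> s) = \<Phi> r \<otimes>\<^bsub>T\<^esub> \<Phi> s" .
  show "\<Phi> (a \<odot>\<^bsub>A\<^esub> r) = a \<odot>\<^bsub>T\<^esub> \<Phi> r" if "a \<in> carrier K" "r \<in> L i"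
  proof -
    have "\<Phi> r \<in> carrier T" using ring_hom_closed[OF h, of r] that by simp
    then show ?thesis
      using that sc[of a] mult[OF scalar_in_L[OF that(1)] that(2)]
        smult_scalar[OF that(1) L_carrier[OF assms(2) that(2)]] by (simp only: smult_T)
  qed
qed (use assms in \<open>unfold embedding_def, blast+\<close>)

lemma supported_closed:
  assumes "m \<le> n"
  defines "E \<equiv> {t \<in> carrier T. \<forall>\<alpha>. t \<alpha> \<noteq> \<zero>\<^bsub>K\<^esub> \<longrightarrow> \<alpha> \<in> exponents m}"
  shows "s \<in> E \<Longrightarrow> t \<in> E \<Longrightarrow> s \<oplus>\<^bsub>T\<^esub> t \<in> E" "s \<in> E \<Longrightarrow> t \<in> E \<Longrightarrow> s \<otimes>\<^bsub>T\<^esub> t \<in> E"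
    "t \<in> E \<Longrightarrow> t [^]\<^bsub>T\<^esub> (k::nat) \<in> E" "f \<in> J \<rightarrow> E \<Longrightarrow> finsum T f J \<in> E"
proof -
  have add: "s \<oplus>\<^bsub>T\<^esub> t \<in> E" if "s \<in> E" "t \<in> E" for s t
  proof -
    have "\<alpha> \<in> exponents m" if nz: "(s \<oplus>\<^bsub>T\<^esub> t) \<alpha> \<noteq> \<zero>\<^bsub>K\<^esub>" for \<alpha>
    proof (rule ccontr)
      assume "\<alpha> \<notin> exponents m"
      then have "s \<alpha> = \<zero>\<^bsub>K\<^esub>" "t \<alpha> = \<zero>\<^bsub>K\<^esub>" using \<open>s \<in> E\<close> \<open>t \<in> E\<close> unfolding E_def by blast+
      then show False using nz by (simp add: TM.T_simps)
    qed
    then show ?thesis using that by (simp add: E_def)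
  qed
  have mult: "s \<otimes>\<^bsub>T\<^esub> t \<in> E" if "s \<in> E" "t \<in> E" for s t
  proof -
    have st: "s \<in> carrier T" "t \<in> carrier T" using that by (auto simp: E_def)
    have "\<alpha> \<in> exponents m" if nz: "(s \<otimes>\<^bsub>T\<^esub> t) \<alpha> \<noteq> \<zero>\<^bsub>K\<^esub>" for \<alpha>
    proof -
      obtain u v where uv: "s u \<noteq> \<zero>\<^bsub>K\<^esub>" "t v \<noteq> \<zero>\<^bsub>K\<^esub>" "\<alpha> = u + v" by (rule TM.mult_support[OF st nz])
      then have "u \<in> exponents m" "v \<in> exponents m" using \<open>s \<in> E\<close> \<open>t \<in> E\<close> unfolding E_def by blast+
      then show ?thesis unfolding uv(3) by (rule exponents_closed(2))
    qed
    then show ?thesis using st by (simp add: E_def)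
  qed
  show "s \<in> E \<Longrightarrow> t \<in> E \<Longrightarrow> s \<oplus>\<^bsub>T\<^esub> t \<in> E" "s \<in> E \<Longrightarrow> t \<in> E \<Longrightarrow> s \<otimes>\<^bsub>T\<^esub> t \<in> E"
    by (fact add, fact mult)
  have one: "\<one>\<^bsub>T\<^esub> \<in> E" by (simp add: E_def) (simp add: TM.T_simps)
  show "t [^]\<^bsub>T\<^esub> (k::nat) \<in> E" if "t \<in> E"
    by (induction k) (use that mult one in auto)
  have zero: "\<zero>\<^bsub>T\<^esub> \<in> E" by (auto simp: E_def) (auto simp: TM.T_simps)
  show "finsum T f J \<in> E" if "f \<in> J \<rightarrow> E"
    using that
  proof (induction J rule: infinite_finite_induct)
    case (insert j J)
    have f: "f j \<in> E" "f \<in> J \<rightarrow> E" by (use insert.prems in \<open>simp_all add: Pi_def\<close>)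
    have E: "E \<subseteq> carrier T" unfolding E_def by (rule Collect_restrict)
    have f': "f j \<in> carrier T" "f \<in> J \<rightarrow> carrier T"
      by (rule subsetD[OF E f(1)], rule subsetD[OF Pi_mono[OF E] f(2)])
    have "f j \<oplus>\<^bsub>T\<^esub> finsum T f J \<in> E" by (rule add[OF f(1) insert.IH[OF f(2)]])
    then show ?case by (simp only: TM.TA.finsum_insert[OF insert(1,2) f'(2,1)])
  qed (use zero in simp_all)
qed

text \<open>As \<open>C\<close> is free of \<open>y_i\<close>, each factor \<open>C\<close> in the
  expansion of the power lowers the degree in \<open>y_i\<close>. The scalar \<open>a\<close>
  collects the twists, and only its being nonzero matters.\<close>

lemma power_leading_term:
  assumes i: "i \<in> {1..n}" and C: "C \<in> carrier T" "\<forall>\<alpha>. C \<alpha> \<noteq> \<zero>\<^bsub>K\<^esub> \<longrightarrow> \<alpha> i = 0"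
  defines "X \<equiv> single K \<one>\<^bsub>K\<^esub> (unit_vec i) \<oplus>\<^bsub>T\<^esub> C"
  shows "\<exists>a\<in>carrier K - {\<zero>\<^bsub>K\<^esub>}. \<exists>Z\<in>carrier T. X [^]\<^bsub>T\<^esub> (j::nat) = single K a (\<lambda>k. int j * unit_vec i k) \<oplus>\<^bsub>T\<^esub> Z
    \<and> (\<forall>\<gamma>. Z \<gamma> \<noteq> \<zero>\<^bsub>K\<^esub> \<longrightarrow> \<gamma> i < int j)"
proof (induction j)
  case 0
  have "(\<lambda>k. int 0 * unit_vec i k) = 0" by (auto simp: fun_eq_iff)
  then show ?case
    by (intro bexI[of _ "\<one>\<^bsub>K\<^esub>"] bexI[of _ "\<zero>\<^bsub>T\<^esub>"]) (auto simp: TM.T_one, auto simp: TM.T_simps)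
next
  case (Suc j)
  let ?e = "unit_vec i" and ?je = "\<lambda>k. int j * unit_vec i k"
  let ?y = "single K \<one>\<^bsub>K\<^esub> ?e"
  obtain a Z where aZ: "a \<in> carrier K" "a \<noteq> \<zero>\<^bsub>K\<^esub>" "Z \<in> carrier T" "X [^]\<^bsub>T\<^esub> j = single K a ?je \<oplus>\<^bsub>T\<^esub> Z"
    "\<And>\<gamma>. Z \<gamma> \<noteq> \<zero>\<^bsub>K\<^esub> \<Longrightarrow> \<gamma> i < int j" using Suc by blast
  have e: "?e \<in> exponents n" "?je \<in> exponents n" using i by (auto simp: exponents_def unit_vec_def)
  have cl: "single K a ?je \<in> carrier T" "?y \<in> carrier T" using aZ e by auto
  let ?b = "twist ?je ?e \<otimes>\<^bsub>K\<^esub> a"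
  have Suc_e: "?je + ?e = (\<lambda>k. int (Suc j) * unit_vec i k)" by (auto simp: fun_eq_iff algebra_simps)
  have top: "single K a ?je \<otimes>\<^bsub>T\<^esub> ?y = single K ?b (\<lambda>k. int (Suc j) * unit_vec i k)"
    using aZ e by (subst TM.single_mult) (simp_all only: Suc_e one_closed r_one)
  define W where "W = single K a ?je \<otimes>\<^bsub>T\<^esub> C \<oplus>\<^bsub>T\<^esub> (Z \<otimes>\<^bsub>T\<^esub> ?y \<oplus>\<^bsub>T\<^esub> Z \<otimes>\<^bsub>T\<^esub> C)"
  have W: "W \<in> carrier T" using cl aZ C by (simp add: W_def)
  have "X [^]\<^bsub>T\<^esub> Suc j = (single K a ?je \<oplus>\<^bsub>T\<^esub> Z) \<otimes>\<^bsub>T\<^esub> (?y \<oplus>\<^bsub>T\<^esub> C)"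
    by (simp add: aZ(4) X_def[symmetric])
  also have "\<dots> = single K a ?je \<otimes>\<^bsub>T\<^esub> ?y \<oplus>\<^bsub>T\<^esub> W"
    using cl aZ C by (simp add: W_def TM.T.l_distr TM.T.r_distr TM.TA.a_ac)
  finally have eq: "X [^]\<^bsub>T\<^esub> Suc j = single K ?b (\<lambda>k. int (Suc j) * unit_vec i k) \<oplus>\<^bsub>T\<^esub> W" by (simp only: top)
  have deg: "\<gamma> i < int (Suc j)" if nz: "W \<gamma> \<noteq> \<zero>\<^bsub>K\<^esub>" for \<gamma>
  proof (rule ccontr)
    assume neg: "\<not> \<gamma> i < int (Suc j)"
    have 1: "(single K a ?je \<otimes>\<^bsub>T\<^esub> C) \<gamma> = \<zero>\<^bsub>K\<^esub>"
    proof (rule ccontr)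
      assume "(single K a ?je \<otimes>\<^bsub>T\<^esub> C) \<gamma> \<noteq> \<zero>\<^bsub>K\<^esub>"
      then obtain u v where "single K a ?je u \<noteq> \<zero>\<^bsub>K\<^esub>" "C v \<noteq> \<zero>\<^bsub>K\<^esub>" "\<gamma> = u + v" by (rule TM.mult_support[OF cl(1) C(1)])
      then show False using neg C(2)[rule_format, of v] by (auto simp: single_def unit_vec_def split: if_splits)
    qed
    have 2: "(Z \<otimes>\<^bsub>T\<^esub> ?y) \<gamma> = \<zero>\<^bsub>K\<^esub>"
    proof (rule ccontr)
      assume "(Z \<otimes>\<^bsub>T\<^esub> ?y) \<gamma> \<noteq> \<zero>\<^bsub>K\<^esub>"
      then obtain u v where "Z u \<noteq> \<zero>\<^bsub>K\<^esub>" "?y v \<noteq> \<zero>\<^bsub>K\<^esub>" "\<gamma> = u + v" by (rule TM.mult_support[OF aZ(3) cl(2)])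
      then show False using neg aZ(5)[of u] by (auto simp: single_def unit_vec_def split: if_splits)
    qed
    have 3: "(Z \<otimes>\<^bsub>T\<^esub> C) \<gamma> = \<zero>\<^bsub>K\<^esub>"
    proof (rule ccontr)
      assume "(Z \<otimes>\<^bsub>T\<^esub> C) \<gamma> \<noteq> \<zero>\<^bsub>K\<^esub>"
      then obtain u v where "Z u \<noteq> \<zero>\<^bsub>K\<^esub>" "C v \<noteq> \<zero>\<^bsub>K\<^esub>" "\<gamma> = u + v" by (rule TM.mult_support[OF aZ(3) C(1)])
      then show False using neg aZ(5)[of u] C(2)[rule_format, of v] by auto
    qed
    show False using nz 1 2 3 by (simp add: W_def TM.T_simps)
  qed
  have "?b \<in> carrier K - {\<zero>\<^bsub>K\<^esub>}" using aZ by (simp add: integral_iff)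
  then show ?case using eq W deg by blast
qed

end

section \<open>The induction step of the embedding\<close>

context iterated_skew_polynomial_algebra
begin

lemma image_L_closed:
  assumes i: "i \<le> n" and ring: "\<forall>r\<in>L i. \<forall>s\<in>L i. \<Phi> (r \<oplus>\<^bsub>A\<^esub> s) = \<Phi> r \<oplus>\<^bsub>T\<^esub> \<Phi> s \<and> \<Phi> (r \<otimes>\<^bsub>A\<^esub> s) = \<Phi> r \<otimes>\<^bsub>T\<^esub> \<Phi> s"
    and smult: "\<forall>a\<in>carrier K. \<forall>r\<in>L i. \<Phi> (a \<odot>\<^bsub>A\<^esub> r) = a \<odot>\<^bsub>T\<^esub> \<Phi> r"
  shows "\<forall>s\<in>\<Phi> ` L i. \<forall>t\<in>\<Phi> ` L i. s \<oplus>\<^bsub>T\<^esub> t \<in> \<Phi> ` L i"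
    "\<forall>s\<in>\<Phi> ` L i. \<forall>t\<in>\<Phi> ` L i. s \<otimes>\<^bsub>T\<^esub> t \<in> \<Phi> ` L i"
    "\<forall>a\<in>carrier K. \<forall>t\<in>\<Phi> ` L i. a \<odot>\<^bsub>T\<^esub> t \<in> \<Phi> ` L i"
proof -
  have "\<Phi> r \<oplus>\<^bsub>T\<^esub> \<Phi> s \<in> \<Phi> ` L i" "\<Phi> r \<otimes>\<^bsub>T\<^esub> \<Phi> s \<in> \<Phi> ` L i" if "r \<in> L i" "s \<in> L i" for r s
    using ring that imageI[OF L_closed(1)[OF that], of \<Phi>] imageI[OF L_closed(2)[OF that], of \<Phi>] by simp_all
  then show "\<forall>s\<in>\<Phi> ` L i. \<forall>t\<in>\<Phi> ` L i. s \<oplus>\<^bsub>T\<^esub> t \<in> \<Phi> ` L i" "\<forall>s\<in>\<Phi> ` L i. \<forall>t\<in>\<Phi> ` L i. s \<otimes>\<^bsub>T\<^esub> t \<in> \<Phi> ` L i"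
    by blast+
  have "a \<odot>\<^bsub>T\<^esub> \<Phi> r \<in> \<Phi> ` L i" if "a \<in> carrier K" "r \<in> L i" for a r
    using smult that imageI[OF L_smult[OF i that], of \<Phi>] by simp
  then show "\<forall>a\<in>carrier K. \<forall>t\<in>\<Phi> ` L i. a \<odot>\<^bsub>T\<^esub> t \<in> \<Phi> ` L i" by blast
qed

lemma embedding_inner:
  assumes m: "m < n" and e: "embedding m \<Phi>"
  shows "\<exists>C\<in>carrier T. (\<forall>\<alpha>. C \<alpha> \<noteq> \<zero>\<^bsub>K\<^esub> \<longrightarrow> \<alpha> \<in> exponents m) \<and>
    (\<forall>j\<in>{Suc m<..n}. conj_y j C = \<Lambda> j (Suc m) \<odot>\<^bsub>T\<^esub> C) \<and>
    (\<forall>r\<in>L m. \<Phi> (\<delta> (Suc m) r) \<oplus>\<^bsub>T\<^esub> conj_y (Suc m) (\<Phi> r) \<otimes>\<^bsub>T\<^esub> C = C \<otimes>\<^bsub>T\<^esub> \<Phi> r)"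
proof -
  let ?i = "Suc m"
  have mn: "m \<le> n" and i: "?i \<in> {1..n}" using m by auto
  note E = embeddingD[OF e mn]
  note tp = \<tau>_props[OF i, simplified]
  define R where "R = \<Phi> ` L m"
  \<comment> \<open>The derivation carried over to the image, which is well defined by injectivity
    of \<open>\<Phi>\<close>.\<close>
  define D where "D = (\<lambda>t. \<Phi> (\<delta> ?i (inv_into (L m) \<Phi> t)))"
  have D: "D (\<Phi> r) = \<Phi> (\<delta> ?i r)" if "r \<in> L m" for r
    using inv_into_f_f[OF E(5) that] by (simp add: D_def)
  have Rc: "R \<subseteq> carrier T" using E(1) by (auto simp: R_def)
  have dL: "\<delta> ?i r \<in> L m" if "r \<in> L m" for r using tp(3) that by auto
  have tL: "\<tau> ?i r \<in> L m" if "r \<in> L m" for r using \<tau>_stable[OF i _ that] by simp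
  have tE: "\<Phi> (\<tau> ?i r) = conj_y ?i (\<Phi> r)" if "r \<in> L m" for r using E(9)[OF _ that, of ?i] m by simp
  have "\<forall>r\<in>L m. \<forall>s\<in>L m. \<Phi> (r \<oplus>\<^bsub>A\<^esub> s) = \<Phi> r \<oplus>\<^bsub>T\<^esub> \<Phi> s \<and> \<Phi> (r \<otimes>\<^bsub>A\<^esub> s) = \<Phi> r \<otimes>\<^bsub>T\<^esub> \<Phi> s"
    "\<forall>a\<in>carrier K. \<forall>r\<in>L m. \<Phi> (a \<odot>\<^bsub>A\<^esub> r) = a \<odot>\<^bsub>T\<^esub> \<Phi> r" using E(2-4) by blast+
  note R_ball = image_L_closed[OF mn this, folded R_def]
  have R_closed: "s \<in> R \<Longrightarrow> t \<in> R \<Longrightarrow> s \<oplus>\<^bsub>T\<^esub> t \<in> R" "s \<in> R \<Longrightarrow> t \<in> R \<Longrightarrow> s \<otimes>\<^bsub>T\<^esub> t \<in> R"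
    "a \<in> carrier K \<Longrightarrow> t \<in> R \<Longrightarrow> a \<odot>\<^bsub>T\<^esub> t \<in> R" for a s t using R_ball by blast+
  have R_single: "single K a 0 \<in> R" if "a \<in> carrier K" for a
    unfolding R_def E(6)[OF that, symmetric] by (rule imageI[OF scalar_in_L[OF that]])
  have "\<exists>C\<in>carrier T. (\<forall>\<alpha>. C \<alpha> \<noteq> \<zero>\<^bsub>K\<^esub> \<longrightarrow> \<alpha> \<in> exponents m \<and>
      (\<exists>s\<in>exponents m. single K \<one>\<^bsub>K\<^esub> s \<in> R \<and> D (single K \<one>\<^bsub>K\<^esub> s) (\<alpha> + s) \<noteq> \<zero>\<^bsub>K\<^esub>)) \<and>
    (\<forall>t\<in>R. D t \<oplus>\<^bsub>T\<^esub> conj_y ?i t \<otimes>\<^bsub>T\<^esub> C = C \<otimes>\<^bsub>T\<^esub> t)"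
  proof (rule inner_skew_derivation[OF mn i Rc, where q = "q ?i"])
    show "\<alpha> \<in> exponents m" if "t \<in> R" "t \<alpha> \<noteq> \<zero>\<^bsub>K\<^esub>" for t \<alpha>
      using that E(7) by (auto simp: R_def)
    show "\<zero>\<^bsub>T\<^esub> \<in> R" using R_single[of "\<zero>\<^bsub>K\<^esub>"] by simp
    show "\<exists>\<beta>\<in>exponents m. single K \<one>\<^bsub>K\<^esub> \<beta> \<in> R \<and> (\<forall>\<alpha>\<in>F. single K \<one>\<^bsub>K\<^esub> (\<beta> + \<alpha>) \<in> R)"
      if "finite F" "F \<subseteq> exponents m" for F
      by (rule common_shift[OF R_ball(2,3) R_single[OF one_closed] mn _ that]) (use E(8) in \<open>auto simp: R_def\<close>)
    show "D t \<in> R" if "t \<in> R" for t using that D dL by (auto simp: R_def)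
    show "D (s \<oplus>\<^bsub>T\<^esub> t) = D s \<oplus>\<^bsub>T\<^esub> D t" if st: "s \<in> R" "t \<in> R" for s t
    proof -
      obtain r r' where r: "r \<in> L m" "s = \<Phi> r" "r' \<in> L m" "t = \<Phi> r'" using st by (auto simp: R_def)
      show ?thesis unfolding r(2,4) E(2)[OF r(1,3), symmetric] D[OF r(1)] D[OF r(3)] D[OF L_closed(1)[OF r(1,3)]]
        using E(2)[OF dL[OF r(1)] dL[OF r(3)]] tp(4)[OF r(1,3)] by simp
    qed
    show "D (a \<odot>\<^bsub>T\<^esub> t) = a \<odot>\<^bsub>T\<^esub> D t" if a: "a \<in> carrier K" and t: "t \<in> R" for a t
    proof -
      obtain r where r: "r \<in> L m" "t = \<Phi> r" using t by (auto simp: R_def)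
      show ?thesis unfolding r(2) E(4)[OF a r(1), symmetric] D[OF r(1)] D[OF L_smult[OF mn a r(1)]]
        using E(4)[OF a dL[OF r(1)]] tp(5)[OF a r(1)] by simp
    qed
    show "D (s \<otimes>\<^bsub>T\<^esub> t) = conj_y ?i s \<otimes>\<^bsub>T\<^esub> D t \<oplus>\<^bsub>T\<^esub> D s \<otimes>\<^bsub>T\<^esub> t" if st: "s \<in> R" "t \<in> R" for s t
    proof -
      obtain r r' where r: "r \<in> L m" "s = \<Phi> r" "r' \<in> L m" "t = \<Phi> r'" using st by (auto simp: R_def)
      show ?thesis unfolding r(2,4) E(3)[OF r(1,3), symmetric] D[OF r(1)] D[OF r(3)] D[OF L_closed(2)[OF r(1,3)]]
          tp(6)[OF r(1,3)] E(2)[OF L_closed(2)[OF tL[OF r(1)] dL[OF r(3)]] L_closed(2)[OF dL[OF r(1)] r(3)]]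
        using E(3)[OF tL[OF r(1)] dL[OF r(3)]] E(3)[OF dL[OF r(1)] r(3)] tE[OF r(1)] by simp
    qed
    show "q ?i \<in> carrier K" "q ?i \<noteq> \<one>\<^bsub>K\<^esub>" using q_in[OF i] by auto
    show "D (conj_y ?i t) = q ?i \<odot>\<^bsub>T\<^esub> conj_y ?i (D t)" if t: "t \<in> R" for t
    proof -
      obtain r where r: "r \<in> L m" "t = \<Phi> r" using t by (auto simp: R_def)
      have qi: "q ?i \<in> carrier K" using q_in[OF i] by auto
      show ?thesis unfolding r(2) tE[OF r(1), symmetric] D[OF tL[OF r(1)]] D[OF r(1)] q_skew[OF i r(1)]
          E(4)[OF qi tL[OF dL[OF r(1)]]] tE[OF dL[OF r(1)]] ..
    qed
  qed (use R_closed in blast)+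
  then obtain C where C: "C \<in> carrier T"
    "\<And>\<alpha>. C \<alpha> \<noteq> \<zero>\<^bsub>K\<^esub> \<Longrightarrow> \<alpha> \<in> exponents m \<and>
      (\<exists>s\<in>exponents m. single K \<one>\<^bsub>K\<^esub> s \<in> R \<and> D (single K \<one>\<^bsub>K\<^esub> s) (\<alpha> + s) \<noteq> \<zero>\<^bsub>K\<^esub>)"
    "\<And>t. t \<in> R \<Longrightarrow> D t \<oplus>\<^bsub>T\<^esub> conj_y ?i t \<otimes>\<^bsub>T\<^esub> C = C \<otimes>\<^bsub>T\<^esub> t" by blast
  \<comment> \<open>An exponent \<open>\<alpha>\<close> of \<open>C\<close> stems from some
    \<open>D (y^s)\<close>. As \<open>y^s\<close> is an eigenvector of \<open>\<tau>_j\<close>, so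
    is its derivative, with eigenvalue scaled by \<open>\<Lambda> j ?i\<close>; comparison at
    \<open>\<alpha> + s\<close> leaves this scalar as the weight of \<open>\<alpha>\<close>.\<close>
  have eigen: "conj_y j C = \<Lambda> j ?i \<odot>\<^bsub>T\<^esub> C" if "j \<in> {?i<..n}" for j
  proof
    have j: "j \<in> {1..n}" "?i < j" "m < j" "j \<in> {m<..n}" using that by auto
    fix \<alpha>
    have l: "\<Lambda> j ?i \<in> carrier K" using Lambda_Units[OF j(1) i] by auto
    have "comm (unit_vec j) \<alpha> = \<Lambda> j ?i" if nz: "C \<alpha> \<noteq> \<zero>\<^bsub>K\<^esub>"
    proof -
      obtain s where s: "s \<in> exponents m" "single K \<one>\<^bsub>K\<^esub> s \<in> R" "D (single K \<one>\<^bsub>K\<^esub> s) (\<alpha> + s) \<noteq> \<zero>\<^bsub>K\<^esub>"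
        using C(2)[OF nz] by blast
      obtain r where r: "r \<in> L m" "single K \<one>\<^bsub>K\<^esub> s = \<Phi> r" using s(2) by (auto simp: R_def)
      let ?P = "\<Phi> (\<delta> ?i r)" and ?c = "comm (unit_vec j) s"
      have "\<Phi> (\<tau> j r) = \<Phi> (?c \<odot>\<^bsub>A\<^esub> r)"
        unfolding E(9)[OF j(4) r(1)] E(4)[OF comm_in r(1)] r(2)[symmetric]
        by (simp add: conj_y_single TM.T_smult_single)
      \<comment> \<open>Injectivity brings the eigenvalue equation back into \<open>A\<close>, where
        \<open>\<tau>_j\<close> and \<open>\<delta>_i\<close> can be exchanged.\<close>
      then have "\<tau> j r = ?c \<odot>\<^bsub>A\<^esub> r"
        by (rule inj_onD[OF E(5)]) (rule \<tau>_stable[OF j(1,3) r(1)], rule L_smult[OF mn comm_in r(1)])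
      then have "\<Lambda> j ?i \<odot>\<^bsub>A\<^esub> (?c \<odot>\<^bsub>A\<^esub> \<delta> ?i r) = \<tau> j (\<delta> ?i r)"
        using \<tau>_comm_\<delta>[OF m j(1,2) r(1)] tp(5)[OF comm_in r(1)] by simp
      then have "\<Lambda> j ?i \<odot>\<^bsub>T\<^esub> (?c \<odot>\<^bsub>T\<^esub> ?P) = conj_y j ?P"
        using E(4)[OF l L_smult[OF mn comm_in dL[OF r(1)]]] E(4)[OF comm_in dL[OF r(1)]] E(9)[OF j(4) dL[OF r(1)]]
        by metis
      then have "(\<Lambda> j ?i \<odot>\<^bsub>T\<^esub> (?c \<odot>\<^bsub>T\<^esub> ?P)) (\<alpha> + s) = conj_y j ?P (\<alpha> + s)" by simp
      then have "\<Lambda> j ?i \<otimes>\<^bsub>K\<^esub> (?c \<otimes>\<^bsub>K\<^esub> ?P (\<alpha> + s)) = (comm (unit_vec j) \<alpha> \<otimes>\<^bsub>K\<^esub> ?c) \<otimes>\<^bsub>K\<^esub> ?P (\<alpha> + s)"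
        by (simp add: TM.T_simps(4) conj_y_def comm_add)
      moreover have P: "?P (\<alpha> + s) \<noteq> \<zero>\<^bsub>K\<^esub>" using s(3) unfolding r(2) D[OF r(1)] .
      moreover have "?P (\<alpha> + s) \<in> carrier K" by (rule TM.T_val[OF E(1)[OF dL[OF r(1)]]])
      ultimately have "\<Lambda> j ?i \<otimes>\<^bsub>K\<^esub> (?c \<otimes>\<^bsub>K\<^esub> ?P (\<alpha> + s)) = comm (unit_vec j) \<alpha> \<otimes>\<^bsub>K\<^esub> (?c \<otimes>\<^bsub>K\<^esub> ?P (\<alpha> + s))"
        "?c \<otimes>\<^bsub>K\<^esub> ?P (\<alpha> + s) \<in> carrier K - {\<zero>\<^bsub>K\<^esub>}" using l by (simp_all add: m_assoc integral_iff)
      then show ?thesis using m_rcancel l by auto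
    qed
    then show "conj_y j C \<alpha> = (\<Lambda> j ?i \<odot>\<^bsub>T\<^esub> C) \<alpha>"
      using l by (cases "C \<alpha> = \<zero>\<^bsub>K\<^esub>") (simp_all add: conj_y_def TM.T_simps(4))
  qed
  have "\<Phi> (\<delta> ?i r) \<oplus>\<^bsub>T\<^esub> conj_y ?i (\<Phi> r) \<otimes>\<^bsub>T\<^esub> C = C \<otimes>\<^bsub>T\<^esub> \<Phi> r" if "r \<in> L m" for r
    using C(3)[of "\<Phi> r"] that D by (simp add: R_def)
  then show ?thesis using C(1,2) eigen by blast
qed

text \<open>In degree \<open>j\<close> of \<open>y_i\<close> the coefficients of \<open>t\<close>
  reappear up to nonzero scalars, and nothing lies above. A leading coefficient over the previous
  subalgebra can therefore be detected in the torus.\<close>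

lemma times_power_top_coefficient:
  assumes i: "i \<in> {1..n}" and C: "C \<in> carrier T" "\<forall>\<alpha>. C \<alpha> \<noteq> \<zero>\<^bsub>K\<^esub> \<longrightarrow> \<alpha> i = 0"
  defines "X \<equiv> single K \<one>\<^bsub>K\<^esub> (unit_vec i) \<oplus>\<^bsub>T\<^esub> C"
  shows "\<exists>a\<in>carrier K - {\<zero>\<^bsub>K\<^esub>}. \<forall>t\<in>carrier T. (\<forall>\<alpha>. t \<alpha> \<noteq> \<zero>\<^bsub>K\<^esub> \<longrightarrow> \<alpha> i = 0) \<longrightarrow>
    (\<forall>\<gamma>. \<gamma> i > int j \<longrightarrow> (t \<otimes>\<^bsub>T\<^esub> X [^]\<^bsub>T\<^esub> j) \<gamma> = \<zero>\<^bsub>K\<^esub>) \<and>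
    (\<forall>\<beta>. \<beta> i = 0 \<longrightarrow> (t \<otimes>\<^bsub>T\<^esub> X [^]\<^bsub>T\<^esub> j) (\<beta> + (\<lambda>k. int j * unit_vec i k))
      = twist \<beta> (\<lambda>k. int j * unit_vec i k) \<otimes>\<^bsub>K\<^esub> (t \<beta> \<otimes>\<^bsub>K\<^esub> a))"
proof -
  let ?je = "\<lambda>k. int j * unit_vec i k"
  obtain a Z where a: "a \<in> carrier K - {\<zero>\<^bsub>K\<^esub>}" and Z: "Z \<in> carrier T"
    and X: "X [^]\<^bsub>T\<^esub> j = single K a ?je \<oplus>\<^bsub>T\<^esub> Z" and Zdeg: "\<And>\<gamma>. Z \<gamma> \<noteq> \<zero>\<^bsub>K\<^esub> \<Longrightarrow> \<gamma> i < int j"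
    using power_leading_term[of i C j, OF i C] unfolding X_def by blast
  have je: "?je \<in> exponents n" using i by (auto simp: exponents_def unit_vec_def)
  have aT: "single K a ?je \<in> carrier T" using a je by auto
  show ?thesis
  proof (intro bexI[OF _ a] ballI impI)
    fix t assume t: "t \<in> carrier T" and t0: "\<forall>\<alpha>. t \<alpha> \<noteq> \<zero>\<^bsub>K\<^esub> \<longrightarrow> \<alpha> i = 0"
    have tZ: "(t \<otimes>\<^bsub>T\<^esub> Z) \<gamma> = \<zero>\<^bsub>K\<^esub>" if "\<gamma> i \<ge> int j" for \<gamma>
    proof (rule ccontr)
      assume "(t \<otimes>\<^bsub>T\<^esub> Z) \<gamma> \<noteq> \<zero>\<^bsub>K\<^esub>"
      then obtain u v where "t u \<noteq> \<zero>\<^bsub>K\<^esub>" "Z v \<noteq> \<zero>\<^bsub>K\<^esub>" "\<gamma> = u + v" by (rule TM.mult_support[OF t Z])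
      then show False using that t0 Zdeg[of v] by auto
    qed
    have val: "(t \<otimes>\<^bsub>T\<^esub> X [^]\<^bsub>T\<^esub> j) \<gamma> = twist (\<gamma> - ?je) ?je \<otimes>\<^bsub>K\<^esub> (t (\<gamma> - ?je) \<otimes>\<^bsub>K\<^esub> a)"
      if "\<gamma> i \<ge> int j" for \<gamma>
      unfolding X TM.T.r_distr[OF aT Z t]
      using tZ[of \<gamma>, OF that] times_single[OF _ je t, of a \<gamma>] a TM.T_val[OF t] by (simp add: TM.T_simps(3))
    have "(t \<otimes>\<^bsub>T\<^esub> X [^]\<^bsub>T\<^esub> j) \<gamma> = \<zero>\<^bsub>K\<^esub>" if g: "\<gamma> i > int j" for \<gamma>
    proof -
      have "(\<gamma> - ?je) i \<noteq> 0" using g by (simp add: unit_vec_def)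
      then have "t (\<gamma> - ?je) = \<zero>\<^bsub>K\<^esub>" using t0 by blast
      then show ?thesis using val[of \<gamma>] g a by simp
    qed
    moreover have "(t \<otimes>\<^bsub>T\<^esub> X [^]\<^bsub>T\<^esub> j) (\<beta> + ?je) = twist \<beta> ?je \<otimes>\<^bsub>K\<^esub> (t \<beta> \<otimes>\<^bsub>K\<^esub> a)" if "\<beta> i = 0" for \<beta>
    proof -
      have "(\<beta> + ?je) i \<ge> int j" using that by (simp add: unit_vec_def)
      from val[of "\<beta> + ?je", OF this] show ?thesis by (simp only: add_diff_cancel_right')
    qed
    ultimately show "(\<forall>\<gamma>. \<gamma> i > int j \<longrightarrow> (t \<otimes>\<^bsub>T\<^esub> X [^]\<^bsub>T\<^esub> j) \<gamma> = \<zero>\<^bsub>K\<^esub>) \<and>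
      (\<forall>\<beta>. \<beta> i = 0 \<longrightarrow> (t \<otimes>\<^bsub>T\<^esub> X [^]\<^bsub>T\<^esub> j) (\<beta> + ?je) = twist \<beta> ?je \<otimes>\<^bsub>K\<^esub> (t \<beta> \<otimes>\<^bsub>K\<^esub> a))" by blast
  qed
qed

lemma embedding_Suc:
  assumes m: "m < n" and e: "embedding m \<Phi>"
  shows "\<exists>\<Psi>. embedding (Suc m) \<Psi>"
proof -
  let ?i = "Suc m"
  let ?e = "unit_vec ?i"
  have mn: "m \<le> n" and i: "?i \<in> {1..n}" "?i \<le> n" using m by auto
  note E = embeddingD[OF e mn]
  note S = step[OF m]
  obtain C where C: "C \<in> carrier T" and C_supp: "\<And>\<alpha>. C \<alpha> \<noteq> \<zero>\<^bsub>K\<^esub> \<Longrightarrow> \<alpha> \<in> exponents m"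
    and C_eigen: "\<And>j. j \<in> {?i<..n} \<Longrightarrow> conj_y j C = \<Lambda> j ?i \<odot>\<^bsub>T\<^esub> C"
    and inner: "\<And>r. r \<in> L m \<Longrightarrow> \<Phi> (\<delta> ?i r) \<oplus>\<^bsub>T\<^esub> conj_y ?i (\<Phi> r) \<otimes>\<^bsub>T\<^esub> C = C \<otimes>\<^bsub>T\<^esub> \<Phi> r"
    using embedding_inner[OF m e] by blast
  have exp_m: "\<alpha> ?i = 0" if "\<alpha> \<in> exponents m" for \<alpha> using that by (auto simp: exponents_def)
  have ei: "?e \<in> exponents ?i" "?e \<in> exponents n" using m by (auto simp: exponents_def unit_vec_def)
  have mono: "exponents m \<subseteq> exponents ?i" "exponents ?i \<subseteq> exponents n" "L m \<subseteq> L ?i"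
    using m by (auto intro!: exponents_mono L_mono)
  let ?y = "single K \<one>\<^bsub>K\<^esub> ?e"
  have y: "?y \<in> carrier T" using ei by auto
  define X where "X = ?y \<oplus>\<^bsub>T\<^esub> C"
  have X: "X \<in> carrier T" using y C by (simp add: X_def)
  have rel: "X \<otimes>\<^bsub>T\<^esub> \<Phi> r = \<Phi> (\<tau> ?i r) \<otimes>\<^bsub>T\<^esub> X \<oplus>\<^bsub>T\<^esub> \<Phi> (\<delta> ?i r)" if r: "r \<in> L m" for r
  proof -
    have d: "\<delta> ?i r \<in> L m" using \<tau>_props(3)[OF i(1)] r by auto
    have t: "\<Phi> (\<tau> ?i r) = conj_y ?i (\<Phi> r)" using E(9)[OF _ r, of ?i] m by simp
    show ?thesis
      unfolding X_def t TM.T.l_distr[OF y C E(1)[OF r]] conj_y_conj[OF i(1) E(1)[OF r]] inner[OF r, symmetric]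
      using y C E(1)[OF r] E(1)[OF d] by (simp add: TM.T.r_distr TM.TA.a_ac)
  qed
  obtain \<Psi> where hom: "\<Psi> \<in> ring_hom (A\<lparr>carrier := L ?i\<rparr>) T" and ext: "\<And>r. r \<in> L m \<Longrightarrow> \<Psi> r = \<Phi> r"
    and \<Psi>x: "\<Psi> (x ?i) = X"
    and rep: "\<And>s. s \<in> L ?i \<Longrightarrow> \<exists>c. (\<forall>j. c j \<in> L m) \<and> finite {j. c j \<noteq> \<zero>\<^bsub>A\<^esub>} \<and>
      s = (\<Oplus>\<^bsub>A\<^esub>j\<in>{j. c j \<noteq> \<zero>\<^bsub>A\<^esub>}. c j \<otimes>\<^bsub>A\<^esub> x ?i [^]\<^bsub>A\<^esub> (j::nat)) \<and>
      \<Psi> s = (\<Oplus>\<^bsub>T\<^esub>j\<in>{j. c j \<noteq> \<zero>\<^bsub>A\<^esub>}. \<Phi> (c j) \<otimes>\<^bsub>T\<^esub> X [^]\<^bsub>T\<^esub> j)"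
    using skew_polynomial_extension[OF kA.A.ring_axioms TM.T_ring S E(10) X rel] by blast
  have P_closed: "\<Psi> r \<in> carrier T" if "r \<in> L ?i" for r using ring_hom_closed[OF hom, of r] that by simp
  have P_add: "\<Psi> (r \<oplus>\<^bsub>A\<^esub> s) = \<Psi> r \<oplus>\<^bsub>T\<^esub> \<Psi> s" if "r \<in> L ?i" "s \<in> L ?i" for r s
    using ring_hom_add[OF hom, of r s] that by simp
  have P_mult: "\<Psi> (r \<otimes>\<^bsub>A\<^esub> s) = \<Psi> r \<otimes>\<^bsub>T\<^esub> \<Psi> s" if "r \<in> L ?i" "s \<in> L ?i" for r s
    using ring_hom_mult[OF hom, of r s] that by simp
  have P_scalar: "\<Psi> (scalar A a) = single K a 0" if "a \<in> carrier K" for a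
    using ext[OF scalar_in_L[OF that]] E(6)[OF that] by simp
  have P_smult: "\<Psi> (a \<odot>\<^bsub>A\<^esub> r) = a \<odot>\<^bsub>T\<^esub> \<Psi> r" if "a \<in> carrier K" "r \<in> L ?i" for a r
    unfolding smult_scalar[OF that(1) L_carrier[OF i(2) that(2)]] P_mult[OF scalar_in_L[OF that(1)] that(2)]
      P_scalar[OF that(1)] smult_T[OF that(1) P_closed[OF that(2)]] ..
  have neg: "\<ominus>\<^bsub>A\<^esub> r = (\<ominus>\<^bsub>K\<^esub> \<one>\<^bsub>K\<^esub>) \<odot>\<^bsub>A\<^esub> r" if "r \<in> L ?i" for r
    using L_carrier[OF i(2) that] by (simp add: kA.smult_l_minus)
  have "inj_on \<Psi> (L ?i)"
  proof (rule inj_onI)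
    fix s s' assume s: "s \<in> L ?i" "s' \<in> L ?i" "\<Psi> s = \<Psi> s'"
    let ?d = "s \<oplus>\<^bsub>A\<^esub> \<ominus>\<^bsub>A\<^esub> s'"
    have d: "?d \<in> L ?i" by (intro L_closed s)
    have "\<Psi> ?d = \<Psi> s' \<oplus>\<^bsub>T\<^esub> (\<ominus>\<^bsub>K\<^esub> \<one>\<^bsub>K\<^esub>) \<odot>\<^bsub>T\<^esub> \<Psi> s'"
      unfolding P_add[OF s(1) L_closed(3)[OF s(2)]] s(3) unfolding neg[OF s(2)] P_smult[OF a_inv_closed[OF one_closed] s(2)] ..
    then have \<Psi>d: "\<Psi> ?d = \<zero>\<^bsub>T\<^esub>" using P_closed[OF s(2)] by (simp add: TM.M.smult_l_minus TM.TA.r_neg)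
    obtain c where c: "\<And>j. c j \<in> L m" "finite {j. c j \<noteq> \<zero>\<^bsub>A\<^esub>}"
      "?d = (\<Oplus>\<^bsub>A\<^esub>j\<in>{j. c j \<noteq> \<zero>\<^bsub>A\<^esub>}. c j \<otimes>\<^bsub>A\<^esub> x ?i [^]\<^bsub>A\<^esub> (j::nat))"
      "\<Psi> ?d = (\<Oplus>\<^bsub>T\<^esub>j\<in>{j. c j \<noteq> \<zero>\<^bsub>A\<^esub>}. \<Phi> (c j) \<otimes>\<^bsub>T\<^esub> X [^]\<^bsub>T\<^esub> j)"
      using rep[OF d] by blast
    have "{j. c j \<noteq> \<zero>\<^bsub>A\<^esub>} = {}"
    proof (rule ccontr)
      assume ne: "{j. c j \<noteq> \<zero>\<^bsub>A\<^esub>} \<noteq> {}"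
      \<comment> \<open>The leading degree. The terms with \<open>j < N\<close> do not reach degree
        \<open>N\<close> in \<open>y_i\<close>, so the leading term cannot be cancelled.\<close>
      define N where "N = Max {j. c j \<noteq> \<zero>\<^bsub>A\<^esub>}"
      have N: "c N \<noteq> \<zero>\<^bsub>A\<^esub>" "\<And>j. c j \<noteq> \<zero>\<^bsub>A\<^esub> \<Longrightarrow> j \<le> N"
        using Max_in[OF c(2) ne] Max_ge[OF c(2)] by (auto simp: N_def)
      have zL: "\<zero>\<^bsub>A\<^esub> \<in> L m" using subringE(2)[OF L_subring[OF mn]] .
      have z: "\<Phi> \<zero>\<^bsub>A\<^esub> = \<zero>\<^bsub>T\<^esub>" using E(2)[OF zL zL] E(1)[OF zL] by simp
      have "\<Phi> (c N) \<noteq> \<zero>\<^bsub>T\<^esub>" using inj_onD[OF E(5) _ c(1) zL, of N] N(1) z by metis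
      then obtain \<beta> where \<beta>: "\<Phi> (c N) \<beta> \<noteq> \<zero>\<^bsub>K\<^esub>" by (auto simp: TM.T_simps fun_eq_iff)
      have \<beta>0: "\<beta> ?i = 0" by (rule exp_m[OF E(7)[OF c(1) \<beta>]])
      let ?Ne = "\<lambda>k. int N * ?e k"
      have XC: "\<forall>\<alpha>. C \<alpha> \<noteq> \<zero>\<^bsub>K\<^esub> \<longrightarrow> \<alpha> ?i = 0" using exp_m C_supp by blast
      have c0: "\<forall>\<alpha>. \<Phi> (c j) \<alpha> \<noteq> \<zero>\<^bsub>K\<^esub> \<longrightarrow> \<alpha> ?i = 0" for j using exp_m E(7)[OF c(1)] by blast
      obtain a where a: "a \<in> carrier K" "a \<noteq> \<zero>\<^bsub>K\<^esub>"
        and top: "(\<Phi> (c N) \<otimes>\<^bsub>T\<^esub> X [^]\<^bsub>T\<^esub> N) (\<beta> + ?Ne) = twist \<beta> ?Ne \<otimes>\<^bsub>K\<^esub> (\<Phi> (c N) \<beta> \<otimes>\<^bsub>K\<^esub> a)"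
        using times_power_top_coefficient[of ?i C N, OF i(1) C XC] c0[of N] E(1)[OF c(1)] \<beta>0 unfolding X_def by blast
      have low: "(\<Phi> (c j) \<otimes>\<^bsub>T\<^esub> X [^]\<^bsub>T\<^esub> j) (\<beta> + ?Ne) = \<zero>\<^bsub>K\<^esub>" if "j < N" for j
      proof -
        have "(\<beta> + ?Ne) ?i > int j" using that \<beta>0 by (simp add: unit_vec_def)
        then show ?thesis
          using times_power_top_coefficient[of ?i C j, OF i(1) C XC] c0[of j] E(1)[OF c(1)] unfolding X_def by blast
      qed
      have cl: "\<Phi> (c j) \<otimes>\<^bsub>T\<^esub> X [^]\<^bsub>T\<^esub> j \<in> carrier T" for j using E(1)[OF c(1)] X by simp
      have "\<Psi> ?d (\<beta> + ?Ne) = (\<Oplus>\<^bsub>K\<^esub>j\<in>{j. c j \<noteq> \<zero>\<^bsub>A\<^esub>}. (\<Phi> (c j) \<otimes>\<^bsub>T\<^esub> X [^]\<^bsub>T\<^esub> j) (\<beta> + ?Ne))"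
        unfolding c(4) by (rule TM.T_finsum_apply) (use cl in blast)
      also have "\<dots> = (\<Oplus>\<^bsub>K\<^esub>j\<in>{j. c j \<noteq> \<zero>\<^bsub>A\<^esub>}. if j = N then (\<Phi> (c N) \<otimes>\<^bsub>T\<^esub> X [^]\<^bsub>T\<^esub> N) (\<beta> + ?Ne) else \<zero>\<^bsub>K\<^esub>)"
        by (rule finsum_cong'[OF refl]) (use TM.T_val[OF cl] N(2) low in \<open>auto simp: le_less\<close>)
      also have "\<dots> = (\<Phi> (c N) \<otimes>\<^bsub>T\<^esub> X [^]\<^bsub>T\<^esub> N) (\<beta> + ?Ne)"
        using finsum_delta[OF c(2) TM.T_val[OF cl]] N(1) by simp
      finally have "twist \<beta> ?Ne \<otimes>\<^bsub>K\<^esub> (\<Phi> (c N) \<beta> \<otimes>\<^bsub>K\<^esub> a) = \<zero>\<^bsub>K\<^esub>"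
        unfolding top \<Psi>d by (simp only: TM.T_simps)
      then show False using a \<beta> TM.T_val[OF E(1)[OF c(1)]] by (simp add: integral_iff)
    qed
    then have "?d = \<zero>\<^bsub>A\<^esub>" using c(3) by simp
    then show "s = s'" using s L_carrier[OF i(2)] by (metis kA.M.minus_minus kA.M.minus_equality kA.M.a_inv_closed)
  qed
  moreover have support: "\<alpha> \<in> exponents ?i" if s: "s \<in> L ?i" and nz: "\<Psi> s \<alpha> \<noteq> \<zero>\<^bsub>K\<^esub>" for s \<alpha>
  proof -
    let ?E = "{t \<in> carrier T. \<forall>\<alpha>. t \<alpha> \<noteq> \<zero>\<^bsub>K\<^esub> \<longrightarrow> \<alpha> \<in> exponents ?i}"
    note sc = supported_closed[OF i(2)]
    have "?y \<in> ?E" using y ei(1) by (auto simp: single_def)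
    moreover have "C \<in> ?E" using C C_supp mono(1) by blast
    ultimately have XE: "X \<in> ?E" unfolding X_def by (rule sc(1))
    have \<Phi>E: "\<Phi> r \<in> ?E" if "r \<in> L m" for r using E(1)[OF that] E(7)[OF that] mono(1) by blast
    obtain c :: "nat \<Rightarrow> 'c" where c: "\<And>j. c j \<in> L m" "\<Psi> s = (\<Oplus>\<^bsub>T\<^esub>j\<in>{j. c j \<noteq> \<zero>\<^bsub>A\<^esub>}. \<Phi> (c j) \<otimes>\<^bsub>T\<^esub> X [^]\<^bsub>T\<^esub> j)"
      using rep[OF s] by blast
    have "\<Psi> s \<in> ?E" unfolding c(2) by (rule sc(4), rule Pi_I) (rule sc(2)[OF \<Phi>E[OF c(1)] sc(3)[OF XE]])
    then show ?thesis using nz by blast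
  qed
  moreover have "\<exists>\<beta>\<in>exponents ?i. single K \<one>\<^bsub>K\<^esub> \<beta> \<in> \<Psi> ` L ?i \<and> single K \<one>\<^bsub>K\<^esub> (\<beta> + \<alpha>) \<in> \<Psi> ` L ?i"
    if \<alpha>: "\<alpha> \<in> exponents ?i" for \<alpha>
  proof -
    define V where "V = \<Psi> ` L ?i"
    have V: "v \<in> carrier T" if "v \<in> V" for v using that P_closed by (auto simp: V_def)
    have "\<forall>r\<in>L ?i. \<forall>s\<in>L ?i. \<Psi> (r \<oplus>\<^bsub>A\<^esub> s) = \<Psi> r \<oplus>\<^bsub>T\<^esub> \<Psi> s \<and> \<Psi> (r \<otimes>\<^bsub>A\<^esub> s) = \<Psi> r \<otimes>\<^bsub>T\<^esub> \<Psi> s"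
      "\<forall>a\<in>carrier K. \<forall>r\<in>L ?i. \<Psi> (a \<odot>\<^bsub>A\<^esub> r) = a \<odot>\<^bsub>T\<^esub> \<Psi> r" using P_add P_mult P_smult by blast+
    note V_ball = image_L_closed[OF i(2) this, folded V_def]
    note V_add = V_ball(1)[rule_format] and V_mult = V_ball(2)[rule_format] and V_smult = V_ball(3)[rule_format]
    note V_shift = monomial_product[OF V_ball(2,3) i(2)]
    have \<Phi>V: "\<Phi> ` L m \<subseteq> V" using ext mono(3) by (force simp: V_def)
    have zV: "single K \<one>\<^bsub>K\<^esub> 0 \<in> \<Phi> ` L m"
      unfolding E(6)[OF one_closed, symmetric] by (rule imageI[OF scalar_in_L[OF one_closed]])
    have XV: "X \<in> V" unfolding \<Psi>x[symmetric] V_def by (rule imageI, rule x_in_L) simp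
    \<comment> \<open>Neither \<open>y_i\<close> nor \<open>C\<close> need lie in the image, only
      their sum \<open>X\<close>. A monomial \<open>y^\<beta>\<close> is chosen for which
      \<open>y^\<beta> C\<close> lies in the image of the previous stage; then
      \<open>y^\<beta> X - y^\<beta> C\<close> is a multiple of the monomial at
      \<open>\<beta> + ?e\<close>.\<close>
    have top: "\<exists>\<beta>\<in>exponents ?i. single K \<one>\<^bsub>K\<^esub> \<beta> \<in> V \<and> single K \<one>\<^bsub>K\<^esub> (\<beta> + ?e) \<in> V"
    proof -
      let ?F = "{\<gamma>. C \<gamma> \<noteq> \<zero>\<^bsub>K\<^esub>}"
      have F: "finite ?F" "?F \<subseteq> exponents m" using TM.T_fin[OF C] C_supp by auto
      obtain \<beta> where \<beta>: "\<beta> \<in> exponents m" "single K \<one>\<^bsub>K\<^esub> \<beta> \<in> \<Phi> ` L m"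
        "\<And>\<gamma>. \<gamma> \<in> ?F \<Longrightarrow> single K \<one>\<^bsub>K\<^esub> (\<beta> + \<gamma>) \<in> \<Phi> ` L m"
      proof -
        have "\<forall>r\<in>L m. \<forall>s\<in>L m. \<Phi> (r \<oplus>\<^bsub>A\<^esub> s) = \<Phi> r \<oplus>\<^bsub>T\<^esub> \<Phi> s \<and> \<Phi> (r \<otimes>\<^bsub>A\<^esub> s) = \<Phi> r \<otimes>\<^bsub>T\<^esub> \<Phi> s"
          "\<forall>a\<in>carrier K. \<forall>r\<in>L m. \<Phi> (a \<odot>\<^bsub>A\<^esub> r) = a \<odot>\<^bsub>T\<^esub> \<Phi> r" using E(2-4) by blast+
        note V0 = image_L_closed(2,3)[OF mn this]
        have "\<forall>\<alpha>\<in>exponents m. \<exists>\<beta>\<in>exponents m. single K \<one>\<^bsub>K\<^esub> \<beta> \<in> \<Phi> ` L m \<and> single K \<one>\<^bsub>K\<^esub> (\<beta> + \<alpha>) \<in> \<Phi> ` L m"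
          using E(8) by blast
        from common_shift[OF V0 zV mn this F] show ?thesis using that by blast
      qed
      have \<beta>n: "\<beta> \<in> exponents n" "\<beta> \<in> exponents ?i" using \<beta>(1) mono by auto
      have b: "single K \<one>\<^bsub>K\<^esub> \<beta> \<in> V" "single K \<one>\<^bsub>K\<^esub> \<beta> \<in> carrier T" using \<beta>(2) \<Phi>V \<beta>n by auto
      have Fn: "?F \<subseteq> exponents n" using F(2) mono by auto
      have bF: "single K (C \<gamma>) \<gamma> \<in> carrier T" if "\<gamma> \<in> ?F" for \<gamma> using TM.T_val[OF C] Fn that by auto
      have "single K \<one>\<^bsub>K\<^esub> \<beta> \<otimes>\<^bsub>T\<^esub> C = (\<Oplus>\<^bsub>T\<^esub>\<gamma>\<in>?F. single K \<one>\<^bsub>K\<^esub> \<beta> \<otimes>\<^bsub>T\<^esub> single K (C \<gamma>) \<gamma>)"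
      proof -
        have "C = (\<Oplus>\<^bsub>T\<^esub>\<gamma>\<in>?F. single K (C \<gamma>) \<gamma>)" by (rule TM.single_expansion[OF C F(1) Fn]) simp
        then have "single K \<one>\<^bsub>K\<^esub> \<beta> \<otimes>\<^bsub>T\<^esub> C = single K \<one>\<^bsub>K\<^esub> \<beta> \<otimes>\<^bsub>T\<^esub> (\<Oplus>\<^bsub>T\<^esub>\<gamma>\<in>?F. single K (C \<gamma>) \<gamma>)" by (rule arg_cong)
        also have "\<dots> = (\<Oplus>\<^bsub>T\<^esub>\<gamma>\<in>?F. single K \<one>\<^bsub>K\<^esub> \<beta> \<otimes>\<^bsub>T\<^esub> single K (C \<gamma>) \<gamma>)"
          by (rule TM.T.finsum_rdistr[OF F(1) b(2)]) (rule Pi_I, rule bF)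
        finally show ?thesis .
      qed
      also have "\<dots> \<in> V"
      proof -
        have summand: "single K \<one>\<^bsub>K\<^esub> \<beta> \<otimes>\<^bsub>T\<^esub> single K (C \<gamma>) \<gamma> \<in> V" if g: "\<gamma> \<in> ?F" for \<gamma>
        proof -
          have gn: "\<gamma> \<in> exponents n" using Fn g by blast
          have "single K \<one>\<^bsub>K\<^esub> \<beta> \<otimes>\<^bsub>T\<^esub> single K (C \<gamma>) \<gamma> = (twist \<beta> \<gamma> \<otimes>\<^bsub>K\<^esub> C \<gamma>) \<odot>\<^bsub>T\<^esub> single K \<one>\<^bsub>K\<^esub> (\<beta> + \<gamma>)"
            using \<beta>n gn TM.T_val[OF C] by (simp add: TM.single_mult TM.T_smult_single)
          also have "\<dots> \<in> V" by (rule V_smult) (use TM.T_val[OF C] \<beta>(3)[OF g] \<Phi>V in auto)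
          finally show ?thesis .
        qed
        have "(\<Oplus>\<^bsub>T\<^esub>\<gamma>\<in>G. single K \<one>\<^bsub>K\<^esub> \<beta> \<otimes>\<^bsub>T\<^esub> single K (C \<gamma>) \<gamma>) \<in> V" if "finite G" "G \<subseteq> ?F" for G
          using that
        proof (induction G rule: finite_induct)
          case empty
          show ?case using V_smult[of "\<zero>\<^bsub>K\<^esub>", OF _ XV] X by simp
        next
          case (insert \<gamma> G)
          have G: "\<gamma> \<in> ?F" "G \<subseteq> ?F" using insert.prems by auto
          have f: "(\<lambda>\<gamma>. single K \<one>\<^bsub>K\<^esub> \<beta> \<otimes>\<^bsub>T\<^esub> single K (C \<gamma>) \<gamma>) \<in> G \<rightarrow> carrier T"
            by (rule Pi_I, rule V, rule summand) (use G(2) in blast)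
          show ?case using V_add[OF summand[OF G(1)] insert.IH[OF G(2)]]
            by (subst TM.TA.finsum_insert[OF insert(1,2) f]) (rule V[OF summand[OF G(1)]])
        qed
        then show ?thesis using F(1) by blast
      qed
      finally have bC: "single K \<one>\<^bsub>K\<^esub> \<beta> \<otimes>\<^bsub>T\<^esub> C \<in> V" .
      have "single K \<one>\<^bsub>K\<^esub> \<beta> \<otimes>\<^bsub>T\<^esub> X \<oplus>\<^bsub>T\<^esub> (\<ominus>\<^bsub>K\<^esub> \<one>\<^bsub>K\<^esub>) \<odot>\<^bsub>T\<^esub> (single K \<one>\<^bsub>K\<^esub> \<beta> \<otimes>\<^bsub>T\<^esub> C) \<in> V"
        by (intro V_add V_mult V_smult b XV bC) simp
      also have "single K \<one>\<^bsub>K\<^esub> \<beta> \<otimes>\<^bsub>T\<^esub> X \<oplus>\<^bsub>T\<^esub> (\<ominus>\<^bsub>K\<^esub> \<one>\<^bsub>K\<^esub>) \<odot>\<^bsub>T\<^esub> (single K \<one>\<^bsub>K\<^esub> \<beta> \<otimes>\<^bsub>T\<^esub> C) = single K \<one>\<^bsub>K\<^esub> \<beta> \<otimes>\<^bsub>T\<^esub> ?y"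
        using b(2) y C by (simp add: X_def TM.T.r_distr TM.M.smult_l_minus TM.TA.a_assoc TM.TA.r_neg)
      also have "\<dots> = single K (twist \<beta> ?e) (\<beta> + ?e)" using \<beta>n ei by (simp add: TM.single_mult)
      finally have "inv\<^bsub>K\<^esub> (twist \<beta> ?e) \<odot>\<^bsub>T\<^esub> single K (twist \<beta> ?e) (\<beta> + ?e) \<in> V"
        by (intro V_smult) auto
      then have "single K \<one>\<^bsub>K\<^esub> (\<beta> + ?e) \<in> V" by (simp add: TM.T_smult_single)
      then show ?thesis using b \<beta>n by blast
    qed
    show ?thesis
      using \<alpha> unfolding V_def[symmetric]
    proof (induction \<alpha> rule: exponents_induct)
      case zero
      show ?case by (rule bexI[of _ 0]) (use zV \<Phi>V in \<open>auto simp del: zero_fun_apply\<close>)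
    next
      case (unit_vec j)
      show ?case
      proof (cases "j \<le> m")
        case True
        then have "unit_vec j \<in> exponents m" using unit_vec by (auto simp: exponents_def unit_vec_def)
        from E(8)[OF this] obtain \<beta> where "\<beta> \<in> exponents m" "single K \<one>\<^bsub>K\<^esub> \<beta> \<in> \<Phi> ` L m"
          "single K \<one>\<^bsub>K\<^esub> (\<beta> + unit_vec j) \<in> \<Phi> ` L m" by blast
        then show ?thesis using subsetD[OF mono(1)] subsetD[OF \<Phi>V] by blast
      next
        case False
        then have "j = ?i" using unit_vec by simp
        then show ?thesis using top by (simp only:)
      qed
    next
      case (add \<alpha> \<alpha>')
      then obtain \<beta> \<beta>' where b: "\<beta> \<in> exponents ?i" "single K \<one>\<^bsub>K\<^esub> \<beta> \<in> V" "single K \<one>\<^bsub>K\<^esub> (\<beta> + \<alpha>) \<in> V"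
        and b': "\<beta>' \<in> exponents ?i" "single K \<one>\<^bsub>K\<^esub> \<beta>' \<in> V" "single K \<one>\<^bsub>K\<^esub> (\<beta>' + \<alpha>') \<in> V" by blast
      have ex: "u \<in> exponents ?i" if "single K \<one>\<^bsub>K\<^esub> u \<in> V" for u
      proof -
        obtain s where s: "s \<in> L ?i" "\<Psi> s = single K \<one>\<^bsub>K\<^esub> u" using \<open>single K \<one>\<^bsub>K\<^esub> u \<in> V\<close> unfolding V_def by (metis imageE)
        have "\<Psi> s u \<noteq> \<zero>\<^bsub>K\<^esub>" unfolding s(2) by (simp add: single_def)
        then show ?thesis by (rule support[OF s(1)])
      qed
      have "(\<beta> + \<alpha>) + (\<beta>' + \<alpha>') = (\<beta> + \<beta>') + (\<alpha> + \<alpha>')" by (simp only: ac_simps)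
      then have "single K \<one>\<^bsub>K\<^esub> ((\<beta> + \<beta>') + (\<alpha> + \<alpha>')) \<in> V"
        using V_shift[OF b(3) b'(3) ex[OF b(3)] ex[OF b'(3)]] by (simp only:)
      then show ?case using V_shift[OF b(2) b'(2) b(1) b'(1)] exponents_closed(2)[OF b(1) b'(1)] by blast
    next
      case (minus \<alpha>)
      then obtain \<beta> where b: "\<beta> \<in> exponents ?i" "single K \<one>\<^bsub>K\<^esub> \<beta> \<in> V" "single K \<one>\<^bsub>K\<^esub> (\<beta> + \<alpha>) \<in> V" by blast
      have "\<beta> + \<alpha> + - \<alpha> = \<beta>" by simp
      moreover have "\<beta> + \<alpha> \<in> exponents ?i"
      proof -
        obtain s where s: "s \<in> L ?i" "\<Psi> s = single K \<one>\<^bsub>K\<^esub> (\<beta> + \<alpha>)" using b(3) unfolding V_def by (metis imageE)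
        have "\<Psi> s (\<beta> + \<alpha>) \<noteq> \<zero>\<^bsub>K\<^esub>" unfolding s(2) by (simp add: single_def)
        then show ?thesis by (rule support[OF s(1)])
      qed
      ultimately show ?case using b by (intro bexI[of _ "\<beta> + \<alpha>"]) (simp_all del: plus_fun_apply uminus_apply)
    qed
  qed
  moreover have "\<Psi> (\<tau> j r) = conj_y j (\<Psi> r)" if j: "j \<in> {?i<..n}" and r: "r \<in> L ?i" for j r
    using i(2) r
  proof (induction r rule: L_induct)
    case (scalar a)
    then show ?case using j by (simp add: \<tau>_scalar P_scalar conj_y_single del: zero_fun_apply)
  next
    case (var k)
    have jk: "j \<in> {1..n}" "?i < j" "k \<in> {1..n}" "k < j" using var j i by auto
    have l: "\<Lambda> j k \<in> carrier K" using Lambda_Units[OF jk(1,3)] by auto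
    show ?case
    proof (cases "k \<le> m")
      case True
      then have k: "x k \<in> L m" using var by (auto intro: x_in_L)
      have "\<tau> j (x k) \<in> L m" using \<tau>_stable[OF jk(1) _ k] jk by simp
      then show ?thesis using ext k E(9)[of j "x k"] jk by simp
    next
      case False
      then have k: "k = ?i" using var by simp
      \<comment> \<open>Conjugation by \<open>y_j\<close> scales \<open>y_i\<close> and
        \<open>C\<close> by the same factor, so their sum is scaled as \<open>\<tau>_j\<close>
        scales \<open>x_i\<close>.\<close>
      have "\<Psi> (\<tau> j (x ?i)) = \<Lambda> j ?i \<odot>\<^bsub>T\<^esub> X"
        using \<tau>_var[of ?i j] jk P_smult[OF l] x_in_L[of ?i ?i] \<Psi>x by (simp add: k)
      also have "\<dots> = conj_y j X"
        unfolding X_def conj_y_add[OF y C] C_eigen[OF j]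
        using l y C comm_unit_vec[OF jk(1,3)] by (simp add: k conj_y_single TM.M.smult_r_distr TM.T_smult_single)
      finally show ?thesis by (simp add: k \<Psi>x)
    qed
  next
    case (add r s)
    have jj: "j \<in> {1..n}" "?i < j" using j i by auto
    then show ?case
      using add P_add \<tau>_hom(1)[OF jj] \<tau>_stable[OF jj] P_closed by (simp add: conj_y_add)
  next
    case (minus r)
    have jj: "j \<in> {1..n}" "?i < j" using j i by auto
    have "\<tau> j (\<ominus>\<^bsub>A\<^esub> r) = (\<ominus>\<^bsub>K\<^esub> \<one>\<^bsub>K\<^esub>) \<odot>\<^bsub>A\<^esub> \<tau> j r"
      unfolding neg[OF minus(1)] by (rule \<tau>_hom(3)[OF jj minus(1,1)]) simp
    then show ?case
      using minus neg[OF minus(1)] P_smult \<tau>_stable[OF jj minus(1)] P_closed by (simp add: conj_y_smult)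
  next
    case (mult r s)
    have jj: "j \<in> {1..n}" "?i < j" using j i by auto
    then show ?case
      using mult P_mult \<tau>_hom(2)[OF jj] \<tau>_stable[OF jj] P_closed by (simp add: conj_y_mult)
  qed
  ultimately have "embedding ?i \<Psi>" unfolding embedding_def using hom P_scalar by blast
  then show ?thesis by blast
qed

lemma embedding_torus_order:
  assumes "embedding n \<Phi>"
  shows "torus_order A \<Phi>"
proof -
  note E = embeddingD[OF assms order_refl]
  have "A\<lparr>carrier := L n\<rparr> = A" by (simp add: top[symmetric])
  then have "\<Phi> \<in> ring_hom A T" using E(10) by simp
  then show ?thesis
    unfolding torus_order_def top using E(4,5,8) L_smult[OF order_refl] kA.A.ring_axioms by blast
qed

theorem torus_order_exists: "\<exists>\<Phi>. torus_order A \<Phi>"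
proof -
  have "\<exists>\<Phi>. embedding m \<Phi>" if "m \<le> n" for m
    using that by (induction m) (use embedding_0 embedding_Suc in auto)
  then show ?thesis using embedding_torus_order by blast
qed

end

section \<open>Multilinear identities\<close>

abbreviation word_prod :: "('a, 'm) ring_scheme \<Rightarrow> (nat \<Rightarrow> 'a) \<Rightarrow> nat list \<Rightarrow> 'a"
  where "word_prod A z w \<equiv> foldr (\<lambda>i p. z i \<otimes>\<^bsub>A\<^esub> p) w \<one>\<^bsub>A\<^esub>"

definition multilinear_eval :: "('k, 'a, 'm) module_scheme \<Rightarrow> nat \<Rightarrow> (nat list \<Rightarrow> 'k) \<Rightarrow> (nat \<Rightarrow> 'a) \<Rightarrow> 'a"
  where "multilinear_eval A m g z = (\<Oplus>\<^bsub>A\<^esub>v\<in>permutations_of_set {..<m}. g v \<odot>\<^bsub>A\<^esub> word_prod A z v)"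

definition multilinear_identity ::
    "('k, 'l) ring_scheme \<Rightarrow> ('k, 'a, 'm) module_scheme \<Rightarrow> nat \<Rightarrow> (nat list \<Rightarrow> 'k) \<Rightarrow> bool"
  where "multilinear_identity K A m g \<longleftrightarrow>
    (\<forall>v\<in>permutations_of_set {..<m}. g v \<in> carrier K) \<and>
    (\<exists>v\<in>permutations_of_set {..<m}. g v \<noteq> \<zero>\<^bsub>K\<^esub>) \<and>
    (\<forall>z. (\<forall>i. z i \<in> carrier A) \<longrightarrow> multilinear_eval A m g z = \<zero>\<^bsub>A\<^esub>)"

lemma finite_words: "finite {v :: nat list. set v \<subseteq> {..<m} \<and> length v \<le> l}"
  by (rule finite_lists_length_le) simp

lemma word_prod_cong: "(\<And>i. i \<in> set w \<Longrightarrow> z i = z' i) \<Longrightarrow> word_prod A z w = word_prod A z' w"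
  by (induction w) auto

lemma (in ring) word_prod_closed [simp]: "(\<And>i. z i \<in> carrier R) \<Longrightarrow> word_prod R z w \<in> carrier R"
  by (induction w) auto

lemma (in ring) word_prod_zero:
  "(\<And>i. z i \<in> carrier R) \<Longrightarrow> k \<in> set w \<Longrightarrow> z k = \<zero> \<Longrightarrow> word_prod R z w = \<zero>"
  by (induction w) auto

text \<open>The substitution used for linearisation: each letter \<open>i\<close> is replaced by the
  sum of the new letters that \<open>h\<close> maps to it, and multiplying out produces exactly the
  words over \<open>w\<close>.\<close>

lemma (in ring) word_prod_expand:
  assumes z: "\<And>i. z i \<in> carrier R"
  shows "word_prod R (\<lambda>i. \<Oplus>j\<in>{j. j < m \<and> h j = i}. z j) w =
    (\<Oplus>v\<in>{v. set v \<subseteq> {..<m} \<and> map h v = w}. word_prod R z v)"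
proof (induction w)
  case Nil
  have "{v. set v \<subseteq> {..<m} \<and> map h v = []} = {[]}" by auto
  then show ?case by simp
next
  case (Cons i w)
  let ?J = "{j. j < m \<and> h j = i}" and ?V = "{v. set v \<subseteq> {..<m} \<and> map h v = w}"
  have fV: "finite ?V"
    by (rule finite_subset[OF _ finite_words[of m "length w"]]) auto
  have "{v. set v \<subseteq> {..<m} \<and> map h v = i # w} = (\<Union>j\<in>?J. (#) j ` ?V)"
    by (auto simp: map_eq_Cons_conv)
  then have "(\<Oplus>v\<in>{v. set v \<subseteq> {..<m} \<and> map h v = i # w}. word_prod R z v)
    = (\<Oplus>j\<in>?J. \<Oplus>v\<in>(#) j ` ?V. word_prod R z v)"
    using add.finprod_UN_disjoint[of ?J "\<lambda>j. (#) j ` ?V" "word_prod R z"] fV z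
    by (auto simp: finsum_def pairwise_def disjnt_def)
  also have "\<dots> = (\<Oplus>j\<in>?J. z j \<otimes> (\<Oplus>v\<in>?V. word_prod R z v))"
  proof (rule finsum_cong'[OF refl])
    fix j assume "j \<in> ?J"
    have "(\<Oplus>v\<in>(#) j ` ?V. word_prod R z v) = (\<Oplus>v\<in>?V. z j \<otimes> word_prod R z v)"
      using add.finprod_reindex[of "word_prod R z" "(#) j" ?V] z by (simp add: finsum_def inj_on_def del: foldr_Cons) simp
    also have "\<dots> = z j \<otimes> (\<Oplus>v\<in>?V. word_prod R z v)"
      by (rule finsum_rdistr[symmetric]) (use fV z in auto)
    finally show "(\<Oplus>v\<in>(#) j ` ?V. word_prod R z v) = z j \<otimes> (\<Oplus>v\<in>?V. word_prod R z v)" .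
  qed (use z in auto)
  also have "\<dots> = (\<Oplus>j\<in>?J. z j) \<otimes> (\<Oplus>v\<in>?V. word_prod R z v)"
    by (rule finsum_ldistr[symmetric]) (use z in auto)
  finally show ?case by (simp add: Cons.IH)
qed

section \<open>Linearisation of polynomial identities\<close>

context k_algebra
begin

lemma nc_eval_substitution:
  assumes f: "f \<in> carrier (free_algebra K UNIV)" and len: "\<And>w. f w \<noteq> \<zero>\<^bsub>K\<^esub> \<Longrightarrow> length w \<le> l"
    and z: "\<And>i. z i \<in> carrier A"
  shows "nc_eval K A f (\<lambda>i. \<Oplus>\<^bsub>A\<^esub>j\<in>{j. j < m \<and> h j = i}. z j) =
    (\<Oplus>\<^bsub>A\<^esub>v\<in>{v. set v \<subseteq> {..<m} \<and> length v \<le> l}. f (map h v) \<odot>\<^bsub>A\<^esub> word_prod A z v)"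
proof -
  let ?V = "{v. set v \<subseteq> {..<m} \<and> length v \<le> l}" and ?W = "{w. f w \<noteq> \<zero>\<^bsub>K\<^esub>}"
  have fin: "finite ?W" and fK [simp]: "f w \<in> carrier K" for w
    using f by (auto simp: free_algebra_def)
  have "nc_eval K A f (\<lambda>i. \<Oplus>\<^bsub>A\<^esub>j\<in>{j. j < m \<and> h j = i}. z j)
    = (\<Oplus>\<^bsub>A\<^esub>w\<in>?W. \<Oplus>\<^bsub>A\<^esub>v\<in>?V. if w = map h v then f (map h v) \<odot>\<^bsub>A\<^esub> word_prod A z v else \<zero>\<^bsub>A\<^esub>)"
    unfolding nc_eval_def
  proof (rule M.finsum_cong'[OF refl])
    fix w assume w: "w \<in> ?W"
    let ?Vw = "{v. set v \<subseteq> {..<m} \<and> map h v = w}"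
    have "length w \<le> l" using len w by blast
    then have sub: "?Vw \<subseteq> ?V" by auto
    have "f w \<odot>\<^bsub>A\<^esub> word_prod A (\<lambda>i. \<Oplus>\<^bsub>A\<^esub>j\<in>{j. j < m \<and> h j = i}. z j) w = f w \<odot>\<^bsub>A\<^esub> (\<Oplus>\<^bsub>A\<^esub>v\<in>?Vw. word_prod A z v)"
      by (simp only: A.word_prod_expand[OF z])
    also have "\<dots> = (\<Oplus>\<^bsub>A\<^esub>v\<in>?Vw. f w \<odot>\<^bsub>A\<^esub> word_prod A z v)"
      by (rule finsum_smult_ldistr) (use finite_subset[OF sub finite_words] z in auto)
    also have "\<dots> = (\<Oplus>\<^bsub>A\<^esub>v\<in>?Vw. if w = map h v then f (map h v) \<odot>\<^bsub>A\<^esub> word_prod A z v else \<zero>\<^bsub>A\<^esub>)"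
      by (rule M.finsum_cong'[OF refl]) (use z in auto)
    also have "\<dots> = (\<Oplus>\<^bsub>A\<^esub>v\<in>?V. if w = map h v then f (map h v) \<odot>\<^bsub>A\<^esub> word_prod A z v else \<zero>\<^bsub>A\<^esub>)"
      by (rule M.finsum_extend[OF finite_words sub]) (use z in auto)
    finally show "f w \<odot>\<^bsub>A\<^esub> word_prod A (\<lambda>i. \<Oplus>\<^bsub>A\<^esub>j\<in>{j. j < m \<and> h j = i}. z j) w =
      (\<Oplus>\<^bsub>A\<^esub>v\<in>?V. if w = map h v then f (map h v) \<odot>\<^bsub>A\<^esub> word_prod A z v else \<zero>\<^bsub>A\<^esub>)" .
  qed (use z in auto)
  also have "\<dots> = (\<Oplus>\<^bsub>A\<^esub>v\<in>?V. \<Oplus>\<^bsub>A\<^esub>w\<in>?W. if w = map h v then f (map h v) \<odot>\<^bsub>A\<^esub> word_prod A z v else \<zero>\<^bsub>A\<^esub>)"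
    by (rule M.finsum_swap[OF fin finite_words]) (use z in auto)
  also have "\<dots> = (\<Oplus>\<^bsub>A\<^esub>v\<in>?V. f (map h v) \<odot>\<^bsub>A\<^esub> word_prod A z v)"
  proof (rule M.finsum_cong'[OF refl])
    fix v
    have "(\<Oplus>\<^bsub>A\<^esub>w\<in>?W. if w = map h v then f (map h v) \<odot>\<^bsub>A\<^esub> word_prod A z v else \<zero>\<^bsub>A\<^esub>)
      = (if map h v \<in> ?W then f (map h v) \<odot>\<^bsub>A\<^esub> word_prod A z v else \<zero>\<^bsub>A\<^esub>)"
      by (rule M.finsum_delta[OF fin]) (use z in auto)
    then show "(\<Oplus>\<^bsub>A\<^esub>w\<in>?W. if w = map h v then f (map h v) \<odot>\<^bsub>A\<^esub> word_prod A z v else \<zero>\<^bsub>A\<^esub>)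
      = f (map h v) \<odot>\<^bsub>A\<^esub> word_prod A z v" using z by simp
  qed (use z in auto)
  finally show ?thesis .
qed

text \<open>A word \<open>w0\<close> of top degree \<open>m\<close> in \<open>f\<close> gets a fresh
  variable for each of its positions, the variable \<open>i\<close> being replaced by the sum of the
  new ones at the positions where \<open>w0\<close> has \<open>i\<close>. Of the result, the part
  that involves all new variables is kept. Its words are permutations, and the coefficient of the
  identity permutation is that of \<open>w0\<close>. No division occurs, so the characteristic is
  arbitrary, and the degree is preserved.\<close>

lemma polynomial_identity_multilinear:
  assumes "polynomial_identity K A f"
  shows "\<exists>g. multilinear_identity K A (nc_degree K f) g"
proof -
  define m where "m = nc_degree K f"
  have f: "f \<in> carrier (free_algebra K UNIV)" and nz: "f \<noteq> (\<lambda>w. \<zero>\<^bsub>K\<^esub>)"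
    and pi: "\<And>a :: nat \<Rightarrow> _. (\<And>i. a i \<in> carrier A) \<Longrightarrow> nc_eval K A f a = \<zero>\<^bsub>A\<^esub>"
    using assms unfolding polynomial_identity_def by (auto simp: free_algebra_def)
  have fK [simp]: "f w \<in> carrier K" for w using f by (simp add: free_algebra_def)
  let ?L = "length ` {w. f w \<noteq> \<zero>\<^bsub>K\<^esub>}"
  have L: "finite ?L" "?L \<noteq> {}" using f nz by (auto simp: free_algebra_def)
  have len: "length w \<le> m" if "f w \<noteq> \<zero>\<^bsub>K\<^esub>" for w
    using Max_ge[OF L(1)] that by (auto simp: m_def nc_degree_def)
  obtain w0 where w0: "f w0 \<noteq> \<zero>\<^bsub>K\<^esub>" "length w0 = m"
    using Max_in[OF L] by (auto simp: m_def nc_degree_def)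
  define g where "g = (\<lambda>v. f (map ((!) w0) v))"
  have gK [simp]: "g v \<in> carrier K" for v by (simp add: g_def)
  let ?V = "\<lambda>k. {v. set v \<subseteq> {..<m} \<and> length v \<le> m \<and> {..<k} \<subseteq> set v}"
  have fin: "finite (?V k)" for k by (rule finite_subset[OF _ finite_words[of m m]]) auto
  \<comment> \<open>One variable at a time: setting \<open>z k\<close> to zero kills the words that
    contain \<open>k\<close> and does not change the others, so the words without \<open>k\<close>
    already sum to zero and can be subtracted.\<close>
  have main: "(\<Oplus>\<^bsub>A\<^esub>v\<in>?V k. g v \<odot>\<^bsub>A\<^esub> word_prod A z v) = \<zero>\<^bsub>A\<^esub>" if "\<And>i. z i \<in> carrier A" for k z
    using that
  proof (induction k arbitrary: z)
    case 0
    have "nc_eval K A f (\<lambda>i. \<Oplus>\<^bsub>A\<^esub>j\<in>{j. j < m \<and> w0 ! j = i}. z j) = \<zero>\<^bsub>A\<^esub>"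
      by (rule pi) (use 0 in auto)
    then show ?case using nc_eval_substitution[OF f len 0, where h = "(!) w0" and m = m] by (simp add: g_def)
  next
    case (Suc k)
    let ?U = "{v \<in> ?V k. k \<notin> set v}" and ?z = "z(k := \<zero>\<^bsub>A\<^esub>)"
    have z': "\<And>i. ?z i \<in> carrier A" using Suc.prems by simp
    have split: "?V k = ?V (Suc k) \<union> ?U" "?V (Suc k) \<inter> ?U = {}" by (auto simp: less_Suc_eq)
    have U: "finite ?U" by (rule finite_subset[OF _ fin[of k]]) blast
    have sum_split: "(\<Oplus>\<^bsub>A\<^esub>v\<in>?V k. g v \<odot>\<^bsub>A\<^esub> word_prod A y v)
      = (\<Oplus>\<^bsub>A\<^esub>v\<in>?V (Suc k). g v \<odot>\<^bsub>A\<^esub> word_prod A y v) \<oplus>\<^bsub>A\<^esub> (\<Oplus>\<^bsub>A\<^esub>v\<in>?U. g v \<odot>\<^bsub>A\<^esub> word_prod A y v)"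
      if "\<And>i. y i \<in> carrier A" for y
    proof -
      have "(\<Oplus>\<^bsub>A\<^esub>v\<in>?V (Suc k) \<union> ?U. g v \<odot>\<^bsub>A\<^esub> word_prod A y v)
        = (\<Oplus>\<^bsub>A\<^esub>v\<in>?V (Suc k). g v \<odot>\<^bsub>A\<^esub> word_prod A y v) \<oplus>\<^bsub>A\<^esub> (\<Oplus>\<^bsub>A\<^esub>v\<in>?U. g v \<odot>\<^bsub>A\<^esub> word_prod A y v)"
        by (rule M.finsum_Un_disjoint[OF fin U split(2)]) (use that in auto)
      then show ?thesis by (simp only: split(1)[symmetric])
    qed
    have "(\<Oplus>\<^bsub>A\<^esub>v\<in>?V (Suc k). g v \<odot>\<^bsub>A\<^esub> word_prod A ?z v) = \<zero>\<^bsub>A\<^esub>"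
      by (rule M.finsum_zero') (subst A.word_prod_zero[of ?z k], use z' in auto)
    then have "(\<Oplus>\<^bsub>A\<^esub>v\<in>?U. g v \<odot>\<^bsub>A\<^esub> word_prod A ?z v) = \<zero>\<^bsub>A\<^esub>"
      using sum_split[of ?z, OF z'] Suc.IH[of ?z, OF z'] z' by (simp del: fun_upd_apply)
    moreover have "(\<Oplus>\<^bsub>A\<^esub>v\<in>?U. g v \<odot>\<^bsub>A\<^esub> word_prod A z v) = (\<Oplus>\<^bsub>A\<^esub>v\<in>?U. g v \<odot>\<^bsub>A\<^esub> word_prod A ?z v)"
    proof (rule M.finsum_cong'[OF refl])
      fix v assume "v \<in> ?U"
      then have "word_prod A z v = word_prod A ?z v" by (intro word_prod_cong) auto
      then show "g v \<odot>\<^bsub>A\<^esub> word_prod A z v = g v \<odot>\<^bsub>A\<^esub> word_prod A ?z v" by simp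
    qed (use z' in auto)
    ultimately show ?case using sum_split[of z, OF Suc.prems] Suc.IH[of z, OF Suc.prems] Suc.prems by (simp del: fun_upd_apply)
  qed
  \<comment> \<open>A word of length at most \<open>m\<close> in which all \<open>m\<close> letters
    occur contains each of them once.\<close>
  have perms: "?V m = permutations_of_set {..<m}"
  proof (intro equalityI subsetI)
    fix v assume "v \<in> ?V m"
    then have v: "set v = {..<m}" "length v \<le> m" by auto
    have "distinct v" using v card_length[of v] by (intro card_distinct) simp
    then show "v \<in> permutations_of_set {..<m}" using v by (simp add: permutations_of_set_def)
  next
    fix v assume "v \<in> permutations_of_set {..<m}"
    then have v: "set v = {..<m}" "distinct v" by (auto simp: permutations_of_set_def)
    then show "v \<in> ?V m" using distinct_card[of v] by simp
  qed
  have "g [0..<m] \<noteq> \<zero>\<^bsub>K\<^esub>" using w0 map_nth[of w0] by (simp add: g_def)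
  moreover have "[0..<m] \<in> permutations_of_set {..<m}" by (auto simp: permutations_of_set_def)
  ultimately have "multilinear_identity K A m g"
    using main[where k = m] unfolding multilinear_identity_def multilinear_eval_def perms by auto
  then show ?thesis unfolding m_def by blast
qed

lemma multilinear_polynomial_identity:
  assumes "multilinear_identity K A m g"
  shows "\<exists>f. polynomial_identity K A f \<and> nc_degree K f = m"
proof -
  let ?P = "permutations_of_set {..<m}"
  define f where "f = (\<lambda>v. if v \<in> ?P then g v else \<zero>\<^bsub>K\<^esub>)"
  have g: "\<And>v. v \<in> ?P \<Longrightarrow> g v \<in> carrier K" and id: "\<And>z. (\<And>i. z i \<in> carrier A) \<Longrightarrow> multilinear_eval A m g z = \<zero>\<^bsub>A\<^esub>"
    using assms unfolding multilinear_identity_def by blast+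
  obtain v0 where v0: "v0 \<in> ?P" "g v0 \<noteq> \<zero>\<^bsub>K\<^esub>" using assms unfolding multilinear_identity_def by blast
  have sub: "{w. f w \<noteq> \<zero>\<^bsub>K\<^esub>} \<subseteq> ?P" by (auto simp: f_def)
  have fin: "finite ?P" by simp
  have fK: "f w \<in> carrier K" for w using g by (simp add: f_def)
  have "polynomial_identity K A f"
    unfolding polynomial_identity_def
  proof (intro conjI allI impI)
    show "f \<in> carrier (free_algebra K UNIV)"
      using finite_subset[OF sub fin] fK by (simp add: free_algebra_def)
    have "f v0 \<noteq> \<zero>\<^bsub>K\<^esub>" using v0 by (simp add: f_def)
    then show "f \<noteq> \<zero>\<^bsub>free_algebra K UNIV\<^esub>" by (auto simp: free_algebra_def fun_eq_iff)
    fix a :: "nat \<Rightarrow> _" assume a: "\<forall>i. a i \<in> carrier A"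
    have "nc_eval K A f a = (\<Oplus>\<^bsub>A\<^esub>w\<in>?P. f w \<odot>\<^bsub>A\<^esub> word_prod A a w)"
      unfolding nc_eval_def by (rule M.finsum_extend[OF fin sub]) (use a fK in auto)
    also have "\<dots> = multilinear_eval A m g a"
      unfolding multilinear_eval_def by (rule M.finsum_cong'[OF refl]) (use a g in \<open>auto simp: f_def\<close>)
    also have "\<dots> = \<zero>\<^bsub>A\<^esub>" by (rule id) (use a in blast)
    finally show "nc_eval K A f a = \<zero>\<^bsub>A\<^esub>" .
  qed
  moreover have "nc_degree K f = m"
  proof -
    have "length w = m" if "w \<in> ?P" for w using length_finite_permutations_of_set[OF that] by simp
    then have "length ` {w. f w \<noteq> \<zero>\<^bsub>K\<^esub>} = {m}" using sub v0 by (auto simp: f_def image_iff)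
    then show ?thesis by (simp add: nc_degree_def)
  qed
  ultimately show ?thesis by blast
qed

lemma polynomial_identity_degrees:
  "(\<exists>f. polynomial_identity K A f \<and> nc_degree K f = m) \<longleftrightarrow> (\<exists>g. multilinear_identity K A m g)"
  using polynomial_identity_multilinear multilinear_polynomial_identity by blast

lemma PI_algebra_iff: "PI_algebra K A \<longleftrightarrow> (\<exists>m g. multilinear_identity K A m g)"
  unfolding PI_algebra_def using polynomial_identity_degrees by blast

end

text \<open>Linear independence of characters: for each \<open>v\<close>, sending \<open>r\<close>
  to \<open>\<theta> [^] E r v\<close> is a character of the additive monoid of functions, and
  distinct \<open>v\<close> give distinct characters because the powers of \<open>\<theta>\<close>
  are distinct.\<close>

lemma (in field) finsum_powers_independent:
  fixes E :: "('j \<Rightarrow> nat) \<Rightarrow> 'i \<Rightarrow> nat"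
  assumes \<theta>: "\<theta> \<in> carrier R" "\<theta> \<noteq> \<zero>" "\<And>i j. \<theta> [^] (i::nat) = \<theta> [^] (j::nat) \<Longrightarrow> i = j"
    and add: "\<And>r r' v. v \<in> X \<Longrightarrow> E (\<lambda>k. r k + r' k) v = E r v + E r' v"
    and X: "finite X" and sep: "\<And>v w. v \<in> X \<Longrightarrow> w \<in> X \<Longrightarrow> (\<And>r. E r v = E r w) \<Longrightarrow> v = w"
    and g: "\<And>v. v \<in> X \<Longrightarrow> g v \<in> carrier R" and sum: "\<And>r. (\<Oplus>v\<in>X. g v \<otimes> \<theta> [^] E r v) = \<zero>"
    and v: "v \<in> X"
  shows "g v = \<zero>"
  using X add sep g sum v
proof (induction X arbitrary: g v rule: finite_induct)
  case (insert u X)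
  note add = insert.prems(1) and sep = insert.prems(2) and g = insert.prems(3) and sum = insert.prems(4)
  have pw [simp]: "\<theta> [^] (k::nat) \<in> carrier R" for k using \<theta> by simp
  have zero_X: "g w = \<zero>" if w: "w \<in> X" for w
  proof -
    obtain r0 where r0: "E r0 w \<noteq> E r0 u" using sep[of w u] w insert.hyps by auto
    \<comment> \<open>Subtracting \<open>\<theta> [^] E r0 u\<close> times the relation at
      \<open>r\<close> from the relation at \<open>r + r0\<close> removes the term of
      \<open>u\<close> and leaves a nonzero multiple of the term of \<open>w\<close>.\<close>
    let ?h = "\<lambda>w. g w \<otimes> (\<theta> [^] E r0 w \<ominus> \<theta> [^] E r0 u)"
    have gX: "\<And>v. v \<in> X \<Longrightarrow> g v \<in> carrier R" "g u \<in> carrier R" using g by auto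
    have "?h w = \<zero>"
    proof (rule insert.IH[of ?h])
      show "(\<Oplus>v\<in>X. ?h v \<otimes> \<theta> [^] E r v) = \<zero>" for r
      proof -
        have 1: "(\<Oplus>v\<in>insert u X. g v \<otimes> \<theta> [^] E (\<lambda>k. r k + r0 k) v) = \<zero>" by (rule sum)
        have 2: "(\<Oplus>v\<in>insert u X. g v \<otimes> \<theta> [^] E r v) \<otimes> (\<ominus> (\<theta> [^] E r0 u)) = \<zero>" using sum by simp
        have 2: "(\<Oplus>v\<in>insert u X. (g v \<otimes> \<theta> [^] E r v) \<otimes> (\<ominus> (\<theta> [^] E r0 u))) = \<zero>"
          using 2 by (subst finsum_ldistr[symmetric]) (use g insert.hyps in auto)
        have "(\<Oplus>v\<in>insert u X. ?h v \<otimes> \<theta> [^] E r v) = (\<Oplus>v\<in>insert u X. g v \<otimes> \<theta> [^] E (\<lambda>k. r k + r0 k) v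
           \<oplus> (g v \<otimes> \<theta> [^] E r v) \<otimes> (\<ominus> (\<theta> [^] E r0 u)))"
        proof (rule finsum_cong'[OF refl])
          fix v assume v: "v \<in> insert u X"
          have "\<theta> [^] E (\<lambda>k. r k + r0 k) v = \<theta> [^] E r v \<otimes> \<theta> [^] E r0 v"
            using add[OF v] \<theta> by (simp add: nat_pow_mult)
          then show "?h v \<otimes> \<theta> [^] E r v = g v \<otimes> \<theta> [^] E (\<lambda>k. r k + r0 k) v
             \<oplus> (g v \<otimes> \<theta> [^] E r v) \<otimes> (\<ominus> (\<theta> [^] E r0 u))"
            using g[OF v] by (simp add: minus_eq l_distr r_distr r_minus l_minus m_ac)
        qed (use g in auto)
        also have "\<dots> = \<zero>"
          using 1 2 g by (subst finsum_addf) auto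
        finally have "?h u \<otimes> \<theta> [^] E r u \<oplus> (\<Oplus>v\<in>X. ?h v \<otimes> \<theta> [^] E r v) = \<zero>"
          using gX insert.hyps by (simp add: Pi_def)
        then show ?thesis using gX by (simp add: minus_eq r_neg)
      qed
    qed (use w add sep gX in auto)
    moreover have "\<theta> [^] E r0 w \<ominus> \<theta> [^] E r0 u \<noteq> \<zero>" using r0 \<theta>(3) pw by (metis r_right_minus_eq)
    ultimately show ?thesis using gX(1)[OF w] by (simp add: integral_iff)
  qed
  have "(\<Oplus>v\<in>insert u X. g v \<otimes> \<theta> [^] E (\<lambda>k. 0) v) = g u \<otimes> \<theta> [^] E (\<lambda>k. 0) u \<oplus> (\<Oplus>v\<in>X. g v \<otimes> \<theta> [^] E (\<lambda>k. 0) v)"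
    using insert.hyps g by (simp add: Pi_def)
  moreover have "(\<Oplus>v\<in>X. g v \<otimes> \<theta> [^] E (\<lambda>k. 0) v) = \<zero>"
    by (rule finsum_zero') (simp add: zero_X)
  ultimately have "g u \<otimes> \<theta> [^] E (\<lambda>k. 0) u = \<zero>" using sum[of "\<lambda>k. 0"] g by simp
  moreover have "\<theta> [^] k \<noteq> \<zero>" for k :: nat by (induction k) (use \<theta> in \<open>auto simp: integral_iff\<close>)
  ultimately have "g u = \<zero>" using g by (simp add: integral_iff)
  then show ?case using zero_X insert.prems(5) by auto
qed simp

text \<open>
  \<open>word_weight r v\<close> counts, with weights \<open>r\<close>, how far the powers of \<open>a\<close> have to be moved to
  the left in the product of the factors \<open>a\<^bsup>r i\<^esup> b\<close>, \<open>i\<close> running through \<open>v\<close>.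
\<close>

fun word_weight :: "(nat \<Rightarrow> nat) \<Rightarrow> nat list \<Rightarrow> nat"
  where "word_weight r [] = 0"
  | "word_weight r (i # v) = sum_list (map r v) + word_weight r v"

lemma word_weight_add: "word_weight (\<lambda>k. r k + r' k) v = word_weight r v + word_weight r' v"
  by (induction v) (auto simp: sum_list_addf)

text \<open>With the indicator function of a letter as weight, the value is the number of letters in
  front of it. It vanishes exactly for the first letter, so the first letters agree; their
  contribution depends only on the set of remaining letters and can be subtracted.\<close>

lemma word_weight_separates:
  assumes "distinct v" "distinct w" "set v = set w" "\<And>r. word_weight r v = word_weight r w"
  shows "v = w"
  using assms
proof (induction v arbitrary: w)
  case (Cons i v)
  then obtain j w' where w: "w = j # w'" by (cases w) auto
  have ind: "word_weight (\<lambda>k. if k = l then 1 else 0) u = 0" if "l \<notin> set u" for l u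
    using that by (induction u) auto
  have "i = j"
  proof (rule ccontr)
    assume "i \<noteq> j"
    then have "i \<in> set w'" using Cons.prems(3) w by auto
    then have "sum_list (map (\<lambda>k. if k = i then 1 else 0 :: nat) w') \<noteq> 0" by auto
    then have "word_weight (\<lambda>k. if k = i then 1 else 0) w \<noteq> 0" by (simp add: w)
    moreover have "word_weight (\<lambda>k. if k = i then 1 else 0) (i # v) = 0"
      using ind[of i v] Cons.prems(1) by auto
    ultimately show False using Cons.prems(4)[of "\<lambda>k. if k = i then 1 else 0"] by metis
  qed
  moreover have "v = w'"
  proof (rule Cons.IH)
    show vw: "distinct v" "distinct w'" using Cons.prems w by auto
    have "i \<notin> set v" "i \<notin> set w'" "insert i (set v) = insert i (set w')"
      using Cons.prems(1-3) \<open>i = j\<close> w by auto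
    then show set_eq: "set v = set w'" by (simp add: insert_ident)
    have "sum_list (map r v) = sum_list (map r w')" for r :: "nat \<Rightarrow> nat"
      using vw set_eq by (simp add: sum_list_distinct_conv_sum_set)
    then show "word_weight r v = word_weight r w'" for r
      using Cons.prems(4)[of r] by (simp add: w)
  qed
  ultimately show ?case by (simp add: w)
qed simp

section \<open>Skew-commuting pairs exclude identities\<close>

context k_algebra
begin

lemma scalar_power_commute:
  assumes ab: "a \<in> carrier A" "b \<in> carrier A" and \<theta>: "\<theta> \<in> carrier K" "b \<otimes>\<^bsub>A\<^esub> a = \<theta> \<odot>\<^bsub>A\<^esub> (a \<otimes>\<^bsub>A\<^esub> b)"
  shows "b \<otimes>\<^bsub>A\<^esub> a [^]\<^bsub>A\<^esub> (k::nat) = (\<theta> [^]\<^bsub>K\<^esub> k) \<odot>\<^bsub>A\<^esub> (a [^]\<^bsub>A\<^esub> k \<otimes>\<^bsub>A\<^esub> b)"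
proof (induction k)
  case (Suc k)
  have "b \<otimes>\<^bsub>A\<^esub> a [^]\<^bsub>A\<^esub> Suc k = (b \<otimes>\<^bsub>A\<^esub> a [^]\<^bsub>A\<^esub> k) \<otimes>\<^bsub>A\<^esub> a" using ab by (simp add: A.m_assoc)
  also have "\<dots> = (\<theta> [^]\<^bsub>K\<^esub> k) \<odot>\<^bsub>A\<^esub> (a [^]\<^bsub>A\<^esub> k \<otimes>\<^bsub>A\<^esub> (b \<otimes>\<^bsub>A\<^esub> a))"
    unfolding Suc using ab \<theta>(1) by (simp add: smult_mult_left A.m_assoc)
  also have "\<dots> = (\<theta> [^]\<^bsub>K\<^esub> Suc k) \<odot>\<^bsub>A\<^esub> (a [^]\<^bsub>A\<^esub> Suc k \<otimes>\<^bsub>A\<^esub> b)"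
    unfolding \<theta>(2) using ab \<theta>(1) by (simp add: smult_mult_right smult_assoc1 A.m_assoc)
  finally show ?case .
qed (use ab in simp)

lemma word_prod_skew_commuting:
  assumes ab: "a \<in> carrier A" "b \<in> carrier A" and \<theta>: "\<theta> \<in> carrier K" "b \<otimes>\<^bsub>A\<^esub> a = \<theta> \<odot>\<^bsub>A\<^esub> (a \<otimes>\<^bsub>A\<^esub> b)"
  shows "word_prod A (\<lambda>k. a [^]\<^bsub>A\<^esub> (r k :: nat) \<otimes>\<^bsub>A\<^esub> b) v =
    (\<theta> [^]\<^bsub>K\<^esub> word_weight r v) \<odot>\<^bsub>A\<^esub> (a [^]\<^bsub>A\<^esub> sum_list (map r v) \<otimes>\<^bsub>A\<^esub> b [^]\<^bsub>A\<^esub> length v)"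
proof (induction v)
  case (Cons i v)
  let ?R = "sum_list (map r v)"
  have "word_prod A (\<lambda>k. a [^]\<^bsub>A\<^esub> r k \<otimes>\<^bsub>A\<^esub> b) (i # v) =
    (\<theta> [^]\<^bsub>K\<^esub> word_weight r v) \<odot>\<^bsub>A\<^esub> (a [^]\<^bsub>A\<^esub> r i \<otimes>\<^bsub>A\<^esub> ((b \<otimes>\<^bsub>A\<^esub> a [^]\<^bsub>A\<^esub> ?R) \<otimes>\<^bsub>A\<^esub> b [^]\<^bsub>A\<^esub> length v))"
    using Cons ab \<theta>(1) by (simp add: smult_mult_right A.m_assoc)
  also have "\<dots> = (\<theta> [^]\<^bsub>K\<^esub> word_weight r (i # v)) \<odot>\<^bsub>A\<^esub> ((a [^]\<^bsub>A\<^esub> r i \<otimes>\<^bsub>A\<^esub> a [^]\<^bsub>A\<^esub> ?R) \<otimes>\<^bsub>A\<^esub> (b \<otimes>\<^bsub>A\<^esub> b [^]\<^bsub>A\<^esub> length v))"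
    unfolding scalar_power_commute[OF ab \<theta>] using ab \<theta>(1)
    by (simp add: smult_mult_left smult_mult_right smult_assoc1[symmetric] A.m_assoc R.nat_pow_mult R.m_comm add.commute)
  also have "b \<otimes>\<^bsub>A\<^esub> b [^]\<^bsub>A\<^esub> length v = b [^]\<^bsub>A\<^esub> length (i # v)"
    using ab A.nat_pow_Suc2[of b "length v"] by simp
  finally show ?case using ab by (simp add: A.nat_pow_mult)
qed (use ab in simp)

lemma skew_commuting_no_identity:
  assumes ab: "a \<in> carrier A" "b \<in> carrier A" and \<theta>: "\<theta> \<in> carrier K" "b \<otimes>\<^bsub>A\<^esub> a = \<theta> \<odot>\<^bsub>A\<^esub> (a \<otimes>\<^bsub>A\<^esub> b)"
    and nz: "\<And>k l. a [^]\<^bsub>A\<^esub> (k::nat) \<otimes>\<^bsub>A\<^esub> b [^]\<^bsub>A\<^esub> (l::nat) \<noteq> \<zero>\<^bsub>A\<^esub>"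
    and free: "\<theta> \<noteq> \<zero>\<^bsub>K\<^esub>" "\<not> root_of_unity K \<theta>"
  shows "\<not> multilinear_identity K A m g"
proof
  assume id: "multilinear_identity K A m g"
  let ?P = "permutations_of_set {..<m}"
  have g: "\<And>v. v \<in> ?P \<Longrightarrow> g v \<in> carrier K"
    and id0: "\<And>z. (\<And>i. z i \<in> carrier A) \<Longrightarrow> multilinear_eval A m g z = \<zero>\<^bsub>A\<^esub>"
    using id unfolding multilinear_identity_def by blast+
  obtain v0 where v0: "v0 \<in> ?P" "g v0 \<noteq> \<zero>\<^bsub>K\<^esub>" using id unfolding multilinear_identity_def by blast
  have P: "set v = {..<m}" "distinct v" "length v = m" if "v \<in> ?P" for v
    using that length_finite_permutations_of_set[OF that] by (auto simp: permutations_of_set_def)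
  have pow: "\<theta> [^]\<^bsub>K\<^esub> i \<noteq> \<theta> [^]\<^bsub>K\<^esub> j" if "i < j" for i j :: nat
  proof
    assume eq: "\<theta> [^]\<^bsub>K\<^esub> i = \<theta> [^]\<^bsub>K\<^esub> j"
    have u: "\<theta> [^]\<^bsub>K\<^esub> k \<in> carrier K - {\<zero>\<^bsub>K\<^esub>}" for k :: nat by (induction k) (use \<theta> free in \<open>auto simp: K.integral_iff\<close>)
    have "\<theta> [^]\<^bsub>K\<^esub> i \<otimes>\<^bsub>K\<^esub> \<theta> [^]\<^bsub>K\<^esub> (j - i) = \<theta> [^]\<^bsub>K\<^esub> i \<otimes>\<^bsub>K\<^esub> \<one>\<^bsub>K\<^esub>"
      using that \<theta>(1) by (simp add: R.nat_pow_mult) (simp only: eq)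
    then have "\<theta> [^]\<^bsub>K\<^esub> (j - i) = \<one>\<^bsub>K\<^esub>" using K.m_lcancel[of "\<theta> [^]\<^bsub>K\<^esub> i" "\<theta> [^]\<^bsub>K\<^esub> (j - i)" "\<one>\<^bsub>K\<^esub>"] u \<theta>(1) by simp
    then show False using free(2) that unfolding root_of_unity_def by (metis zero_less_diff)
  qed
  have "g v0 = \<zero>\<^bsub>K\<^esub>"
  proof (rule K.finsum_powers_independent[of \<theta> ?P word_weight])
    show "\<theta> [^]\<^bsub>K\<^esub> i = \<theta> [^]\<^bsub>K\<^esub> j \<Longrightarrow> i = j" for i j :: nat using pow by (metis linorder_neqE_nat)
    show "v = w" if "v \<in> ?P" "w \<in> ?P" "\<And>r. word_weight r v = word_weight r w" for v w
      by (rule word_weight_separates) (use P that in auto)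
    show "(\<Oplus>\<^bsub>K\<^esub>v\<in>?P. g v \<otimes>\<^bsub>K\<^esub> \<theta> [^]\<^bsub>K\<^esub> word_weight r v) = \<zero>\<^bsub>K\<^esub>" for r
    proof -
      \<comment> \<open>The total powers of \<open>a\<close> and \<open>b\<close> do not depend on
        the order of the factors. The value of the identity is thus a scalar times
        \<open>?t\<close>, and for every \<open>r\<close> this scalar must vanish.\<close>
      let ?z = "\<lambda>k. a [^]\<^bsub>A\<^esub> r k \<otimes>\<^bsub>A\<^esub> b" and ?t = "a [^]\<^bsub>A\<^esub> (\<Sum>k<m. r k) \<otimes>\<^bsub>A\<^esub> b [^]\<^bsub>A\<^esub> m"
      let ?c = "\<Oplus>\<^bsub>K\<^esub>v\<in>?P. g v \<otimes>\<^bsub>K\<^esub> \<theta> [^]\<^bsub>K\<^esub> word_weight r v"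
      have t: "?t \<in> carrier A" using ab by simp
      have cK: "?c \<in> carrier K" using g \<theta>(1) by (intro R.finsum_closed) auto
      have "?c \<odot>\<^bsub>A\<^esub> ?t = (\<Oplus>\<^bsub>A\<^esub>v\<in>?P. (g v \<otimes>\<^bsub>K\<^esub> \<theta> [^]\<^bsub>K\<^esub> word_weight r v) \<odot>\<^bsub>A\<^esub> ?t)"
        by (rule R.finsum_hom[where h = "\<lambda>c. c \<odot>\<^bsub>A\<^esub> ?t"])
          (use g \<theta>(1) t M.abelian_monoid_axioms in \<open>auto simp: smult_l_distr\<close>)
      also have "\<dots> = multilinear_eval A m g ?z"
        unfolding multilinear_eval_def
      proof (rule M.finsum_cong'[OF refl])
        fix v assume v: "v \<in> ?P"
        have "sum_list (map r v) = (\<Sum>k<m. r k)" using P[OF v] by (simp add: sum_list_distinct_conv_sum_set)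
        then show "(g v \<otimes>\<^bsub>K\<^esub> \<theta> [^]\<^bsub>K\<^esub> word_weight r v) \<odot>\<^bsub>A\<^esub> ?t = g v \<odot>\<^bsub>A\<^esub> word_prod A ?z v"
          unfolding word_prod_skew_commuting[OF ab \<theta>] using P[OF v] g[OF v] \<theta>(1) t by (simp add: smult_assoc1)
      qed (use g ab in auto)
      also have "\<dots> = \<zero>\<^bsub>A\<^esub>" by (rule id0) (use ab in simp)
      finally have zero: "?c \<odot>\<^bsub>A\<^esub> ?t = \<zero>\<^bsub>A\<^esub>" .
      show ?thesis
      proof (rule ccontr)
        assume "?c \<noteq> \<zero>\<^bsub>K\<^esub>"
        then have u: "?c \<in> Units K" using cK by (simp add: K.field_Units)
        have "?t = (inv\<^bsub>K\<^esub> ?c \<otimes>\<^bsub>K\<^esub> ?c) \<odot>\<^bsub>A\<^esub> ?t" using u t by simp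
        also have "\<dots> = \<zero>\<^bsub>A\<^esub>" using smult_assoc1[of "inv\<^bsub>K\<^esub> ?c" ?c ?t] u cK t zero by simp
        finally show False using nz by blast
      qed
    qed
  qed (use \<theta> free g v0 word_weight_add in auto)
  then show False using v0 by simp
qed

end

section \<open>Identities of orders in the quantum torus\<close>

context field
begin

lemma root_of_unity_cancel:
  assumes "x \<in> carrier R" "y \<in> carrier R" "root_of_unity R x" "root_of_unity R (x \<otimes> y)"
  shows "root_of_unity R y"
proof -
  obtain k l :: nat where kl: "k > 0" "x [^] k = \<one>" "l > 0" "(x \<otimes> y) [^] l = \<one>"
    using assms unfolding root_of_unity_def by blast
  have "\<one> = (x \<otimes> y) [^] (l * k)" using nat_pow_pow[of "x \<otimes> y" l k] kl assms by simp
  also have "\<dots> = x [^] (k * l) \<otimes> y [^] (l * k)"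
    using assms nat_pow_distrib[of x y "l * k"] by (simp add: mult.commute)
  also have "x [^] (k * l) = \<one>" using nat_pow_pow[of x k l] kl assms by simp
  finally have "y [^] (l * k) = \<one>" using assms by simp
  then show ?thesis using kl unfolding root_of_unity_def by (metis nat_0_less_mult_iff)
qed

lemma common_root_exponent:
  assumes "finite X" "X \<subseteq> carrier R" "\<And>x. x \<in> X \<Longrightarrow> root_of_unity R x"
  shows "\<exists>N::nat. N > 0 \<and> (\<forall>x\<in>X. x [^] N = \<one>)"
  using assms
proof (induction X rule: finite_induct)
  case (insert x X)
  then obtain N k :: nat where N: "N > 0" "\<forall>x\<in>X. x [^] N = \<one>" and k: "k > 0" "x [^] k = \<one>"
    unfolding root_of_unity_def by (metis insert_iff insert_subset)
  have "z [^] (N * k) = \<one>" if "z \<in> X" for z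
    using nat_pow_pow[of z N k] N(2) insert.prems that by auto
  moreover have "x [^] (N * k) = \<one>"
    using nat_pow_pow[of x k N] k insert.prems by (simp add: mult.commute)
  ultimately show ?case using N k by (intro exI[of _ "N * k"]) auto
qed (auto intro: exI[of _ 1])

end

context ring
begin

lemma word_prod_update_add:
  assumes z: "\<And>i. z i \<in> carrier R" and st: "s \<in> carrier R" "t \<in> carrier R" and w: "distinct w" "k \<in> set w"
  shows "word_prod R (z(k := s \<oplus> t)) w = word_prod R (z(k := s)) w \<oplus> word_prod R (z(k := t)) w"
  using w
proof (induction w)
  case (Cons i w)
  have cl: "\<And>u i. u \<in> carrier R \<Longrightarrow> (z(k := u)) i \<in> carrier R" using z by simp
  have wc: "word_prod R (z(k := u)) w \<in> carrier R" if "u \<in> carrier R" for u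
    by (rule word_prod_closed) (rule cl[OF that])
  show ?case
  proof (cases "i = k")
    case True
    have "word_prod R (z(k := u)) w = word_prod R z w" for u
      by (rule word_prod_cong) (use Cons.prems True in auto)
    then show ?thesis using True st z by (simp add: l_distr)
  next
    case False
    then show ?thesis using Cons st z wc by (simp add: r_distr del: fun_upd_apply) (simp add: r_distr)
  qed
qed simp

end

text \<open>The exponent is \<open>m = 2 * M ^ 2\<close>: half of the factors of its factorial,
  those beyond \<open>M ^ 2\<close>, already exceed \<open>M ^ 2\<close> each.\<close>

lemma exists_power_less_fact: "\<exists>m::nat. M ^ m < fact m" for M :: nat
proof -
  have "(k + 1) ^ j \<le> (fact (k + j) :: nat)" for k j :: nat
  proof (induction j)
    case (Suc j)
    have "(k + 1) * (k + 1) ^ j \<le> Suc (k + j) * fact (k + j)" by (rule mult_mono) (use Suc in auto)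
    then show ?case by simp
  qed simp
  from this[of "M ^ 2" "M ^ 2"] have le: "(M ^ 2 + 1) ^ M ^ 2 \<le> (fact (2 * M ^ 2) :: nat)" by (simp add: mult_2)
  show ?thesis
  proof (cases "M = 0")
    case False
    then have "(M ^ 2) ^ M ^ 2 < (M ^ 2 + 1) ^ M ^ 2" by (intro power_strict_mono) auto
    then have "M ^ (2 * M ^ 2) < fact (2 * M ^ 2)" using le by (simp add: power_mult)
    then show ?thesis by blast
  qed (auto intro: exI[of _ 1])
qed

section \<open>Comparison of the identities of an order with those of the torus\<close>

context quantum_torus
begin

lemma twist_mult_nat:
  "twist (\<lambda>i. int k * \<alpha> i) \<beta> = twist \<alpha> \<beta> [^] k" "twist \<beta> (\<lambda>i. int k * \<alpha> i) = twist \<beta> \<alpha> [^] k"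
proof (induction k)
  case 0
  case 1 show ?case using twist_0(1)[of \<beta>] by (simp add: zero_fun_def)
  case 2 show ?case using twist_0(2)[of \<beta>] by (simp add: zero_fun_def)
next
  case (Suc k)
  have s: "(\<lambda>i. int (Suc k) * \<alpha> i) = (\<lambda>i. int k * \<alpha> i) + \<alpha>" by (auto simp: fun_eq_iff algebra_simps)
  case 1 show ?case using Suc.IH unfolding s twist_add by simp
  case 2 show ?case using Suc.IH unfolding s twist_add by simp
qed

lemma twist_pow:
  assumes N: "\<And>i j. i \<in> {1..n} \<Longrightarrow> j \<in> {1..n} \<Longrightarrow> \<Lambda> i j [^] (N::nat) = \<one>"
    and "\<alpha> \<in> exponents n" "\<beta> \<in> exponents n"
  shows "twist \<alpha> \<beta> [^] N = \<one>"
proof -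
  have neg: "u [^] N = \<one>" if "u \<in> carrier K" "v \<in> carrier K" "u \<otimes> v = \<one>" "v [^] N = \<one>" for u v
    using that nat_pow_distrib[of u v N] by simp
  show ?thesis
    using assms(2)
  proof (induction \<alpha> rule: exponents_induct)
    case (unit_vec i)
    show ?case using assms(3)
    proof (induction \<beta> rule: exponents_induct)
      case (unit_vec j)
      then show ?case using \<open>i \<in> {1..n}\<close> N by (simp add: twist_unit_vec)
    next
      case (minus \<beta>)
      show ?case by (rule neg[OF _ _ _ minus]) (simp_all add: twist_add(2)[symmetric] del: uminus_apply plus_fun_apply zero_fun_apply)
    qed (simp_all add: twist_add nat_pow_distrib del: uminus_apply plus_fun_apply zero_fun_apply)
  next
    case (minus \<alpha>)
    show ?case by (rule neg[OF _ _ _ minus]) (simp_all add: twist_add(1)[symmetric] del: uminus_apply plus_fun_apply zero_fun_apply)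
  qed (simp_all add: twist_add nat_pow_distrib del: uminus_apply plus_fun_apply zero_fun_apply)
qed

text \<open>Injectivity of \<open>\<Phi>\<close> pulls the axioms back from the torus. In this way
  the quotient that defines quantum affine space becomes an algebra as soon as it is known to be an
  order.\<close>

lemma order_k_algebra:
  assumes "torus_order B \<Phi>"
  shows "k_algebra K B"
proof -
  interpret B: quantum_torus_order K n \<Lambda> T B \<Phi> by unfold_locales (use assms in \<open>auto simp: T_def\<close>)
  interpret TK: k_algebra K T by (rule TM.T_k_algebra)
  note h = ring_hom_closed[OF B.\<Phi>_hom] ring_hom_add[OF B.\<Phi>_hom] ring_hom_mult[OF B.\<Phi>_hom] ring_hom_one[OF B.\<Phi>_hom]
    B.\<Phi>_smult B.smult_in
  note eq = inj_onD[OF B.\<Phi>_inj]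
  have "module K B"
  proof (rule moduleI)
    show "abelian_group B" "cring K" by (rule B.B.abelian_group_axioms, rule cring_axioms)
  qed (auto intro!: eq simp: h TM.M.smult_l_distr TM.M.smult_r_distr TM.M.smult_assoc1)
  then show ?thesis
    unfolding k_algebra_def k_algebra_axioms_def using field_axioms B.B_ring
    by (auto intro!: eq simp: h TK.smult_mult_left TK.smult_mult_right)
qed

lemma order_multilinear_eval:
  assumes "torus_order B \<Phi>" and g: "\<And>v. v \<in> permutations_of_set {..<m} \<Longrightarrow> g v \<in> carrier K"
    and z: "\<And>i. z i \<in> carrier B"
  shows "\<Phi> (multilinear_eval B m g z) = multilinear_eval T m g (\<lambda>i. \<Phi> (z i))"
proof -
  interpret B: quantum_torus_order K n \<Lambda> T B \<Phi> by unfold_locales (use assms in \<open>auto simp: T_def\<close>)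
  have w: "\<Phi> (word_prod B z v) = word_prod T (\<lambda>i. \<Phi> (z i)) v" for v
    by (induction v) (use z in \<open>auto simp: ring_hom_one[OF B.\<Phi>_hom] ring_hom_mult[OF B.\<Phi>_hom]\<close>)
  have cl: "\<Phi> b \<in> carrier T" if "b \<in> carrier B" for b using ring_hom_closed[OF B.\<Phi>_hom that] .
  have "\<Phi> (multilinear_eval B m g z) = (\<Oplus>\<^bsub>T\<^esub>v\<in>permutations_of_set {..<m}. \<Phi> (g v \<odot>\<^bsub>B\<^esub> word_prod B z v))"
    unfolding multilinear_eval_def
    by (rule B.B.finsum_hom[where h = \<Phi>])
      (use z g B.smult_in cl TM.TA.abelian_monoid_axioms B.\<Phi>_zero ring_hom_add[OF B.\<Phi>_hom] in auto)
  also have "\<dots> = multilinear_eval T m g (\<lambda>i. \<Phi> (z i))"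
    unfolding multilinear_eval_def
    by (rule TM.TA.finsum_cong'[OF refl]) (use z g cl in \<open>auto simp: B.\<Phi>_smult w\<close>)
  finally show ?thesis .
qed

lemma central_power:
  assumes N: "\<And>i j. i \<in> {1..n} \<Longrightarrow> j \<in> {1..n} \<Longrightarrow> \<Lambda> i j [^] (N::nat) = \<one>"
    and \<beta>: "\<beta> \<in> exponents n" and t: "t \<in> carrier T"
  shows "single K \<one> (\<lambda>i. int N * \<beta> i) \<otimes>\<^bsub>T\<^esub> t = t \<otimes>\<^bsub>T\<^esub> single K \<one> (\<lambda>i. int N * \<beta> i)"
proof
  fix \<gamma>
  let ?b = "\<lambda>i. int N * \<beta> i"
  have b: "?b \<in> exponents n" using \<beta> by (auto simp: exponents_def)
  have v: "t \<delta> \<in> carrier K" for \<delta> by (rule TM.T_val[OF t])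
  have tw: "twist u v [^] N = \<one>" if "u \<in> exponents n" "v \<in> exponents n" for u v
    by (rule twist_pow[OF N that])
  show "(single K \<one> ?b \<otimes>\<^bsub>T\<^esub> t) \<gamma> = (t \<otimes>\<^bsub>T\<^esub> single K \<one> ?b) \<gamma>"
    unfolding single_times[OF one_closed b t] times_single[OF one_closed b t]
  proof (cases "t (\<gamma> - ?b) = \<zero>")
    case False
    then have "\<gamma> - ?b \<in> exponents n" by (rule TM.T_supp[OF t])
    then show "twist ?b (\<gamma> - ?b) \<otimes> (\<one> \<otimes> t (\<gamma> - ?b)) = twist (\<gamma> - ?b) ?b \<otimes> (t (\<gamma> - ?b) \<otimes> \<one>)"
      unfolding twist_mult_nat using v tw[OF \<beta>] tw[OF _ \<beta>] by simp
  qed simp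
qed

lemma word_prod_central:
  assumes c: "c \<in> carrier T" "\<And>t. t \<in> carrier T \<Longrightarrow> c \<otimes>\<^bsub>T\<^esub> t = t \<otimes>\<^bsub>T\<^esub> c" and z: "\<And>i. z i \<in> carrier T"
  shows "word_prod T (\<lambda>i. c \<otimes>\<^bsub>T\<^esub> z i) v = c [^]\<^bsub>T\<^esub> length v \<otimes>\<^bsub>T\<^esub> word_prod T z v"
proof (induction v)
  case (Cons i v)
  have "(c \<otimes>\<^bsub>T\<^esub> z i) \<otimes>\<^bsub>T\<^esub> (c [^]\<^bsub>T\<^esub> length v \<otimes>\<^bsub>T\<^esub> word_prod T z v)
    = c \<otimes>\<^bsub>T\<^esub> (c [^]\<^bsub>T\<^esub> length v \<otimes>\<^bsub>T\<^esub> z i) \<otimes>\<^bsub>T\<^esub> word_prod T z v"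
  proof -
    have "c [^]\<^bsub>T\<^esub> k \<otimes>\<^bsub>T\<^esub> z i = z i \<otimes>\<^bsub>T\<^esub> c [^]\<^bsub>T\<^esub> k" for k :: nat
    proof (induction k)
      case (Suc k)
      have "c [^]\<^bsub>T\<^esub> Suc k \<otimes>\<^bsub>T\<^esub> z i = c [^]\<^bsub>T\<^esub> k \<otimes>\<^bsub>T\<^esub> (z i \<otimes>\<^bsub>T\<^esub> c)"
        using c z by (simp add: TM.T.m_assoc)
      also have "\<dots> = z i \<otimes>\<^bsub>T\<^esub> c [^]\<^bsub>T\<^esub> Suc k"
        using c(1) z Suc by (simp add: TM.T.m_assoc[symmetric])
      finally show ?case .
    qed (use z in simp)
    then show ?thesis using c(1) z by (simp add: TM.T.m_assoc)
  qed
  also have "\<dots> = c [^]\<^bsub>T\<^esub> length (i # v) \<otimes>\<^bsub>T\<^esub> word_prod T z (i # v)"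
    using c(1) z TM.T.nat_pow_Suc2[of c "length v"] by (simp add: TM.T.m_assoc)
  finally show ?case by (simp add: Cons)
qed simp

lemma order_multilinear_identity:
  assumes o: "torus_order B \<Phi>"
    and N: "N > 0" "\<And>i j. i \<in> {1..n} \<Longrightarrow> j \<in> {1..n} \<Longrightarrow> \<Lambda> i j [^] (N::nat) = \<one>"
  shows "multilinear_identity K B m g \<longleftrightarrow> multilinear_identity K T m g"
proof -
  interpret B: quantum_torus_order K n \<Lambda> T B \<Phi> by unfold_locales (use assms in \<open>auto simp: T_def\<close>)
  interpret TK: k_algebra K T by (rule TM.T_k_algebra)
  interpret BK: k_algebra K B by (rule order_k_algebra[OF o])
  let ?P = "permutations_of_set {..<m}"
  have "(\<forall>z. (\<forall>i. z i \<in> carrier B) \<longrightarrow> multilinear_eval B m g z = \<zero>\<^bsub>B\<^esub>) \<longleftrightarrow>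
    (\<forall>z. (\<forall>i. z i \<in> carrier T) \<longrightarrow> multilinear_eval T m g z = \<zero>\<^bsub>T\<^esub>)" (is "?L \<longleftrightarrow> ?R")
    if g: "\<And>v. v \<in> ?P \<Longrightarrow> g v \<in> carrier K"
  proof
    assume ?R
    show ?L
    proof (intro allI impI)
      fix z :: "nat \<Rightarrow> _" assume z: "\<forall>i. z i \<in> carrier B"
      have "\<Phi> (multilinear_eval B m g z) = \<Phi> \<zero>\<^bsub>B\<^esub>"
        using order_multilinear_eval[OF o g, where z = z] z \<open>?R\<close> ring_hom_closed[OF B.\<Phi>_hom] B.\<Phi>_zero by simp
      moreover have "multilinear_eval B m g z \<in> carrier B"
        unfolding multilinear_eval_def by (rule B.B.finsum_closed) (use z g B.smult_in in auto)
      ultimately show "multilinear_eval B m g z = \<zero>\<^bsub>B\<^esub>" using inj_onD[OF B.\<Phi>_inj] by simp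
    qed
  next
    assume ?L
    show ?R
    proof (intro allI impI)
      fix z0 :: "nat \<Rightarrow> _" assume z0: "\<forall>i. z0 i \<in> carrier T"
      \<comment> \<open>A multilinear identity only sees the first \<open>m\<close> arguments. The
        remaining ones are set to one to leave finitely many values, which have a common
        denominator.\<close>
      define z where "z = (\<lambda>i. if i < m then z0 i else \<one>\<^bsub>T\<^esub>)"
      have z: "z i \<in> carrier T" for i using z0 by (simp add: z_def)
      have "finite (range z)" by (rule finite_subset[of _ "insert \<one>\<^bsub>T\<^esub> (z0 ` {..<m})"]) (auto simp: z_def)
      moreover have "range z \<subseteq> carrier T" using z by auto
      ultimately obtain \<beta> where \<beta>S: "\<beta> \<in> B.S" and all: "\<forall>t\<in>range z. single K \<one> \<beta> \<otimes>\<^bsub>T\<^esub> t \<in> \<Phi> ` carrier B \<and> t \<otimes>\<^bsub>T\<^esub> single K \<one> \<beta> \<in> \<Phi> ` carrier B"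
        by (rule B.denominators[THEN bexE])
      have "single K \<one> \<beta> \<otimes>\<^bsub>T\<^esub> z i \<in> \<Phi> ` carrier B" for i using bspec[OF all, of "z i"] by simp
      note \<beta> = \<beta>S this
      \<comment> \<open>The denominator \<open>y^\<beta>\<close> need not be central, but the
        monomial with exponent \<open>N \<beta>\<close> is. The additional factor, a multiple of the
        monomial at \<open>(N - 1) \<beta>\<close>, again lies in the image, so \<open>c\<close>
        clears denominators as well.\<close>
      define c where "c = single K \<one> (\<lambda>i. int N * \<beta> i)"
      have \<beta>n: "\<beta> \<in> exponents n" "(\<lambda>i. int N * \<beta> i) \<in> exponents n" "(\<lambda>i. int (N - 1) * \<beta> i) \<in> exponents n"
        using B.S_exponents[OF \<beta>(1)] B.S_exponents[OF B.S_mult[OF \<beta>(1)]] by auto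
      have c: "c \<in> carrier T" "c \<in> Units T" using \<beta>n by (auto simp: c_def intro!: single_Units)
      have "(\<lambda>i. int N * \<beta> i) = (\<lambda>i. int (N - 1) * \<beta> i) + \<beta>" using N(1) by (auto simp: fun_eq_iff algebra_simps)
      then have c_split: "c = single K (inv (twist (\<lambda>i. int (N - 1) * \<beta> i) \<beta>)) (\<lambda>i. int (N - 1) * \<beta> i) \<otimes>\<^bsub>T\<^esub> single K \<one> \<beta>"
        unfolding c_def using \<beta>n by (subst TM.single_mult) (simp_all only: Units_inv_closed twist_Units one_closed r_one Units_r_inv)
      have im: "c \<otimes>\<^bsub>T\<^esub> z i \<in> \<Phi> ` carrier B" for i
      proof -
        have "c \<otimes>\<^bsub>T\<^esub> z i = single K (inv (twist (\<lambda>i. int (N - 1) * \<beta> i) \<beta>)) (\<lambda>i. int (N - 1) * \<beta> i) \<otimes>\<^bsub>T\<^esub> (single K \<one> \<beta> \<otimes>\<^bsub>T\<^esub> z i)"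
          unfolding c_split using \<beta>n z by (intro TM.T.m_assoc) auto
        then show ?thesis using B.image_closed(1)[OF B.single_in_image[OF B.S_mult[OF \<beta>(1)]] \<beta>(2)] by simp
      qed
      define y where "y = (\<lambda>i. inv_into (carrier B) \<Phi> (c \<otimes>\<^bsub>T\<^esub> z i))"
      have y: "y i \<in> carrier B" "\<Phi> (y i) = c \<otimes>\<^bsub>T\<^esub> z i" for i
        unfolding y_def by (rule inv_into_into[OF im], rule f_inv_into_f[OF im])
      have wT: "word_prod T z v \<in> carrier T" for v using z by simp
      have central: "\<And>t. t \<in> carrier T \<Longrightarrow> c \<otimes>\<^bsub>T\<^esub> t = t \<otimes>\<^bsub>T\<^esub> c"
        unfolding c_def by (rule central_power[OF N(2) \<beta>n(1)])
      have ev: "multilinear_eval T m g z \<in> carrier T"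
        unfolding multilinear_eval_def by (rule TM.TA.finsum_closed) (use z g in auto)
      have "c [^]\<^bsub>T\<^esub> m \<otimes>\<^bsub>T\<^esub> multilinear_eval T m g z = (\<Oplus>\<^bsub>T\<^esub>v\<in>?P. c [^]\<^bsub>T\<^esub> m \<otimes>\<^bsub>T\<^esub> (g v \<odot>\<^bsub>T\<^esub> word_prod T z v))"
        unfolding multilinear_eval_def by (rule TM.T.finsum_rdistr) (use c z g in auto)
      also have "\<dots> = multilinear_eval T m g (\<lambda>i. c \<otimes>\<^bsub>T\<^esub> z i)"
        unfolding multilinear_eval_def
      proof (rule TM.TA.finsum_cong'[OF refl])
        fix v assume v: "v \<in> ?P"
        then have len: "length v = m" using length_finite_permutations_of_set by fastforce
        have wc: "word_prod T (\<lambda>i. c \<otimes>\<^bsub>T\<^esub> z i) v = c [^]\<^bsub>T\<^esub> m \<otimes>\<^bsub>T\<^esub> word_prod T z v"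
          by (subst len[symmetric], rule word_prod_central) (rule c(1), rule central, assumption, rule z)
        show "c [^]\<^bsub>T\<^esub> m \<otimes>\<^bsub>T\<^esub> (g v \<odot>\<^bsub>T\<^esub> word_prod T z v) = g v \<odot>\<^bsub>T\<^esub> word_prod T (\<lambda>i. c \<otimes>\<^bsub>T\<^esub> z i) v"
          unfolding wc using c(1) wT g[OF v] by (simp add: TK.smult_mult_right)
      qed (use c z g in auto)
      also have "\<dots> = \<Phi> (multilinear_eval B m g y)" using order_multilinear_eval[OF o g y(1)] by (simp add: y(2))
      also have "\<dots> = \<zero>\<^bsub>T\<^esub>" using \<open>?L\<close> y(1) B.\<Phi>_zero by simp
      finally have eq0: "c [^]\<^bsub>T\<^esub> m \<otimes>\<^bsub>T\<^esub> multilinear_eval T m g z = \<zero>\<^bsub>T\<^esub>" .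
      have "c [^]\<^bsub>T\<^esub> m \<in> Units T" using TM.T.Units_pow_closed[OF c(2)] .
      then have "multilinear_eval T m g z = \<zero>\<^bsub>T\<^esub>"
        using eq0 ev c(1) TM.T.Units_l_cancel[of "c [^]\<^bsub>T\<^esub> m" "multilinear_eval T m g z" "\<zero>\<^bsub>T\<^esub>"] by simp
      moreover have "multilinear_eval T m g z = multilinear_eval T m g z0"
        unfolding multilinear_eval_def
      proof (rule TM.TA.finsum_cong'[OF refl])
        fix v assume "v \<in> ?P"
        then have "word_prod T z v = word_prod T z0 v"
          by (intro word_prod_cong) (auto simp: z_def permutations_of_set_def)
        then show "g v \<odot>\<^bsub>T\<^esub> word_prod T z v = g v \<odot>\<^bsub>T\<^esub> word_prod T z0 v" by simp
      qed (use z0 g in auto)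
      ultimately show "multilinear_eval T m g z0 = \<zero>\<^bsub>T\<^esub>" by simp
    qed
  qed
  then show ?thesis unfolding multilinear_identity_def by blast
qed

text \<open>For exponents of monomials in the image, a commutation factor that is not a root of
  unity would exclude identities. Every exponent is a difference of two of these, so cancellation of
  roots of unity extends the claim to arbitrary exponents, in one argument of \<open>comm\<close>
  after the other.\<close>

lemma order_identity_roots_of_unity:
  assumes o: "torus_order B \<Phi>" and id: "multilinear_identity K B m g" and ij: "i \<in> {1..n}" "j \<in> {1..n}"
  shows "root_of_unity K (\<Lambda> i j)"
proof -
  interpret B: quantum_torus_order K n \<Lambda> T B \<Phi> by unfold_locales (use assms in \<open>auto simp: T_def\<close>)
  interpret BK: k_algebra K B by (rule order_k_algebra[OF o])
  interpret \<Phi>: ring_hom_ring B T \<Phi>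
    using B.\<Phi>_hom B.B_ring TM.T_ring by (simp add: ring_hom_ring_def ring_hom_ring_axioms_def)
  have pow: "\<Phi> (b [^]\<^bsub>B\<^esub> k) = \<Phi> b [^]\<^bsub>T\<^esub> k" if "b \<in> carrier B" for b and k :: nat
    by (induction k) (use that in auto)
  have S: "root_of_unity K (comm \<beta> \<gamma>)" if "\<beta> \<in> B.S" "\<gamma> \<in> B.S" for \<beta> \<gamma>
  proof (rule ccontr)
    assume nr: "\<not> root_of_unity K (comm \<beta> \<gamma>)"
    obtain b where b: "b \<in> carrier B" "\<Phi> b = single K \<one> \<beta>" using \<open>\<beta> \<in> B.S\<close> by (auto simp: B.S_def)
    obtain a where a: "a \<in> carrier B" "\<Phi> a = single K \<one> \<gamma>" using \<open>\<gamma> \<in> B.S\<close> by (auto simp: B.S_def)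
    note ex = B.S_exponents[OF that(1)] B.S_exponents[OF that(2)]
    have "\<Phi> (b \<otimes>\<^bsub>B\<^esub> a) = \<Phi> (comm \<beta> \<gamma> \<odot>\<^bsub>B\<^esub> (a \<otimes>\<^bsub>B\<^esub> b))"
      using a b ex by (simp add: B.\<Phi>_smult TM.single_mult TM.T_smult_single comm_twist add.commute[of \<beta>])
    then have rel: "b \<otimes>\<^bsub>B\<^esub> a = comm \<beta> \<gamma> \<odot>\<^bsub>B\<^esub> (a \<otimes>\<^bsub>B\<^esub> b)"
      by (rule inj_onD[OF B.\<Phi>_inj]) (use a b in auto)
    have "a [^]\<^bsub>B\<^esub> k \<otimes>\<^bsub>B\<^esub> b [^]\<^bsub>B\<^esub> l \<noteq> \<zero>\<^bsub>B\<^esub>" for k l :: nat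
    proof
      assume "a [^]\<^bsub>B\<^esub> k \<otimes>\<^bsub>B\<^esub> b [^]\<^bsub>B\<^esub> l = \<zero>\<^bsub>B\<^esub>"
      then have "\<Phi> (a [^]\<^bsub>B\<^esub> k \<otimes>\<^bsub>B\<^esub> b [^]\<^bsub>B\<^esub> l) = \<zero>\<^bsub>T\<^esub>" by (simp only: B.\<Phi>_zero)
      then have "single K \<one> \<gamma> [^]\<^bsub>T\<^esub> k \<otimes>\<^bsub>T\<^esub> single K \<one> \<beta> [^]\<^bsub>T\<^esub> l = \<zero>\<^bsub>T\<^esub>"
        using a b pow[OF a(1)] pow[OF b(1)] by simp
      moreover have "single K \<one> \<gamma> [^]\<^bsub>T\<^esub> k \<otimes>\<^bsub>T\<^esub> single K \<one> \<beta> [^]\<^bsub>T\<^esub> l \<in> Units T"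
        using ex by (intro TM.T.Units_m_closed TM.T.Units_pow_closed single_Units) auto
      ultimately have "\<zero>\<^bsub>T\<^esub> \<in> Units T" by simp
      then have "\<one>\<^bsub>T\<^esub> = \<zero>\<^bsub>T\<^esub>" unfolding Units_def by auto
      then have "\<one>\<^bsub>T\<^esub> (0 :: nat \<Rightarrow> int) = \<zero>\<^bsub>T\<^esub> (0 :: nat \<Rightarrow> int)" by simp
      then show False by (simp add: TM.T_one TM.T_simps single_def del: zero_fun_apply)
    qed
    then show False
      using BK.skew_commuting_no_identity[OF a(1) b(1) comm_in rel _ comm_nz nr] id by blast
  qed
  have 1: "root_of_unity K (comm \<alpha> \<gamma>)" if \<alpha>: "\<alpha> \<in> exponents n" and \<gamma>: "\<gamma> \<in> B.S" for \<alpha> \<gamma>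
  proof -
    obtain \<beta> where \<beta>: "\<beta> \<in> B.S" "\<beta> + \<alpha> \<in> B.S" using B.monomials[OF \<alpha>] \<alpha> by (auto simp: B.S_def)
    show ?thesis
      using root_of_unity_cancel[OF comm_in comm_in S[OF \<beta>(1) \<gamma>], of \<alpha> \<gamma>] S[OF \<beta>(2) \<gamma>] by (simp add: comm_add)
  qed
  have 2: "root_of_unity K (comm \<alpha> \<gamma>)" if \<alpha>: "\<alpha> \<in> exponents n" and \<gamma>: "\<gamma> \<in> exponents n" for \<alpha> \<gamma>
  proof -
    obtain \<beta> where \<beta>: "\<beta> \<in> B.S" "\<beta> + \<gamma> \<in> B.S" using B.monomials[OF \<gamma>] \<gamma> by (auto simp: B.S_def)
    show ?thesis
      using root_of_unity_cancel[OF comm_in comm_in 1[OF \<alpha> \<beta>(1)], of \<alpha> \<gamma>] 1[OF \<alpha> \<beta>(2)] by (simp add: comm_add)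
  qed
  show ?thesis using 2[of "unit_vec i" "unit_vec j"] comm_unit_vec[OF ij] ij by auto
qed

section \<open>A multilinear identity of the torus\<close>

fun word_twist :: "(nat \<Rightarrow> nat \<Rightarrow> int) \<Rightarrow> nat list \<Rightarrow> 'a"
  where "word_twist \<alpha> [] = \<one>"
  | "word_twist \<alpha> (i # v) = twist (\<alpha> i) (sum_list (map \<alpha> v)) \<otimes> word_twist \<alpha> v"

lemma word_twist_in [simp]: "word_twist \<alpha> v \<in> carrier K"
  by (induction v) auto

lemma word_twist_nz [simp]: "word_twist \<alpha> v \<noteq> \<zero>"
  by (induction v) (auto simp: integral_iff)

lemma sum_list_exponents:
  "(\<And>i. i \<in> set v \<Longrightarrow> \<alpha> i \<in> exponents n) \<Longrightarrow> sum_list (map \<alpha> v) \<in> exponents n"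
  by (induction v) (auto simp del: plus_fun_apply zero_fun_apply)

lemma word_prod_single:
  assumes "\<And>i. i \<in> set v \<Longrightarrow> \<alpha> i \<in> exponents n"
  shows "word_prod T (\<lambda>i. single K \<one> (\<alpha> i)) v = single K (word_twist \<alpha> v) (sum_list (map \<alpha> v))"
  using assms
proof (induction v)
  case (Cons i v)
  have "sum_list (map \<alpha> v) \<in> exponents n" by (rule sum_list_exponents) (use Cons.prems in simp)
  then have "single K \<one> (\<alpha> i) \<otimes>\<^bsub>T\<^esub> single K (word_twist \<alpha> v) (sum_list (map \<alpha> v)) =
    single K (word_twist \<alpha> (i # v)) (sum_list (map \<alpha> (i # v)))"
    using Cons.prems by (subst TM.single_mult) simp_all
  then show ?case using Cons by (simp del: plus_fun_apply)
qed (simp add: TM.T_one del: zero_fun_apply)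

text \<open>The twist is bimultiplicative with values in the \<open>N\<close>-th roots of unity.
  Hence each argument enters only through its residues, of which there are
  \<open>N ^ n\<close>.\<close>

lemma twist_mod:
  assumes N: "N > 0" "\<And>i j. i \<in> {1..n} \<Longrightarrow> j \<in> {1..n} \<Longrightarrow> \<Lambda> i j [^] (N::nat) = \<one>"
    and ex: "u \<in> exponents n" "u' \<in> exponents n" "v \<in> exponents n" "v' \<in> exponents n"
    and dv: "\<And>k. int N dvd u k - u' k" "\<And>k. int N dvd v k - v' k"
  shows "twist u v = twist u' v'"
proof -
  define p q where "p = (\<lambda>k. (u k - u' k) div int N)" and "q = (\<lambda>k. (v k - v' k) div int N)"
  have pq: "p \<in> exponents n" "q \<in> exponents n" using ex by (auto simp: exponents_def p_def q_def)
  have u: "u = u' + (\<lambda>k. int N * p k)" and v: "v = v' + (\<lambda>k. int N * q k)"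
    using dv by (auto simp: fun_eq_iff p_def q_def)
  have tw: "twist s t [^] N = \<one>" if "s \<in> exponents n" "t \<in> exponents n" for s t
    by (rule twist_pow[OF N(2) that])
  have "twist u v = twist u' v" unfolding u twist_add(1) twist_mult_nat(1) tw[OF pq(1) ex(3)] by simp
  also have "\<dots> = twist u' v'" unfolding v twist_add(2) twist_mult_nat(2) tw[OF ex(2) pq(2)] by simp
  finally show ?thesis .
qed

lemma word_twist_mod:
  assumes N: "N > 0" "\<And>i j. i \<in> {1..n} \<Longrightarrow> j \<in> {1..n} \<Longrightarrow> \<Lambda> i j [^] (N::nat) = \<one>"
    and ex: "\<And>i. i \<in> set v \<Longrightarrow> \<alpha> i \<in> exponents n" "\<And>i. i \<in> set v \<Longrightarrow> \<alpha>' i \<in> exponents n"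
    and dv: "\<And>i k. i \<in> set v \<Longrightarrow> int N dvd \<alpha> i k - \<alpha>' i k"
  shows "word_twist \<alpha> v = word_twist \<alpha>' v"
  using ex dv
proof (induction v)
  case (Cons i v)
  have dv: "int N dvd sum_list (map \<alpha> v) k - sum_list (map \<alpha>' v) k" for k
    using Cons.prems(3)
  proof (induction v)
    case (Cons j v)
    have "int N dvd (\<alpha> j k - \<alpha>' j k) + (sum_list (map \<alpha> v) k - sum_list (map \<alpha>' v) k)"
      using Cons by (intro dvd_add) auto
    then show ?case by (simp add: algebra_simps)
  qed simp
  have "twist (\<alpha> i) (sum_list (map \<alpha> v)) = twist (\<alpha>' i) (sum_list (map \<alpha>' v))"
    by (rule twist_mod[OF N]) (use Cons.prems dv in \<open>auto intro!: sum_list_exponents\<close>)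
  then show ?case using Cons by simp
qed simp

lemma multilinear_eval_linear:
  assumes z: "\<And>i. z i \<in> carrier T" and k: "k < m" and g: "\<And>v. v \<in> permutations_of_set {..<m} \<Longrightarrow> g v \<in> carrier K"
  shows "multilinear_eval T m g (z(k := \<zero>\<^bsub>T\<^esub>)) = \<zero>\<^bsub>T\<^esub>"
    "s \<in> carrier T \<Longrightarrow> t \<in> carrier T \<Longrightarrow> multilinear_eval T m g (z(k := s \<oplus>\<^bsub>T\<^esub> t)) =
      multilinear_eval T m g (z(k := s)) \<oplus>\<^bsub>T\<^esub> multilinear_eval T m g (z(k := t))"
    "a \<in> carrier K \<Longrightarrow> t \<in> carrier T \<Longrightarrow> multilinear_eval T m g (z(k := a \<odot>\<^bsub>T\<^esub> t)) =
      a \<odot>\<^bsub>T\<^esub> multilinear_eval T m g (z(k := t))"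
proof -
  interpret TK: k_algebra K T by (rule TM.T_k_algebra)
  let ?P = "permutations_of_set {..<m}"
  have P: "distinct v" "k \<in> set v" if "v \<in> ?P" for v using that k by (auto simp: permutations_of_set_def)
  have zc: "(z(k := t)) i \<in> carrier T" if "t \<in> carrier T" for t i using that z by simp
  have wc: "word_prod T (z(k := t)) v \<in> carrier T" if "t \<in> carrier T" for t v
    by (rule TM.T.word_prod_closed) (rule zc[OF that])
  show "multilinear_eval T m g (z(k := \<zero>\<^bsub>T\<^esub>)) = \<zero>\<^bsub>T\<^esub>"
    unfolding multilinear_eval_def
  proof (rule TM.TA.finsum_zero')
    fix v assume v: "v \<in> ?P"
    have "word_prod T (z(k := \<zero>\<^bsub>T\<^esub>)) v = \<zero>\<^bsub>T\<^esub>"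
      by (rule TM.T.word_prod_zero[OF zc P(2)[OF v]]) simp_all
    then show "g v \<odot>\<^bsub>T\<^esub> word_prod T (z(k := \<zero>\<^bsub>T\<^esub>)) v = \<zero>\<^bsub>T\<^esub>" using g[OF v] by simp
  qed
  show "multilinear_eval T m g (z(k := s \<oplus>\<^bsub>T\<^esub> t)) =
      multilinear_eval T m g (z(k := s)) \<oplus>\<^bsub>T\<^esub> multilinear_eval T m g (z(k := t))"
    if st: "s \<in> carrier T" "t \<in> carrier T"
  proof -
    have "multilinear_eval T m g (z(k := s \<oplus>\<^bsub>T\<^esub> t)) =
      (\<Oplus>\<^bsub>T\<^esub>v\<in>?P. g v \<odot>\<^bsub>T\<^esub> word_prod T (z(k := s)) v \<oplus>\<^bsub>T\<^esub> g v \<odot>\<^bsub>T\<^esub> word_prod T (z(k := t)) v)"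
      unfolding multilinear_eval_def
      by (rule TM.TA.finsum_cong'[OF refl])
        (use g wc[OF st(1)] wc[OF st(2)] P TM.T.word_prod_update_add[of z, OF z st] in \<open>auto simp: TM.M.smult_r_distr simp del: fun_upd_apply\<close>)
    then show ?thesis unfolding multilinear_eval_def
      using TM.TA.finsum_addf[of "\<lambda>v. g v \<odot>\<^bsub>T\<^esub> word_prod T (z(k := s)) v" ?P "\<lambda>v. g v \<odot>\<^bsub>T\<^esub> word_prod T (z(k := t)) v"]
        g wc[OF st(1)] wc[OF st(2)] by (simp add: Pi_def del: fun_upd_apply)
  qed
  show "multilinear_eval T m g (z(k := a \<odot>\<^bsub>T\<^esub> t)) = a \<odot>\<^bsub>T\<^esub> multilinear_eval T m g (z(k := t))"
    if at: "a \<in> carrier K" "t \<in> carrier T"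
  proof -
    have upd: "word_prod T (z(k := a \<odot>\<^bsub>T\<^esub> t)) v = a \<odot>\<^bsub>T\<^esub> word_prod T (z(k := t)) v"
      if "distinct v" "k \<in> set v" for v
      using that
    proof (induction v)
      case (Cons i v)
      show ?case
      proof (cases "i = k")
        case True
        have "word_prod T (z(k := u)) v = word_prod T z v" for u
          by (rule word_prod_cong) (use Cons.prems True in auto)
        then show ?thesis using True at z by (simp add: TK.smult_mult_left)
      next
        case False
        then have "word_prod T (z(k := a \<odot>\<^bsub>T\<^esub> t)) (i # v) = z i \<otimes>\<^bsub>T\<^esub> word_prod T (z(k := a \<odot>\<^bsub>T\<^esub> t)) v"
          "word_prod T (z(k := t)) (i # v) = z i \<otimes>\<^bsub>T\<^esub> word_prod T (z(k := t)) v" by simp_all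
        then show ?thesis
            using False Cons TK.smult_mult_right[OF at(1) z wc[OF at(2)], of i v] by (simp del: fun_upd_apply foldr_Cons)
      qed
    qed simp
    have "multilinear_eval T m g (z(k := a \<odot>\<^bsub>T\<^esub> t)) = (\<Oplus>\<^bsub>T\<^esub>v\<in>?P. a \<odot>\<^bsub>T\<^esub> (g v \<odot>\<^bsub>T\<^esub> word_prod T (z(k := t)) v))"
      unfolding multilinear_eval_def
    proof (rule TM.TA.finsum_cong'[OF refl])
      fix v assume v: "v \<in> ?P"
      show "g v \<odot>\<^bsub>T\<^esub> word_prod T (z(k := a \<odot>\<^bsub>T\<^esub> t)) v = a \<odot>\<^bsub>T\<^esub> (g v \<odot>\<^bsub>T\<^esub> word_prod T (z(k := t)) v)"
        unfolding upd[OF P[OF v]] using wc[OF at(2)] g[OF v] at(1)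
        by (simp add: TM.M.smult_assoc1[symmetric] m_comm del: fun_upd_apply)
    qed (use g wc[OF at(2)] at(1) in \<open>auto simp del: fun_upd_apply\<close>)
    also have "\<dots> = a \<odot>\<^bsub>T\<^esub> multilinear_eval T m g (z(k := t))"
      unfolding multilinear_eval_def
      by (rule TM.M.finsum_smult_ldistr[symmetric]) (use g wc[OF at(2)] at(1) in \<open>auto simp del: fun_upd_apply\<close>)
    finally show ?thesis .
  qed
qed

text \<open>By linearity in each argument it suffices to test monomials. The induction frees the
  arguments one by one: the first \<open>k\<close> are arbitrary while the remaining ones are
  monomials.\<close>

lemma multilinear_identityI:
  assumes g: "\<And>v. v \<in> permutations_of_set {..<m} \<Longrightarrow> g v \<in> carrier K" "\<exists>v\<in>permutations_of_set {..<m}. g v \<noteq> \<zero>"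
    and mono: "\<And>\<alpha>. (\<And>i. \<alpha> i \<in> exponents n) \<Longrightarrow> multilinear_eval T m g (\<lambda>i. single K \<one> (\<alpha> i)) = \<zero>\<^bsub>T\<^esub>"
  shows "multilinear_identity K T m g"
proof -
  let ?P = "permutations_of_set {..<m}"
  have "multilinear_eval T m g z = \<zero>\<^bsub>T\<^esub>"
    if "k \<le> m" "\<And>i. z i \<in> carrier T" "\<And>i. k \<le> i \<Longrightarrow> i < m \<Longrightarrow> \<exists>\<alpha>\<in>exponents n. z i = single K \<one> \<alpha>" for k z
    using that
  proof (induction k arbitrary: z)
    case 0
    have "\<exists>\<alpha>. \<alpha> \<in> exponents n \<and> (i < m \<longrightarrow> z i = single K \<one> \<alpha>)" for i
      using 0(3)[of i] exponents_closed(1) by (cases "i < m") blast+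
    then obtain \<alpha> where \<alpha>: "\<And>i. \<alpha> i \<in> exponents n" "\<And>i. i < m \<Longrightarrow> z i = single K \<one> (\<alpha> i)" by metis
    have "multilinear_eval T m g z = multilinear_eval T m g (\<lambda>i. single K \<one> (\<alpha> i))"
      unfolding multilinear_eval_def
    proof (rule TM.TA.finsum_cong'[OF refl])
      fix v assume "v \<in> ?P"
      then have "word_prod T z v = word_prod T (\<lambda>i. single K \<one> (\<alpha> i)) v"
        by (intro word_prod_cong) (auto simp: \<alpha>(2) permutations_of_set_def)
      then show "g v \<odot>\<^bsub>T\<^esub> word_prod T z v = g v \<odot>\<^bsub>T\<^esub> word_prod T (\<lambda>i. single K \<one> (\<alpha> i)) v" by simp
    qed (use g(1) \<alpha>(1) in auto)
    then show ?case using mono[of \<alpha>, OF \<alpha>(1)] by simp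
  next
    case (Suc k)
    have k: "k < m" using Suc.prems by simp
    note lin = multilinear_eval_linear[of z k m g, OF Suc.prems(2) k g(1)]
    have "multilinear_eval T m g (z(k := t)) = \<zero>\<^bsub>T\<^esub>" if "t \<in> carrier T" for t
      using that
    proof (induction t rule: TM.T_induct)
      case (single a \<alpha>)
      have "multilinear_eval T m g (z(k := single K \<one> \<alpha>)) = \<zero>\<^bsub>T\<^esub>"
      proof (rule Suc.IH)
        fix i assume "k \<le> i" "i < m"
        then show "\<exists>\<beta>\<in>exponents n. (z(k := single K \<one> \<alpha>)) i = single K \<one> \<beta>"
          using Suc.prems(3)[of i] single(2) by (cases "i = k") auto
      qed (use k Suc.prems(2) single(2) in auto)
      then show ?case
        unfolding single_eq_smult[OF single(1)] using lin(3)[of a "single K \<one> \<alpha>"] single by (simp del: fun_upd_apply)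
    qed (use lin in \<open>simp_all del: fun_upd_apply\<close>)
    from this[of "z k"] show ?case using Suc.prems(2) by simp
  qed
  from this[of m] show ?thesis unfolding multilinear_identity_def using g by auto
qed

lemma roots_of_unity_exponent:
  assumes "\<forall>i\<in>{1..n}. \<forall>j\<in>{1..n}. root_of_unity K (\<Lambda> i j)"
  shows "\<exists>N::nat. N > 0 \<and> (\<forall>i\<in>{1..n}. \<forall>j\<in>{1..n}. \<Lambda> i j [^] N = \<one>)"
proof -
  let ?X = "(\<lambda>(i, j). \<Lambda> i j) ` ({1..n} \<times> {1..n})"
  have "?X \<subseteq> carrier K" using Lambda_Units Units_closed by auto
  moreover have "finite ?X" "\<And>x. x \<in> ?X \<Longrightarrow> root_of_unity K x" using assms by auto
  ultimately obtain N :: nat where "N > 0" "\<forall>x\<in>?X. x [^] N = \<one>"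
    using common_root_exponent[of ?X] by blast
  then show ?thesis by auto
qed

lemma torus_multilinear_identity:
  assumes N: "N > 0" "\<And>i j. i \<in> {1..n} \<Longrightarrow> j \<in> {1..n} \<Longrightarrow> \<Lambda> i j [^] (N::nat) = \<one>"
  shows "\<exists>m g. multilinear_identity K T m g"
proof -
  obtain m :: nat where m: "(N ^ n) ^ m < fact m" using exists_power_less_fact by blast
  let ?P = "permutations_of_set {..<m}" and ?J = "PiE {..<m} (\<lambda>_. box n 0 (int N))"
  \<comment> \<open>Each choice of residues for \<open>m\<close> exponents gives one equation, each
    permutation one unknown coefficient; by the choice of \<open>m\<close> there is a nontrivial
    solution.\<close>
  have "card ?J < card ?P"
    using m by (simp add: card_PiE card_box prod_constant)
  moreover have "finite ?J" by (intro finite_PiE) (auto simp: card_box)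
  ultimately obtain g where g: "\<And>v. v \<in> ?P \<Longrightarrow> g v \<in> carrier K" "\<exists>v\<in>?P. g v \<noteq> \<zero>"
    and sum: "\<And>\<rho>. \<rho> \<in> ?J \<Longrightarrow> (\<Oplus>v\<in>?P. word_twist \<rho> v \<otimes> g v) = \<zero>"
    using linear_system_nontrivial_solution[of ?J ?P word_twist] by auto
  have "multilinear_identity K T m g"
  proof (rule multilinear_identityI[OF g])
    fix \<alpha> :: "nat \<Rightarrow> nat \<Rightarrow> int" assume \<alpha>: "\<And>i. \<alpha> i \<in> exponents n"
    define \<rho> where "\<rho> = restrict (\<lambda>i k. \<alpha> i k mod int N) {..<m}"
    have \<rho>J: "\<rho> \<in> ?J" using \<alpha> N(1) by (auto simp: \<rho>_def box_def exponents_def)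
    let ?s = "\<Sum>i<m. \<alpha> i"
    have s: "?s \<in> exponents n"
      using sum_list_exponents[of "[0..<m]" \<alpha>] \<alpha> by (simp add: interv_sum_list_conv_sum_set_nat atLeast0LessThan)
    have "multilinear_eval T m g (\<lambda>i. single K \<one> (\<alpha> i)) = (\<Oplus>\<^bsub>T\<^esub>v\<in>?P. single K (word_twist \<rho> v \<otimes> g v) ?s)"
      unfolding multilinear_eval_def
    proof (rule TM.TA.finsum_cong'[OF refl])
      fix v assume v: "v \<in> ?P"
      then have dv: "set v = {..<m}" "distinct v" by (auto simp: permutations_of_set_def)
      have "word_twist \<alpha> v = word_twist \<rho> v"
      proof (rule word_twist_mod[OF N])
        show "\<rho> i \<in> exponents n" if "i \<in> set v" for i
          using \<alpha>[of i] that dv by (auto simp: \<rho>_def exponents_def)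
        show "int N dvd \<alpha> i k - \<rho> i k" if "i \<in> set v" for i k using that dv by (simp add: \<rho>_def)
      qed (auto intro: \<alpha>)
      moreover have "sum_list (map \<alpha> v) = ?s" using dv by (simp add: sum_list_distinct_conv_sum_set)
      ultimately show "g v \<odot>\<^bsub>T\<^esub> word_prod T (\<lambda>i. single K \<one> (\<alpha> i)) v = single K (word_twist \<rho> v \<otimes> g v) ?s"
        unfolding word_prod_single[OF \<alpha>] using g(1)[OF v] by (simp add: TM.T_smult_single m_comm)
    qed (use g(1) s in auto)
    also have "\<dots> = single K (\<Oplus>v\<in>?P. word_twist \<rho> v \<otimes> g v) ?s"
      by (rule finsum_hom[where h = "\<lambda>a. single K a ?s", symmetric])
        (use g(1) s TM.TA.abelian_monoid_axioms in auto, auto simp: TM.T_simps single_def)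
    finally show "multilinear_eval T m g (\<lambda>i. single K \<one> (\<alpha> i)) = \<zero>\<^bsub>T\<^esub>" using sum[OF \<rho>J] by simp
  qed
  then show ?thesis by blast
qed

theorem order_PI_algebra_iff:
  assumes o: "torus_order B \<Phi>"
  shows "PI_algebra K B \<longleftrightarrow> (\<forall>i\<in>{1..n}. \<forall>j\<in>{1..n}. root_of_unity K (\<Lambda> i j))"
proof
  interpret BK: k_algebra K B by (rule order_k_algebra[OF o])
  show "\<forall>i\<in>{1..n}. \<forall>j\<in>{1..n}. root_of_unity K (\<Lambda> i j)" if "PI_algebra K B"
    using that order_identity_roots_of_unity[OF o] unfolding BK.PI_algebra_iff by blast
  assume "\<forall>i\<in>{1..n}. \<forall>j\<in>{1..n}. root_of_unity K (\<Lambda> i j)"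
  then obtain N :: nat where N: "N > 0" "\<And>i j. i \<in> {1..n} \<Longrightarrow> j \<in> {1..n} \<Longrightarrow> \<Lambda> i j [^] N = \<one>"
    using roots_of_unity_exponent by blast
  then show "PI_algebra K B"
    using torus_multilinear_identity[OF N] order_multilinear_identity[OF o N] unfolding BK.PI_algebra_iff by blast
qed

text \<open>The least degree of an identity is the least \<open>m\<close> that admits a multilinear
  one. The exponent \<open>N\<close> depends only on \<open>\<Lambda>\<close>, so both orders share
  their multilinear identities with the same torus.\<close>

theorem orders_have_equal_PI_degree:
  assumes o: "torus_order B \<Phi>" "torus_order C \<Psi>" and pi: "PI_algebra K B"
  shows "PI_degree K B = PI_degree K C"
proof -
  interpret BK: k_algebra K B by (rule order_k_algebra[OF o(1)])
  interpret CK: k_algebra K C by (rule order_k_algebra[OF o(2)])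
  obtain N :: nat where N: "N > 0" "\<And>i j. i \<in> {1..n} \<Longrightarrow> j \<in> {1..n} \<Longrightarrow> \<Lambda> i j [^] N = \<one>"
    using roots_of_unity_exponent pi order_PI_algebra_iff[OF o(1)] by blast
  have "multilinear_identity K B = multilinear_identity K C"
    using order_multilinear_identity[OF o(1) N] order_multilinear_identity[OF o(2) N] by (intro ext) blast
  then show ?thesis
    unfolding PI_degree_def BK.polynomial_identity_degrees CK.polynomial_identity_degrees by simp
qed

end

section \<open>Quantum affine space as an order\<close>

text \<open>For structures that coincide with a known ring on its carrier only: the product of the
  free algebra differs from that of the twisted algebra outside the carrier, and the quotient
  algebra is another record than the factor ring.\<close>

lemma ring_cong:
  assumes "ring R" "carrier S = carrier R" "\<one>\<^bsub>S\<^esub> = \<one>\<^bsub>R\<^esub>" "\<zero>\<^bsub>S\<^esub> = \<zero>\<^bsub>R\<^esub>"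
    and add: "\<And>x y. x \<in> carrier R \<Longrightarrow> y \<in> carrier R \<Longrightarrow> x \<oplus>\<^bsub>S\<^esub> y = x \<oplus>\<^bsub>R\<^esub> y"
    and mult: "\<And>x y. x \<in> carrier R \<Longrightarrow> y \<in> carrier R \<Longrightarrow> x \<otimes>\<^bsub>S\<^esub> y = x \<otimes>\<^bsub>R\<^esub> y"
  shows "ring S"
proof -
  interpret R: ring R by fact
  show ?thesis
  proof (rule ringI)
    show "abelian_group S"
    proof (rule abelian_groupI)
      fix x assume "x \<in> carrier S"
      then show "\<exists>y\<in>carrier S. y \<oplus>\<^bsub>S\<^esub> x = \<zero>\<^bsub>S\<^esub>"
        using assms(2,4) add R.l_neg R.a_inv_closed by metis
    qed (simp_all add: assms(2-4) add R.a_ac)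
    show "monoid S" by (rule monoidI) (simp_all add: assms(2-4) mult R.m_assoc)
  qed (simp_all add: assms(2-4) add mult R.l_distr R.r_distr)
qed

lemma (in twisted_monoid_algebra) single_add:
  "a \<in> carrier K \<Longrightarrow> b \<in> carrier K \<Longrightarrow> single K a u \<oplus>\<^bsub>T\<^esub> single K b u = single K (a \<oplus> b) u"
  by (simp add: T_simps(3) single_def fun_eq_iff)

section \<open>The free algebra and evaluation of its elements\<close>

locale free_algebra_over = field K for K (structure) +
  fixes I :: "nat set" and F W
  defines "F \<equiv> free_algebra K I" and "W \<equiv> twisted_algebra K {w. set w \<subseteq> I} (@) [] (\<lambda>_ _. \<one>)"
begin

sublocale W: twisted_monoid_algebra K "{w. set w \<subseteq> I}" "(@)" "[]" "\<lambda>_ _. \<one>" W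
  by unfold_locales simp_all

lemma F_simps:
  "carrier F = carrier W" "\<zero>\<^bsub>F\<^esub> = \<zero>\<^bsub>W\<^esub>" "\<one>\<^bsub>F\<^esub> = single K \<one> []" "add F = add W" "module.smult F = module.smult W"
proof -
  show "carrier F = carrier W"
    unfolding F_def W_def free_algebra_def twisted_algebra_def partial_object.simps by (rule Collect_cong) blast
qed (unfold F_def W_def free_algebra_def twisted_algebra_def single_def,
    simp_all only: partial_object.simps monoid.simps ring.simps module.simps)

lemma F_mult_apply: "(f \<otimes>\<^bsub>F\<^esub> g) w = (\<Oplus>i\<in>{..length w}. f (take i w) \<otimes> g (drop i w))"
  by (simp add: F_def free_algebra_def)

lemma F_single_mult:
  assumes "a \<in> carrier K" "b \<in> carrier K"
  shows "single K a u \<otimes>\<^bsub>F\<^esub> single K b v = single K (a \<otimes> b) (u @ v)"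
proof
  fix w
  have "(single K a u \<otimes>\<^bsub>F\<^esub> single K b v) w = (\<Oplus>i\<in>{..length w}. if i = length u then if w = u @ v then a \<otimes> b else \<zero> else \<zero>)"
    unfolding F_mult_apply
  proof (rule finsum_cong'[OF refl])
    fix i assume i: "i \<in> {..length w}"
    have iff: "take i w = u \<and> drop i w = v \<longleftrightarrow> i = length u \<and> w = u @ v"
      using i by (auto simp: min_def)
    have "single K a u (take i w) \<otimes> single K b v (drop i w) =
      (if take i w = u \<and> drop i w = v then a \<otimes> b else \<zero>)"
      using assms by (auto simp: single_def)
    then show "single K a u (take i w) \<otimes> single K b v (drop i w) =
      (if i = length u then if w = u @ v then a \<otimes> b else \<zero> else \<zero>)"
      unfolding iff by simp
  qed (use assms in auto)
  also have "\<dots> = single K (a \<otimes> b) (u @ v) w"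
    using assms finsum_delta[of "{..length w}" "if w = u @ v then a \<otimes> b else \<zero>" "length u"]
    by (auto simp: single_def)
  finally show "(single K a u \<otimes>\<^bsub>F\<^esub> single K b v) w = single K (a \<otimes> b) (u @ v) w" .
qed

text \<open>One product splits a word at every position, the other runs over pairs of words in the
  supports. Both are additive in each factor, so they need only be compared on monomials.\<close>

lemma F_mult:
  assumes "f \<in> carrier W" "g \<in> carrier W"
  shows "f \<otimes>\<^bsub>F\<^esub> g = f \<otimes>\<^bsub>W\<^esub> g"
proof -
  have zero: "\<zero>\<^bsub>W\<^esub> \<otimes>\<^bsub>F\<^esub> g = \<zero>\<^bsub>W\<^esub>" "g \<otimes>\<^bsub>F\<^esub> \<zero>\<^bsub>W\<^esub> = \<zero>\<^bsub>W\<^esub>" if "g \<in> carrier W" for g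
    using W.T_val[OF that] by (auto simp: fun_eq_iff F_mult_apply W.T_simps intro!: finsum_zero')
  have l: "(f \<oplus>\<^bsub>W\<^esub> f') \<otimes>\<^bsub>F\<^esub> g = f \<otimes>\<^bsub>F\<^esub> g \<oplus>\<^bsub>W\<^esub> f' \<otimes>\<^bsub>F\<^esub> g" if "f \<in> carrier W" "f' \<in> carrier W" "g \<in> carrier W" for f f' g
    using W.T_val[OF that(1)] W.T_val[OF that(2)] W.T_val[OF that(3)]
    by (auto simp: fun_eq_iff F_mult_apply W.T_simps(3) l_distr intro!: finsum_addf)
  have r: "g \<otimes>\<^bsub>F\<^esub> (f \<oplus>\<^bsub>W\<^esub> f') = g \<otimes>\<^bsub>F\<^esub> f \<oplus>\<^bsub>W\<^esub> g \<otimes>\<^bsub>F\<^esub> f'" if "f \<in> carrier W" "f' \<in> carrier W" "g \<in> carrier W" for f f' g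
    using W.T_val[OF that(1)] W.T_val[OF that(2)] W.T_val[OF that(3)]
    by (auto simp: fun_eq_iff F_mult_apply W.T_simps(3) r_distr intro!: finsum_addf)
  show ?thesis
    using assms(1)
  proof (induction f rule: W.T_induct)
    case (single a u)
    show ?case using assms(2)
    proof (induction g rule: W.T_induct)
      case s': (single b v)
      show ?case using single s' F_single_mult[of a b u v] W.single_mult[of a b u v] by simp
    next
      case (add g g')
      then show ?case using single r W.T.r_distr by simp
    qed (use single zero in simp)
  next
    case (add f f')
    then show ?case using assms(2) l W.T.l_distr by simp
  qed (use assms zero in simp)
qed

lemma F_k_algebra: "k_algebra K F"
proof -
  interpret WK: k_algebra K W by (rule W.T_k_algebra)
  have ring: "ring F"
    by (rule ring_cong[OF W.T_ring]) (simp_all add: F_simps F_mult W.T_one)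
  then interpret F: ring F .
  have "module K F"
    by (rule moduleI) (auto simp: F_simps W.M.smult_l_distr W.M.smult_r_distr W.M.smult_assoc1 cring_axioms F.abelian_group_axioms)
  then show ?thesis
    unfolding k_algebra_def k_algebra_axioms_def using field_axioms ring
    by (auto simp: F_simps F_mult WK.smult_mult_left WK.smult_mult_right)
qed

sublocale F: k_algebra K F by (rule F_k_algebra)

lemma F_single_in [simp]: "a \<in> carrier K \<Longrightarrow> set u \<subseteq> I \<Longrightarrow> single K a u \<in> carrier F"
  by (simp add: F_simps)

lemma F_induct [consumes 1, case_names zero single add]:
  assumes "f \<in> carrier F" "P \<zero>\<^bsub>F\<^esub>" "\<And>a u. a \<in> carrier K \<Longrightarrow> set u \<subseteq> I \<Longrightarrow> P (single K a u)"
    "\<And>f g. f \<in> carrier F \<Longrightarrow> g \<in> carrier F \<Longrightarrow> P f \<Longrightarrow> P g \<Longrightarrow> P (f \<oplus>\<^bsub>F\<^esub> g)"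
  shows "P f"
  using assms(1)[unfolded F_simps(1)]
  by (induction f rule: W.T_induct) (use assms(2-) in \<open>auto simp: F_simps\<close>)

lemma free_var_single: "free_var K i = single K \<one> [i]"
  by (simp add: free_var_def single_def)

text \<open>The universal property of the free algebra. By additivity, multiplicativity comes down
  to monomials, where words are concatenated.\<close>

lemma nc_eval_hom:
  assumes B: "k_algebra K B" and y: "\<And>i. y i \<in> carrier B"
  shows "nc_eval K B \<zero>\<^bsub>F\<^esub> y = \<zero>\<^bsub>B\<^esub>"
    "a \<in> carrier K \<Longrightarrow> set u \<subseteq> I \<Longrightarrow> nc_eval K B (single K a u) y = a \<odot>\<^bsub>B\<^esub> word_prod B y u"
    "f \<in> carrier F \<Longrightarrow> nc_eval K B f y \<in> carrier B"
    "f \<in> carrier F \<Longrightarrow> g \<in> carrier F \<Longrightarrow> nc_eval K B (f \<oplus>\<^bsub>F\<^esub> g) y = nc_eval K B f y \<oplus>\<^bsub>B\<^esub> nc_eval K B g y"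
    "a \<in> carrier K \<Longrightarrow> f \<in> carrier F \<Longrightarrow> nc_eval K B (a \<odot>\<^bsub>F\<^esub> f) y = a \<odot>\<^bsub>B\<^esub> nc_eval K B f y"
    "(\<lambda>f. nc_eval K B f y) \<in> ring_hom F B"
proof -
  interpret B: k_algebra K B by fact
  have wp [simp]: "word_prod B y w \<in> carrier B" for w using y by simp
  have FK [simp]: "f w \<in> carrier K" if "f \<in> carrier F" for f w
    using that W.T_val by (simp add: F_simps)
  have fin: "finite {w. f w \<noteq> \<zero>}" if "f \<in> carrier F" for f
    using that W.T_fin by (simp add: F_simps)
  have ext: "nc_eval K B f y = (\<Oplus>\<^bsub>B\<^esub>w\<in>U. f w \<odot>\<^bsub>B\<^esub> word_prod B y w)"
    if "f \<in> carrier F" "finite U" "{w. f w \<noteq> \<zero>} \<subseteq> U" for f U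
    unfolding nc_eval_def by (rule B.M.finsum_extend) (use that in auto)
  show ev_zero: "nc_eval K B \<zero>\<^bsub>F\<^esub> y = \<zero>\<^bsub>B\<^esub>"
    by (simp add: nc_eval_def F_simps W.T_simps)
  show ev_single: "nc_eval K B (single K a u) y = a \<odot>\<^bsub>B\<^esub> word_prod B y u" if "a \<in> carrier K" "set u \<subseteq> I" for a u
  proof -
    have "{w. single K a u w \<noteq> \<zero>} \<subseteq> {u}" and "single K a u u = a" by (auto simp: single_def)
    then show ?thesis using ext[OF F_single_in[OF that], of "{u}"] that by simp
  qed
  show cl: "nc_eval K B f y \<in> carrier B" if "f \<in> carrier F" for f
    unfolding nc_eval_def by (rule B.M.finsum_closed) (use that in auto)
  show ev_add: "nc_eval K B (f \<oplus>\<^bsub>F\<^esub> g) y = nc_eval K B f y \<oplus>\<^bsub>B\<^esub> nc_eval K B g y" if fg: "f \<in> carrier F" "g \<in> carrier F" for f g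
  proof -
    let ?U = "{w. f w \<noteq> \<zero>} \<union> {w. g w \<noteq> \<zero>}"
    have U: "finite ?U" using fin fg by simp
    have app: "(f \<oplus>\<^bsub>F\<^esub> g) w = f w \<oplus> g w" for w by (simp add: F_simps W.T_simps)
    have "nc_eval K B (f \<oplus>\<^bsub>F\<^esub> g) y = (\<Oplus>\<^bsub>B\<^esub>w\<in>?U. (f \<oplus>\<^bsub>F\<^esub> g) w \<odot>\<^bsub>B\<^esub> word_prod B y w)"
      by (rule ext[OF _ U]) (use fg in \<open>auto simp: app\<close>)
    also have "\<dots> = (\<Oplus>\<^bsub>B\<^esub>w\<in>?U. f w \<odot>\<^bsub>B\<^esub> word_prod B y w \<oplus>\<^bsub>B\<^esub> g w \<odot>\<^bsub>B\<^esub> word_prod B y w)"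
      by (rule B.M.finsum_cong'[OF refl]) (use fg in \<open>auto simp: app B.smult_l_distr\<close>)
    also have "\<dots> = (\<Oplus>\<^bsub>B\<^esub>w\<in>?U. f w \<odot>\<^bsub>B\<^esub> word_prod B y w) \<oplus>\<^bsub>B\<^esub> (\<Oplus>\<^bsub>B\<^esub>w\<in>?U. g w \<odot>\<^bsub>B\<^esub> word_prod B y w)"
      by (rule B.M.finsum_addf) (use fg in auto)
    also have "\<dots> = nc_eval K B f y \<oplus>\<^bsub>B\<^esub> nc_eval K B g y"
      using ext[OF fg(1) U] ext[OF fg(2) U] by simp
    finally show ?thesis .
  qed
  show "nc_eval K B (a \<odot>\<^bsub>F\<^esub> f) y = a \<odot>\<^bsub>B\<^esub> nc_eval K B f y" if a: "a \<in> carrier K" and f: "f \<in> carrier F" for a f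
    using f
  proof (induction f rule: F_induct)
    case zero
    then show ?case using a by (simp add: ev_zero)
  next
    case (single b u)
    have "a \<odot>\<^bsub>F\<^esub> single K b u = single K (a \<otimes> b) u" using W.T_smult_single[of a b u] a single by (simp add: F_simps)
    then show ?case using a single by (simp add: ev_single B.smult_assoc1)
  next
    case (add f g)
    then show ?case
      using a cl by (simp add: F.smult_r_distr B.smult_r_distr ev_add)
  qed
  have wp_append: "word_prod B y (u @ v) = word_prod B y u \<otimes>\<^bsub>B\<^esub> word_prod B y v" for u v
    by (induction u) (use y in \<open>simp_all add: B.A.m_assoc\<close>)
  show "(\<lambda>f. nc_eval K B f y) \<in> ring_hom F B"
  proof (rule ring_hom_memI)
    show "nc_eval K B \<one>\<^bsub>F\<^esub> y = \<one>\<^bsub>B\<^esub>" using ev_single[of \<one> "[]"] by (simp add: F_simps(3))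
    fix f g assume f: "f \<in> carrier F" and g: "g \<in> carrier F"
    show "nc_eval K B (f \<otimes>\<^bsub>F\<^esub> g) y = nc_eval K B f y \<otimes>\<^bsub>B\<^esub> nc_eval K B g y"
      using f
    proof (induction f rule: F_induct)
      case (single a u)
      show ?case using g
      proof (induction g rule: F_induct)
        case s: (single b v)
        show ?case
          using single s ev_single[of "a \<otimes> b" "u @ v", unfolded wp_append]
          by (simp add: F_single_mult ev_single B.smult_mult_left B.smult_mult_right B.smult_assoc1[symmetric] m_comm)
      next
        case (add g g')
        then show ?case using single by (simp add: F.A.r_distr B.A.r_distr ev_add cl)
      qed (use single in \<open>simp add: ev_zero cl\<close>)
    next
      case (add f f')
      then show ?case using g by (simp add: F.A.l_distr B.A.l_distr ev_add cl)
    qed (use g in \<open>simp add: ev_zero cl\<close>)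
  qed (use cl ev_add in auto)
qed

end

section \<open>Normal forms in quantum affine space and the kernel of the map to the torus\<close>

locale quantum_affine_algebra = quantum_torus + FA: free_algebra_over K "{1..n}" F W for F W
begin

text \<open>The value outside \<open>{1..n}\<close> is a default that sends every index to an
  element of the torus, as evaluation asks for an assignment on all indices.\<close>

definition letter :: "nat \<Rightarrow> nat \<Rightarrow> int"
  where "letter i = (if i \<in> {1..n} then unit_vec i else 0)"

definition eval_letters :: "(nat list \<Rightarrow> 'a) \<Rightarrow> (nat \<Rightarrow> int) \<Rightarrow> 'a"
  where "eval_letters f = nc_eval K T f (\<lambda>i. single K \<one> (letter i))"

definition commutators :: "(nat list \<Rightarrow> 'a) set"
  where "commutators = {(free_var K i \<otimes>\<^bsub>F\<^esub> free_var K j) \<ominus>\<^bsub>F\<^esub> (\<Lambda> i j \<odot>\<^bsub>F\<^esub> (free_var K j \<otimes>\<^bsub>F\<^esub> free_var K i)) | i j.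
    i \<in> {1..n} \<and> j \<in> {1..n}}"

definition "J = Idl\<^bsub>F\<^esub> commutators"

abbreviation content :: "nat list \<Rightarrow> nat \<Rightarrow> int"
  where "content w \<equiv> sum_list (map letter w)"

lemma letter_exponents [simp]: "letter i \<in> exponents n"
  by (simp add: letter_def)

lemma content_apply: "set w \<subseteq> {1..n} \<Longrightarrow> content w i = int (count (mset w) i)"
  by (induction w) (auto simp: letter_def unit_vec_def)

lemma content_exponents [simp]: "content w \<in> exponents n"
  by (rule sum_list_exponents) simp

lemma letters_closed: "single K \<one> (letter i) \<in> carrier T"
  by simp

lemma eval_hom:
  "f \<in> carrier F \<Longrightarrow> eval_letters f \<in> carrier T"
  "f \<in> carrier F \<Longrightarrow> g \<in> carrier F \<Longrightarrow> eval_letters (f \<oplus>\<^bsub>F\<^esub> g) = eval_letters f \<oplus>\<^bsub>T\<^esub> eval_letters g"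
  "a \<in> carrier K \<Longrightarrow> f \<in> carrier F \<Longrightarrow> eval_letters (a \<odot>\<^bsub>F\<^esub> f) = a \<odot>\<^bsub>T\<^esub> eval_letters f"
  "eval_letters \<in> ring_hom F T"
  unfolding eval_letters_def[abs_def]
  using FA.nc_eval_hom[of T "\<lambda>i. single K \<one> (letter i)", OF TM.T_k_algebra letters_closed] by blast+

lemma eval_letters_single:
  "a \<in> carrier K \<Longrightarrow> set u \<subseteq> {1..n} \<Longrightarrow> eval_letters (single K a u) = single K (a \<otimes> word_twist letter u) (content u)"
  unfolding eval_letters_def FA.nc_eval_hom(2)[OF TM.T_k_algebra letters_closed]
  by (simp add: word_prod_single TM.T_smult_single)

lemma eval_letters_hom_ring: "ring_hom_ring F T eval_letters"
proof -
  show ?thesis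
    using eval_hom(4) FA.F.A.ring_axioms TM.T_ring by (simp add: ring_hom_ring_def ring_hom_ring_axioms_def)
qed

lemma single_smult: "a \<in> carrier K \<Longrightarrow> b \<in> carrier K \<Longrightarrow> a \<odot>\<^bsub>F\<^esub> single K b u = single K (a \<otimes> b) u"
  unfolding FA.F_simps by (rule FA.W.T_smult_single)

lemma commutator_eq:
  assumes ij: "i \<in> {1..n}" "j \<in> {1..n}"
  shows "(free_var K i \<otimes>\<^bsub>F\<^esub> free_var K j) \<ominus>\<^bsub>F\<^esub> (\<Lambda> i j \<odot>\<^bsub>F\<^esub> (free_var K j \<otimes>\<^bsub>F\<^esub> free_var K i))
    = single K \<one> [i, j] \<oplus>\<^bsub>F\<^esub> single K (\<ominus> \<Lambda> i j) [j, i]"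
proof -
  have l: "\<Lambda> i j \<in> carrier K" using Lambda_Units[OF ij] by (rule Units_closed)
  have w: "set [i, j] \<subseteq> {1..n}" "set [j, i] \<subseteq> {1..n}" using ij by auto
  have "\<ominus>\<^bsub>F\<^esub> single K (\<Lambda> i j) [j, i] = (\<ominus> \<one>) \<odot>\<^bsub>F\<^esub> single K (\<Lambda> i j) [j, i]"
    using l FA.F_single_in[OF l w(2)] FA.F.smult_l_minus[of \<one> "single K (\<Lambda> i j) [j, i]"] by simp
  also have "\<dots> = single K (\<ominus> \<Lambda> i j) [j, i]"
    using l by (simp add: single_smult l_minus)
  finally show ?thesis
    using l by (simp add: FA.free_var_single FA.F_single_mult single_smult a_minus_def)
qed

lemma commutators_closed: "commutators \<subseteq> carrier F"
proof
  fix f assume "f \<in> commutators"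
  then obtain i j where ij: "i \<in> {1..n}" "j \<in> {1..n}" and f: "f = single K \<one> [i, j] \<oplus>\<^bsub>F\<^esub> single K (\<ominus> \<Lambda> i j) [j, i]"
    unfolding commutators_def using commutator_eq by blast
  have l: "\<Lambda> i j \<in> carrier K" using Lambda_Units[OF ij] by (rule Units_closed)
  show "f \<in> carrier F" unfolding f by (rule FA.F.M.a_closed; rule FA.F_single_in) (use l ij in auto)
qed

lemma J_ideal: "ideal J F"
  unfolding J_def by (rule FA.F.A.genideal_ideal[OF commutators_closed])

lemma J_closed:
  "f \<in> J \<Longrightarrow> f \<in> carrier F" "f \<in> J \<Longrightarrow> g \<in> J \<Longrightarrow> f \<oplus>\<^bsub>F\<^esub> g \<in> J" "f \<in> carrier F \<Longrightarrow> g \<in> J \<Longrightarrow> f \<otimes>\<^bsub>F\<^esub> g \<in> J"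
  "f \<in> J \<Longrightarrow> g \<in> carrier F \<Longrightarrow> f \<otimes>\<^bsub>F\<^esub> g \<in> J" "a \<in> carrier K \<Longrightarrow> f \<in> J \<Longrightarrow> a \<odot>\<^bsub>F\<^esub> f \<in> J" "\<zero>\<^bsub>F\<^esub> \<in> J"
proof -
  interpret J: ideal J F by (rule J_ideal)
  show cl: "f \<in> J \<Longrightarrow> f \<in> carrier F" for f by (rule J.a_Hcarr)
  show "f \<in> J \<Longrightarrow> g \<in> J \<Longrightarrow> f \<oplus>\<^bsub>F\<^esub> g \<in> J" by (rule J.a_closed)
  show l: "f \<in> carrier F \<Longrightarrow> g \<in> J \<Longrightarrow> f \<otimes>\<^bsub>F\<^esub> g \<in> J" for f g by (rule J.I_l_closed)
  show "f \<in> J \<Longrightarrow> g \<in> carrier F \<Longrightarrow> f \<otimes>\<^bsub>F\<^esub> g \<in> J" by (rule J.I_r_closed)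
  show "a \<odot>\<^bsub>F\<^esub> f \<in> J" if "a \<in> carrier K" "f \<in> J"
  proof -
    have "(a \<odot>\<^bsub>F\<^esub> \<one>\<^bsub>F\<^esub>) \<otimes>\<^bsub>F\<^esub> f = a \<odot>\<^bsub>F\<^esub> f" using that cl by (simp add: FA.F.smult_mult_left)
    then show ?thesis using l[of "a \<odot>\<^bsub>F\<^esub> \<one>\<^bsub>F\<^esub>" f] that by simp
  qed
  show "\<zero>\<^bsub>F\<^esub> \<in> J" by (rule J.zero_closed)
qed

lemma J_kernel: "J \<subseteq> a_kernel F T eval_letters"
proof -
  interpret H: ring_hom_ring F T eval_letters by (rule eval_letters_hom_ring)
  have "commutators \<subseteq> a_kernel F T eval_letters"
  proof
    fix f assume fc: "f \<in> commutators"
    then obtain i j where ij: "i \<in> {1..n}" "j \<in> {1..n}" and f: "f = single K \<one> [i, j] \<oplus>\<^bsub>F\<^esub> single K (\<ominus> \<Lambda> i j) [j, i]"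
      unfolding commutators_def using commutator_eq by blast
    have l: "\<Lambda> i j \<in> carrier K" using Lambda_Units[OF ij] by (rule Units_closed)
    have w: "set [i, j] \<subseteq> {1..n}" "set [j, i] \<subseteq> {1..n}" using ij by auto
    have c: "content [j, i] = content [i, j]" by (simp add: add.commute)
    have tw: "word_twist letter [i, j] = \<Lambda> i j \<otimes> word_twist letter [j, i]"
      using ij comm_twist[of "unit_vec i" "unit_vec j"] comm_unit_vec[OF ij] by (simp add: letter_def)
    have "eval_letters f = single K (\<one> \<otimes> word_twist letter [i, j]) (content [i, j])
      \<oplus>\<^bsub>T\<^esub> single K (\<ominus> \<Lambda> i j \<otimes> word_twist letter [j, i]) (content [j, i])"
      unfolding f eval_hom(2)[OF FA.F_single_in[OF one_closed w(1)] FA.F_single_in[OF a_inv_closed[OF l] w(2)]]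
        eval_letters_single[OF one_closed w(1)] eval_letters_single[OF a_inv_closed[OF l] w(2)] ..
    also have "\<dots> = \<zero>\<^bsub>T\<^esub>"
    proof -
      have cancel: "\<one> \<otimes> (\<Lambda> i j \<otimes> t) \<oplus> \<ominus> \<Lambda> i j \<otimes> t = \<zero>" if "t \<in> carrier K" for t
        using l that by (simp add: l_minus r_neg)
      have "\<one> \<otimes> (\<Lambda> i j \<otimes> word_twist letter [j, i]) \<oplus> \<ominus> \<Lambda> i j \<otimes> word_twist letter [j, i] = \<zero>"
        by (rule cancel[OF word_twist_in])
      moreover have "single K (\<one> \<otimes> (\<Lambda> i j \<otimes> word_twist letter [j, i])) u \<oplus>\<^bsub>T\<^esub> single K (\<ominus> \<Lambda> i j \<otimes> word_twist letter [j, i]) u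
        = single K (\<one> \<otimes> (\<Lambda> i j \<otimes> word_twist letter [j, i]) \<oplus> \<ominus> \<Lambda> i j \<otimes> word_twist letter [j, i]) u" for u
        by (rule TM.single_add) (intro m_closed one_closed l a_inv_closed word_twist_in)+
      ultimately show ?thesis unfolding c tw by (simp only: TM.single_zero)
    qed
    finally have ev: "eval_letters f = \<zero>\<^bsub>T\<^esub>" .
    show "f \<in> a_kernel F T eval_letters"
      unfolding a_kernel_def' by (rule CollectI, rule conjI, rule subsetD[OF commutators_closed fc], rule ev)
  qed
  then show ?thesis unfolding J_def by (rule FA.F.A.genideal_minimal[OF H.kernel_is_ideal])
qed

text \<open>Modulo \<open>J\<close> the word \<open>u\<close> equals \<open>- c\<close> times
  \<open>v\<close>; the sum avoids differences in later computations. Nothing is claimed about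
  \<open>c\<close>, since the relation is used only to show that sorted words span.\<close>

definition proportional_mod :: "nat list \<Rightarrow> nat list \<Rightarrow> bool"
  where "proportional_mod u v \<longleftrightarrow> (\<exists>c\<in>carrier K. single K \<one> u \<oplus>\<^bsub>F\<^esub> single K c v \<in> J)"

lemma single_add: "single K a u \<oplus>\<^bsub>F\<^esub> single K b u = single K (a \<oplus> b) u" if "a \<in> carrier K" "b \<in> carrier K"
  using that FA.W.single_add by (simp add: FA.F_simps)

text \<open>\<open>F\<close> and \<open>W\<close> have the same zero; from here on simplification is
  meant to produce the one of \<open>F\<close>.\<close>

lemma single_zero_F: "single K \<zero> u = \<zero>\<^bsub>F\<^esub>"
  by (simp add: FA.F_simps(2))

declare FA.W.single_zero [simp del] single_zero_F [simp]

lemma proportional_refl: "proportional_mod u u"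
  unfolding proportional_mod_def
  by (rule bexI[of _ "\<ominus> \<one>"]) (simp_all add: single_add r_neg J_closed(6))

lemma proportional_trans:
  assumes "proportional_mod u v" "proportional_mod v w" and W: "set u \<subseteq> {1..n}" "set v \<subseteq> {1..n}" "set w \<subseteq> {1..n}"
  shows "proportional_mod u w"
proof -
  obtain c d where c: "c \<in> carrier K" "single K \<one> u \<oplus>\<^bsub>F\<^esub> single K c v \<in> J"
    and d: "d \<in> carrier K" "single K \<one> v \<oplus>\<^bsub>F\<^esub> single K d w \<in> J"
    using assms unfolding proportional_mod_def by blast
  let ?d = "(\<ominus> c) \<odot>\<^bsub>F\<^esub> (single K \<one> v \<oplus>\<^bsub>F\<^esub> single K d w)"
  have in_F: "single K a u \<in> carrier F" "single K a v \<in> carrier F" "single K a w \<in> carrier F" if "a \<in> carrier K" for a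
    using that W FA.F_single_in by blast+
  have "?d \<in> J" using c d by (intro J_closed(5)) auto
  also have "?d = single K (\<ominus> c) v \<oplus>\<^bsub>F\<^esub> single K ((\<ominus> c) \<otimes> d) w"
    using c d in_F by (simp add: FA.F.smult_r_distr single_smult)
  finally have "(single K \<one> u \<oplus>\<^bsub>F\<^esub> single K c v) \<oplus>\<^bsub>F\<^esub> (single K (\<ominus> c) v \<oplus>\<^bsub>F\<^esub> single K ((\<ominus> c) \<otimes> d) w) \<in> J"
    by (rule J_closed(2)[OF c(2)])
  also have "(single K \<one> u \<oplus>\<^bsub>F\<^esub> single K c v) \<oplus>\<^bsub>F\<^esub> (single K (\<ominus> c) v \<oplus>\<^bsub>F\<^esub> single K ((\<ominus> c) \<otimes> d) w)
    = single K \<one> u \<oplus>\<^bsub>F\<^esub> ((single K c v \<oplus>\<^bsub>F\<^esub> single K (\<ominus> c) v) \<oplus>\<^bsub>F\<^esub> single K ((\<ominus> c) \<otimes> d) w)"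
    using c d in_F by (simp add: FA.F.M.a_assoc)
  also have "\<dots> = single K \<one> u \<oplus>\<^bsub>F\<^esub> single K ((\<ominus> c) \<otimes> d) w"
    using c d in_F by (simp add: single_add r_neg)
  finally show ?thesis unfolding proportional_mod_def using c d by blast
qed

lemma proportional_mult:
  assumes "proportional_mod u v" and W: "set u \<subseteq> {1..n}" "set v \<subseteq> {1..n}" "set w \<subseteq> {1..n}"
  shows "proportional_mod (w @ u) (w @ v)" "proportional_mod (u @ w) (v @ w)"
proof -
  obtain c where c: "c \<in> carrier K" "single K \<one> u \<oplus>\<^bsub>F\<^esub> single K c v \<in> J"
    using assms unfolding proportional_mod_def by blast
  have in_F: "single K a u \<in> carrier F" "single K a v \<in> carrier F" "single K a w \<in> carrier F" if "a \<in> carrier K" for a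
    using that W FA.F_single_in by blast+
  have "single K \<one> w \<otimes>\<^bsub>F\<^esub> (single K \<one> u \<oplus>\<^bsub>F\<^esub> single K c v) \<in> J" "(single K \<one> u \<oplus>\<^bsub>F\<^esub> single K c v) \<otimes>\<^bsub>F\<^esub> single K \<one> w \<in> J"
    by (intro J_closed(3,4) c in_F one_closed)+
  moreover have "single K \<one> w \<otimes>\<^bsub>F\<^esub> (single K \<one> u \<oplus>\<^bsub>F\<^esub> single K c v) = single K \<one> (w @ u) \<oplus>\<^bsub>F\<^esub> single K c (w @ v)"
    "(single K \<one> u \<oplus>\<^bsub>F\<^esub> single K c v) \<otimes>\<^bsub>F\<^esub> single K \<one> w = single K \<one> (u @ w) \<oplus>\<^bsub>F\<^esub> single K c (v @ w)"
    using c in_F by (simp_all add: FA.F.A.r_distr FA.F.A.l_distr FA.F_single_mult)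
  ultimately show "proportional_mod (w @ u) (w @ v)" "proportional_mod (u @ w) (v @ w)"
    unfolding proportional_mod_def using c by auto
qed

lemma proportional_swap:
  assumes ij: "i \<in> {1..n}" "j \<in> {1..n}"
  shows "proportional_mod [i, j] [j, i]"
proof -
  have "single K \<one> [i, j] \<oplus>\<^bsub>F\<^esub> single K (\<ominus> \<Lambda> i j) [j, i] \<in> commutators"
    unfolding commutators_def commutator_eq[OF ij, symmetric] using ij by blast
  then have "single K \<one> [i, j] \<oplus>\<^bsub>F\<^esub> single K (\<ominus> \<Lambda> i j) [j, i] \<in> J"
    unfolding J_def using FA.F.A.genideal_self[OF commutators_closed] by blast
  moreover have "\<ominus> \<Lambda> i j \<in> carrier K" using Lambda_Units[OF ij] by (intro a_inv_closed Units_closed)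
  ultimately show ?thesis unfolding proportional_mod_def by blast
qed

text \<open>Insertion sort: each letter that \<open>i\<close> passes costs one defining relation,
  applied inside a longer word.\<close>

lemma proportional_insort:
  "i \<in> {1..n} \<Longrightarrow> set w \<subseteq> {1..n} \<Longrightarrow> proportional_mod (i # w) (insort i w)"
proof (induction w)
  case (Cons j w)
  show ?case
  proof (cases "i \<le> j")
    case False
    have j: "j \<in> {1..n}" "set w \<subseteq> {1..n}" using Cons.prems by auto
    have "proportional_mod ([i, j] @ w) ([j, i] @ w)"
      by (rule proportional_mult(2)[OF proportional_swap]) (use Cons.prems j in auto)
    moreover have "proportional_mod ([j] @ (i # w)) ([j] @ insort i w)"
      by (rule proportional_mult(1)[OF Cons.IH]) (use Cons.prems j in \<open>auto simp: set_insort_key\<close>)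
    ultimately have "proportional_mod (i # j # w) (j # i # w)" "proportional_mod (j # i # w) (j # insort i w)"
      by simp_all
    then have "proportional_mod (i # j # w) (j # insort i w)"
      by (rule proportional_trans) (use Cons.prems j in \<open>simp_all add: set_insort_key\<close>)
    then show ?thesis using False by simp
  qed (simp add: proportional_refl)
qed (simp add: proportional_refl)

lemma proportional_sort: "set w \<subseteq> {1..n} \<Longrightarrow> proportional_mod w (sort w)"
proof (induction w)
  case (Cons i w)
  have i: "i \<in> {1..n}" "set w \<subseteq> {1..n}" using Cons.prems by auto
  have "proportional_mod ([i] @ w) ([i] @ sort w)"
    by (rule proportional_mult(1)[OF Cons.IH]) (use i in auto)
  moreover have "proportional_mod (i # sort w) (insort i (sort w))"
    by (rule proportional_insort) (use i in auto)
  ultimately show ?case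
    using proportional_trans[of "i # w" "i # sort w" "insort i (sort w)"] i by (simp add: set_insort_key)
qed (simp add: proportional_refl)

text \<open>Sorting every word of \<open>f\<close> with the relations gives its normal form, of
  which \<open>h\<close> is the negative.\<close>

lemma sorted_representative:
  assumes "f \<in> carrier F"
  shows "\<exists>h\<in>carrier F. (\<forall>w. h w \<noteq> \<zero> \<longrightarrow> sorted w) \<and> f \<oplus>\<^bsub>F\<^esub> h \<in> J"
  using assms
proof (induction f rule: FA.F_induct)
  case zero
  show ?case by (rule bexI[of _ "\<zero>\<^bsub>F\<^esub>"]) (simp_all add: J_closed(6), simp add: FA.F_simps(2) FA.W.T_simps(1-3))
next
  case (single a u)
  obtain c where c: "c \<in> carrier K" "single K \<one> u \<oplus>\<^bsub>F\<^esub> single K c (sort u) \<in> J"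
    using proportional_sort[OF single(2)] unfolding proportional_mod_def by blast
  have s: "set (sort u) \<subseteq> {1..n}" using single(2) by simp
  have "a \<odot>\<^bsub>F\<^esub> (single K \<one> u \<oplus>\<^bsub>F\<^esub> single K c (sort u)) = single K a u \<oplus>\<^bsub>F\<^esub> single K (a \<otimes> c) (sort u)"
    using single c FA.F_single_in[OF _ s] by (simp add: FA.F.smult_r_distr single_smult)
  then have "single K a u \<oplus>\<^bsub>F\<^esub> single K (a \<otimes> c) (sort u) \<in> J" using J_closed(5)[OF single(1) c(2)] by simp
  moreover have "single K (a \<otimes> c) (sort u) \<in> carrier F" using single(1) c(1) s by (intro FA.F_single_in) auto
  moreover have "sorted w" if "single K (a \<otimes> c) (sort u) w \<noteq> \<zero>" for w
    using that by (auto simp: single_def split: if_splits)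
  ultimately show ?case by blast
next
  case (add f g)
  then obtain h k where h: "h \<in> carrier F" "\<And>w. h w \<noteq> \<zero> \<Longrightarrow> sorted w" "f \<oplus>\<^bsub>F\<^esub> h \<in> J"
    and k: "k \<in> carrier F" "\<And>w. k w \<noteq> \<zero> \<Longrightarrow> sorted w" "g \<oplus>\<^bsub>F\<^esub> k \<in> J" by blast
  have "(f \<oplus>\<^bsub>F\<^esub> g) \<oplus>\<^bsub>F\<^esub> (h \<oplus>\<^bsub>F\<^esub> k) = (f \<oplus>\<^bsub>F\<^esub> h) \<oplus>\<^bsub>F\<^esub> (g \<oplus>\<^bsub>F\<^esub> k)"
    using add(1,2) h(1) k(1) by (simp add: FA.F.M.a_ac)
  then have "(f \<oplus>\<^bsub>F\<^esub> g) \<oplus>\<^bsub>F\<^esub> (h \<oplus>\<^bsub>F\<^esub> k) \<in> J" using J_closed(2)[OF h(3) k(3)] by simp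
  moreover have "sorted w" if "(h \<oplus>\<^bsub>F\<^esub> k) w \<noteq> \<zero>" for w
  proof (rule ccontr)
    assume "\<not> sorted w"
    then have "h w = \<zero>" "k w = \<zero>" using h(2) k(2) by blast+
    then show False using that by (simp add: FA.F_simps FA.W.T_simps)
  qed
  ultimately show ?case using FA.F.M.a_closed[OF h(1) k(1)] by blast
qed

text \<open>A sorted word is determined by how often each letter occurs, hence by its content.
  Distinct sorted words are therefore sent to nonzero multiples of distinct basis elements of the
  torus, and their images are independent.\<close>

lemma eval_letters_sorted:
  assumes h: "h \<in> carrier F" "\<And>w. h w \<noteq> \<zero> \<Longrightarrow> sorted w" and 0: "eval_letters h = \<zero>\<^bsub>T\<^esub>"
  shows "h = \<zero>\<^bsub>F\<^esub>"
proof -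
  let ?H = "{w. h w \<noteq> \<zero>}"
  have hK: "h w \<in> carrier K" for w using h(1) FA.W.T_val by (simp add: FA.F_simps)
  have fin: "finite ?H" and wd: "\<And>w. w \<in> ?H \<Longrightarrow> set w \<subseteq> {1..n}"
    using h(1) FA.W.T_fin FA.W.T_supp[of h] by (auto simp: FA.F_simps)
  have "h w0 = \<zero>" for w0
  proof (rule ccontr)
    assume w0: "h w0 \<noteq> \<zero>"
    have inj: "w = w0" if "w \<in> ?H" "content w = content w0" for w
    proof -
      have "mset w = mset w0"
      proof (rule multiset_eqI)
        fix i
        have "int (count (mset w) i) = content w i" "int (count (mset w0) i) = content w0 i"
          using content_apply[OF wd[OF that(1)]] content_apply[OF wd[of w0]] w0 by simp_all
        then show "count (mset w) i = count (mset w0) i" using that(2) by (simp only: of_nat_eq_iff[symmetric])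
      qed
      then have "sort w = sort w0" by (metis sorted_list_of_multiset_mset)
      then show ?thesis using h(2)[of w] h(2)[OF w0] that by (simp add: sorted_sort_id)
    qed
    have cl: "single K (h w \<otimes> word_twist letter w) (content w) \<in> carrier T" for w using hK by simp
    have "eval_letters h = (\<Oplus>\<^bsub>T\<^esub>w\<in>?H. single K (h w \<otimes> word_twist letter w) (content w))"
      unfolding eval_letters_def nc_eval_def
      by (rule TM.TA.finsum_cong'[OF refl]) (use cl hK in \<open>auto simp: word_prod_single TM.T_smult_single\<close>)
    moreover have "\<zero> = eval_letters h (content w0)" using 0 by (simp add: TM.T_simps(2))
    ultimately have "\<zero> = (\<Oplus>\<^bsub>T\<^esub>w\<in>?H. single K (h w \<otimes> word_twist letter w) (content w)) (content w0)"
      by (simp only:)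
    also have "\<dots> = (\<Oplus>w\<in>?H. single K (h w \<otimes> word_twist letter w) (content w) (content w0))"
      by (rule TM.T_finsum_apply) (use cl in blast)
    also have "\<dots> = (\<Oplus>w\<in>?H. if w = w0 then h w0 \<otimes> word_twist letter w0 else \<zero>)"
    proof (rule finsum_cong'[OF refl])
      fix w assume "w \<in> ?H"
      then show "single K (h w \<otimes> word_twist letter w) (content w) (content w0) = (if w = w0 then h w0 \<otimes> word_twist letter w0 else \<zero>)"
        using inj[of w] by (cases "w = w0") (auto simp: single_def)
    qed (use hK in auto)
    also have "\<dots> = h w0 \<otimes> word_twist letter w0"
      using finsum_delta[OF fin, of "h w0 \<otimes> word_twist letter w0" w0] hK w0 by simp
    finally have prod: "h w0 \<otimes> word_twist letter w0 = \<zero>" by simp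
    then show False using integral[OF prod hK word_twist_in] w0 by simp
  qed
  then show ?thesis by (auto simp: FA.F_simps FA.W.T_simps)
qed

text \<open>Sorted words span modulo the relations and have independent images, so the relations
  generate the whole kernel. This also proves that the ordered monomials form a basis of quantum
  affine space.\<close>

lemma kernel_eq: "a_kernel F T eval_letters = J"
proof
  show "a_kernel F T eval_letters \<subseteq> J"
  proof
    fix f assume "f \<in> a_kernel F T eval_letters"
    then have f: "f \<in> carrier F" "eval_letters f = \<zero>\<^bsub>T\<^esub>" by (auto simp: a_kernel_def')
    obtain h where h: "h \<in> carrier F" "\<And>w. h w \<noteq> \<zero> \<Longrightarrow> sorted w" "f \<oplus>\<^bsub>F\<^esub> h \<in> J"
      using sorted_representative[OF f(1)] by blast
    have "eval_letters (f \<oplus>\<^bsub>F\<^esub> h) = \<zero>\<^bsub>T\<^esub>" using J_kernel h(3) by (auto simp: a_kernel_def')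
    then have "eval_letters h = \<zero>\<^bsub>T\<^esub>" using f h(1) eval_hom(1)[OF h(1)] by (simp add: eval_hom(2))
    then have "h = \<zero>\<^bsub>F\<^esub>" using eval_letters_sorted[OF h(1)] h(2) by blast
    then show "f \<in> J" using h(3) f(1) by simp
  qed
qed (rule J_kernel)

lemma quotient_smult:
  assumes c: "c \<in> carrier K" and f: "f \<in> carrier F"
  shows "c \<odot>\<^bsub>quotient_algebra F J\<^esub> (J +>\<^bsub>F\<^esub> f) = J +>\<^bsub>F\<^esub> (c \<odot>\<^bsub>F\<^esub> f)"
proof -
  have "J <+>\<^bsub>F\<^esub> ((\<odot>\<^bsub>F\<^esub>) c ` (J +>\<^bsub>F\<^esub> f)) = J +>\<^bsub>F\<^esub> (c \<odot>\<^bsub>F\<^esub> f)"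
  proof (intro equalityI subsetI)
    fix x assume "x \<in> J <+>\<^bsub>F\<^esub> ((\<odot>\<^bsub>F\<^esub>) c ` (J +>\<^bsub>F\<^esub> f))"
    then obtain g h where gh: "g \<in> J" "h \<in> J" "x = g \<oplus>\<^bsub>F\<^esub> c \<odot>\<^bsub>F\<^esub> (h \<oplus>\<^bsub>F\<^esub> f)"
      by (auto simp: set_add_def' a_r_coset_def')
    have "x = (g \<oplus>\<^bsub>F\<^esub> c \<odot>\<^bsub>F\<^esub> h) \<oplus>\<^bsub>F\<^esub> c \<odot>\<^bsub>F\<^esub> f"
      using gh c f J_closed(1) by (simp add: FA.F.smult_r_distr FA.F.M.a_assoc)
    moreover have "g \<oplus>\<^bsub>F\<^esub> c \<odot>\<^bsub>F\<^esub> h \<in> J" by (intro J_closed(2,5) gh c)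
    ultimately show "x \<in> J +>\<^bsub>F\<^esub> (c \<odot>\<^bsub>F\<^esub> f)" by (auto simp: a_r_coset_def')
  next
    fix x assume "x \<in> J +>\<^bsub>F\<^esub> (c \<odot>\<^bsub>F\<^esub> f)"
    then obtain g where g: "g \<in> J" "x = g \<oplus>\<^bsub>F\<^esub> c \<odot>\<^bsub>F\<^esub> f" by (auto simp: a_r_coset_def')
    moreover have "f \<in> J +>\<^bsub>F\<^esub> f" unfolding a_r_coset_def' using J_closed(6) f FA.F.M.l_zero[OF f] by force
    ultimately show "x \<in> J <+>\<^bsub>F\<^esub> ((\<odot>\<^bsub>F\<^esub>) c ` (J +>\<^bsub>F\<^esub> f))" unfolding set_add_def' by blast
  qed
  then show ?thesis by (simp add: quotient_algebra_def)
qed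

theorem quotient_torus_order: "torus_order (quotient_algebra F J) (\<lambda>X. the_elem (eval_letters ` X))"
proof -
  interpret H: ring_hom_ring F T eval_letters by (rule eval_letters_hom_ring)
  let ?Q = "quotient_algebra F J" and ?\<Psi> = "\<lambda>X. the_elem (eval_letters ` X)"
  interpret J: ideal J F by (rule J_ideal)
  have carrier: "carrier ?Q = a_rcosets\<^bsub>F\<^esub> J" by (simp add: quotient_algebra_def FactRing_def)
  have rep: "\<exists>f\<in>carrier F. X = J +>\<^bsub>F\<^esub> f" if "X \<in> carrier ?Q" for X
    using that unfolding carrier A_RCOSETS_def' by blast
  have coset_in: "J +>\<^bsub>F\<^esub> f \<in> carrier ?Q" if "f \<in> carrier F" for f
    using that unfolding carrier A_RCOSETS_def' by blast
  have val: "?\<Psi> (J +>\<^bsub>F\<^esub> f) = eval_letters f" if "f \<in> carrier F" for f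
    using H.the_elem_simp[OF that] by (simp add: kernel_eq)
  have iso: "?\<Psi> \<in> ring_iso (F Quot J) (T\<lparr>carrier := eval_letters ` carrier F\<rparr>)"
    using H.FactRing_iso_set_aux by (simp add: kernel_eq)
  have "ring ?Q"
    by (rule ring_cong[OF J.quotient_is_ring]) (simp_all add: quotient_algebra_def)
  moreover have hom: "?\<Psi> \<in> ring_hom ?Q T"
  proof (rule ring_hom_memI)
    fix X assume "X \<in> carrier ?Q"
    then show "?\<Psi> X \<in> carrier T" using rep val eval_hom(1) by metis
  qed (use iso in \<open>auto simp: ring_iso_def ring_hom_def quotient_algebra_def\<close>)
  moreover have "inj_on ?\<Psi> (carrier ?Q)"
    using iso by (simp add: ring_iso_def bij_betw_def quotient_algebra_def)
  moreover have "c \<odot>\<^bsub>?Q\<^esub> X \<in> carrier ?Q \<and> ?\<Psi> (c \<odot>\<^bsub>?Q\<^esub> X) = c \<odot>\<^bsub>T\<^esub> ?\<Psi> X"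
    if c: "c \<in> carrier K" and X: "X \<in> carrier ?Q" for c X
  proof -
    obtain f where f: "f \<in> carrier F" "X = J +>\<^bsub>F\<^esub> f" using rep[OF X] by blast
    have cf: "c \<odot>\<^bsub>F\<^esub> f \<in> carrier F" using c f by simp
    show ?thesis unfolding f(2) quotient_smult[OF c f(1)] val[OF f(1)] val[OF cf] eval_hom(3)[OF c f(1)]
      using coset_in[OF cf] by blast
  qed
  moreover have "\<exists>\<beta>\<in>exponents n. single K \<one> \<beta> \<in> ?\<Psi> ` carrier ?Q \<and> single K \<one> (\<beta> + \<alpha>) \<in> ?\<Psi> ` carrier ?Q"
    if \<alpha>: "\<alpha> \<in> exponents n" for \<alpha>
  proof -
    \<comment> \<open>A word is sent to its monomial up to the nonzero scalar
      \<open>word_twist\<close>, which is divided out beforehand.\<close>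
    have mono: "single K \<one> (content u) \<in> ?\<Psi> ` carrier ?Q" if u: "set u \<subseteq> {1..n}" for u
    proof -
      have f: "single K (inv (word_twist letter u)) u \<in> carrier F"
        using u word_twist_nz[of letter u] word_twist_in[of letter u] by (intro FA.F_single_in) (auto simp: field_Units simp del: word_twist_nz word_twist_in)
      have "inv (word_twist letter u) \<otimes> word_twist letter u = \<one>"
        using word_twist_nz[of letter u] word_twist_in[of letter u] by (intro Units_l_inv) (auto simp: field_Units simp del: word_twist_nz word_twist_in)
      moreover have "inv (word_twist letter u) \<in> carrier K"
        using word_twist_nz[of letter u] word_twist_in[of letter u] by (intro Units_inv_closed) (auto simp: field_Units simp del: word_twist_nz word_twist_in)
      ultimately have "?\<Psi> (J +>\<^bsub>F\<^esub> single K (inv (word_twist letter u)) u) = single K \<one> (content u)"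
        unfolding val[OF f] using u by (simp add: eval_letters_single)
      then show ?thesis using coset_in[OF f] by (metis imageI)
    qed
    \<comment> \<open>The negative and the positive part of \<open>\<alpha>\<close> are realised by
      words \<open>u\<close> and \<open>v\<close>; only nonnegative exponents come from
      words.\<close>
    have "\<exists>u v. set u \<subseteq> {1..n} \<and> set v \<subseteq> {1..n} \<and> content u + \<alpha> = content v"
      using \<alpha>
    proof (induction \<alpha> rule: exponents_induct)
      case zero
      show ?case by (rule exI[of _ "[]"], rule exI[of _ "[]"]) simp
    next
      case (unit_vec j)
      then have "letter j = unit_vec j" by (simp add: letter_def)
      then show ?case using unit_vec by (intro exI[of _ "[]"] exI[of _ "[j]"]) auto
    next
      case (add \<alpha> \<beta>)
      then obtain u v u' v' where "set u \<subseteq> {1..n}" "set v \<subseteq> {1..n}" "content u + \<alpha> = content v"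
        "set u' \<subseteq> {1..n}" "set v' \<subseteq> {1..n}" "content u' + \<beta> = content v'" by blast
      moreover have "content (u @ u') + (\<alpha> + \<beta>) = (content u + \<alpha>) + (content u' + \<beta>)"
        by (simp only: map_append sum_list_append ac_simps)
      ultimately show ?case by (intro exI[of _ "u @ u'"] exI[of _ "v @ v'"]) (simp only: map_append sum_list_append set_append Un_subset_iff simp_thms)
    next
      case (minus \<alpha>)
      then obtain u v where "set u \<subseteq> {1..n}" "set v \<subseteq> {1..n}" "content u + \<alpha> = content v" by blast
      moreover have "content u + \<alpha> + - \<alpha> = content u" by simp
      ultimately show ?case by (intro exI[of _ v] exI[of _ u]) (simp only: simp_thms)
    qed
    then obtain u v where uv: "set u \<subseteq> {1..n}" "set v \<subseteq> {1..n}" "content u + \<alpha> = content v" by blast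
    show ?thesis
      by (rule bexI[OF _ content_exponents[of u]]) (unfold uv(3), intro conjI mono uv(1,2))
  qed
  ultimately show ?thesis unfolding torus_order_def by blast
qed

end

context quantum_torus
begin

theorem quantum_affine_space_torus_order: "\<exists>\<Psi>. torus_order (quantum_affine_space K n \<Lambda>) \<Psi>"
proof -
  interpret Q: quantum_affine_algebra K n \<Lambda> T "free_algebra K {1..n}"
      "twisted_algebra K {w. set w \<subseteq> {1..n}} (@) [] (\<lambda>_ _. \<one>)"
    by unfold_locales (simp_all add: T_def)
  have "quantum_affine_space K n \<Lambda> = quotient_algebra (free_algebra K {1..n}) Q.J"
    unfolding quantum_affine_space_def Q.J_def Q.commutators_def Let_def ..
  then show ?thesis using Q.quotient_torus_order by auto
qed

end

theorem corollary4p7: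
  fixes K :: "('k, 'l) ring_scheme"
    and A :: "('k, 'a, 'm) module_scheme"
    and n :: nat
    and x :: "nat \<Rightarrow> 'a"
    and \<tau> \<delta> :: "nat \<Rightarrow> 'a \<Rightarrow> 'a"
    and \<Lambda> :: "nat \<Rightarrow> nat \<Rightarrow> 'k"
    and q :: "nat \<Rightarrow> 'k"
  assumes "field K"
    and "iterated_skew_polynomial_ring K A n x \<tau> \<delta>"
    and "mult_antisymmetric K n \<Lambda>"
    and "\<And>i j. 1 \<le> j \<Longrightarrow> j < i \<Longrightarrow> i \<le> n \<Longrightarrow> \<tau> i (x j) = \<Lambda> i j \<odot>\<^bsub>A\<^esub> x j"
    and "\<And>i. i \<in> {1..n} \<Longrightarrow> q i \<in> carrier K - {\<zero>\<^bsub>K\<^esub>, \<one>\<^bsub>K\<^esub>}"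
    and "\<And>i r. i \<in> {1..n} \<Longrightarrow> r \<in> lower_subalgebra K A x i
          \<Longrightarrow> \<delta> i (\<tau> i r) = q i \<odot>\<^bsub>A\<^esub> \<tau> i (\<delta> i r)"
    and "\<And>i. i \<in> {1..n} \<Longrightarrow>
          \<exists>d. higher_skew_derivation K A (lower_subalgebra K A x i) (q i) (\<tau> i) d \<and>
              locally_nilpotent A (lower_subalgebra K A x i) d \<and>
              iterative K A (lower_subalgebra K A x i) (q i) d \<and>
              (\<forall>r\<in>lower_subalgebra K A x i. d 1 r = \<delta> i r)"
  shows "isomorphic_division_rings_of_fractions K A (quantum_affine_space K n \<Lambda>) \<and>
    (PI_algebra K A \<longleftrightarrow> (\<forall>i\<in>{1..n}. \<forall>j\<in>{1..n}. root_of_unity K (\<Lambda> i j))) \<and>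
    (PI_algebra K A \<longrightarrow>
      PI_algebra K (quantum_affine_space K n \<Lambda>) \<and>
      PI_degree K A = PI_degree K (quantum_affine_space K n \<Lambda>))"
proof -
  define T where "T = twisted_algebra K (exponents n) (+) 0 (\<lambda>\<alpha> \<beta>. finprod (units_of K)
      (\<lambda>p. \<Lambda> (fst p) (snd p) [^]\<^bsub>units_of K\<^esub> (\<alpha> (fst p) * \<beta> (snd p)))
      {p \<in> {1..n} \<times> {1..n}. snd p < fst p})"
  interpret iterated_skew_polynomial_algebra K n \<Lambda> T A x \<tau> \<delta> q
    unfolding iterated_skew_polynomial_algebra_def iterated_skew_polynomial_algebra_axioms_def
      quantum_torus_def quantum_torus_axioms_def
    using assms(1-6) by (auto simp: T_def)
  obtain \<Phi> where \<Phi>: "torus_order A \<Phi>" using torus_order_exists by blast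
  obtain \<Psi> where \<Psi>: "torus_order (quantum_affine_space K n \<Lambda>) \<Psi>"
    using quantum_affine_space_torus_order by blast
  show ?thesis
    using orders_have_isomorphic_fractions[OF \<Phi> \<Psi>] order_PI_algebra_iff[OF \<Phi>] order_PI_algebra_iff[OF \<Psi>]
      orders_have_equal_PI_degree[OF \<Phi> \<Psi>] by blast
qed

end
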